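(* Let $d\ge 1$, $0<m<1$, $R>0$. Assume $\rho_0\in L^\infty(B_R)$, $\rho_0\ge 0$; $V\in W^{2,\infty}(B_R)$, $V\ge 0$, $\nabla V\cdot\nu=0$ on $\partial B_R$; $K\in W^{2,\infty}(B_R\times B_R)$, $K(x,y)=K(y,x)\ge 0$, $\nabla_xK(x,y)\cdot\nu(x)=0$ for $(x,y)\in\partial B_R\times B_R$. Let $\rho$ be the strong solution of problem (P) of the context, let $t_n\to\infty$ be a sequence of times, and set $\rho^{[n]}(t,x)=\rho(t+t_n,x)$ for $(t,x)\in[0,1]\times B_R$. Then there exists $\widehat\mu\in W^{-1,1}(B_R)$ (independent of time) such that, up to a subsequence, $\rho^{[n]}\to\widehat\mu$ in $C([0,1];W^{-1,1}(B_R))$.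
   Context: $B_R\subset\mathbb R^d$ is the open ball of radius $R$ centred at $0$, $\nu$ its outward normal, $\rho_t=\rho(t,\cdot)$. $W^{-1,1}(B_R)$ is the space of distributions $\mu$ on $B_R$ with finite norm $\|\mu\|_{W^{-1,1}(B_R)}=\inf\{\|F\|_{L^1(B_R)}:\ \mu=\operatorname{div}F\}$. Problem (P): $\frac{\partial\rho}{\partial t}=\Delta\rho^m+\nabla\cdot(\rho\nabla V)+\nabla\cdot(\rho\nabla\int_{B_R}K(\cdot,y)\rho(y)\,dy)$ in $(0,\infty)\times B_R$, $\rho(0,\cdot)=\rho_0$, with $(\nabla\rho^m+\rho\nabla V+\rho\nabla\int_{B_R}K(\cdot,y)\rho(y)\,dy)\cdot\nu=0$ on $(0,\infty)\times\partial B_R$. A strong solution is a nonnegative $\rho$ such that for every $T>0$: $\rho\in C([0,T];L^1(B_R))\cap L^\infty((0,T)\times B_R)$, $\rho^m\in L^2(0,T;H^2(B_R))$, $\frac{\partial\rho}{\partial t}\in L^2((0,T)\times B_R)$, and for all $\varphi\in C^\infty([0,T]\times\overline{B_R})$ with $\varphi(T,\cdot)=0$, $$\int_{B_R}\rho_0\varphi(0)+\int_0^T\!\!\int_{B_R}\rho_t\frac{\partial\varphi}{\partial t}=\int_0^T\!\!\int_{B_R}\nabla\rho_t^m\cdot\nabla\varphi+\int_0^T\!\!\int_{B_R}\rho_t\Big(\nabla V+\nabla\int_{B_R}K(\cdot,y)\rho_t(y)\,dy\Big)\cdot\nabla\varphi .$$ *)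

theory Defs
  imports "HOL-Analysis.Analysis"
begin

subsection \<open>Smooth functions and test functions\<close>

definition pderiv_at :: "'a::euclidean_space \<Rightarrow> ('a \<Rightarrow> real) \<Rightarrow> 'a \<Rightarrow> real" where
  "pderiv_at b f x = frechet_derivative f (at x) b"

definition grad :: "('a::euclidean_space \<Rightarrow> real) \<Rightarrow> 'a \<Rightarrow> 'a" where
  "grad f x = (\<Sum>b\<in>Basis. pderiv_at b f x *\<^sub>R b)"

fun iter_pderiv :: "'a::euclidean_space list \<Rightarrow> ('a \<Rightarrow> real) \<Rightarrow> 'a \<Rightarrow> real" where
  "iter_pderiv [] f = f"
| "iter_pderiv (b # bs) f = pderiv_at b (iter_pderiv bs f)"

text \<open>Partial derivatives of all orders exist and are (Frechet) differentiable, hence continuous;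
  meant for open \<open>U\<close>.\<close>
definition smooth_on :: "'a::euclidean_space set \<Rightarrow> ('a \<Rightarrow> real) \<Rightarrow> bool" where
  "smooth_on U f \<longleftrightarrow>
     (\<forall>bs. set bs \<subseteq> Basis \<longrightarrow> (\<forall>x\<in>U. iter_pderiv bs f differentiable at x))"

text \<open>\<open>C\<^sup>\<infinity>(S)\<close> for a set \<open>S\<close> that need not be open, such as \<open>[0,T] \<times> cball 0 R\<close>: smoothness up to
  the boundary is smoothness on an open neighbourhood.\<close>
definition smooth_up_to :: "'a::euclidean_space set \<Rightarrow> ('a \<Rightarrow> real) \<Rightarrow> bool" where
  "smooth_up_to S f \<longleftrightarrow> (\<exists>U. open U \<and> S \<subseteq> U \<and> smooth_on U f)"

definition test_fun :: "'a::euclidean_space set \<Rightarrow> ('a \<Rightarrow> real) \<Rightarrow> bool" where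
  "test_fun U f \<longleftrightarrow> smooth_on UNIV f \<and> (\<exists>C. compact C \<and> C \<subseteq> U \<and> (\<forall>x. x \<notin> C \<longrightarrow> f x = 0))"

subsection \<open>Lebesgue spaces and weak derivatives\<close>

text \<open>Elements of the function spaces are represented by functions; only their values almost
  everywhere on \<open>U\<close> matter.\<close>

definition L1_on :: "'a::euclidean_space set \<Rightarrow> ('a \<Rightarrow> 'b::euclidean_space) \<Rightarrow> bool" where
  "L1_on U f \<longleftrightarrow> set_integrable lebesgue U f"

definition L1_norm :: "'a::euclidean_space set \<Rightarrow> ('a \<Rightarrow> 'b::euclidean_space) \<Rightarrow> real" where
  "L1_norm U f = (LINT x:U|lebesgue. norm (f x))"

definition L2_on :: "'a::euclidean_space set \<Rightarrow> ('a \<Rightarrow> 'b::euclidean_space) \<Rightarrow> bool" where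
  "L2_on U f \<longleftrightarrow> set_borel_measurable lebesgue U f \<and>
     set_integrable lebesgue U (\<lambda>x. (norm (f x))\<^sup>2)"

definition Linf_on :: "'a::euclidean_space set \<Rightarrow> ('a \<Rightarrow> 'b::euclidean_space) \<Rightarrow> bool" where
  "Linf_on U f \<longleftrightarrow> set_borel_measurable lebesgue U f \<and>
     (\<exists>C. AE x in lebesgue. x \<in> U \<longrightarrow> norm (f x) \<le> C)"

definition L1_loc :: "'a::euclidean_space set \<Rightarrow> ('a \<Rightarrow> 'b::euclidean_space) \<Rightarrow> bool" where
  "L1_loc U f \<longleftrightarrow> (\<forall>C. compact C \<and> C \<subseteq> U \<longrightarrow> L1_on C f)"

definition has_weak_pderiv ::
    "'a::euclidean_space set \<Rightarrow> 'a \<Rightarrow> ('a \<Rightarrow> real) \<Rightarrow> ('a \<Rightarrow> real) \<Rightarrow> bool" where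
  "has_weak_pderiv U b f g \<longleftrightarrow> L1_loc U f \<and> L1_loc U g \<and>
     (\<forall>\<phi>. test_fun U \<phi> \<longrightarrow>
        (LINT x:U|lebesgue. f x * pderiv_at b \<phi> x) = - (LINT x:U|lebesgue. g x * \<phi> x))"

definition has_weak_grad ::
    "'a::euclidean_space set \<Rightarrow> ('a \<Rightarrow> real) \<Rightarrow> ('a \<Rightarrow> 'a) \<Rightarrow> bool" where
  "has_weak_grad U f G \<longleftrightarrow> (\<forall>b\<in>Basis. has_weak_pderiv U b f (\<lambda>x. G x \<bullet> b))"

text \<open>Determined only almost everywhere on \<open>U\<close>, and only if a weak gradient exists.\<close>
definition weak_grad :: "'a::euclidean_space set \<Rightarrow> ('a \<Rightarrow> real) \<Rightarrow> 'a \<Rightarrow> 'a" where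
  "weak_grad U f = (SOME G. has_weak_grad U f G)"

text \<open>The space \<open>W\<^bsup>2,\<infinity>\<^esup>(U)\<close>.\<close>
definition W2inf_on :: "'a::euclidean_space set \<Rightarrow> ('a \<Rightarrow> real) \<Rightarrow> bool" where
  "W2inf_on U f \<longleftrightarrow> Linf_on U f \<and>
     (\<exists>G. has_weak_grad U f G \<and> Linf_on U G \<and>
        (\<forall>b\<in>Basis. \<exists>H. has_weak_grad U (\<lambda>x. G x \<bullet> b) H \<and> Linf_on U H))"

text \<open>The Bochner space \<open>L\<^sup>2(0,T;H\<^sup>2(U))\<close>, with \<open>L\<^sup>2(0,T;L\<^sup>2(U))\<close> identified with
  \<open>L\<^sup>2((0,T) \<times> U)\<close>: almost every slice has weak derivatives \<open>G t\<close>, \<open>H b t\<close> of first and second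
  order in \<open>x\<close>, and these are jointly measurable and square integrable in \<open>(t, x)\<close>.\<close>
definition L2_H2_on ::
    "real \<Rightarrow> 'a::euclidean_space set \<Rightarrow> (real \<Rightarrow> 'a \<Rightarrow> real) \<Rightarrow> bool" where
  "L2_H2_on T U u \<longleftrightarrow> L2_on ({0<..<T} \<times> U) (\<lambda>(t, x). u t x) \<and>
     (\<exists>G H. L2_on ({0<..<T} \<times> U) (\<lambda>(t, x). G t x) \<and>
        (\<forall>b\<in>Basis. L2_on ({0<..<T} \<times> U) (\<lambda>(t, x). H b t x)) \<and>
        (AE t in lebesgue. t \<in> {0<..<T} \<longrightarrow>
           has_weak_grad U (u t) (G t) \<and>
           (\<forall>b\<in>Basis. has_weak_grad U (\<lambda>x. G t x \<bullet> b) (H b t))))"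

definition C_L1_on :: "real set \<Rightarrow> 'a::euclidean_space set \<Rightarrow> (real \<Rightarrow> 'a \<Rightarrow> real) \<Rightarrow> bool" where
  "C_L1_on I U u \<longleftrightarrow> (\<forall>t\<in>I. L1_on U (u t)) \<and>
     (\<forall>s\<in>I. ((\<lambda>t. L1_norm U (\<lambda>x. u t x - u s x)) \<longlongrightarrow> 0) (at s within I))"

subsection \<open>Distributions and \<open>W\<^bsup>-1,1\<^esup>\<close>\<close>

text \<open>A distribution on \<open>U\<close> is a functional on all functions of which only the restriction to the
  test functions on \<open>U\<close> is relevant.\<close>
definition distribution_on ::
    "'a::euclidean_space set \<Rightarrow> (('a \<Rightarrow> real) \<Rightarrow> real) \<Rightarrow> bool" where
  "distribution_on U \<mu> \<longleftrightarrow>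
     (\<forall>\<phi> \<psi> a b. test_fun U \<phi> \<and> test_fun U \<psi> \<longrightarrow>
        \<mu> (\<lambda>x. a * \<phi> x + b * \<psi> x) = a * \<mu> \<phi> + b * \<mu> \<psi>) \<and>
     (\<forall>C. compact C \<and> C \<subseteq> U \<longrightarrow>
        (\<exists>A N. \<forall>\<phi> M. test_fun U \<phi> \<and> (\<forall>x. x \<notin> C \<longrightarrow> \<phi> x = 0) \<and>
           (\<forall>bs x. set bs \<subseteq> Basis \<and> length bs \<le> N \<longrightarrow> \<bar>iter_pderiv bs \<phi> x\<bar> \<le> M) \<longrightarrow>
           \<bar>\<mu> \<phi>\<bar> \<le> A * M))"

definition dist_of_fun ::
    "'a::euclidean_space set \<Rightarrow> ('a \<Rightarrow> real) \<Rightarrow> ('a \<Rightarrow> real) \<Rightarrow> real" where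
  "dist_of_fun U f \<phi> = (LINT x:U|lebesgue. f x * \<phi> x)"

definition is_div_on ::
    "'a::euclidean_space set \<Rightarrow> (('a \<Rightarrow> real) \<Rightarrow> real) \<Rightarrow> ('a \<Rightarrow> 'a) \<Rightarrow> bool" where
  "is_div_on U \<mu> F \<longleftrightarrow>
     (\<forall>\<phi>. test_fun U \<phi> \<longrightarrow> \<mu> \<phi> = - (LINT x:U|lebesgue. F x \<bullet> grad \<phi> x))"

text \<open>The norm is \<open>\<infinity>\<close> if \<open>\<mu>\<close> is not the divergence of an \<open>L\<^sup>1\<close> field.\<close>
definition Wm11_norm :: "'a::euclidean_space set \<Rightarrow> (('a \<Rightarrow> real) \<Rightarrow> real) \<Rightarrow> ennreal" where
  "Wm11_norm U \<mu> = (INF F\<in>{F. L1_on U F \<and> is_div_on U \<mu> F}. ennreal (L1_norm U F))"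

definition Wm11 :: "'a::euclidean_space set \<Rightarrow> (('a \<Rightarrow> real) \<Rightarrow> real) set" where
  "Wm11 U = {\<mu>. distribution_on U \<mu> \<and> Wm11_norm U \<mu> < \<infinity>}"

definition C_Wm11 ::
    "real set \<Rightarrow> 'a::euclidean_space set \<Rightarrow> (real \<Rightarrow> ('a \<Rightarrow> real) \<Rightarrow> real) set" where
  "C_Wm11 I U = {u. (\<forall>t\<in>I. u t \<in> Wm11 U) \<and>
     (\<forall>s\<in>I. ((\<lambda>t. Wm11_norm U (\<lambda>\<phi>. u t \<phi> - u s \<phi>)) \<longlongrightarrow> 0) (at s within I))}"

definition tendsto_C_Wm11 ::
    "real set \<Rightarrow> 'a::euclidean_space set \<Rightarrow> (nat \<Rightarrow> real \<Rightarrow> ('a \<Rightarrow> real) \<Rightarrow> real) \<Rightarrow>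
     (real \<Rightarrow> ('a \<Rightarrow> real) \<Rightarrow> real) \<Rightarrow> bool" where
  "tendsto_C_Wm11 I U u v \<longleftrightarrow> (\<forall>k. u k \<in> C_Wm11 I U) \<and> v \<in> C_Wm11 I U \<and>
     (\<lambda>k. SUP t\<in>I. Wm11_norm U (\<lambda>\<phi>. u k t \<phi> - v t \<phi>)) \<longlonglongrightarrow> 0"

subsection \<open>The aggregation-diffusion problem on a ball\<close>

definition outward_normal :: "real \<Rightarrow> 'a::euclidean_space \<Rightarrow> 'a" where
  "outward_normal R x = x /\<^sub>R R"

text \<open>For \<open>V\<close> in \<open>W\<^bsup>2,\<infinity>\<^esup>\<close> the gradient has a (unique) representative that is continuous on the closed
  ball; the boundary values are those of this representative. Likewise for \<open>K\<close> below.\<close>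
definition no_flux_V :: "real \<Rightarrow> ('a::euclidean_space \<Rightarrow> real) \<Rightarrow> bool" where
  "no_flux_V R V \<longleftrightarrow>
     (\<exists>G. continuous_on (cball 0 R) G \<and> has_weak_grad (ball 0 R) V G \<and>
        (\<forall>x\<in>sphere 0 R. G x \<bullet> outward_normal R x = 0))"

text \<open>The first component of the gradient \<open>G\<close> on the product space is the gradient with respect to
  the first variable of \<open>K\<close>.\<close>
definition no_flux_K :: "real \<Rightarrow> ('a::euclidean_space \<Rightarrow> 'a \<Rightarrow> real) \<Rightarrow> bool" where
  "no_flux_K R K \<longleftrightarrow>
     (\<exists>G. continuous_on (cball 0 R \<times> cball 0 R) G \<and>
        has_weak_grad (ball 0 R \<times> ball 0 R) (\<lambda>(x, y). K x y) G \<and>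
        (\<forall>x\<in>sphere 0 R. \<forall>y\<in>ball 0 R. fst (G (x, y)) \<bullet> outward_normal R x = 0))"

definition interaction ::
    "real \<Rightarrow> ('a::euclidean_space \<Rightarrow> 'a \<Rightarrow> real) \<Rightarrow> ('a \<Rightarrow> real) \<Rightarrow> 'a \<Rightarrow> real" where
  "interaction R K u x = (LINT y:ball 0 R|lebesgue. K x y * u y)"

definition strong_solution ::
    "real \<Rightarrow> real \<Rightarrow> ('a::euclidean_space \<Rightarrow> real) \<Rightarrow> ('a \<Rightarrow> 'a \<Rightarrow> real) \<Rightarrow> ('a \<Rightarrow> real) \<Rightarrow>
     (real \<Rightarrow> 'a \<Rightarrow> real) \<Rightarrow> bool" where
  "strong_solution m R V K \<rho>0 \<rho> \<longleftrightarrow>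
     (\<forall>t\<ge>0. AE x in lebesgue. x \<in> ball 0 R \<longrightarrow> 0 \<le> \<rho> t x) \<and>
     (\<forall>T>0.
        C_L1_on {0..T} (ball 0 R) \<rho> \<and>
        Linf_on ({0<..<T} \<times> ball 0 R) (\<lambda>(t, x). \<rho> t x) \<and>
        L2_H2_on T (ball 0 R) (\<lambda>t x. \<rho> t x powr m) \<and>
        (\<exists>g. L2_on ({0<..<T} \<times> ball 0 R) g \<and>
           has_weak_pderiv ({0<..<T} \<times> ball 0 R) (1, 0) (\<lambda>(t, x). \<rho> t x) g) \<and>
        (\<forall>\<phi>. smooth_up_to ({0..T} \<times> cball 0 R) \<phi> \<and> (\<forall>x\<in>cball 0 R. \<phi> (T, x) = 0) \<longrightarrow>
           (LINT x:ball 0 R|lebesgue. \<rho>0 x * \<phi> (0, x)) +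
           (LINT t:{0..T}|lebesgue. LINT x:ball 0 R|lebesgue. \<rho> t x * pderiv_at (1, 0) \<phi> (t, x)) =
           (LINT t:{0..T}|lebesgue. LINT x:ball 0 R|lebesgue.
              weak_grad (ball 0 R) (\<lambda>y. \<rho> t y powr m) x \<bullet> grad (\<lambda>y. \<phi> (t, y)) x) +
           (LINT t:{0..T}|lebesgue. LINT x:ball 0 R|lebesgue.
              \<rho> t x *
              ((weak_grad (ball 0 R) V x + weak_grad (ball 0 R) (interaction R K (\<rho> t)) x)
                 \<bullet> grad (\<lambda>y. \<phi> (t, y)) x))))"

end

theory Submission
  imports Defs "HOL-Complex_Analysis.Great_Picard" "HOL-Library.Diagonal_Subsequence"
begin

text \<open>The free energy with density \<open>\<rho>\<^sup>m / (m - 1) + V \<rho> + \<rho> K\<rho> / 2\<close> controls the flux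
  \<open>J = grad \<rho>\<^sup>m + \<rho> (grad V + grad K\<rho>)\<close>: it decreases at rate \<open>|J|\<^sup>2 / \<rho>\<close>, so by the Cauchy-Schwarz
  inequality the square of the integral of \<open>|J|\<close> over a time interval \<open>[a, b]\<close> is at most
  \<open>2 (E(a) - E(b)) (b - a)\<close> times the mass. Since \<open>m < 1\<close>, the energy is bounded below, whence
  \<open>E(t\<^sub>n) - E(t\<^sub>n + 1)\<close> tends to \<open>0\<close>; and \<open>\<rho>(t\<^sub>n + t) - \<rho>(t\<^sub>n)\<close> is the divergence of a time
  integral of the flux, so it tends to \<open>0\<close> in \<open>W\<^bsup>-1,1\<^esup>\<close> uniformly in \<open>t\<close>. The functions
  \<open>\<rho>(t\<^sub>n)\<close> are bounded in \<open>L\<^sup>1\<close>, and \<open>L\<^sup>1\<close> embeds compactly into \<open>W\<^bsup>-1,1\<^esup>\<close>: averaging the inverse of the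
  divergence along rays over an open set of directions gives a compact right inverse.

  The entropy is singular at \<open>\<rho> = 0\<close>, so it is regularised by a parameter \<open>e\<close> that tends to \<open>0\<close> in the
  resulting inequality. The dissipation inequality is only needed in integrated form; it is obtained by testing the
  difference of the equation at two times (convexity of the entropy) and averaging in time, which
  avoids a chain rule in time.\<close>

text \<open>The natural test function is the derivative of the entropy, a negative power of \<rho>,
  while spatial regularity is available for \<rho>^m. Everything is therefore written in
  \<open>u = \<rho>^m\<close>: the test function becomes a power of \<open>u + e\<close>, with
  gradient \<open>(u + e) powr (- 1 / m)\<close> times grad u. This weight is \<open>1 / w\<close>
  for \<open>w = (u + e) powr (1 / m)\<close>, slightly larger than the mobility \<rho>, so the
  dissipation is not a perfect square; completing it costs \<open>(w - \<rho>) / 2\<close> times the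
  squared drift, which is of order \<open>e\<close>, and half of the quadratic term, which explains
  the factor 2 in front of the energy drop. The flux is then estimated as
  \<open>|J| = (|J| / sqrt w) * sqrt w\<close>, and the integral of \<open>w\<close> exceeds that of
  \<rho> only by order \<open>e\<close>. The W^{-1,1} norm is an infimum over fields, so each upper
  bound is proved by exhibiting one field: the time integral of the flux for increments in time,
  averaged line integrals for a single density. The limit is the divergence of an L1 limit of such
  line integrals.\<close>

abbreviation lborel_nn_integral :: "('a::euclidean_space \<Rightarrow> ennreal) \<Rightarrow> ennreal" (binder \<open>LBNN \<close> 10)
  where "lborel_nn_integral f \<equiv> integral\<^sup>N lborel f"

lemmas bochner_cong = Bochner_Integration.integral_cong
  and bochner_bound = Bochner_Integration.integrable_bound

section \<open>Smooth functions and mollification\<close>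

lemma pderiv_at_eq: "(f has_derivative f') (at x) ==> pderiv_at b f x = f' b" by (metis pderiv_at_def frechet_derivative_at)

text \<open>The set \<open>X\<close> acts as an invariant: iterated partial derivatives never leave
  it, so no formula for them is required.\<close>

lemma smooth_coinduct:
 assumes "f \<in> X"
  and diff: "!!g x. g \<in> X ==> g differentiable at x"
  and closed: "!!g b. g \<in> X ==> b \<in> Basis ==> pderiv_at b g \<in> X"
 shows "smooth_on UNIV f"
proof -
 have "iter_pderiv bs f \<in> X" if "set bs \<subseteq> Basis" for bs using that by (induction bs) (auto intro: closed \<open>f \<in> X\<close>)
 then show ?thesis unfolding smooth_on_def using diff by blast
qed

lemma iter_pderiv_snoc: "iter_pderiv (bs @ [b]) f = iter_pderiv bs (pderiv_at b f)" by (induction bs) auto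

lemma smooth_on_pderiv_at: "smooth_on U f ==> b \<in> Basis ==> smooth_on U (pderiv_at b f)"
 unfolding smooth_on_def by (auto simp flip: iter_pderiv_snoc)

lemma smooth_on_differentiable: "smooth_on U f ==> x \<in> U ==> f differentiable at x"
 unfolding smooth_on_def by (metis empty_subsetI iter_pderiv.simps(1) list.set(1))

lemma smooth_on_continuous_on: "smooth_on UNIV f ==> continuous_on A f"
 by (meson UNIV_I continuous_at_imp_continuous_on differentiable_imp_continuous_within smooth_on_differentiable)

lemma differentiable_has_derivative_grad:
 fixes f :: "'a::euclidean_space => real"
 assumes "f differentiable at x"
 shows "(f has_derivative (%k. grad f x \<bullet> k)) (at x)"
proof -
 let ?D = "frechet_derivative f (at x)"
 have D: "(f has_derivative ?D) (at x)" using assms frechet_derivative_works by blast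
 have "?D k = grad f x \<bullet> k" for k
 proof -
  have lin: "linear ?D" using D has_derivative_linear by blast
  have "?D k = ?D (\<Sum>b\<in>Basis. (k \<bullet> b) *\<^sub>R b)" by (simp add: euclidean_representation)
  also have "\<dots> = (\<Sum>b\<in>Basis. (k \<bullet> b) * ?D b)" by (simp add: linear_sum[OF lin] linear_cmul[OF lin])
  also have "\<dots> = grad f x \<bullet> k" by (simp add: grad_def pderiv_at_def inner_sum_left inner_sum_right inner_commute mult.commute)
  finally show ?thesis .
 qed
 then show ?thesis using D by (metis (no_types, lifting) ext)
qed

lemma smooth_has_derivative_grad:
 "smooth_on UNIV f ==> (f has_derivative (%k. grad f x \<bullet> k)) (at x)"
 by (simp add: differentiable_has_derivative_grad smooth_on_differentiable)

lemma grad_eqI: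
 fixes f :: "'a::euclidean_space => real"
 assumes "(f has_derivative (%k. g \<bullet> k)) (at x)"
 shows "grad f x = g" by (simp add: grad_def pderiv_at_eq[OF assms] euclidean_representation)

lemma grad_inner_Basis: "b \<in> Basis ==> grad f x \<bullet> b = pderiv_at b f x"
 by (simp add: grad_def inner_sum_left inner_Basis if_distrib cong: if_cong)

text \<open>Smoothness of compound functions is obtained by coinduction on a function algebra that is
 closed under partial derivatives.\<close>

inductive_set fun_algebra :: "('a => real) set => ('a => real) set" for S where
 base: "f \<in> S ==> f \<in> fun_algebra S"
| const: "(%x. c) \<in> fun_algebra S"
| add: "f \<in> fun_algebra S ==> g \<in> fun_algebra S ==> (%x. f x + g x) \<in> fun_algebra S"
| mult: "f \<in> fun_algebra S ==> g \<in> fun_algebra S ==> (%x. f x * g x) \<in> fun_algebra S"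

lemma fun_algebra_sum:
 "(!!i. i \<in> I ==> f i \<in> fun_algebra S) ==> (%x. \<Sum>i\<in>I. f i x) \<in> fun_algebra S"
 by (induction I rule: infinite_finite_induct) (auto intro: fun_algebra.intros)

lemma fun_algebra_prod:
 "(!!i. i \<in> I ==> f i \<in> fun_algebra S) ==> (%x. \<Prod>i\<in>I. f i x) \<in> fun_algebra S"
 by (induction I rule: infinite_finite_induct) (auto intro: fun_algebra.intros)

text \<open>The sum and product rules close the algebra under partial derivatives as soon as the
  derivatives of the generators lie in the algebra; these derivatives may thus be sums and products
  of generators.\<close>

lemma fun_algebra_smooth:
 fixes f :: "'a::euclidean_space => real"
 assumes "f \<in> fun_algebra S"
  and diff: "!!g x. g \<in> S ==> g differentiable at x"
  and closed: "!!g b. g \<in> S ==> b \<in> Basis ==> pderiv_at b g \<in> fun_algebra S"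
 shows "smooth_on UNIV f"
proof (rule smooth_coinduct[OF assms(1)])
 show d: "g differentiable at x" if "g \<in> fun_algebra S" for g x using that by induction (auto intro: diff)
 show "pderiv_at b g \<in> fun_algebra S" if "g \<in> fun_algebra S" "b \<in> Basis" for g b using that(1)
 proof induction
  case (base f)
  then show ?case using closed that(2) by blast
 next
  case (const c)
  have "pderiv_at b (%x::'a. c) = (%x. 0)" by (rule ext, rule pderiv_at_eq[where f' = "%_. 0"]) simp
  then show ?case by (simp add: fun_algebra.const)
 next
  case (add f g)
  have "pderiv_at b (%x. f x + g x) = (%x. pderiv_at b f x + pderiv_at b g x)"
  proof
   fix x
   have "((%x. f x + g x) has_derivative (%k. grad f x \<bullet> k + grad g x \<bullet> k)) (at x)"
    by (intro has_derivative_add differentiable_has_derivative_grad d add)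
   then show "pderiv_at b (%x. f x + g x) x = pderiv_at b f x + pderiv_at b g x" using that(2) by (simp add: pderiv_at_eq grad_inner_Basis)
  qed
  then show ?case using add by (simp add: fun_algebra.add)
 next
  case (mult f g)
  have "pderiv_at b (%x. f x * g x) = (%x. f x * pderiv_at b g x + pderiv_at b f x * g x)"
  proof
   fix x
   have "((%x. f x * g x) has_derivative (%k. f x * (grad g x \<bullet> k) + (grad f x \<bullet> k) * g x)) (at x)"
    by (intro has_derivative_mult differentiable_has_derivative_grad d mult)
   then show "pderiv_at b (%x. f x * g x) x = f x * pderiv_at b g x + pderiv_at b f x * g x"
    using that(2) by (simp add: pderiv_at_eq grad_inner_Basis)
  qed
  then show ?case using mult by (auto intro!: fun_algebra.add fun_algebra.mult)
 qed
qed

lemma smooth_const: "smooth_on UNIV (%x::'a::euclidean_space. c)" by (rule fun_algebra_smooth[where S = "{}"]) (auto intro: fun_algebra.const)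

lemma smooth_fun_algebra:
 fixes f :: "'a::euclidean_space => real"
 assumes "f \<in> fun_algebra (Collect (smooth_on UNIV))"
 shows "smooth_on UNIV f" by (rule fun_algebra_smooth[OF assms]) (auto intro: smooth_on_differentiable fun_algebra.base smooth_on_pderiv_at)

lemma smooth_add: 
 fixes f g :: "'a::euclidean_space => real"
 shows "smooth_on UNIV f ==> smooth_on UNIV g ==> smooth_on UNIV (%x. f x + g x)"
 by (intro smooth_fun_algebra fun_algebra.add fun_algebra.base) auto

lemma smooth_mult:
 fixes f g :: "'a::euclidean_space => real"
 shows "smooth_on UNIV f ==> smooth_on UNIV g ==> smooth_on UNIV (%x. f x * g x)"
 by (intro smooth_fun_algebra fun_algebra.mult fun_algebra.base) auto

lemma smooth_cmult:
 fixes f :: "'a::euclidean_space => real"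
 shows "smooth_on UNIV f ==> smooth_on UNIV (%x. c * f x)" by (intro smooth_mult smooth_const)

lemma has_derivative_affine_comp:
 fixes f :: "'a::euclidean_space => real"
 assumes "smooth_on UNIV f"
 shows "((%x. f (a + c *\<^sub>R x)) has_derivative (%k. (c *\<^sub>R grad f (a + c *\<^sub>R x)) \<bullet> k)) (at x)"
proof -
 have "((%x. a + c *\<^sub>R x) has_derivative (%k. c *\<^sub>R k)) (at x)" by (auto intro!: derivative_eq_intros)
 from has_derivative_compose[OF this smooth_has_derivative_grad[OF assms]]
 show ?thesis by simp
qed

lemma pderiv_at_affine_comp:
 fixes f :: "'a::euclidean_space => real"
 assumes "smooth_on UNIV f" "b \<in> Basis"
 shows "pderiv_at b (%x. f (a + c *\<^sub>R x)) x = c * pderiv_at b f (a + c *\<^sub>R x)"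
 using pderiv_at_eq[OF has_derivative_affine_comp[OF assms(1)], of b] assms(2) by (simp add: grad_inner_Basis)

lemma smooth_affine_comp:
 fixes f :: "'a::euclidean_space => real"
 assumes "smooth_on UNIV f"
 shows "smooth_on UNIV (%x. f (a + c *\<^sub>R x))"
proof (rule smooth_coinduct)
 let ?X = "{%x. k * g (a + c *\<^sub>R x) |k g. smooth_on UNIV g}"
 show "(%x. f (a + c *\<^sub>R x)) \<in> ?X" using assms by (auto intro!: exI[of _ 1] exI[of _ f])
 show "h differentiable at x" if hX: "h \<in> ?X" for h x
 proof -
  obtain k g where h: "h = (%x. k * g (a + c *\<^sub>R x))" and g: "smooth_on UNIV g" using hX by blast
  show ?thesis unfolding h using has_derivative_mult_right[OF has_derivative_affine_comp[OF g]] by (rule differentiableI)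
 qed
 show "pderiv_at b h \<in> ?X" if "h \<in> ?X" "b \<in> Basis" for h b
 proof -
  obtain k g where h: "h = (%x. k * g (a + c *\<^sub>R x))" and g: "smooth_on UNIV g" using \<open>h \<in> ?X\<close> by blast
  have "pderiv_at b h x = (k * c) * pderiv_at b g (a + c *\<^sub>R x)" for x
  proof -
   have "(h has_derivative (%v. k * ((c *\<^sub>R grad g (a + c *\<^sub>R x)) \<bullet> v))) (at x)"
    unfolding h by (intro has_derivative_mult_right has_derivative_affine_comp g)
   then show ?thesis using that(2) by (simp add: pderiv_at_eq grad_inner_Basis)
  qed
  then have "pderiv_at b h = (%x. (k * c) * pderiv_at b g (a + c *\<^sub>R x))" ..
  then show ?thesis using smooth_on_pderiv_at[OF g that(2)] by blast
 qed
qed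

text \<open>Differentiation lowers the exponent by one, so all exponents are taken as generators at
  once, together with the smooth functions, which contain the inner derivative. The shift
  \<open>e > 0\<close> keeps the base positive.\<close>

lemma smooth_powr_comp:
 fixes v :: "'a::euclidean_space => real"
 assumes v: "smooth_on UNIV v" and pos: "!!x. 0 <= v x" and e: "e > 0"
 shows "smooth_on UNIV (%x. (v x + e) powr c)" (is ?th1)
  and "grad (%x. (v x + e) powr c) x = (c * (v x + e) powr (c - 1)) *\<^sub>R grad v x" (is ?th2)
proof -
 have D: "((%x. (v x + e) powr c) has_derivative (%k. ((c * (v x + e) powr (c - 1)) *\<^sub>R grad v x) \<bullet> k)) (at x)"
  for c x
 proof -
  have p: "v x + e > 0" using pos[of x] e by linarith
  have "((%y. y powr c) has_derivative (%k. (c * (v x + e) powr (c - 1)) * k)) (at (v x + e))"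
   using has_real_derivative_powr[OF p, of c] by (simp add: has_field_derivative_def)
  moreover have "((%x. v x + e) has_derivative (%k. grad v x \<bullet> k)) (at x)"
   by (auto intro!: derivative_eq_intros smooth_has_derivative_grad v)
  ultimately show ?thesis using has_derivative_compose by fastforce
 qed
 show ?th2 using D by (rule grad_eqI)
 let ?S = "Collect (smooth_on UNIV) \<union> {%x. (v x + e) powr c |c. True}"
 show ?th1
 proof (rule fun_algebra_smooth[where S = ?S])
  show "(%x. (v x + e) powr c) \<in> fun_algebra ?S" by (auto intro!: fun_algebra.base)
  show "g differentiable at x" if "g \<in> ?S" for g x using that D by (auto simp: differentiable_def dest!: smooth_on_differentiable)
  show "pderiv_at b g \<in> fun_algebra ?S" if "g \<in> ?S" "b \<in> Basis" for g b using that(1)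
  proof
   assume "g \<in> Collect (smooth_on UNIV)"
   then show ?thesis using that(2) by (auto intro!: fun_algebra.base smooth_on_pderiv_at)
  next
   assume "g \<in> {%x. (v x + e) powr c |c. True}"
   then obtain c where g: "g = (%x. (v x + e) powr c)" by auto
   have "pderiv_at b g x = c * (v x + e) powr (c - 1) * pderiv_at b v x" for x
    unfolding g using pderiv_at_eq[OF D, of b] that(2) by (simp add: grad_inner_Basis)
   then have eq: "pderiv_at b g = (%x. c * (v x + e) powr (c - 1) * pderiv_at b v x)" ..
   show ?thesis unfolding eq using that(2) v by (intro fun_algebra.mult fun_algebra.const) (auto intro!: fun_algebra.base smooth_on_pderiv_at)
  qed
 qed
qed

section \<open>Flat functions of one variable and bump functions\<close>

definition exp_recip :: "real poly => real => real" where
 "exp_recip p x = (if 0 < x then poly p (1 / x) * exp (- (1 / x)) else 0)"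

lemma tendsto_poly_mult_exp_at_top:
 "((%y. poly p y * exp (- y)) \<longlongrightarrow> (0::real)) at_top"
proof -
 have "((%y. \<Sum>i\<le>degree p. coeff p i * (y ^ i / exp y)) \<longlongrightarrow> (\<Sum>i\<le>degree p. coeff p i * 0)) at_top"
  by (intro tendsto_sum tendsto_mult tendsto_const tendsto_power_div_exp_0)
 then show ?thesis by (simp add: poly_altdef sum_distrib_right exp_minus divide_inverse mult.assoc)
qed

lemma exp_recip_tendsto_0: "(exp_recip p \<longlongrightarrow> 0) (at_right 0)"
proof -
 have "((%x. poly p (1 / x) * exp (- (1 / x))) \<longlongrightarrow> 0) (at_right 0)"
  using filterlim_compose[OF tendsto_poly_mult_exp_at_top filterlim_inverse_at_top_right] by (simp add: inverse_eq_divide)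
 moreover have "eventually (%x. poly p (1 / x) * exp (- (1 / x)) = exp_recip p x) (at_right 0)"
  by (auto simp: eventually_at_right_field exp_recip_def intro!: exI[of _ 1])
 ultimately show ?thesis by (rule Lim_transform_eventually)
qed

text \<open>For \<open>x > 0\<close> the derivative of \<open>p (1 / x) * exp (- 1 / x)\<close> has
  the same shape with \<open>p\<close> replaced by \<open>X^2 (p - p')\<close>, and
  \<open>[:0, 0, 1:]\<close> is \<open>X^2\<close>. Indexing the family by polynomials makes it
  closed under differentiation.\<close>

lemma DERIV_exp_recip:
 "(exp_recip p has_real_derivative exp_recip ([:0, 0, 1:] * (p - pderiv p)) x) (at x)"
proof -
 consider "x > 0" | "x < 0" | "x = 0" by linarith
 then show ?thesis
 proof cases
  case 1
  have "((%x. poly p (1 / x) * exp (- (1 / x))) has_real_derivative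
    exp_recip ([:0, 0, 1:] * (p - pderiv p)) x) (at x)"
  proof -
   have inv: "((%x. 1 / x) has_real_derivative - (1 / x\<^sup>2)) (at x)"
    using 1 by (auto intro!: derivative_eq_intros simp: power2_eq_square)
   have "((%x. poly p (1 / x)) has_real_derivative poly (pderiv p) (1 / x) * - (1 / x\<^sup>2)) (at x)"
    by (rule DERIV_chain2[OF poly_DERIV inv])
   moreover have "((%x. exp (- (1 / x))) has_real_derivative exp (- (1 / x)) * - (- (1 / x\<^sup>2))) (at x)"
    by (rule DERIV_chain2[OF DERIV_exp DERIV_minus[OF inv]])
   ultimately have "((%x. poly p (1 / x) * exp (- (1 / x))) has_real_derivative
     poly (pderiv p) (1 / x) * - (1 / x\<^sup>2) * exp (- (1 / x)) +
     exp (- (1 / x)) * - (- (1 / x\<^sup>2)) * poly p (1 / x)) (at x)" by (rule DERIV_mult)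
   moreover have "poly (pderiv p) (1 / x) * - (1 / x\<^sup>2) * exp (- (1 / x)) +
     exp (- (1 / x)) * - (- (1 / x\<^sup>2)) * poly p (1 / x) = exp_recip ([:0, 0, 1:] * (p - pderiv p)) x"
    using 1 by (simp add: exp_recip_def power2_eq_square right_diff_distrib left_diff_distrib)
   ultimately show ?thesis by simp
  qed
  then show ?thesis by (rule has_field_derivative_transform_within_open[of _ _ _ "{0<..}"]) (use 1 in \<open>auto simp: exp_recip_def\<close>)
 next
  case 2
  have "((%x. 0) has_real_derivative 0) (at x)" by simp
  then have "(exp_recip p has_real_derivative 0) (at x)" by (rule has_field_derivative_transform_within_open[of _ _ _ "{..<0}"])
    (use 2 in \<open>auto simp: exp_recip_def\<close>)
  then show ?thesis using 2 by (simp add: exp_recip_def)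
 next
  case 3
  \<comment> \<open>At 0 the difference quotient from the right is again a member of the family,
    with polynomial \<open>X p\<close>, and every member tends to 0 there.\<close>
  have "eventually (%h. exp_recip ([:0, 1:] * p) h = exp_recip p h / h) (at_right 0)"
   by (auto simp: eventually_at_right_field exp_recip_def intro!: exI[of _ 1])
  then have "((%h. exp_recip p h / h) \<longlongrightarrow> 0) (at_right 0)" by (rule Lim_transform_eventually[OF exp_recip_tendsto_0])
  moreover have "((%h. exp_recip p h / h) \<longlongrightarrow> 0) (at_left 0)" by (rule Lim_transform_eventually[OF tendsto_const])
    (auto simp: eventually_at_left_field exp_recip_def intro!: exI[of _ "-1"])
  ultimately have "((%h. exp_recip p h / h) \<longlongrightarrow> 0) (at 0)" by (simp add: filterlim_split_at)
  then show ?thesis using 3 by (simp add: DERIV_def exp_recip_def)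
 qed
qed

lemma has_derivative_exp_recip_affine:
 fixes w :: "'a::euclidean_space"
 shows "((%x. exp_recip p (r + x \<bullet> w)) has_derivative
      (%k. exp_recip ([:0, 0, 1:] * (p - pderiv p)) (r + x \<bullet> w) * (k \<bullet> w))) (at x)"
proof -
 have "((%x. r + x \<bullet> w) has_derivative (%k. k \<bullet> w)) (at x)" by (auto intro!: derivative_eq_intros)
 from has_derivative_compose[OF this DERIV_exp_recip[THEN has_field_derivative_imp_has_derivative]]
 show ?thesis .
qed

lemma smooth_prod_exp_recip:
 fixes w z :: "'a::euclidean_space => 'a"
 shows "smooth_on UNIV (%x. \<Prod>b\<in>Basis. exp_recip 1 (r b + x \<bullet> w b) * exp_recip 1 (s b + x \<bullet> z b))"
proof (rule fun_algebra_smooth)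
 let ?S = "{%x::'a. exp_recip p (r + x \<bullet> w) |p r w. True}"
 have base: "(%x. exp_recip p (r + x \<bullet> w)) \<in> fun_algebra ?S" for p r w by (rule fun_algebra.base) blast
 show "(%x. \<Prod>b\<in>Basis. exp_recip 1 (r b + x \<bullet> w b) * exp_recip 1 (s b + x \<bullet> z b)) \<in> fun_algebra ?S"
  by (intro fun_algebra_prod fun_algebra.mult base)
 show "g differentiable at x" if "g \<in> ?S" for g x using that by (auto intro: differentiableI[OF has_derivative_exp_recip_affine])
 show "pderiv_at b g \<in> fun_algebra ?S" if "g \<in> ?S" "b \<in> Basis" for g b
 proof -
  obtain p r w where g: "g = (%x. exp_recip p (r + x \<bullet> w))" using \<open>g \<in> ?S\<close> by blast
  have "pderiv_at b g = (%x. exp_recip ([:0, 0, 1:] * (p - pderiv p)) (r + x \<bullet> w) * (b \<bullet> w))"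
   unfolding g using pderiv_at_eq[OF has_derivative_exp_recip_affine] by blast
  then show ?thesis using fun_algebra.mult[OF base fun_algebra.const] by simp
 qed
qed

text \<open>Positive exactly on the open cube of half side \<open>r\<close>. A cube is described by
  linear functions of \<open>x\<close>, so that no norm has to be differentiated.\<close>

definition box_bump :: "real => 'a::euclidean_space => real" where
 "box_bump r x = (\<Prod>b\<in>Basis. exp_recip 1 (r + x \<bullet> b) * exp_recip 1 (r + x \<bullet> (- b)))"

lemma smooth_box_bump: "smooth_on UNIV (box_bump r :: 'a::euclidean_space => real)"
 unfolding box_bump_def[abs_def] by (rule smooth_prod_exp_recip)

lemma exp_recip_1: "exp_recip 1 x \<ge> 0" "exp_recip 1 x > 0 \<longleftrightarrow> x > 0" "exp_recip 1 x = 0 \<longleftrightarrow> x <= 0"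
 by (auto simp: exp_recip_def)

lemma box_bump_nonneg: "0 <= box_bump r x" unfolding box_bump_def by (intro prod_nonneg ballI mult_nonneg_nonneg exp_recip_1)

lemma box_bump_eq_0_iff: "box_bump r x = 0 \<longleftrightarrow> (\<exists>b\<in>Basis. r <= \<bar>x \<bullet> b\<bar>)"
proof -
 have "exp_recip 1 (r + t) * exp_recip 1 (r + - t) = 0 \<longleftrightarrow> r <= \<bar>t\<bar>" for t by (simp add: exp_recip_1) linarith
 then show ?thesis unfolding box_bump_def by (simp add: inner_minus_right)
qed

lemma ex_mollifier:
 assumes "0 < r"
 obtains \<eta> :: "'a::euclidean_space => real"
 where "smooth_on UNIV \<eta>" "!!x. 0 <= \<eta> x" "!!x. r <= norm x ==> \<eta> x = 0"
  "integrable lborel \<eta>" "integral\<^sup>L lborel \<eta> = 1"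
proof -
 \<comment> \<open>The cube of half side \<open>r / d\<close> lies in the ball of radius
   \<open>r\<close>, because the norm is at most the sum of the absolute coordinates.\<close>
 define c where "c = r / real DIM('a)"
 have c: "c > 0" using assms by (simp add: c_def)
 define \<beta> where "\<beta> = (box_bump c :: 'a => real)"
 have sm: "smooth_on UNIV \<beta>" unfolding \<beta>_def by (rule smooth_box_bump)
 have supp: "\<beta> x = 0" if "r <= norm x" for x
 proof -
  have "\<exists>b\<in>Basis. c <= \<bar>x \<bullet> b\<bar>"
  proof (rule ccontr)
   assume "\<not> ?thesis"
   then have "!!b. b \<in> Basis ==> \<bar>x \<bullet> b\<bar> < c" by auto
   then have "(\<Sum>b\<in>Basis. \<bar>x \<bullet> b\<bar>) < (\<Sum>b\<in>(Basis::'a set). c)" by (intro sum_strict_mono) auto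
   also have "\<dots> = r" by (simp add: c_def)
   finally show False using norm_le_l1[of x] that by linarith
  qed
  then show ?thesis by (simp add: \<beta>_def box_bump_eq_0_iff)
 qed
 have cont: "continuous_on A \<beta>" for A using sm by (rule smooth_on_continuous_on)
 have int: "integrable lborel \<beta>"
 proof -
  have "integrable lborel (%x. indicator (cball 0 r) x *\<^sub>R \<beta> x)" by (intro borel_integrable_compact cont) auto
  moreover have "(%x. indicator (cball 0 r) x *\<^sub>R \<beta> x) = \<beta>" using supp by (auto simp: indicator_def fun_eq_iff)
  ultimately show ?thesis by simp
 qed
 have nn: "0 <= \<beta> x" for x by (simp add: \<beta>_def box_bump_nonneg)
 \<comment> \<open>If the integral were 0, the open set where \<beta> is nonzero would be a null
   set, hence empty; but it contains the origin.\<close>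
 have pos: "integral\<^sup>L lborel \<beta> > 0"
 proof -
  have "integral\<^sup>L lborel \<beta> \<noteq> 0"
  proof
   assume "integral\<^sup>L lborel \<beta> = 0"
   then have ae: "AE x in lborel. \<beta> x = 0" using integral_nonneg_eq_0_iff_AE[OF int] nn by auto
   have op: "open {x. \<beta> x \<noteq> 0}" using open_vimage[OF _ cont, of "- {0}"] by (auto simp: vimage_def)
   have "{x. \<beta> x \<noteq> 0} \<in> null_sets lborel" using ae op by (subst (asm) AE_iff_null) auto
   then have "{x. \<beta> x \<noteq> 0} = {}" using open_not_negligible[OF op] null_sets_completionI[of "{x. \<beta> x \<noteq> 0}" lborel]
    by (auto simp: negligible_iff_null_sets)
   moreover have "\<beta> 0 \<noteq> 0" using c by (auto simp: \<beta>_def box_bump_eq_0_iff)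
   ultimately show False by blast
  qed
  then show ?thesis using nn Bochner_Integration.integral_nonneg[of lborel \<beta>] by (simp add: less_le)
 qed
 show ?thesis
 proof (rule that[of "%x. (1 / integral\<^sup>L lborel \<beta>) * \<beta> x"])
  show "smooth_on UNIV (%x. (1 / integral\<^sup>L lborel \<beta>) * \<beta> x)" by (rule smooth_cmult[OF sm])
 qed (use int pos nn supp in auto)
qed

lemma smooth_compact_support_bounds:
 fixes \<zeta> :: "'a::euclidean_space => real"
 assumes sm: "smooth_on UNIV \<zeta>" and C: "compact C" "!!x. x \<notin> C ==> \<zeta> x = 0"
 obtains L where "0 <= L" "!!x. \<bar>\<zeta> x\<bar> <= L" "!!x. norm (grad \<zeta> x) <= L"
  "!!x y. \<bar>\<zeta> x - \<zeta> y\<bar> <= L * norm (x - y)" "!!x. x \<notin> C ==> grad \<zeta> x = 0"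
proof -
 have contz: "continuous_on C \<zeta>" by (rule smooth_on_continuous_on[OF sm])
 have contg: "continuous_on C (grad \<zeta>)" unfolding grad_def using sm
  by (auto intro!: continuous_intros smooth_on_continuous_on smooth_on_pderiv_at)
 have g0: "grad \<zeta> x = 0" if "x \<notin> C" for x
 proof (rule grad_eqI)
  have "((%_. 0) has_derivative (%_. 0)) (at x)" by simp
  then have "(\<zeta> has_derivative (%_. 0)) (at x)" by (rule has_derivative_transform_within_open[of _ _ _ _ "- C"])
    (use that C compact_imp_closed in auto)
  then show "(\<zeta> has_derivative (\<bullet>) 0) (at x)" by (simp add: inner_zero_left[abs_def])
 qed
 obtain A where A: "!!x. x \<in> C ==> norm (\<zeta> x) <= A"
  using compact_imp_bounded[OF compact_continuous_image[OF contz C(1)]] unfolding bounded_iff by blast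
 obtain A' where A': "!!x. x \<in> C ==> norm (grad \<zeta> x) <= A'"
  using compact_imp_bounded[OF compact_continuous_image[OF contg C(1)]] unfolding bounded_iff by blast
 define L where "L = max 0 (max A A')"
 have gL: "norm (grad \<zeta> x) <= L" for x using A'[of x] g0[of x] by (cases "x \<in> C") (auto simp: L_def)
 show ?thesis
 proof (rule that[of L])
  show "0 <= L" by (simp add: L_def)
  show "\<bar>\<zeta> x\<bar> <= L" for x using A[of x] C(2)[of x] by (cases "x \<in> C") (auto simp: L_def)
  show "\<bar>\<zeta> x - \<zeta> y\<bar> <= L * norm (x - y)" for x y
  proof -
   have "norm (\<zeta> x - \<zeta> y) <= L * norm (x - y)"
   proof (rule differentiable_bound[of UNIV \<zeta> "%x k. grad \<zeta> x \<bullet> k"])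
    show "onorm (%k. grad \<zeta> x \<bullet> k) <= L" for x
    proof (rule onorm_le)
     fix k
     have "norm (grad \<zeta> x \<bullet> k) <= norm (grad \<zeta> x) * norm k" by (simp add: Cauchy_Schwarz_ineq2)
     also have "\<dots> <= L * norm k" by (intro mult_right_mono gL) auto
     finally show "norm (grad \<zeta> x \<bullet> k) <= L * norm k" .
    qed
   qed (use smooth_has_derivative_grad[OF sm] in auto)
   then show ?thesis by simp
  qed
 qed (use gL g0 in auto)
qed

lemma set_integral_lebesgue_eq_lborel:
 fixes f :: "'a::euclidean_space => 'b::euclidean_space"
 assumes "f \<in> borel_measurable borel" "!!x. x \<notin> U ==> f x = 0"
 shows "(LINT x:U|lebesgue. f x) = integral\<^sup>L lborel f"
proof -
 have "(%x. indicator U x *\<^sub>R f x) = f" using assms(2) by (auto simp: indicator_def fun_eq_iff)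
 then show ?thesis unfolding set_lebesgue_integral_def using assms(1) by (simp add: integral_completion)
qed

section \<open>Convolution with a contracted argument\<close>

definition mollify :: "real => ('a::euclidean_space => real) => ('a => real) => 'a => real" where
 "mollify c \<eta> F x = (LBINT z. F z * \<eta> (c *\<^sub>R x - z))"

lemma integrable_mollify:
 fixes F :: "'a::euclidean_space => real"
 assumes F: "integrable lborel F" and z: "continuous_on UNIV \<zeta>" "!!x. \<bar>\<zeta> x\<bar> <= L"
 shows "integrable lborel (%z. F z * \<zeta> (a - z))"
proof (rule bochner_bound[of lborel "%z. L * F z"])
 have [measurable]: "\<zeta> \<in> borel_measurable borel" using z(1) by (rule borel_measurable_continuous_onI)
 show "(%z. F z * \<zeta> (a - z)) \<in> borel_measurable lborel" using F by measurable
 show "AE z in lborel. norm (F z * \<zeta> (a - z)) <= norm (L * F z)"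
 proof (intro AE_I2)
  fix y
  have "\<bar>F y\<bar> * \<bar>\<zeta> (a - y)\<bar> <= \<bar>F y\<bar> * \<bar>L\<bar>" using z(2)[of "a - y"] by (intro mult_left_mono) auto
  then show "norm (F y * \<zeta> (a - y)) <= norm (L * F y)" by (simp add: abs_mult mult.commute)
 qed
qed (use F in auto)

lemma smooth_cball_support_bounds:
 fixes \<zeta> :: "'a::euclidean_space => real"
 assumes sm: "smooth_on UNIV \<zeta>" and supp: "!!x. r < norm x ==> \<zeta> x = 0"
 obtains L where "0 <= L" "!!x. \<bar>\<zeta> x\<bar> <= L" "!!x. norm (grad \<zeta> x) <= L"
  "!!x y. \<bar>\<zeta> x - \<zeta> y\<bar> <= L * norm (x - y)" "!!x. r < norm x ==> grad \<zeta> x = 0"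
proof -
 have "\<zeta> x = 0" if "x \<notin> cball 0 r" for x using supp that by auto
 from smooth_compact_support_bounds[OF sm compact_cball this]
 obtain L where "0 <= L" "!!x. \<bar>\<zeta> x\<bar> <= L" "!!x. norm (grad \<zeta> x) <= L"
  "!!x y. \<bar>\<zeta> x - \<zeta> y\<bar> <= L * norm (x - y)" "!!x. x \<notin> cball 0 r ==> grad \<zeta> x = 0"
  by blast
 then show ?thesis by (intro that[of L]) (auto simp: mem_cball)
qed

text \<open>Differentiation under the integral sign: the remainder quotient \<open>e\<close> of the
  kernel is at most \<open>2 * L * \<bar>c\<bar>\<close> by the Lipschitz and gradient bounds, and
  it tends to 0 pointwise. The limit is taken along sequences so that dominated convergence
  applies.\<close>

lemma mollify_has_derivative:
 fixes F :: "'a::euclidean_space => real"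
 assumes F: "integrable lborel F" and sm: "smooth_on UNIV \<zeta>"
  and supp: "!!x. r < norm x ==> \<zeta> x = 0"
 shows "(mollify c \<zeta> F has_derivative
      (%k. (\<Sum>b\<in>Basis. (c * mollify c (pderiv_at b \<zeta>) F x) *\<^sub>R b) \<bullet> k)) (at x)"
  (is "(_ has_derivative (%k. ?g \<bullet> k)) _")
proof -
 obtain L where L: "0 <= L" "!!x. \<bar>\<zeta> x\<bar> <= L" "!!x. norm (grad \<zeta> x) <= L"
  "!!x y. \<bar>\<zeta> x - \<zeta> y\<bar> <= L * norm (x - y)" using smooth_cball_support_bounds[OF sm supp] by metis
 have gradb: "\<bar>grad \<zeta> y \<bullet> k\<bar> <= L * norm k" for y k
  by (meson Cauchy_Schwarz_ineq2 L(3) mult_right_mono norm_ge_zero order_trans)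
 have contz: "continuous_on UNIV \<zeta>" by (rule smooth_on_continuous_on[OF sm])
 have contp: "continuous_on UNIV (pderiv_at b \<zeta>)" if "b \<in> Basis" for b
  using smooth_on_continuous_on smooth_on_pderiv_at[OF sm that] by blast
 have contg: "continuous_on UNIV (%y. grad \<zeta> y \<bullet> k)" for k unfolding grad_def by (intro continuous_intros contp)
 have pb: "\<bar>pderiv_at b \<zeta> y\<bar> <= L" if "b \<in> Basis" for b y using gradb[of y b] that by (simp add: grad_inner_Basis)
 have intz: "integrable lborel (%z. F z * \<zeta> (a - z))" for a using integrable_mollify[OF F contz L(2)] .
 have intg: "integrable lborel (%z. F z * (grad \<zeta> (a - z) \<bullet> k))" for a k using integrable_mollify[OF F contg gradb] .
 have g: "?g \<bullet> k = c * (LBINT z. F z * (grad \<zeta> (c *\<^sub>R x - z) \<bullet> k))" for k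
 proof -
  have "(LBINT z. F z * (grad \<zeta> (c *\<^sub>R x - z) \<bullet> k))
    = (LBINT z. (\<Sum>b\<in>Basis. (b \<bullet> k) * (F z * pderiv_at b \<zeta> (c *\<^sub>R x - z))))"
   by (simp add: grad_def inner_sum_left sum_distrib_left mult_ac)
  also have "\<dots> = (\<Sum>b\<in>Basis. (b \<bullet> k) * mollify c (pderiv_at b \<zeta>) F x)" unfolding mollify_def
   by (subst Bochner_Integration.integral_sum) (auto intro!: integrable_mult_right integrable_mollify[OF F contp pb])
  finally show ?thesis by (simp add: inner_sum_left sum_distrib_left mult_ac)
 qed
 show ?thesis unfolding has_derivative_at
 proof
  show "bounded_linear (%k. ?g \<bullet> k)" by (rule bounded_linear_inner_right)
  show "(%h. norm (mollify c \<zeta> F (x + h) - mollify c \<zeta> F x - ?g \<bullet> h) / norm h) \<midarrow>0\<rightarrow> 0"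
   unfolding tendsto_at_iff_sequentially
  proof (intro allI impI)
   fix X :: "nat => 'a"
   assume X: "\<forall>i. X i \<in> UNIV - {0}" "X \<longlonglongrightarrow> 0"
   define e where "e i z = (\<zeta> (c *\<^sub>R x - z + c *\<^sub>R X i) - \<zeta> (c *\<^sub>R x - z)
    - grad \<zeta> (c *\<^sub>R x - z) \<bullet> (c *\<^sub>R X i)) / norm (X i)" for i z
   have eq: "(mollify c \<zeta> F (x + X i) - mollify c \<zeta> F x - ?g \<bullet> X i) / norm (X i)
     = (LBINT z. F z * e i z)" for i
   proof -
    have "mollify c \<zeta> F (x + X i) - mollify c \<zeta> F x - ?g \<bullet> X i
     = (LBINT z. F z * \<zeta> (c *\<^sub>R (x + X i) - z) - F z * \<zeta> (c *\<^sub>R x - z)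
       - c * (F z * (grad \<zeta> (c *\<^sub>R x - z) \<bullet> X i)))" unfolding g unfolding mollify_def using intz intg by simp
    also have "\<dots> / norm (X i) = (LBINT z. F z * e i z)" unfolding integral_divide_zero[symmetric]
     by (intro bochner_cong refl) (simp add: e_def field_simps scaleR_add_right)
    finally show ?thesis .
   qed
   have ebound: "\<bar>e i z\<bar> <= 2 * L * \<bar>c\<bar>" for i z
   proof -
    have Xi: "norm (X i) > 0" using X(1) by auto
    have "\<bar>\<zeta> (c *\<^sub>R x - z + c *\<^sub>R X i) - \<zeta> (c *\<^sub>R x - z)\<bar> <= L * norm (c *\<^sub>R X i)"
     using L(4)[of "c *\<^sub>R x - z + c *\<^sub>R X i" "c *\<^sub>R x - z"] by simp
    moreover have "\<bar>grad \<zeta> (c *\<^sub>R x - z) \<bullet> (c *\<^sub>R X i)\<bar> <= L * norm (c *\<^sub>R X i)" by (rule gradb)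
    ultimately have "\<bar>\<zeta> (c *\<^sub>R x - z + c *\<^sub>R X i) - \<zeta> (c *\<^sub>R x - z)
      - grad \<zeta> (c *\<^sub>R x - z) \<bullet> (c *\<^sub>R X i)\<bar> <= (2 * L * \<bar>c\<bar>) * norm (X i)"
     using abs_triangle_ineq4[of "\<zeta> (c *\<^sub>R x - z + c *\<^sub>R X i) - \<zeta> (c *\<^sub>R x - z)" "grad \<zeta> (c *\<^sub>R x - z) \<bullet> (c *\<^sub>R X i)"]
     unfolding norm_scaleR by (simp add: mult_ac)
    then show ?thesis unfolding e_def using Xi by (simp add: divide_le_eq)
   qed
   have elim: "(%i. e i z) \<longlonglongrightarrow> 0" for z
   proof -
    let ?y = "c *\<^sub>R x - z"
    have "((%k. \<zeta> (?y + c *\<^sub>R k)) has_derivative (%k. (c *\<^sub>R grad \<zeta> (?y + c *\<^sub>R 0)) \<bullet> k)) (at 0)"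
     by (rule has_derivative_affine_comp[OF sm])
    then have "(%h. norm (\<zeta> (?y + c *\<^sub>R h) - \<zeta> ?y - c * (grad \<zeta> ?y \<bullet> h)) / norm h) \<midarrow>0\<rightarrow> 0"
     unfolding has_derivative_at by simp
    then have "(%i. norm (\<zeta> (?y + c *\<^sub>R X i) - \<zeta> ?y - c * (grad \<zeta> ?y \<bullet> X i)) / norm (X i)) \<longlonglongrightarrow> 0"
     using X unfolding tendsto_at_iff_sequentially comp_def by blast
    then have "(%i. norm (e i z)) \<longlonglongrightarrow> 0" by (simp add: e_def)
    then show ?thesis by (rule tendsto_norm_zero_cancel)
   qed
   have "(%i. LBINT z. F z * e i z) \<longlonglongrightarrow> (\<integral>z. 0 \<partial>(lborel::'a measure))"
   proof (rule integral_dominated_convergence[where w = "%z. (2 * L * \<bar>c\<bar>) * norm (F z)"])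
    have [measurable]: "\<zeta> \<in> borel_measurable borel" "(%y. grad \<zeta> y \<bullet> k) \<in> borel_measurable borel" for k
     using contz contg by (auto intro: borel_measurable_continuous_onI)
    show "(%z. F z * e i z) \<in> borel_measurable lborel" for i unfolding e_def using F by measurable
    show "AE z in lborel. (%i. F z * e i z) \<longlonglongrightarrow> 0" using elim tendsto_mult_right_zero by blast
    show "AE z in lborel. norm (F z * e i z) <= (2 * L * \<bar>c\<bar>) * norm (F z)" for i
     using mult_right_mono[OF ebound abs_ge_zero] by (auto simp: abs_mult mult.commute)
   qed (use F in auto)
   then have "(%i. norm (LBINT z. F z * e i z)) \<longlonglongrightarrow> 0" using tendsto_norm_zero by fastforce
   then show "((%h. norm (mollify c \<zeta> F (x + h) - mollify c \<zeta> F x - ?g \<bullet> h) / norm h) \<circ> X) \<longlonglongrightarrow> 0"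
    by (simp add: comp_def flip: eq)
  qed
 qed
qed

lemma pderiv_at_mollify:
 fixes F :: "'a::euclidean_space => real"
 assumes F: "integrable lborel F" and sm: "smooth_on UNIV \<zeta>"
  and supp: "!!x. r < norm x ==> \<zeta> x = 0" and b: "b \<in> Basis"
 shows "pderiv_at b (mollify c \<zeta> F) x = c * mollify c (pderiv_at b \<zeta>) F x"
 using pderiv_at_eq[OF mollify_has_derivative[OF F sm supp, of r c x], of b] b by (simp add: inner_sum_left inner_Basis if_distrib cong: if_cong)

text \<open>Derivatives fall on the kernel, which stays smooth with the same support radius, and
  each contributes a factor \<open>c\<close>; hence the invariant consists of scalar multiples of
  mollifications.\<close>

lemma smooth_mollify:
 fixes F :: "'a::euclidean_space => real"
 assumes F: "integrable lborel F" and sm: "smooth_on UNIV \<eta>"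
  and supp: "!!x. r < norm x ==> \<eta> x = 0"
 shows "smooth_on UNIV (mollify c \<eta> F)"
proof (rule smooth_coinduct)
 let ?X = "{%x. k * mollify c \<zeta> F x |k \<zeta>. smooth_on UNIV \<zeta> \<and> (\<forall>x. r < norm x --> \<zeta> x = 0)}"
 show "mollify c \<eta> F \<in> ?X" using sm supp by (auto intro!: exI[of _ 1] exI[of _ \<eta>])
 show "h differentiable at x" if hX: "h \<in> ?X" for h x
 proof -
  obtain k \<zeta> where h: "h = (%x. k * mollify c \<zeta> F x)" and z: "smooth_on UNIV \<zeta>"
   "!!x. r < norm x ==> \<zeta> x = 0" using hX by blast
  show ?thesis unfolding h using has_derivative_mult_right[OF mollify_has_derivative[OF F z]] by (rule differentiableI)
 qed
 show "pderiv_at b h \<in> ?X" if hX: "h \<in> ?X" and b: "b \<in> Basis" for h b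
 proof -
  obtain k \<zeta> where h: "h = (%x. k * mollify c \<zeta> F x)" and z: "smooth_on UNIV \<zeta>"
   "!!x. r < norm x ==> \<zeta> x = 0" using hX by blast
  have "pderiv_at b h x = (k * c) * mollify c (pderiv_at b \<zeta>) F x" for x
  proof -
   note D = mollify_has_derivative[OF F z, of r c x]
   have "pderiv_at b h x = k * pderiv_at b (mollify c \<zeta> F) x"
    unfolding h by (simp add: pderiv_at_eq[OF has_derivative_mult_right[OF D]] pderiv_at_eq[OF D])
   then show ?thesis by (simp add: pderiv_at_mollify[OF F z b])
  qed
  then have eq: "pderiv_at b h = (%x. (k * c) * mollify c (pderiv_at b \<zeta>) F x)" ..
  have "pderiv_at b \<zeta> x = 0" if "r < norm x" for x
  proof -
   have "grad \<zeta> x = 0" using smooth_cball_support_bounds[OF z] that by metis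
   then show ?thesis using grad_inner_Basis[OF b, of \<zeta> x] by simp
  qed
  then show ?thesis unfolding eq using smooth_on_pderiv_at[OF z(1) b] by blast
 qed
qed

lemma test_fun_mollifier:
 fixes \<eta> :: "'a::euclidean_space => real"
 assumes sm: "smooth_on UNIV \<eta>" and supp: "!!x. r < norm x ==> \<eta> x = 0"
  and x: "norm a + r < R"
 shows "test_fun (ball 0 R) (%z. \<eta> (a - z))" unfolding test_fun_def
proof
 show "smooth_on UNIV (%z. \<eta> (a - z))" using smooth_affine_comp[OF sm, of a "-1"] by simp
 show "\<exists>C. compact C \<and> C \<subseteq> ball 0 R \<and> (\<forall>z. z \<notin> C --> \<eta> (a - z) = 0)"
 proof (intro exI conjI)
  show "compact (cball a r)" by simp
  show "cball a r \<subseteq> ball 0 R"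
  proof
   fix z assume "z \<in> cball a r"
   then show "z \<in> ball 0 R" using norm_triangle_ineq2[of z a] x by (simp add: dist_norm norm_minus_commute)
  qed
  show "\<forall>z. z \<notin> cball a r --> \<eta> (a - z) = 0" using supp by (auto simp: dist_norm)
 qed
qed

text \<open>For such \<open>x\<close> the kernel, as a function of the integration variable
  \<open>z\<close>, is supported inside the ball and is an admissible test function. Its derivative
  in \<open>z\<close> is minus that of \<eta>, which cancels the sign in the definition of the weak
  derivative.\<close>

lemma mollify_weak_pderiv:
 fixes F g :: "'a::euclidean_space => real"
 assumes F: "F \<in> borel_measurable borel" "!!x. x \<notin> ball 0 R ==> F x = 0"
  and g: "g \<in> borel_measurable borel" "!!x. x \<notin> ball 0 R ==> g x = 0"
  and weak: "has_weak_pderiv (ball 0 R) b F g" and b: "b \<in> Basis"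
  and sm: "smooth_on UNIV \<eta>" and supp: "!!x. r < norm x ==> \<eta> x = 0"
  and x: "norm (c *\<^sub>R x) + r < R"
 shows "mollify c (pderiv_at b \<eta>) F x = mollify c \<eta> g x"
proof -
 let ?\<phi> = "%z. \<eta> (c *\<^sub>R x - z)"
 have [measurable]: "\<eta> \<in> borel_measurable borel" "pderiv_at b \<eta> \<in> borel_measurable borel"
  by (auto intro!: borel_measurable_continuous_onI smooth_on_continuous_on smooth_on_pderiv_at sm b)
 note [measurable] = F(1) g(1)
 have tf: "test_fun (ball 0 R) ?\<phi>" by (rule test_fun_mollifier[OF sm supp x])
 have p: "pderiv_at b ?\<phi> z = - pderiv_at b \<eta> (c *\<^sub>R x - z)" for z
  using pderiv_at_affine_comp[OF sm b, of "c *\<^sub>R x" "-1" z] by simp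
 have "(LINT z:ball 0 R|lebesgue. F z * pderiv_at b ?\<phi> z) = - (LINT z:ball 0 R|lebesgue. g z * ?\<phi> z)"
  using weak tf unfolding has_weak_pderiv_def by blast
 also have "(LINT z:ball 0 R|lebesgue. F z * pderiv_at b ?\<phi> z) = - mollify c (pderiv_at b \<eta>) F x"
  unfolding p mollify_def by (subst set_integral_lebesgue_eq_lborel) (auto simp: F(2))
 also have "(LINT z:ball 0 R|lebesgue. g z * ?\<phi> z) = mollify c \<eta> g x"
  unfolding mollify_def by (subst set_integral_lebesgue_eq_lborel) (auto simp: g(2))
 finally show ?thesis by simp
qed

lemma ball_cball_borel [measurable]:
 "ball (a::'a::euclidean_space) r \<in> sets borel" "cball a r \<in> sets borel" by (auto intro: borel_open borel_closed)

lemma integrable_indicator_bounded: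
 fixes S :: "'a::euclidean_space set"
 assumes "bounded S" "S \<in> sets borel"
 shows "integrable lborel (indicator S :: 'a => real)"
 using emeasure_bounded_finite[OF assms(1)] assms(2) by (intro integrable_real_indicator) auto

section \<open>Affine changes of variables and continuity of composition in L2\<close>

lemma nn_integral_lborel_affine:
 fixes t :: "'a::euclidean_space"
 assumes [measurable]: "f \<in> borel_measurable borel" and "c \<noteq> 0"
 shows "(LBNN x. f x) = ennreal (\<bar>c\<bar> ^ DIM('a)) * (LBNN x. f (t + c *\<^sub>R x))" by (subst lborel_affine[OF assms(2), of t])
  (simp add: nn_integral_density nn_integral_distr nn_integral_cmult)

lemma lborel_distr_reflect: "distr lborel borel (%x. t - x) = (lborel :: 'a::euclidean_space measure)"
 using lborel_affine[of "-1" t, symmetric] by (simp add: density_1)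

lemma integral_lborel_reflect:
 fixes f :: "'a::euclidean_space => 'b::{banach, second_countable_topology}"
 assumes [measurable]: "f \<in> borel_measurable borel"
 shows "(LBINT z. f (t - z)) = integral\<^sup>L lborel f"
proof -
 have "integral\<^sup>L lborel f = integral\<^sup>L (distr lborel borel (%x. t - x)) f" by (simp add: lborel_distr_reflect)
 also have "\<dots> = (LBINT z. f (t - z))" by (rule integral_distr) auto
 finally show ?thesis by simp
qed

lemma integrable_lborel_reflect:
 fixes f :: "'a::euclidean_space => 'b::{banach, second_countable_topology}"
 assumes "integrable lborel f"
 shows "integrable lborel (%z. f (t - z))"
proof -
 have "integrable (distr lborel borel (%x. t - x)) f" using assms by (simp add: lborel_distr_reflect)
 then show ?thesis using assms by (subst (asm) integrable_distr_eq) auto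
qed

lemma ennreal_double_sum: "0 <= a ==> 0 <= b ==> 2 * (ennreal a + ennreal b) = ennreal (2 * (a + b))"
 by (simp add: ennreal_mult' ennreal_plus distrib_left)

lemma power2_norm_add3_le:
 fixes a b c :: "'b::real_inner"
 shows "(norm (a + b + c))\<^sup>2 <= 3 * ((norm a)\<^sup>2 + (norm b)\<^sup>2 + (norm c)\<^sup>2)"
proof -
 have "norm (a + b + c) <= norm a + norm b + norm c" by (metis add_mono norm_triangle_le order_refl)
 then have "(norm (a + b + c))\<^sup>2 <= (norm a + norm b + norm c)\<^sup>2" by (rule power_mono) simp
 also have "\<dots> <= 3 * ((norm a)\<^sup>2 + (norm b)\<^sup>2 + (norm c)\<^sup>2)"
  using sum_squares_ge_zero[of "norm a - norm b" "norm b - norm c"]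
   zero_le_square[of "norm a - norm c"] by (simp add: power2_eq_square algebra_simps)
 finally show ?thesis .
qed

text \<open>Truncation in size and in space reduces the claim to a bounded function with bounded
  support. Such a function is an almost everywhere limit of continuous ones; clipping these provides
  a common dominating function and preserves continuity.\<close>

lemma L2_approx_continuous:
 fixes F :: "'a::euclidean_space => 'b::euclidean_space"
 assumes F[measurable]: "F \<in> borel_measurable borel"
  and fin: "(LBNN x. ennreal ((norm (F x))\<^sup>2)) < \<infinity>" and e: "(0::real) < e"
 obtains G r where "continuous_on UNIV G" "!!x. r < norm x ==> G x = 0"
  "(LBNN x. ennreal ((norm (F x - G x))\<^sup>2)) <= ennreal e"
proof -
 define Fk where "Fk k x = (if norm x <= real k \<and> norm (F x) <= real k then F x else 0)" for k :: nat and x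
 have Fk[measurable]: "Fk k \<in> borel_measurable borel" for k unfolding Fk_def by measurable
 have "(%k. LBNN x. ennreal ((norm (F x - Fk k x))\<^sup>2)) \<longlonglongrightarrow> (\<integral>\<^sup>+x. 0 \<partial>(lborel :: 'a measure))"
 proof (rule nn_integral_dominated_convergence[where w = "%x. ennreal ((norm (F x))\<^sup>2)"])
  show "AE x in lborel. (%k. ennreal ((norm (F x - Fk k x))\<^sup>2)) \<longlonglongrightarrow> 0"
  proof (intro AE_I2 tendsto_eventually)
   fix x
   obtain K :: nat where K: "max (norm x) (norm (F x)) <= K" using real_arch_simple by blast
   show "\<forall>\<^sub>F k in sequentially. ennreal ((norm (F x - Fk k x))\<^sup>2) = 0"
    using eventually_ge_at_top[of K] by eventually_elim (use K in \<open>auto simp: Fk_def\<close>)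
  qed
 qed (use fin in \<open>auto simp: Fk_def\<close>)
 then have "\<forall>\<^sub>F k in sequentially. (LBNN x. ennreal ((norm (F x - Fk k x))\<^sup>2)) < ennreal (e / 4)"
  using e by (intro order_tendstoD(2)[of _ 0]) auto
 then obtain k where k0: "k \<ge> 1" and k: "(LBNN x. ennreal ((norm (F x - Fk k x))\<^sup>2)) < ennreal (e / 4)"
  using eventually_conj[OF eventually_ge_at_top[of 1]] eventually_happens' sequentially_bot by (metis (mono_tags, lifting))
 have kpos: "real k > 0" using k0 by simp
 have "Fk k measurable_on UNIV" by (intro lebesgue_measurable_imp_measurable_on) (auto intro: measurable_completion)
 then obtain N g where N: "negligible N" and g: "!!n. continuous_on UNIV (g n)"
  and lim: "!!x. x \<notin> N ==> (%n. g n x) \<longlonglongrightarrow> Fk k x" unfolding measurable_on_def by auto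
 \<comment> \<open>\<open>cl\<close> is the radial retraction onto the ball of radius
   \<open>k\<close>, and \<open>cut\<close> drops from 1 to 0 between the radii \<open>k\<close> and
   \<open>k + 1\<close>; neither changes the limit \<open>Fk k\<close>.\<close>
 define cl where "cl y = (real k / max (real k) (norm y)) *\<^sub>R y" for y :: 'b
 define cut where "cut x = max 0 (min 1 (real k + 1 - norm x))" for x :: 'a
 define G where "G n x = cut x *\<^sub>R cl (g n x)" for n x
 have cl_norm: "norm (cl y) <= k" for y using kpos by (auto simp: cl_def divide_le_eq max_def)
 have cl_id: "cl y = y" if "norm y <= k" for y using that kpos by (auto simp: cl_def max_def)
 have chi: "0 <= cut x" "cut x <= 1" "real k + 1 < norm x ==> cut x = 0" "norm x <= k ==> cut x = 1" for x
  by (auto simp: cut_def)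
 have contcl: "continuous_on UNIV cl" unfolding cl_def using kpos by (intro continuous_intros) (auto simp: max_def)
 have contG: "continuous_on UNIV (G n)" for n unfolding G_def cut_def by (intro continuous_intros continuous_on_compose2[OF contcl g]) auto
 have [measurable]: "G n \<in> borel_measurable borel" for n using contG by (rule borel_measurable_continuous_onI)
 have G0: "G n x = 0" if "real k + 1 < norm x" for n x using chi(3)[OF that] by (simp add: G_def)
 have Gk: "norm (G n x) <= k" for n x using mult_mono[OF chi(2) cl_norm[of "g n x"], of x] chi(1)[of x] by (simp add: G_def)
 have Fkk: "norm (Fk k x) <= k" for x by (simp add: Fk_def)
 have limG: "(%n. G n x) \<longlonglongrightarrow> Fk k x" if "x \<notin> N" for x
 proof -
  have "(%n. cl (g n x)) \<longlonglongrightarrow> cl (Fk k x)"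
   using contcl lim[OF that] by (auto simp: continuous_on_eq_continuous_at intro: isCont_tendsto_compose)
  then have "(%n. G n x) \<longlonglongrightarrow> cut x *\<^sub>R Fk k x" unfolding G_def cl_id[OF Fkk] by (intro tendsto_intros)
  moreover have "cut x *\<^sub>R Fk k x = Fk k x" using chi(4)[of x] by (cases "norm x <= k") (auto simp: Fk_def)
  ultimately show ?thesis by simp
 qed
 have "(%n. LBNN x. ennreal ((norm (Fk k x - G n x))\<^sup>2)) \<longlonglongrightarrow> (\<integral>\<^sup>+x. 0 \<partial>(lborel :: 'a measure))"
 proof (rule nn_integral_dominated_convergence[where 
    w = "%x. ennreal ((2 * real k)\<^sup>2) * indicator (cball 0 (real k + 1)) x"])
  show "AE x in lborel. ennreal ((norm (Fk k x - G n x))\<^sup>2)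
    <= ennreal ((2 * real k)\<^sup>2) * indicator (cball 0 (real k + 1)) x" for n
  proof (intro AE_I2)
   fix x
   show "ennreal ((norm (Fk k x - G n x))\<^sup>2) <= ennreal ((2 * real k)\<^sup>2) * indicator (cball 0 (real k + 1)) x"
   proof (cases "norm x <= real k + 1")
    case True
    have "norm (Fk k x - G n x) <= 2 * real k" using norm_triangle_ineq4[of "Fk k x" "G n x"] Gk[of n x] Fkk[of x] by simp
    then have "(norm (Fk k x - G n x))\<^sup>2 <= (2 * real k)\<^sup>2" by (intro power_mono) auto
    then show ?thesis using True by (auto intro: ennreal_leI)
   next
    case False
    then show ?thesis using G0[of x n] by (auto simp: Fk_def)
   qed
  qed
  show "AE x in lborel. (%n. ennreal ((norm (Fk k x - G n x))\<^sup>2)) \<longlonglongrightarrow> 0"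
  proof -
   have "AE x in lborel. x \<notin> N" using AE_not_in[of N lebesgue] N by (simp add: negligible_iff_null_sets AE_completion_iff)
   then show ?thesis
   proof eventually_elim
    case (elim x)
    have "(%n. (norm (Fk k x - G n x))\<^sup>2) \<longlonglongrightarrow> (norm (Fk k x - Fk k x))\<^sup>2"
     by (intro tendsto_intros limG elim)
    then show ?case by (simp add: tendsto_ennreal_iff flip: ennreal_0)
   qed
  qed
  show "(\<integral>\<^sup>+x. ennreal ((2 * real k)\<^sup>2) * indicator (cball 0 (real k + 1)) x \<partial>(lborel::'a measure)) < \<infinity>"
   by (subst nn_integral_cmult_indicator)
    (use emeasure_lborel_cball_finite[of "0::'a" "real k + 1"] in \<open>auto simp: ennreal_mult_less_top\<close>)
 qed measurable
 then have "\<forall>\<^sub>F n in sequentially. (LBNN x. ennreal ((norm (Fk k x - G n x))\<^sup>2)) < ennreal (e / 4)"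
  using e by (intro order_tendstoD(2)[of _ 0]) auto
 then obtain n where n: "(LBNN x. ennreal ((norm (Fk k x - G n x))\<^sup>2)) < ennreal (e / 4)" using eventually_happens' sequentially_bot by blast
 show ?thesis
 proof (rule that[of "G n" "real k + 1"])
  have "(LBNN x. ennreal ((norm (F x - G n x))\<^sup>2)) <=
    (LBNN x. 2 * (ennreal ((norm (F x - Fk k x))\<^sup>2) + ennreal ((norm (Fk k x - G n x))\<^sup>2)))"
  proof (rule nn_integral_mono)
   fix x
   have "(norm (F x - G n x))\<^sup>2 <= (norm (F x - Fk k x) + norm (Fk k x - G n x))\<^sup>2"
    using norm_triangle_ineq[of "F x - Fk k x" "Fk k x - G n x"] by (intro power_mono) auto
   also have "\<dots> <= 2 * ((norm (F x - Fk k x))\<^sup>2 + (norm (Fk k x - G n x))\<^sup>2)"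
    using zero_le_power2[of "norm (F x - Fk k x) - norm (Fk k x - G n x)"] by (simp add: power2_eq_square algebra_simps)
   finally have "ennreal ((norm (F x - G n x))\<^sup>2) <= ennreal (2 * ((norm (F x - Fk k x))\<^sup>2 + (norm (Fk k x - G n x))\<^sup>2))"
    by (rule ennreal_leI)
   then show "ennreal ((norm (F x - G n x))\<^sup>2) <= 2 * (ennreal ((norm (F x - Fk k x))\<^sup>2) + ennreal ((norm (Fk k x - G n x))\<^sup>2))"
    by (simp only: ennreal_double_sum zero_le_power2)
  qed
  also have "\<dots> = 2 * ((LBNN x. ennreal ((norm (F x - Fk k x))\<^sup>2)) + (LBNN x. ennreal ((norm (Fk k x - G n x))\<^sup>2)))"
   by (simp add: nn_integral_cmult nn_integral_add)
  also have "\<dots> <= 2 * (ennreal (e / 4) + ennreal (e / 4))" using k n by (intro mult_left_mono add_mono) auto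
  also have "\<dots> = ennreal e" using e by (subst ennreal_double_sum) auto
  finally show "(LBNN x. ennreal ((norm (F x - G n x))\<^sup>2)) <= ennreal e" .
 qed (use contG G0 in auto)
qed

lemma ennreal_numeral_mult: "numeral w * ennreal x = ennreal (numeral w * x)" by (metis ennreal_mult' ennreal_numeral zero_le_numeral)

text \<open>For a continuous approximation \<open>G\<close>, uniform continuity controls
  \<open>G (T x) - G x\<close>, and the assumption that composition with \<open>T\<close> at most
  doubles integrals controls \<open>F (T x) - G (T x)\<close>. This form covers translations in time
  as well as contractions combined with translations in space.\<close>

lemma L2_comp_near_id:
 fixes F :: "'a::euclidean_space => 'b::euclidean_space"
 assumes F[measurable]: "F \<in> borel_measurable borel"
  and fin: "(LBNN x. ennreal ((norm (F x))\<^sup>2)) < \<infinity>" and e: "(0::real) < e"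
  and S[measurable]: "S \<in> sets borel" and bdd: "bounded S"
 obtains \<delta> where "0 < \<delta>"
  "!!T. T \<in> borel_measurable borel ==>
    (!!f. f \<in> borel_measurable borel ==> (LBNN x. f (T x)) <= 2 * (LBNN x. f x)) ==>
    (!!x. x \<in> S ==> dist (T x) x < \<delta>) ==>
    (LBNN x. indicator S x * ennreal ((norm (F (T x) - F x))\<^sup>2)) <= ennreal e"
proof -
 \<comment> \<open>The budget is \<open>3 * (2 * e / 18 + e / 6 + e / 18) = e\<close>: the 3 comes
   from squaring a sum of three terms, the 2 from composition with \<open>T\<close>, and
   \<open>e / 6\<close> is the share of uniform continuity.\<close>
 have "0 < e / 18" using e by simp
 then obtain G r where G: "continuous_on UNIV G" and G0: "!!x. r < norm x ==> G x = 0"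
  and FG: "(LBNN x. ennreal ((norm (F x - G x))\<^sup>2)) <= ennreal (e / 18)" using L2_approx_continuous[OF F fin] by metis
 have [measurable]: "G \<in> borel_measurable borel" using G by (rule borel_measurable_continuous_onI)
 define M where "M = measure lborel S"
 have M: "emeasure lborel S = ennreal M" unfolding M_def using emeasure_bounded_finite[OF bdd] by (simp add: emeasure_eq_ennreal_measure)
 have M0: "M \<ge> 0" by (simp add: M_def)
 define \<omega> where "\<omega> = sqrt (e / (6 * (M + 1)))"
 have w: "\<omega> > 0" using e M0 by (simp add: \<omega>_def)
 have w2: "\<omega>\<^sup>2 * M <= e / 6"
 proof -
  have "\<omega>\<^sup>2 * M = e / 6 * (M / (M + 1))" using e M0 by (simp add: \<omega>_def)
  also have "\<dots> <= e / 6 * 1" using e M0 by (intro mult_left_mono) auto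
  finally show ?thesis by simp
 qed
 obtain s where s: "!!x. x \<in> S ==> norm x <= s" using bdd bounded_iff by blast
 \<comment> \<open>The extra 1 leaves room for \<open>T x\<close>, which has distance less than
   \<open>min d 1\<close> from a point of \<open>S\<close>.\<close>
 have "uniformly_continuous_on (cball 0 (s + 1)) G" by (intro compact_uniformly_continuous continuous_on_subset[OF G]) auto
 then obtain d where d: "d > 0"
  "!!x y. x \<in> cball 0 (s + 1) ==> y \<in> cball 0 (s + 1) ==> dist y x < d ==> dist (G y) (G x) < \<omega>"
  unfolding uniformly_continuous_on_def using w by meson
 define a where "a x = ennreal ((norm (F x - G x))\<^sup>2)" for x
 have [measurable]: "a \<in> borel_measurable borel" unfolding a_def by measurable
 show ?thesis
 proof (rule that[of "min d 1"])
  fix T :: "'a => 'a"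
  assume T[measurable]: "T \<in> borel_measurable borel"
   and T2: "!!f. f \<in> borel_measurable borel ==> (LBNN x. f (T x)) <= 2 * (LBNN x. f x)"
   and near: "!!x. x \<in> S ==> dist (T x) x < min d 1"
  have "(LBNN x. indicator S x * ennreal ((norm (F (T x) - F x))\<^sup>2))
    <= (LBNN x. 3 * (a (T x) + ennreal (\<omega>\<^sup>2) * indicator S x + a x))"
  proof (rule nn_integral_mono)
   fix x
   show "indicator S x * ennreal ((norm (F (T x) - F x))\<^sup>2) <= 3 * (a (T x) + ennreal (\<omega>\<^sup>2) * indicator S x + a x)"
   proof (cases "x \<in> S")
    case True
    have "norm (T x) <= norm x + dist (T x) x" by (simp add: dist_norm norm_triangle_sub)
    then have "dist (G (T x)) (G x) < \<omega>" using near[OF True] s[OF True] by (intro d) auto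
    then have g: "(norm (G (T x) - G x))\<^sup>2 <= \<omega>\<^sup>2" by (intro power_mono) (auto simp: dist_norm)
    have "(norm (F (T x) - F x))\<^sup>2 = (norm ((F (T x) - G (T x)) + (G (T x) - G x) + (G x - F x)))\<^sup>2" by simp
    also have "\<dots> <= 3 * ((norm (F (T x) - G (T x)))\<^sup>2 + (norm (G (T x) - G x))\<^sup>2 + (norm (G x - F x))\<^sup>2)"
     by (rule power2_norm_add3_le)
    also have "\<dots> <= 3 * ((norm (F (T x) - G (T x)))\<^sup>2 + \<omega>\<^sup>2 + (norm (F x - G x))\<^sup>2)"
     using g by (simp add: norm_minus_commute)
    finally have "ennreal ((norm (F (T x) - F x))\<^sup>2) <=
      ennreal (3 * ((norm (F (T x) - G (T x)))\<^sup>2 + \<omega>\<^sup>2 + (norm (F x - G x))\<^sup>2))" by (rule ennreal_leI)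
    also have "\<dots> = 3 * (a (T x) + ennreal (\<omega>\<^sup>2) + a x)" by (simp add: a_def ennreal_mult')
    finally show ?thesis using True by simp
   qed auto
  qed
  also have "\<dots> = 3 * ((LBNN x. a (T x)) + ennreal (\<omega>\<^sup>2) * ennreal M + (LBNN x. a x))"
   by (simp add: nn_integral_cmult nn_integral_add nn_integral_cmult_indicator flip: M)
  also have "\<dots> <= 3 * (2 * ennreal (e / 18) + ennreal (\<omega>\<^sup>2 * M) + ennreal (e / 18))"
  proof (intro mult_left_mono add_mono)
   have *: "(LBNN x. a x) <= ennreal (e / 18)" using FG by (simp add: a_def)
   then show "(LBNN x. a x) <= ennreal (e / 18)" .
   show "(LBNN x. a (T x)) <= 2 * ennreal (e / 18)" using T2[of a] mult_left_mono[OF *, of 2] by (auto intro: order_trans)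
   show "ennreal (\<omega>\<^sup>2) * ennreal M <= ennreal (\<omega>\<^sup>2 * M)" by (simp add: ennreal_mult')
  qed auto
  also have "\<dots> = ennreal (3 * (2 * (e / 18) + \<omega>\<^sup>2 * M + e / 18))"
   using e M0 by (subst ennreal_numeral_mult ennreal_plus[symmetric]; simp)+
  also have "\<dots> <= ennreal e" using w2 by (intro ennreal_leI) (simp add: field_simps)
  finally show "(LBNN x. indicator S x * ennreal ((norm (F (T x) - F x))\<^sup>2)) <= ennreal e" .
 qed (use d in auto)
qed

text \<open>Jensen's inequality for the square under the probability density \<eta>; it expresses
  that the variance is nonnegative.\<close>

lemma square_integral_le_prob:
 fixes u \<eta> :: "'a => real"
 assumes [measurable]: "u \<in> borel_measurable M" "\<eta> \<in> borel_measurable M"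
  and nn: "!!x. 0 <= \<eta> x" and int: "integrable M \<eta>" "integral\<^sup>L M \<eta> = 1"
 shows "ennreal ((\<integral>x. u x * \<eta> x \<partial>M)\<^sup>2) <= (\<integral>\<^sup>+x. ennreal ((u x)\<^sup>2 * \<eta> x) \<partial>M)"
proof (cases "(\<integral>\<^sup>+x. ennreal ((u x)\<^sup>2 * \<eta> x) \<partial>M) = \<infinity>")
 case False
 have i2: "integrable M (%x. (u x)\<^sup>2 * \<eta> x)" using False nn by (intro integrableI_nonneg) (auto simp: top.not_eq_extremum)
 have i1: "integrable M (%x. u x * \<eta> x)"
 proof (rule bochner_bound[of M "%x. (u x)\<^sup>2 * \<eta> x + \<eta> x"])
  show "AE x in M. norm (u x * \<eta> x) <= norm ((u x)\<^sup>2 * \<eta> x + \<eta> x)"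
  proof (intro AE_I2)
   fix x
   have "\<bar>u x\<bar> <= (u x)\<^sup>2 + 1" using zero_le_power2[of "\<bar>u x\<bar> - 1 / 2"] by (simp add: power2_eq_square algebra_simps)
   then have "\<bar>u x\<bar> * \<eta> x <= ((u x)\<^sup>2 + 1) * \<eta> x" using nn by (rule mult_right_mono)
   then show "norm (u x * \<eta> x) <= norm ((u x)\<^sup>2 * \<eta> x + \<eta> x)" using nn[of x] by (simp add: abs_mult algebra_simps)
  qed
 qed (use i2 int in auto)
 let ?A = "\<integral>x. u x * \<eta> x \<partial>M"
 have "0 <= (\<integral>x. (u x - ?A)\<^sup>2 * \<eta> x \<partial>M)" using nn by (intro Bochner_Integration.integral_nonneg) auto
 also have "\<dots> = (\<integral>x. (u x)\<^sup>2 * \<eta> x - 2 * ?A * (u x * \<eta> x) + ?A\<^sup>2 * \<eta> x \<partial>M)"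
  by (intro bochner_cong refl) (simp add: power2_eq_square algebra_simps)
 also have "\<dots> = (\<integral>x. (u x)\<^sup>2 * \<eta> x \<partial>M) - ?A\<^sup>2" using i1 i2 int by (simp add: power2_eq_square)
 finally have "?A\<^sup>2 <= (\<integral>x. (u x)\<^sup>2 * \<eta> x \<partial>M)" by simp
 then show ?thesis using nn i2 by (subst nn_integral_eq_integral) (auto intro: ennreal_leI)
qed simp

section \<open>Smoothing up to the boundary of the ball\<close>

definition mollifier :: "real => 'a::euclidean_space => real" where
 "mollifier r = (SOME \<eta>. smooth_on UNIV \<eta> \<and> (\<forall>x. 0 <= \<eta> x) \<and> (\<forall>x. r <= norm x --> \<eta> x = 0) \<and>
   integrable lborel \<eta> \<and> integral\<^sup>L lborel \<eta> = 1)"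

lemma mollifier:
 assumes "0 < r"
 shows "smooth_on UNIV (mollifier r :: 'a::euclidean_space => real)" "0 <= mollifier r (x::'a)"
  "r <= norm x ==> mollifier r x = 0"
  "integrable lborel (mollifier r :: 'a => real)" "integral\<^sup>L lborel (mollifier r :: 'a => real) = 1"
proof -
 have "\<exists>\<eta>::'a => real. smooth_on UNIV \<eta> \<and> (\<forall>x. 0 <= \<eta> x) \<and> (\<forall>x. r <= norm x --> \<eta> x = 0) \<and>
   integrable lborel \<eta> \<and> integral\<^sup>L lborel \<eta> = 1" using ex_mollifier[OF assms] by metis
 from someI_ex[OF this]
 show "smooth_on UNIV (mollifier r :: 'a => real)" "0 <= mollifier r (x::'a)"
  "r <= norm x ==> mollifier r x = 0"
  "integrable lborel (mollifier r :: 'a => real)" "integral\<^sup>L lborel (mollifier r :: 'a => real) = 1"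
  unfolding mollifier_def[symmetric] by blast+
qed

text \<open>Contracting the argument before mollifying makes the result smooth up to the boundary of
 \<open>ball 0 R\<close> while only values of \<open>F\<close> inside the ball enter.\<close>

definition contraction :: "nat => real" where
 "contraction n = 1 - 1 / (real n + 2)"

text \<open>Half of the gap \<open>(1 - c) * R\<close> that contraction by \<open>c\<close> leaves
  to the boundary, so that the support of the shifted kernel stays strictly inside the ball.\<close>

definition smoothing_radius :: "real => nat => real" where
 "smoothing_radius R n = (1 - contraction n) * (R / 2)"

definition smoothing :: "real => nat => ('a::euclidean_space => real) => 'a => real" where
 "smoothing R n F = mollify (contraction n) (mollifier (smoothing_radius R n)) F"

lemma contraction_bounds: "1 / 2 <= contraction n" "contraction n < 1" by (auto simp: contraction_def field_simps)

lemma contraction_tendsto: "contraction \<longlonglongrightarrow> 1"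
proof -
 have "(%n. 1 / (real n + 2)) \<longlonglongrightarrow> 0"
  using LIMSEQ_ignore_initial_segment[OF lim_1_over_n, of 2] by (simp add: add.commute)
 then have "(%n. 1 - 1 / (real n + 2)) \<longlonglongrightarrow> 1 - 0" by (intro tendsto_intros)
 then show ?thesis by (simp add: contraction_def[abs_def])
qed

context
 fixes R :: real and F :: "'a::euclidean_space => real"
 assumes R: "0 < R" and Fi: "integrable lborel F"
begin

private lemma radius: "0 < smoothing_radius R n" using R contraction_bounds[of n] by (simp add: smoothing_radius_def)

private lemma [measurable]: "mollifier (smoothing_radius R n) \<in> borel_measurable borel"
 by (intro borel_measurable_continuous_onI smooth_on_continuous_on mollifier radius)

lemma smooth_smoothing: "smooth_on UNIV (smoothing R n F)" unfolding smoothing_def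
 by (rule smooth_mollify[OF Fi mollifier(1)[OF radius]]) (rule mollifier(3)[OF radius less_imp_le])

lemma smoothing_nonneg: "(!!x. 0 <= F x) ==> 0 <= smoothing R n F x" unfolding smoothing_def mollify_def
 by (intro Bochner_Integration.integral_nonneg mult_nonneg_nonneg mollifier(2)[OF radius])

lemma smoothing_diff_square_le:
 "ennreal ((smoothing R n F x - F x)\<^sup>2) <=
   (LBNN w. ennreal ((F (contraction n *\<^sub>R x - w) - F x)\<^sup>2 * mollifier (smoothing_radius R n) w))"
proof -
 let ?\<eta> = "mollifier (smoothing_radius R n) :: 'a => real" and ?a = "contraction n *\<^sub>R x"
 note \<eta> = mollifier[OF radius, of n]
 have F[measurable]: "F \<in> borel_measurable borel" using Fi by auto
 obtain L where L: "!!x. \<bar>?\<eta> x\<bar> <= L" using smooth_cball_support_bounds[OF \<eta>(1) \<eta>(3)[OF less_imp_le]] by metis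
 have i: "integrable lborel (%z. F z * ?\<eta> (?a - z))" by (rule integrable_mollify[OF Fi smooth_on_continuous_on[OF \<eta>(1)] L])
 have i': "integrable lborel (%w. F (?a - w) * ?\<eta> w)" using integrable_lborel_reflect[OF i, of ?a] by simp
 have [measurable]: "?\<eta> \<in> borel_measurable borel" by (intro borel_measurable_continuous_onI smooth_on_continuous_on \<eta>)
 have m: "(%z. F z * ?\<eta> (?a - z)) \<in> borel_measurable borel" by measurable
 have "smoothing R n F x = (LBINT w. F (?a - w) * ?\<eta> w)" unfolding smoothing_def mollify_def using integral_lborel_reflect[OF m, of ?a] by simp
 then have "smoothing R n F x - F x = (LBINT w. (F (?a - w) - F x) * ?\<eta> w)" unfolding left_diff_distrib[of "F _" "F x"]
  by (subst Bochner_Integration.integral_diff) (use i' \<eta>(4,5) in auto)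
 then show ?thesis using square_integral_le_prob[of "%w. F (?a - w) - F x" lborel ?\<eta>, OF _ _ \<eta>(2,4,5)] by simp
qed

text \<open>By Jensen and Fubini the error is at most an average over \<open>w\<close> of the
  squared L2 distances between \<open>F (c x - w)\<close> and \<open>F x\<close>. These are small
  uniformly in the relevant \<open>w\<close>, because \<open>c x - w\<close> is close to
  \<open>x\<close> on the ball and the Jacobian is close to 1.\<close>

lemma smoothing_L2_tendsto:
 assumes fin: "(LBNN x. ennreal ((F x)\<^sup>2)) < \<infinity>"
 shows "(%n. LBNN x. indicator (ball 0 R) x * ennreal ((smoothing R n F x - F x)\<^sup>2)) \<longlonglongrightarrow> 0"
proof -
 have F[measurable]: "F \<in> borel_measurable borel" using Fi by auto
 have ev: "\<forall>\<^sub>F n in sequentially. (LBNN x. indicator (ball 0 R) x * ennreal ((smoothing R n F x - F x)\<^sup>2)) <= ennreal e"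
  if e: "0 < e" for e :: real
 proof -
  have "(LBNN x. ennreal ((norm (F x))\<^sup>2)) < \<infinity>" using fin by simp
  from L2_comp_near_id[OF F this e, of "ball 0 R"]
  obtain \<delta> where d: "0 < \<delta>" and near:
   "!!T. T \<in> borel_measurable borel ==>
    (!!f. f \<in> borel_measurable borel ==> (LBNN x. f (T x)) <= 2 * (LBNN x. f x)) ==>
    (!!x. x \<in> ball 0 R ==> dist (T x) x < \<delta>) ==>
    (LBNN x. indicator (ball 0 R) x * ennreal ((norm (F (T x) - F x))\<^sup>2)) <= ennreal e" by auto
  have "(%n. contraction n ^ DIM('a)) \<longlonglongrightarrow> 1 ^ DIM('a)" by (intro tendsto_intros contraction_tendsto)
  \<comment> \<open>With a Jacobian above 1/2, composition at most doubles integrals, as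
    \<open>near\<close> demands.\<close>
  then have ev1: "\<forall>\<^sub>F n in sequentially. 1 / 2 < contraction n ^ DIM('a)" by (rule order_tendstoD) simp
  \<comment> \<open>Bound for the displacement: \<open>(1 - c) * R\<close> from the contraction and
    \<open>(1 - c) * R / 2\<close> from the support of the kernel.\<close>
  have "(%n. (1 - contraction n) * (R + R / 2)) \<longlonglongrightarrow> (1 - 1) * (R + R / 2)"
   by (intro tendsto_intros contraction_tendsto)
  then have ev2: "\<forall>\<^sub>F n in sequentially. (1 - contraction n) * (R + R / 2) < \<delta>"
   using d by (intro order_tendstoD(2)[of _ 0]) auto
  show ?thesis using ev1 ev2
  proof eventually_elim
   case (elim n)
   let ?c = "contraction n" and ?\<eta> = "mollifier (smoothing_radius R n) :: 'a => real"
   note \<eta> = mollifier[OF radius, of n]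
   have c0: "0 < ?c" using contraction_bounds[of n] by simp
   have inner: "(LBNN x. indicator (ball 0 R) x * ennreal ((F (?c *\<^sub>R x - w) - F x)\<^sup>2 * ?\<eta> w))
     <= ennreal e * ennreal (?\<eta> w)" for w
   proof (cases "smoothing_radius R n <= norm w")
    case True
    then show ?thesis using \<eta>(3)[OF True] by simp
   next
    case False
    have "(LBNN x. indicator (ball 0 R) x * ennreal ((norm (F (?c *\<^sub>R x - w) - F x))\<^sup>2)) <= ennreal e"
    proof (rule near)
     fix f :: "'a => ennreal" assume f[measurable]: "f \<in> borel_measurable borel"
     have "1 * (LBNN x. f (?c *\<^sub>R x - w)) <= ennreal (2 * \<bar>?c\<bar> ^ DIM('a)) * (LBNN x. f (- w + ?c *\<^sub>R x))"
      using elim(1) c0 by (intro mult_mono) (auto simp flip: ennreal_1 intro!: ennreal_leI)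
     also have "\<dots> = 2 * (ennreal (\<bar>?c\<bar> ^ DIM('a)) * (LBNN x. f (- w + ?c *\<^sub>R x)))"
      by (simp only: ennreal_numeral_mult[symmetric] mult.assoc)
     also have "\<dots> = 2 * (LBNN x. f x)" using nn_integral_lborel_affine[OF f, of ?c "- w"] c0 by simp
     finally show "(LBNN x. f (?c *\<^sub>R x - w)) <= 2 * (LBNN x. f x)" by simp
    next
     fix x :: 'a assume "x \<in> ball 0 R"
     have "dist (?c *\<^sub>R x - w) x = norm (- ((1 - ?c) *\<^sub>R x) - w)" by (simp add: dist_norm algebra_simps)
     also have "\<dots> <= norm ((1 - ?c) *\<^sub>R x) + norm w" using norm_triangle_ineq4[of "- ((1 - ?c) *\<^sub>R x)" w] by simp
     also have "\<dots> <= (1 - ?c) * R + norm w"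
      using \<open>x \<in> ball 0 R\<close> contraction_bounds[of n] by (auto intro!: mult_left_mono)
     also have "\<dots> <= (1 - ?c) * (R + R / 2)" using False unfolding smoothing_radius_def distrib_left by linarith
     finally show "dist (?c *\<^sub>R x - w) x < \<delta>" using elim(2) by linarith
    qed auto
    then have "(LBNN x. indicator (ball 0 R) x * ennreal ((F (?c *\<^sub>R x - w) - F x)\<^sup>2)) * ennreal (?\<eta> w)
     <= ennreal e * ennreal (?\<eta> w)" by (intro mult_right_mono) auto
    moreover have "(LBNN x. indicator (ball 0 R) x * ennreal ((F (?c *\<^sub>R x - w) - F x)\<^sup>2 * ?\<eta> w))
     = (LBNN x. indicator (ball 0 R) x * ennreal ((F (?c *\<^sub>R x - w) - F x)\<^sup>2)) * ennreal (?\<eta> w)"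
    proof (subst nn_integral_multc[symmetric])
     show "(%x. indicator (ball 0 R) x * ennreal ((F (?c *\<^sub>R x - w) - F x)\<^sup>2)) \<in> borel_measurable lborel" by measurable
    qed (simp only: ennreal_mult''[OF \<eta>(2)] mult.assoc)
    ultimately show ?thesis by simp
   qed
   have "(LBNN x. indicator (ball 0 R) x * ennreal ((smoothing R n F x - F x)\<^sup>2))
    <= (LBNN x. (LBNN w. indicator (ball 0 R) x * ennreal ((F (?c *\<^sub>R x - w) - F x)\<^sup>2 * ?\<eta> w)))"
    by (subst nn_integral_cmult) (auto intro!: nn_integral_mono mult_left_mono smoothing_diff_square_le)
   also have "\<dots> = (LBNN w. (LBNN x. indicator (ball 0 R) x * ennreal ((F (?c *\<^sub>R x - w) - F x)\<^sup>2 * ?\<eta> w)))"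
    by (rule lborel_pair.Fubini') measurable
   also have "\<dots> <= (LBNN w. ennreal e * ennreal (?\<eta> w))" by (intro nn_integral_mono inner)
   also have "\<dots> = ennreal e * (LBNN w. ennreal (?\<eta> w))" by (rule nn_integral_cmult) measurable
   also have "(LBNN w. ennreal (?\<eta> w)) = 1" by (subst nn_integral_eq_integral) (use \<eta>(2,4,5) in auto)
   finally show ?case by simp
  qed
 qed
 show ?thesis
 proof (rule order_tendstoI)
  fix a :: ennreal assume "0 < a"
  then obtain e :: real where e: "0 < e" "ennreal e < a"
   by (metis dense ennreal_cases ennreal_less_zero_iff infinity_ennreal_def less_top_ennreal not_less_iff_gr_or_eq top.not_eq_extremum)
  show "\<forall>\<^sub>F n in sequentially. (LBNN x. indicator (ball 0 R) x * ennreal ((smoothing R n F x - F x)\<^sup>2)) < a"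
   using ev[OF e(1)] by eventually_elim (use e(2) in auto)
 qed auto
qed

text \<open>The factor \<open>contraction n\<close> is the inner derivative of the contracted
  argument. On the ball the shifted kernel is an admissible test function thanks to the choice of
  \<open>smoothing_radius\<close>.\<close>

lemma smoothing_weak_pderiv:
 assumes F: "!!x. x \<notin> ball 0 R ==> F x = 0"
  and g: "g \<in> borel_measurable borel" "!!x. x \<notin> ball 0 R ==> g x = 0"
  and weak: "has_weak_pderiv (ball 0 R) b F g" and b: "b \<in> Basis" and x: "x \<in> ball 0 R"
 shows "pderiv_at b (smoothing R n F) x = contraction n * smoothing R n g x"
proof -
 let ?r = "smoothing_radius R n"
 note \<eta> = mollifier[OF radius, of n]
 have F': "F \<in> borel_measurable borel" using Fi by auto
 have "norm (contraction n *\<^sub>R x) + ?r < R"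
 proof -
  have "contraction n * norm x <= contraction n * R" using x contraction_bounds[of n] by (intro mult_left_mono) auto
  moreover have "contraction n * R + ?r < R"
  proof -
   have "contraction n * R + smoothing_radius R n = R - (1 - contraction n) * R / 2" by (simp add: smoothing_radius_def field_simps)
   then show ?thesis using R mult_pos_pos[of "1 - contraction n" R] contraction_bounds[of n] by linarith
  qed
  ultimately show ?thesis using contraction_bounds[of n] by (simp only: norm_scaleR abs_of_nonneg)
 qed
 from mollify_weak_pderiv[OF F' F g weak b \<eta>(1) \<eta>(3)[OF less_imp_le] this]
 show ?thesis unfolding smoothing_def by (subst pderiv_at_mollify[OF Fi \<eta>(1) \<eta>(3)[OF less_imp_le] b]) auto
qed

end

section \<open>The fundamental lemma of the calculus of variations\<close>

text \<open>Each face contributes a factor \<open>exp (- 1 / ((n + 1) * t))\<close>, where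
  \<open>t\<close> is the signed distance to the face, replaced by 0 for \<open>t <= 0\<close>. It
  tends to 1 for \<open>t > 0\<close>, so the products converge at every point.\<close>

lemma box_indicator_limit:
 fixes a c :: "'a::euclidean_space"
 assumes ac: "cbox a c \<subseteq> U"
 obtains \<phi> :: "nat => 'a => real"
 where "!!n. test_fun U (\<phi> n)" "!!n x. 0 <= \<phi> n x" "!!n x. \<phi> n x <= 1"
  "!!n x. x \<notin> box a c ==> \<phi> n x = 0" "!!x. (%n. \<phi> n x) \<longlonglongrightarrow> indicator (box a c) x"
proof -
 let ?E = "exp_recip 1"
 define \<phi> where "\<phi> n x = (\<Prod>b\<in>Basis. ?E (- real (Suc n) * (a \<bullet> b) + x \<bullet> (real (Suc n) *\<^sub>R b)) *
   ?E (real (Suc n) * (c \<bullet> b) + x \<bullet> (- real (Suc n) *\<^sub>R b)))" for n and x :: 'a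
 have phi: "\<phi> n x = (\<Prod>b\<in>Basis. ?E (real (Suc n) * (x \<bullet> b - a \<bullet> b)) * ?E (real (Suc n) * (c \<bullet> b - x \<bullet> b)))" for n x
  unfolding \<phi>_def by (intro prod.cong refl arg_cong2[where f = "(*)"] arg_cong[where f = ?E]) (simp_all add: algebra_simps)
 have E1: "?E t <= 1" for t by (simp add: exp_recip_def)
 have zero: "\<phi> n x = 0" if x: "x \<notin> box a c" for n x
 proof -
  obtain b where b: "b \<in> Basis" "x \<bullet> b <= a \<bullet> b \<or> c \<bullet> b <= x \<bullet> b"
   using x by (auto simp: mem_box not_less)
  then have "?E (real (Suc n) * (x \<bullet> b - a \<bullet> b)) * ?E (real (Suc n) * (c \<bullet> b - x \<bullet> b)) = 0"
   by (auto simp: exp_recip_1 mult_le_0_iff)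
  then show ?thesis unfolding phi using b(1) by (intro prod_zero) auto
 qed
 show ?thesis
 proof (rule that[of \<phi>])
  show "test_fun U (\<phi> n)" for n unfolding test_fun_def
  proof
   show "smooth_on UNIV (\<phi> n)" unfolding \<phi>_def[abs_def] by (rule smooth_prod_exp_recip)
   show "\<exists>C. compact C \<and> C \<subseteq> U \<and> (\<forall>x. x \<notin> C --> \<phi> n x = 0)"
    using ac zero box_subset_cbox[of a c] by (intro exI[of _ "cbox a c"]) auto
  qed
  show "0 <= \<phi> n x" for n x unfolding phi by (intro prod_nonneg ballI mult_nonneg_nonneg exp_recip_1)
  show "\<phi> n x <= 1" for n x unfolding phi by (intro prod_le_1 conjI mult_nonneg_nonneg exp_recip_1 mult_le_one E1)
  show "\<phi> n x = 0" if "x \<notin> box a c" for n x using zero[OF that] .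
  show "(%n. \<phi> n x) \<longlonglongrightarrow> indicator (box a c) x" for x
  proof (cases "x \<in> box a c")
   case True
   have lim: "(%n. ?E (real (Suc n) * t)) \<longlonglongrightarrow> 1" if t: "0 < t" for t
   proof -
    have "(%n. exp (- (1 / real (Suc n) * (1 / t)))) \<longlonglongrightarrow> exp (- (0 * (1 / t)))"
     by (intro tendsto_intros LIMSEQ_Suc lim_1_over_n)
    then show ?thesis using t by (simp add: exp_recip_def zero_less_mult_iff)
   qed
   have "(%n. \<phi> n x) \<longlonglongrightarrow> (\<Prod>b\<in>(Basis::'a set). 1 * 1)"
    unfolding phi using True by (intro tendsto_prod tendsto_mult lim) (auto simp: mem_box)
   then show ?thesis using True by simp
  next
   case False
   then show ?thesis using zero by simp
  qed
 qed
qed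

text \<open>Open boxes form an intersection-stable generator of the Borel sets, so vanishing
  integrals extend to all Borel sets, in particular to the sets where \<open>f\<close> has a fixed
  sign.\<close>

lemma AE_eq_0_if_box_integrals_eq_0:
 fixes f :: "'a::euclidean_space => real"
 assumes f: "integrable lborel f"
  and box: "!!a b. (LBINT x. indicator (box a b) x * f x) = 0"
 shows "AE x in lborel. f x = 0"
proof -
 have i: "integrable lborel (%x. indicator A x * f x)" if "A \<in> sets borel" for A
  using integrable_real_mult_indicator[of A lborel f] that f by (simp add: mult.commute)
 \<comment> \<open>The complement step of the induction uses the integral over the whole space,
   obtained as a limit over growing boxes.\<close>
 have total: "integral\<^sup>L lborel f = 0"
 proof -
  have "(%n. LBINT x. indicator (box (- real n *\<^sub>R One) (real n *\<^sub>R One)) x * f x) \<longlonglongrightarrow> integral\<^sup>L lborel f"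
  proof (rule integral_dominated_convergence[where w = "%x. norm (f x)"])
   show "AE x in lborel. (%n. indicator (box (- real n *\<^sub>R One) (real n *\<^sub>R One)) x * f x) \<longlonglongrightarrow> f x"
   proof (intro AE_I2 tendsto_eventually)
    fix x :: 'a
    obtain N :: nat where N: "norm x < N" using reals_Archimedean2 by blast
    show "\<forall>\<^sub>F n in sequentially. indicator (box (- real n *\<^sub>R One) (real n *\<^sub>R One)) x * f x = f x"
     using eventually_ge_at_top[of N]
    proof eventually_elim
     case (elim n)
     have "\<bar>x \<bullet> b\<bar> < real n" if "b \<in> Basis" for b using Basis_le_norm[OF that, of x] N elim by linarith
     then have "x \<in> box (- real n *\<^sub>R One) (real n *\<^sub>R One)"
      by (auto simp: mem_box abs_less_iff inner_sum_left inner_Basis if_distrib cong: if_cong) (metis minus_less_iff)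
     then show ?case by simp
    qed
   qed
  qed (use f in \<open>auto simp: indicator_def\<close>)
  then show ?thesis by (simp add: box LIMSEQ_const_iff)
 qed
 have all: "(LBINT x. indicator A x * f x) = 0" if "A \<in> sets borel" for A
 proof -
  let ?G = "range (%(a, b). box a b :: 'a set)"
  have Asig: "A \<in> sigma_sets UNIV ?G" using that by (subst (asm) borel_eq_box) auto
  have Gst: "Int_stable ?G"
  proof (rule Int_stableI)
   fix A B assume "A \<in> ?G" "B \<in> ?G"
   then obtain a b c d where "A = box a b" "B = box c d" by auto
   then have "A \<inter> B = box (\<Sum>i\<in>Basis. max (a \<bullet> i) (c \<bullet> i) *\<^sub>R i) (\<Sum>i\<in>Basis. min (b \<bullet> i) (d \<bullet> i) *\<^sub>R i)"
    by (simp add: box_Int_box)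
   then show "A \<inter> B \<in> ?G" by auto
  qed
  have GP: "?G \<subseteq> Pow UNIV" by simp
  from Gst GP Asig show ?thesis
  proof (induction rule: sigma_sets_induct_disjoint)
   case (compl A)
   then have A: "A \<in> sets borel" by (subst borel_eq_box) auto
   have "(LBINT x. indicator (UNIV - A) x * f x) = (LBINT x. f x - indicator A x * f x)" by (intro bochner_cong) (auto simp: indicator_def)
   also have "\<dots> = 0" using i[OF A] f total compl by simp
   finally show ?case .
  next
   case (union A)
   then have A: "A i \<in> sets borel" for i by (subst borel_eq_box) auto
   then have "set_integrable lborel (\<Union>i. A i) f" unfolding set_integrable_def using i[of "\<Union>i. A i"] by simp
   then have "(LINT x:(\<Union>i. A i)|lborel. f x) = (\<Sum>i. (LINT x:A i|lborel. f x))"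
    using A union(1) by (intro lebesgue_integral_countable_add) (auto simp: disjoint_family_on_def)
   then show ?case using union(3) by (simp add: set_lebesgue_integral_def)
  qed (use box in auto)
 qed
 have meas[measurable]: "f \<in> borel_measurable borel" using f by auto
 have abs0: "(LBINT x. \<bar>f x\<bar>) = 0"
 proof -
  have "(LBINT x. \<bar>f x\<bar>) = (LBINT x. indicator {x. 0 <= f x} x * f x - indicator {x. f x < 0} x * f x)"
   by (intro bochner_cong) (auto simp: indicator_def)
  also have "\<dots> = 0" by (subst Bochner_Integration.integral_diff) (auto intro!: i simp: all)
  finally show ?thesis .
 qed
 have "AE x in lborel. \<bar>f x\<bar> = 0" using integral_nonneg_eq_0_iff_AE[of lborel "%x. \<bar>f x\<bar>"] abs0 f by auto
 then show ?thesis by simp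
qed

text \<open>The claim is local: for a box with closure in \<open>U\<close> the indicator is a
  bounded limit of test functions, so the integral of \<open>h\<close> over every such box vanishes.
  Countably many closed boxes cover \<open>U\<close>, and their frontiers are null sets.\<close>

lemma AE_eq_0_if_test_integrals_eq_0:
 fixes h :: "'a::euclidean_space => real"
 assumes U: "open U" and h: "L1_loc U h"
  and test: "!!\<phi>. test_fun U \<phi> ==> (LINT x:U|lebesgue. h x * \<phi> x) = 0"
 shows "AE x in lebesgue. x \<in> U --> h x = 0"
proof -
 have int: "integrable lebesgue (%x. indicator (cbox a c) x * h x)" if "cbox a c \<subseteq> U" for a c
  using h that unfolding L1_loc_def L1_on_def set_integrable_def by (auto simp: compact_cbox)
 have int': "integrable lebesgue (%x. indicator (box a c) x * h x)" if "cbox a c \<subseteq> U" for a c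
 proof -
  have "integrable lebesgue (%x. indicator (cbox a c) x * h x * indicator (box a c) x)"
   by (intro integrable_real_mult_indicator int that) auto
  moreover have "(%x. indicator (cbox a c) x * h x * indicator (box a c) x) = (%x. indicator (box a c) x * h x)"
   using box_subset_cbox[of a c] by (auto simp: indicator_def fun_eq_iff)
  ultimately show ?thesis by simp
 qed
 have zero: "(\<integral>x. indicator (box a c) x * h x \<partial>lebesgue) = 0" if ac: "cbox a c \<subseteq> U" for a c
 proof -
  obtain \<phi> :: "nat => 'a => real"
   where phi: "!!n. test_fun U (\<phi> n)" "!!n x. 0 <= \<phi> n x" "!!n x. \<phi> n x <= 1"
    "!!n x. x \<notin> box a c ==> \<phi> n x = 0" "!!x. (%n. \<phi> n x) \<longlonglongrightarrow> indicator (box a c) x"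
   using box_indicator_limit[OF ac] by blast
  have [measurable]: "\<phi> n \<in> borel_measurable lebesgue" for n
  proof -
   have "\<phi> n \<in> borel_measurable borel"
    using phi(1)[of n] by (auto simp: test_fun_def intro: borel_measurable_continuous_onI smooth_on_continuous_on)
   then show ?thesis by (auto intro: measurable_completion)
  qed
  have i: "integrable lebesgue (%x. indicator (box a c) x * h x)" by (rule int'[OF ac])
  then have [measurable]: "(%x. indicator (box a c) x * h x) \<in> borel_measurable lebesgue" by auto
  have "(%n. \<integral>x. (indicator (box a c) x * h x) * \<phi> n x \<partial>lebesgue) \<longlonglongrightarrow>
    (\<integral>x. (indicator (box a c) x * h x) * indicator (box a c) x \<partial>lebesgue)"
  proof (rule integral_dominated_convergence[where w = "%x. norm (indicator (box a c) x * h x)"])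
   show "AE x in lebesgue. (%n. (indicator (box a c) x * h x) * \<phi> n x) \<longlonglongrightarrow> (indicator (box a c) x * h x) * indicator (box a c) x"
    by (intro AE_I2 tendsto_intros phi)
   show "AE x in lebesgue. norm ((indicator (box a c) x * h x) * \<phi> n x) <= norm (indicator (box a c) x * h x)" for n
    using phi(2,3) by (intro AE_I2) (auto simp: abs_mult intro: mult_left_le)
   show "(%x. (indicator (box a c) x * h x) * indicator (box a c) x) \<in> borel_measurable lebesgue"
    by (rule borel_measurable_times[OF borel_measurable_integrable[OF i]]) (auto intro: measurable_completion)
   show "(%x. (indicator (box a c) x * h x) * \<phi> n x) \<in> borel_measurable lebesgue" for n
    by (rule borel_measurable_times[OF borel_measurable_integrable[OF i]]) auto
  qed (use i in auto)
  moreover have "(\<integral>x. (indicator (box a c) x * h x) * \<phi> n x \<partial>lebesgue) = 0" for n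
  proof -
   have "(\<integral>x. (indicator (box a c) x * h x) * \<phi> n x \<partial>lebesgue) = (LINT x:U|lebesgue. h x * \<phi> n x)"
    unfolding set_lebesgue_integral_def using phi(4) ac box_subset_cbox[of a c] by (intro bochner_cong) (auto simp: indicator_def)
   then show ?thesis using test[OF phi(1)] by simp
  qed
  moreover have "(%x. (indicator (box a c) x * h x) * indicator (box a c) x) = (%x. indicator (box a c) x * h x)"
   by (auto simp: indicator_def)
  ultimately show ?thesis by (simp add: LIMSEQ_const_iff)
 qed
 have boxAE: "AE x in lebesgue. x \<in> box a c --> h x = 0" if ac: "cbox a c \<subseteq> U" for a c
 proof -
  let ?f = "%x. indicator (box a c) x * h x"
  \<comment> \<open>\<open>h\<close> is only Lebesgue measurable; the criterion for box integrals is
    applied to a Borel version of its restriction.\<close>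
  obtain f where f[measurable]: "f \<in> borel_measurable lborel" and eq: "AE x in lborel. ?f x = f x"
   using completion_ex_borel_measurable_real[of ?f lborel] int'[OF ac] by auto
  have eq': "AE x in lebesgue. ?f x = f x" using eq by (rule AE_completion)
  have "integrable lebesgue f" using int'[OF ac] by (rule integrable_cong_AE_imp) (use eq' in \<open>auto intro: measurable_completion\<close>)
  then have fi: "integrable lborel f" using f by (simp add: integrable_completion)
  have "AE x in lborel. f x = 0"
  proof (rule AE_eq_0_if_box_integrals_eq_0[OF fi])
   fix p q
   let ?e = "\<Sum>i\<in>Basis. max (p \<bullet> i) (a \<bullet> i) *\<^sub>R i" and ?f' = "\<Sum>i\<in>Basis. min (q \<bullet> i) (c \<bullet> i) *\<^sub>R i"
   have I: "box p q \<inter> box a c = box ?e ?f'" by (simp add: box_Int_box)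
   have sub: "cbox ?e ?f' \<subseteq> U" using ac by (auto simp: mem_box subset_iff)
   have "(LBINT x. indicator (box p q) x * f x) = (\<integral>x. indicator (box p q) x * f x \<partial>lebesgue)"
    by (subst integral_completion) auto
   also have "\<dots> = (\<integral>x. indicator (box p q) x * ?f x \<partial>lebesgue)"
   proof (rule integral_cong_AE)
    show "(%x. indicator (box p q) x * ?f x) \<in> borel_measurable lebesgue"
     by (rule borel_measurable_times[OF _ borel_measurable_integrable[OF int'[OF ac]]]) (auto intro: measurable_completion)
    show "(%x. indicator (box p q) x * f x) \<in> borel_measurable lebesgue" by (intro measurable_completion) measurable
    show "AE x in lebesgue. indicator (box p q) x * f x = indicator (box p q) x * ?f x" using eq' by eventually_elim simp
   qed
   also have "\<dots> = (\<integral>x. indicator (box ?e ?f') x * h x \<partial>lebesgue)"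
    unfolding I[symmetric] by (intro bochner_cong) (auto simp: indicator_def)
   also have "\<dots> = 0" by (rule zero[OF sub])
   finally show "(LBINT x. indicator (box p q) x * f x) = 0" .
  qed
  then have "AE x in lebesgue. f x = 0" by (rule AE_completion)
  with eq' show ?thesis by eventually_elim (auto simp: indicator_def)
 qed
 obtain \<D> where D: "countable \<D>" "\<D> \<subseteq> Pow U" "!!X. X \<in> \<D> ==> \<exists>a c. X = cbox a c" "\<Union>\<D> = U"
  using open_countable_Union_open_cbox[OF U] by metis
 have "AE x in lebesgue. x \<in> X --> h x = 0" if "X \<in> \<D>" for X
 proof -
  obtain a c where X: "X = cbox a c" using D(3)[OF \<open>X \<in> \<D>\<close>] by blast
  have "cbox a c \<subseteq> U" using D(2) \<open>X \<in> \<D>\<close> X by blast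
  from boxAE[OF this] have "AE x in lebesgue. x \<in> box a c --> h x = 0" .
  moreover have "AE x in lebesgue. x \<notin> cbox a c - box a c"
   using negligible_frontier_interval[of a c] by (intro AE_not_in) (simp add: negligible_iff_null_sets)
  ultimately show ?thesis unfolding X by eventually_elim auto
 qed
 then have "AE x in lebesgue. \<forall>X\<in>\<D>. x \<in> X --> h x = 0" by (subst AE_ball_countable[OF D(1)]) auto
 then show ?thesis by eventually_elim (use D(4) in auto)
qed

section \<open>Square integrable fields\<close>

text \<open>Fields on a region are extended by 0 and taken to be Borel, so that all integrals run
  over the whole space and Fubini and translations apply directly.\<close>

definition square_integrable :: "('a::euclidean_space => 'b::euclidean_space) => bool" where
 "square_integrable f \<longleftrightarrow> f \<in> borel_measurable borel \<and> integrable lborel (%x. (norm (f x))\<^sup>2)"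

definition L2_sqnorm :: "('a::euclidean_space => 'b::euclidean_space) => real" where
 "L2_sqnorm f = (LBINT x. (norm (f x))\<^sup>2)"

lemma square_integrable_measurable: "square_integrable f ==> f \<in> borel_measurable borel"
 and square_integrableD: "square_integrable f ==> integrable lborel (%x. (norm (f x))\<^sup>2)"
 by (auto simp: square_integrable_def)

lemma L2_sqnorm_nonneg: "0 <= L2_sqnorm f" by (simp add: L2_sqnorm_def)

lemma square_integrableI_nn:
 assumes "f \<in> borel_measurable borel" "(LBNN x. ennreal ((norm (f x))\<^sup>2)) < \<infinity>"
 shows "square_integrable f" unfolding square_integrable_def using assms by (auto intro!: integrableI_nonneg)

lemma nn_L2_sqnorm:
 assumes "square_integrable f"
 shows "(LBNN x. ennreal ((norm (f x))\<^sup>2)) = ennreal (L2_sqnorm f)"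
 unfolding L2_sqnorm_def by (rule nn_integral_eq_integral[OF square_integrableD[OF assms]]) simp

lemma square_integrable_bound:
 assumes f: "square_integrable f" and g: "g \<in> borel_measurable borel"
  and le: "!!x. norm (g x) <= C * norm (f x)"
 shows "square_integrable g" "L2_sqnorm g <= C\<^sup>2 * L2_sqnorm f"
proof -
 have le2: "(norm (g x))\<^sup>2 <= C\<^sup>2 * (norm (f x))\<^sup>2" for x using power_mono[OF le[of x], of 2] by (simp add: power_mult_distrib)
 have i: "integrable lborel (%x. C\<^sup>2 * (norm (f x))\<^sup>2)" using square_integrableD[OF f] by simp
 show "square_integrable g" unfolding square_integrable_def using g le2 by (auto intro!: bochner_bound[OF i])
 then show "L2_sqnorm g <= C\<^sup>2 * L2_sqnorm f" unfolding L2_sqnorm_def integral_mult_right_zero[symmetric]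
  by (intro integral_mono i square_integrableD le2)
qed

lemma square_integrable_add:
 assumes f: "square_integrable f" and g: "square_integrable g"
 shows "square_integrable (%x. f x + g x)" "L2_sqnorm (%x. f x + g x) <= 2 * L2_sqnorm f + 2 * L2_sqnorm g"
proof -
 note [measurable] = square_integrable_measurable[OF f] square_integrable_measurable[OF g]
 have le2: "(norm (f x + g x))\<^sup>2 <= 2 * (norm (f x))\<^sup>2 + 2 * (norm (g x))\<^sup>2" for x
 proof -
  have "(norm (f x + g x))\<^sup>2 <= (norm (f x) + norm (g x))\<^sup>2" by (intro power_mono norm_triangle_ineq) simp
  also have "\<dots> <= 2 * (norm (f x))\<^sup>2 + 2 * (norm (g x))\<^sup>2"
   using zero_le_power2[of "norm (f x) - norm (g x)"] by (simp add: power2_eq_square algebra_simps)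
  finally show ?thesis .
 qed
 have i: "integrable lborel (%x. 2 * (norm (f x))\<^sup>2 + 2 * (norm (g x))\<^sup>2)"
  using square_integrableD[OF f] square_integrableD[OF g] by simp
 show sq: "square_integrable (%x. f x + g x)" unfolding square_integrable_def using le2 by (auto intro!: bochner_bound[OF i])
 have "L2_sqnorm (%x. f x + g x) <= (LBINT x. 2 * (norm (f x))\<^sup>2 + 2 * (norm (g x))\<^sup>2)"
  unfolding L2_sqnorm_def by (intro integral_mono i square_integrableD[OF sq] le2)
 then show "L2_sqnorm (%x. f x + g x) <= 2 * L2_sqnorm f + 2 * L2_sqnorm g"
  using square_integrableD[OF f] square_integrableD[OF g] by (simp add: L2_sqnorm_def)
qed

lemma square_integrable_minus: "square_integrable f ==> square_integrable (%x. - f x)" by (simp add: square_integrable_def)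

lemma square_integrable_diff:
 assumes f: "square_integrable f" and g: "square_integrable g"
 shows "square_integrable (%x. f x - g x)" "L2_sqnorm (%x. f x - g x) <= 2 * L2_sqnorm f + 2 * L2_sqnorm g"
 using square_integrable_add[OF f square_integrable_minus[OF g]] by (simp_all add: L2_sqnorm_def)

lemma square_integrable_inner_Basis:
 assumes f: "square_integrable f" and b: "b \<in> Basis"
 shows "square_integrable (%x. f x \<bullet> b)" by (rule square_integrable_bound(1)[OF f, where C = 1])
  (use square_integrable_measurable[OF f] Basis_le_norm[OF b] in auto)

lemma square_integrable_scaleR:
 assumes f: "square_integrable f" and m: "m \<in> borel_measurable borel" "!!x. \<bar>m x\<bar> <= C"
 shows "square_integrable (%x. m x *\<^sub>R f x)" "L2_sqnorm (%x. m x *\<^sub>R f x) <= C\<^sup>2 * L2_sqnorm f"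
proof -
 note [measurable] = square_integrable_measurable[OF f] m(1)
 have "norm (m x *\<^sub>R f x) <= C * norm (f x)" for x using mult_right_mono[OF m(2), of "norm (f x)" x] by simp
 then show "square_integrable (%x. m x *\<^sub>R f x)" "L2_sqnorm (%x. m x *\<^sub>R f x) <= C\<^sup>2 * L2_sqnorm f"
  by (auto intro!: square_integrable_bound[OF f])
qed

lemma L2_Cauchy_Schwarz:
 assumes f: "square_integrable f" and g: "square_integrable g"
 shows "integrable lborel (%x. norm (f x) * norm (g x))"
  "(LBINT x. norm (f x) * norm (g x))\<^sup>2 <= L2_sqnorm f * L2_sqnorm g"
proof -
 note [measurable] = square_integrable_measurable[OF f] square_integrable_measurable[OF g]
 show i: "integrable lborel (%x. norm (f x) * norm (g x))"
 proof (rule bochner_bound[of lborel "%x. (norm (f x))\<^sup>2 + (norm (g x))\<^sup>2"])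
  show "AE x in lborel. norm (norm (f x) * norm (g x)) <= norm ((norm (f x))\<^sup>2 + (norm (g x))\<^sup>2)"
  proof (intro AE_I2)
   fix x
   have "2 * (norm (f x) * norm (g x)) <= (norm (f x))\<^sup>2 + (norm (g x))\<^sup>2"
    using zero_le_power2[of "norm (f x) - norm (g x)"] by (simp add: power2_eq_square algebra_simps)
   moreover have "0 <= norm (f x) * norm (g x)" by simp
   ultimately have "norm (f x) * norm (g x) <= (norm (f x))\<^sup>2 + (norm (g x))\<^sup>2" by linarith
   then show "norm (norm (f x) * norm (g x)) <= norm ((norm (f x))\<^sup>2 + (norm (g x))\<^sup>2)" by simp
  qed
 qed (use square_integrableD[OF f] square_integrableD[OF g] in auto)
 have "ennreal ((LBINT x. norm (f x) * norm (g x))\<^sup>2) = (LBNN x. ennreal (norm (f x)) * ennreal (norm (g x)))\<^sup>2"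
  using nn_integral_eq_integral[OF i] by (simp add: ennreal_mult ennreal_power)
 also have "\<dots> <= (LBNN x. (ennreal (norm (f x)))\<^sup>2) * (LBNN x. (ennreal (norm (g x)))\<^sup>2)"
  by (rule Cauchy_Schwarz_nn_integral) measurable
 also have "\<dots> = ennreal (L2_sqnorm f * L2_sqnorm g)" using nn_L2_sqnorm[OF f] nn_L2_sqnorm[OF g]
  by (simp add: ennreal_power ennreal_mult L2_sqnorm_nonneg)
 finally show "(LBINT x. norm (f x) * norm (g x))\<^sup>2 <= L2_sqnorm f * L2_sqnorm g" by (simp add: L2_sqnorm_nonneg)
qed

lemma L2_inner:
 assumes f: "square_integrable f" and g: "square_integrable g"
 shows "integrable lborel (%x. f x \<bullet> g x)"
  "\<bar>LBINT x. f x \<bullet> g x\<bar> <= sqrt (L2_sqnorm f * L2_sqnorm g)"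
proof -
 note [measurable] = square_integrable_measurable[OF f] square_integrable_measurable[OF g]
 note CS = L2_Cauchy_Schwarz[OF f g]
 show i: "integrable lborel (%x. f x \<bullet> g x)" by (rule bochner_bound[OF CS(1)]) (auto simp: Cauchy_Schwarz_ineq2)
 have "\<bar>LBINT x. f x \<bullet> g x\<bar> <= (LBINT x. norm (f x \<bullet> g x))"
  using integral_norm_bound[of lborel "%x. f x \<bullet> g x"] by simp
 also have "\<dots> <= (LBINT x. norm (f x) * norm (g x))" using i CS(1) by (intro integral_mono) (auto simp: Cauchy_Schwarz_ineq2)
 also have "\<dots> <= sqrt (L2_sqnorm f * L2_sqnorm g)" using CS(2) by (rule real_le_rsqrt)
 finally show "\<bar>LBINT x. f x \<bullet> g x\<bar> <= sqrt (L2_sqnorm f * L2_sqnorm g)" .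
qed

text \<open>Strong convergence to 0 is paired with mere boundedness of the second factor, by the
  Cauchy-Schwarz inequality.\<close>

lemma L2_pairing_tendsto_0:
 assumes f: "!!n::nat. square_integrable (f n)" and lim: "(%n. L2_sqnorm (f n)) \<longlonglongrightarrow> 0"
  and g: "!!n. square_integrable (g n)" and bd: "!!n. L2_sqnorm (g n) <= B"
 shows "(%n. LBINT x. f n x \<bullet> g n x) \<longlonglongrightarrow> 0"
proof (rule Lim_null_comparison)
 have "(%n. sqrt (L2_sqnorm (f n) * B)) \<longlonglongrightarrow> sqrt (0 * B)" by (intro tendsto_intros lim)
 then show "(%n. sqrt (L2_sqnorm (f n) * B)) \<longlonglongrightarrow> 0" by simp
 show "\<forall>\<^sub>F n in sequentially. norm (LBINT x. f n x \<bullet> g n x) <= sqrt (L2_sqnorm (f n) * B)"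
 proof (intro always_eventually allI)
  fix n
  have "norm (LBINT x. f n x \<bullet> g n x) <= sqrt (L2_sqnorm (f n) * L2_sqnorm (g n))" using L2_inner(2)[OF f g] by simp
  also have "\<dots> <= sqrt (L2_sqnorm (f n) * B)" by (intro real_sqrt_le_mono mult_left_mono bd L2_sqnorm_nonneg)
  finally show "norm (LBINT x. f n x \<bullet> g n x) <= sqrt (L2_sqnorm (f n) * B)" .
 qed
qed

lemma square_integrable_imp_integrable:
 fixes f :: "'a::euclidean_space => 'b::euclidean_space"
 assumes f: "square_integrable f" and zero: "!!x. x \<notin> S ==> f x = 0"
  and S: "bounded S" "S \<in> sets borel"
 shows "integrable lborel f"
proof (rule bochner_bound[of lborel "%x. (norm (f x))\<^sup>2 + indicator S x"])
 have "integrable lborel (indicator S :: 'a => real)" by (rule integrable_indicator_bounded[OF S])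
 then show "integrable lborel (%x. (norm (f x))\<^sup>2 + indicator S x)" using square_integrableD[OF f] by auto
 show "AE x in lborel. norm (f x) <= norm ((norm (f x))\<^sup>2 + indicator S x)"
 proof (intro AE_I2)
  fix x
  show "norm (f x) <= norm ((norm (f x))\<^sup>2 + indicator S x)" using zero_le_power2[of "norm (f x) - 1 / 2"] zero[of x]
   by (cases "x \<in> S") (auto simp: power2_eq_square algebra_simps)
 qed
qed (use square_integrable_measurable[OF f] in auto)

lemma square_integrable_bounded:
 fixes f :: "'a::euclidean_space => 'b::euclidean_space"
 assumes f: "f \<in> borel_measurable borel" and zero: "!!x. x \<notin> S ==> f x = 0" and le: "!!x. norm (f x) <= C"
  and S: "bounded S" "S \<in> sets borel"
 shows "square_integrable f"
proof -
 have i: "integrable lborel (indicator S :: 'a => real)" by (rule integrable_indicator_bounded[OF S])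
 have "square_integrable (indicator S :: 'a => real)"
  unfolding square_integrable_def using i S(2) by (simp add: power2_eq_square flip: indicator_inter_arith)
 then show ?thesis
 proof (rule square_integrable_bound(1)[where C = C])
  show "norm (f x) <= C * norm (indicator S x :: real)" for x using zero[of x] le[of x] by (cases "x \<in> S") auto
 qed (rule f)
qed

section \<open>Powers of a Sobolev function as test functions\<close>

lemma powr_lipschitz:
 fixes c e :: real
 assumes c: "c <= 1" and e: "0 < e"
 obtains L where "0 <= L" "!!a b. 0 <= a ==> 0 <= b ==> \<bar>(a + e) powr c - (b + e) powr c\<bar> <= L * \<bar>a - b\<bar>"
proof -
 define L where "L = \<bar>c\<bar> * e powr (c - 1)"
 have "\<bar>(a + e) powr c - (b + e) powr c\<bar> <= L * \<bar>a - b\<bar>" if "0 <= a" "0 <= b" for a b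
 proof -
  have "norm ((a + e) powr c - (b + e) powr c) <= L * norm (a - b)"
  proof (rule field_differentiable_bound[of "{0..}" "%y. (y + e) powr c" "%y. c * (y + e) powr (c - 1)"])
   fix y :: real assume y: "y \<in> {0..}"
   then have p: "y + e > 0" using e by simp
   show "((%y. (y + e) powr c) has_field_derivative c * (y + e) powr (c - 1)) (at y within {0..})"
    using p by (auto intro!: derivative_eq_intros has_field_derivative_at_within[OF DERIV_chain2[OF has_real_derivative_powr]])
   have "(y + e) powr (c - 1) <= e powr (c - 1)" using c e y by (intro powr_mono2') auto
   then show "norm (c * (y + e) powr (c - 1)) <= L" by (simp add: L_def abs_mult mult_left_mono)
  qed (use that in auto)
  then show ?thesis by simp
 qed
 moreover have "0 <= L" by (simp add: L_def)
 ultimately show ?thesis using that by blast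
qed

context
 fixes R :: real and v :: "'a::euclidean_space => real" and G :: "'a => 'a"
 assumes R: "0 < R"
  and v: "square_integrable v" "!!x. x \<notin> ball 0 R ==> v x = 0"
  and G: "square_integrable G" "!!x. x \<notin> ball 0 R ==> G x = 0"
  and weak: "has_weak_grad (ball 0 R) v G"
begin

private definition "B = indicat_real (ball 0 R :: 'a set)"

private lemma B_meas[measurable]: "B \<in> borel_measurable borel" unfolding B_def by measurable

private lemma vi: "integrable lborel v" by (rule square_integrable_imp_integrable[OF v(1), where S = "ball 0 R"]) (use v(2) in auto)

lemma smoothing_continuous_on: 
 "smooth_on UNIV (smoothing R n v)" by (rule smooth_smoothing[OF R vi])

private lemma L2_ball_tendsto:
 fixes f :: "nat => 'a => real"
 assumes f: "square_integrable g" "!!x. x \<notin> ball 0 R ==> g x = 0"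
 shows "square_integrable (%x. B x * (smoothing R n g x - g x))"
  "(%n. L2_sqnorm (%x. B x * (smoothing R n g x - g x))) \<longlonglongrightarrow> 0"
proof -
 have gi: "integrable lborel g" by (rule square_integrable_imp_integrable[OF f(1), where S = "ball 0 R"]) (use f(2) in auto)
 have gm[measurable]: "g \<in> borel_measurable borel" using f(1) by (rule square_integrable_measurable)
 have cont: "continuous_on A (smoothing R n g)" for A n by (intro smooth_on_continuous_on smooth_smoothing R gi)
 have [measurable]: "smoothing R n g \<in> borel_measurable borel" for n by (intro borel_measurable_continuous_onI cont)
 have sq: "square_integrable (%x. B x * (smoothing R n g x - g x))" for n
 proof -
  obtain C where C: "!!x. x \<in> cball 0 R ==> norm (smoothing R n g x) <= C"
   using compact_imp_bounded[OF compact_continuous_image[OF cont compact_cball]] unfolding bounded_iff by blast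
  have "square_integrable (%x. B x * smoothing R n g x)"
  proof (rule square_integrable_bounded[of _ "ball 0 R" "max 0 C"])
   show "norm (B x * smoothing R n g x) <= max 0 C" for x using C[of x] by (cases "x \<in> ball 0 R") (auto simp: B_def)
  qed (auto simp: B_def)
  from square_integrable_diff(1)[OF this f(1)]
  show ?thesis using f(2) by (rule_tac square_integrable_bound(1)[where C = 1]) (auto simp: B_def algebra_simps indicator_def)
 qed
 then show "square_integrable (%x. B x * (smoothing R n g x - g x))" .
 have "(LBNN x. ennreal ((g x)\<^sup>2)) < \<infinity>" using nn_L2_sqnorm[OF f(1)] by simp
 from smoothing_L2_tendsto[OF R gi this]
 have "(%n. ennreal (L2_sqnorm (%x. B x * (smoothing R n g x - g x)))) \<longlonglongrightarrow> 0"
 proof (rule Lim_transform_eventually[OF _ always_eventually], intro allI)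
  fix n
  have "(LBNN x. indicator (ball 0 R) x * ennreal ((smoothing R n g x - g x)\<^sup>2))
   = (LBNN x. ennreal ((norm (B x * (smoothing R n g x - g x)))\<^sup>2))" by (intro nn_integral_cong) (auto simp: B_def indicator_def)
  also have "\<dots> = ennreal (L2_sqnorm (%x. B x * (smoothing R n g x - g x)))" by (rule nn_L2_sqnorm[OF sq])
  finally show "(LBNN x. indicator (ball 0 R) x * ennreal ((smoothing R n g x - g x)\<^sup>2))
   = ennreal (L2_sqnorm (%x. B x * (smoothing R n g x - g x)))" .
 qed
 then show "(%n. L2_sqnorm (%x. B x * (smoothing R n g x - g x))) \<longlonglongrightarrow> 0"
  by (simp add: L2_sqnorm_nonneg flip: ennreal_0)
qed

private lemma grad_smoothing:
 assumes x: "x \<in> ball 0 R"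
 shows "grad (smoothing R n v) x = (\<Sum>b\<in>Basis. (contraction n * smoothing R n (%x. G x \<bullet> b) x) *\<^sub>R b)"
proof -
 have "pderiv_at b (smoothing R n v) x = contraction n * smoothing R n (%x. G x \<bullet> b) x" if b: "b \<in> Basis" for b
 proof (rule smoothing_weak_pderiv[OF R vi v(2) _ _ _ b x])
  show "has_weak_pderiv (ball 0 R) b v (%x. G x \<bullet> b)" using weak b by (simp add: has_weak_grad_def)
 qed (use square_integrable_measurable[OF G(1)] G(2) in auto)
 then show ?thesis unfolding grad_def by (intro sum.cong) auto
qed

text \<open>Inside the ball the error in direction \<open>b\<close> is
  \<open>c * (S - G x \<bullet> b) - (1 - c) * (G x \<bullet> b)\<close>, where \<open>S\<close> is
  the smoothing of that component: the first part tends to 0 by mollification, the second because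
  the contraction factor \<open>c\<close> tends to 1.\<close>

private lemma grad_smoothing_tendsto:
 "square_integrable (%x. B x *\<^sub>R (grad (smoothing R n v) x - G x))"
 "(%n. L2_sqnorm (%x. B x *\<^sub>R (grad (smoothing R n v) x - G x))) \<longlonglongrightarrow> 0"
proof -
 let ?s = "%n b x. B x * (smoothing R n (%x. G x \<bullet> b) x - G x \<bullet> b)"
 let ?f = "%n x. B x *\<^sub>R (grad (smoothing R n v) x - G x)"
 have Gb: "square_integrable (%x. G x \<bullet> b)" if "b \<in> Basis" for b using square_integrable_inner_Basis[OF G(1) that] .
 have s: "square_integrable (?s n b)" "(%n. L2_sqnorm (?s n b)) \<longlonglongrightarrow> 0" if "b \<in> Basis" for n b
  using L2_ball_tendsto[OF Gb[OF that]] G(2) by auto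
 have [measurable]: "grad (smoothing R n v) \<in> borel_measurable borel" for n unfolding grad_def
  by (intro borel_measurable_continuous_onI continuous_intros smooth_on_continuous_on smooth_on_pderiv_at
    smooth_smoothing R vi)
 have Gm[measurable]: "G \<in> borel_measurable borel" using G(1) by (rule square_integrable_measurable)
 let ?w = "%n x. (\<Sum>b\<in>Basis. 2 * (norm (?s n b x))\<^sup>2 + 2 * (1 - contraction n)\<^sup>2 * (norm (G x \<bullet> b))\<^sup>2)"
 have le: "(norm (?f n x))\<^sup>2 <= ?w n x" for n x
 proof (cases "x \<in> ball 0 R")
  case True
  then have Bx: "B x = 1" by (simp add: B_def)
  have "?f n x \<bullet> b = contraction n * (smoothing R n (%x. G x \<bullet> b) x - G x \<bullet> b) - (1 - contraction n) * (G x \<bullet> b)"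
   if "b \<in> Basis" for b using that Bx by (simp add: grad_smoothing[OF True] inner_diff_left inner_sum_left inner_Basis if_distrib
     left_diff_distrib right_diff_distrib cong: if_cong)
  moreover have "(contraction n * p - (1 - contraction n) * q)\<^sup>2 <= 2 * p\<^sup>2 + 2 * (1 - contraction n)\<^sup>2 * q\<^sup>2" for p q
  proof -
   have "(contraction n * p - (1 - contraction n) * q)\<^sup>2 <= 2 * (contraction n * p)\<^sup>2 + 2 * ((1 - contraction n) * q)\<^sup>2"
    using zero_le_power2[of "contraction n * p + (1 - contraction n) * q"] by (simp add: power2_eq_square algebra_simps)
   moreover have "(contraction n * p)\<^sup>2 <= p\<^sup>2"
    using contraction_bounds[of n] by (auto simp: power_mult_distrib intro!: mult_left_le_one_le power_le_one)
   ultimately show ?thesis by (simp add: power_mult_distrib)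
  qed
  ultimately have "(?f n x \<bullet> b)\<^sup>2 <= 2 * (norm (?s n b x))\<^sup>2 + 2 * (1 - contraction n)\<^sup>2 * (norm (G x \<bullet> b))\<^sup>2"
   if "b \<in> Basis" for b using that True by (simp add: B_def)
  then have "(\<Sum>b\<in>Basis. (?f n x \<bullet> b)\<^sup>2) <= ?w n x" by (rule sum_mono)
  moreover have "(norm (?f n x))\<^sup>2 = (\<Sum>b\<in>Basis. (?f n x \<bullet> b)\<^sup>2)"
   by (subst power2_norm_eq_inner, subst euclidean_inner) (simp add: power2_eq_square)
  ultimately show ?thesis by simp
 next
  case False
  then show ?thesis by (simp add: B_def sum_nonneg)
 qed
 have wi: "integrable lborel (?w n)" for n
  using square_integrableD[OF s(1)] square_integrableD[OF Gb] by (intro Bochner_Integration.integrable_sum) auto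
 show sq: "square_integrable (?f n)" for n unfolding square_integrable_def using le by (auto intro!: bochner_bound[OF wi[of n]] simp: sum_nonneg)
 have "L2_sqnorm (?f n) <= (\<Sum>b\<in>Basis. 2 * L2_sqnorm (?s n b) + 2 * (1 - contraction n)\<^sup>2 * L2_sqnorm (%x. G x \<bullet> b))" for n
 proof -
  have "L2_sqnorm (?f n) <= (LBINT x. ?w n x)" unfolding L2_sqnorm_def using square_integrableD[OF sq] le by (intro integral_mono wi)
  also have "\<dots> = (\<Sum>b\<in>Basis. 2 * L2_sqnorm (?s n b) + 2 * (1 - contraction n)\<^sup>2 * L2_sqnorm (%x. G x \<bullet> b))"
   unfolding L2_sqnorm_def using square_integrableD[OF s(1)] square_integrableD[OF Gb] by (subst Bochner_Integration.integral_sum) auto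
  finally show ?thesis .
 qed
 then have le': "norm (L2_sqnorm (?f n)) <= (\<Sum>b\<in>Basis. 2 * L2_sqnorm (?s n b) + 2 * (1 - contraction n)\<^sup>2 * L2_sqnorm (%x. G x \<bullet> b))" for n
  by (simp add: L2_sqnorm_nonneg)
 have "(%n. \<Sum>b\<in>Basis. 2 * L2_sqnorm (?s n b) + 2 * (1 - contraction n)\<^sup>2 * L2_sqnorm (%x. G x \<bullet> b))
   \<longlonglongrightarrow> (\<Sum>b\<in>(Basis::'a set). 2 * 0 + 2 * (1 - 1)\<^sup>2 * L2_sqnorm (%x. G x \<bullet> b))"
  by (intro tendsto_intros s(2) contraction_tendsto)
 then have "(%n. \<Sum>b\<in>Basis. 2 * L2_sqnorm (?s n b) + 2 * (1 - contraction n)\<^sup>2 * L2_sqnorm (%x. G x \<bullet> b)) \<longlonglongrightarrow> 0"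
  by simp
 then show "(%n. L2_sqnorm (?f n)) \<longlonglongrightarrow> 0" by (rule Lim_null_comparison[OF always_eventually[OF allI[OF le']]])
qed

text \<open>The test functions \<open>(v + e) powr c\<close> are not smooth; they are approximated by
 \<open>(v\<^sub>n + e) powr c\<close> with \<open>v\<^sub>n\<close> a smoothing of \<open>v\<close>.\<close>

lemma div_identity_powr:
 fixes r :: "'a => real" and Y :: "'a => 'a"
 assumes vpos: "!!x. 0 <= v x" and c: "c <= 1" and e: "0 < e"
  and r: "square_integrable r" "!!x. x \<notin> ball 0 R ==> r x = 0"
  and Y: "square_integrable Y" "!!x. x \<notin> ball 0 R ==> Y x = 0"
  and eq: "!!\<psi>. smooth_on UNIV \<psi> ==> (LBINT x. r x * \<psi> x) = - (LBINT x. Y x \<bullet> grad \<psi> x)"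
 shows "(LBINT x. r x * (v x + e) powr c) = - (LBINT x. Y x \<bullet> ((c * (v x + e) powr (c - 1)) *\<^sub>R G x))"
proof -
 define w where "w n = smoothing R n v" for n
 have sm: "smooth_on UNIV (w n)" for n unfolding w_def by (rule smoothing_continuous_on)
 have wpos: "0 <= w n x" for n x unfolding w_def by (rule smoothing_nonneg[OF R vi vpos])
 have [measurable]: "w n \<in> borel_measurable borel" "grad (w n) \<in> borel_measurable borel" for n unfolding grad_def
  by (intro borel_measurable_continuous_onI continuous_intros smooth_on_continuous_on smooth_on_pderiv_at sm; assumption?)+
 have [measurable]: "v \<in> borel_measurable borel" "G \<in> borel_measurable borel"
   "r \<in> borel_measurable borel" "Y \<in> borel_measurable borel" using v G r Y by (auto intro: square_integrable_measurable)
 have f: "square_integrable (%x. B x * (w n x - v x))" "(%n. L2_sqnorm (%x. B x * (w n x - v x))) \<longlonglongrightarrow> 0" for n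
  using L2_ball_tendsto[OF v] unfolding w_def by auto
 have g: "square_integrable (%x. B x *\<^sub>R (grad (w n) x - G x))" 
  "(%n. L2_sqnorm (%x. B x *\<^sub>R (grad (w n) x - G x))) \<longlonglongrightarrow> 0" for n
  using grad_smoothing_tendsto unfolding w_def by auto
 obtain L where L: "0 <= L" "!!a b. 0 <= a ==> 0 <= b ==> \<bar>(a + e) powr c - (b + e) powr c\<bar> <= L * \<bar>a - b\<bar>"
  using powr_lipschitz[OF c e] by metis
 have pb: "(a + e) powr (c - 1) <= e powr (c - 1)" if "0 <= a" for a using c e that by (intro powr_mono2') auto
 \<comment> \<open>The factor \<open>(w n + e) powr (c - 1)\<close> depends nonlinearly on
   \<open>w n\<close>; its convergence is obtained along a subsequence that converges almost
   everywhere.\<close>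
 obtain k where k: "strict_mono k" and kAE: "AE x in lborel. (%n. (norm (B x * (w (k n) x - v x)))\<^sup>2) \<longlonglongrightarrow> 0"
 proof -
  have "\<exists>k::nat=>nat. strict_mono k \<and> (AE x in lborel. (%n. (norm (B x * (w (k n) x - v x)))\<^sup>2) \<longlonglongrightarrow> 0)"
   by (rule tendsto_L1_AE_subseq) (use square_integrableD[OF f(1)] f(2) in \<open>auto simp: L2_sqnorm_def\<close>)
  then show ?thesis using that by blast
 qed
 let ?h = "%y. (y + e) powr c" and ?h' = "%y. c * (y + e) powr (c - 1)"
 have h'b: "\<bar>?h' y\<bar> <= \<bar>c\<bar> * e powr (c - 1)" if "0 <= y" for y using pb[OF that] by (simp add: abs_mult mult_left_mono)
 have zero: "(LBINT x. r x * ?h (w n x)) + (LBINT x. Y x \<bullet> (?h' (w n x) *\<^sub>R grad (w n) x)) = 0" for n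
  using eq[OF smooth_powr_comp(1)[OF sm wpos e]] smooth_powr_comp(2)[OF sm wpos e] by simp
 have sqh: "square_integrable (%x. B x * (?h (w n x) - ?h (v x)))" 
  "L2_sqnorm (%x. B x * (?h (w n x) - ?h (v x))) <= L\<^sup>2 * L2_sqnorm (%x. B x * (w n x - v x))" for n
 proof -
  have "norm (B x * (?h (w n x) - ?h (v x))) <= L * norm (B x * (w n x - v x))" for x
   using L(2)[OF wpos vpos, of n x x] by (simp add: B_def indicator_def)
  then show "square_integrable (%x. B x * (?h (w n x) - ?h (v x)))" 
   "L2_sqnorm (%x. B x * (?h (w n x) - ?h (v x))) <= L\<^sup>2 * L2_sqnorm (%x. B x * (w n x - v x))"
   by (auto intro!: square_integrable_bound[OF f(1)])
 qed
 \<comment> \<open>The deviation from the value at \<open>v = 0\<close> is at most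
   \<open>L * v\<close>, and the remaining constant is bounded on the ball.\<close>
 have sqv: "square_integrable (%x. B x * ?h (v x))"
 proof -
  have 1: "square_integrable (%x. B x * e powr c)"
   by (rule square_integrable_bounded[of _ "ball 0 R" "e powr c"]) (auto simp: B_def indicator_def)
  have 2: "square_integrable (%x. B x * (?h (v x) - e powr c))"
  proof (rule square_integrable_bound(1)[OF v(1), where C = L])
   show "norm (B x * (?h (v x) - e powr c)) <= L * norm (v x)" for x
    using L(2)[OF vpos[of x], of 0] L(1) by (auto simp: B_def indicator_def abs_mult)
  qed measurable
  have "(%x. B x * e powr c + B x * (?h (v x) - e powr c)) = (%x. B x * ?h (v x))" by (auto simp: algebra_simps)
  then show ?thesis using square_integrable_add(1)[OF 1 2] by simp
 qed
 have lim1: "(%n. LBINT x. r x * ?h (w n x)) \<longlonglongrightarrow> (LBINT x. r x * ?h (v x))"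
 proof -
  have l0: "(%n. L2_sqnorm (%x. B x * (?h (w n x) - ?h (v x)))) \<longlonglongrightarrow> 0"
  proof (rule tendsto_sandwich[OF _ _ tendsto_const[of 0]])
   show "(%n. L\<^sup>2 * L2_sqnorm (%x. B x * (w n x - v x))) \<longlonglongrightarrow> 0"
    using tendsto_mult_right_zero[OF f(2)] .
  qed (use sqh in \<open>auto simp: L2_sqnorm_nonneg\<close>)
  have "(%n. LBINT x. (B x * (?h (w n x) - ?h (v x))) \<bullet> r x) \<longlonglongrightarrow> 0"
   by (rule L2_pairing_tendsto_0[OF sqh(1) l0 r(1) order_refl])
  moreover have "(LBINT x. (B x * (?h (w n x) - ?h (v x))) \<bullet> r x)
    = (LBINT x. r x * ?h (w n x)) - (LBINT x. r x * ?h (v x))" for n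
  proof -
   have i1: "integrable lborel (%x. (B x * (?h (w n x) - ?h (v x))) \<bullet> r x)" by (rule L2_inner(1)[OF sqh(1) r(1)])
   have i2: "integrable lborel (%x. (B x * ?h (v x)) \<bullet> r x)" by (rule L2_inner(1)[OF sqv r(1)])
   have e2: "(%x. (B x * ?h (v x)) \<bullet> r x) = (%x. r x * ?h (v x))" using r(2) by (auto simp: B_def indicator_def fun_eq_iff)
   have "(LBINT x. r x * ?h (w n x)) = (LBINT x. (B x * (?h (w n x) - ?h (v x))) \<bullet> r x + (B x * ?h (v x)) \<bullet> r x)"
    using r(2) by (intro bochner_cong) (auto simp: B_def indicator_def algebra_simps)
   also have "\<dots> = (LBINT x. (B x * (?h (w n x) - ?h (v x))) \<bullet> r x) + (LBINT x. (B x * ?h (v x)) \<bullet> r x)"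
    by (rule Bochner_Integration.integral_add[OF i1 i2])
   finally show ?thesis unfolding e2 by simp
  qed
  ultimately have "(%n. (LBINT x. r x * ?h (w n x)) - (LBINT x. r x * ?h (v x))) \<longlonglongrightarrow> 0" by simp
  then show ?thesis by (simp add: LIM_zero_iff)
 qed
 have YG: "integrable lborel (%x. Y x \<bullet> G x)" by (rule L2_inner(1)[OF Y(1) G(1)])
 have sqY: "square_integrable (%x. ?h' (w n x) *\<^sub>R Y x)" 
  "L2_sqnorm (%x. ?h' (w n x) *\<^sub>R Y x) <= (\<bar>c\<bar> * e powr (c - 1))\<^sup>2 * L2_sqnorm Y" for n
  using wpos h'b by (auto intro!: square_integrable_scaleR[OF Y(1)])
 \<comment> \<open>Both factors vary with \<open>n\<close>. The gradient error tends to 0 in L2 and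
   meets a bounded field; the remaining term, with the fixed gradient \<open>G\<close>, converges by
   dominated convergence.\<close>
 have lim2: "(%n. LBINT x. Y x \<bullet> (?h' (w (k n) x) *\<^sub>R grad (w (k n)) x)) \<longlonglongrightarrow> (LBINT x. Y x \<bullet> (?h' (v x) *\<^sub>R G x))"
 proof -
  have a: "(%n. LBINT x. (B x *\<^sub>R (grad (w n) x - G x)) \<bullet> (?h' (w n x) *\<^sub>R Y x)) \<longlonglongrightarrow> 0"
   by (rule L2_pairing_tendsto_0[OF g sqY])
  have a': "(%n. LBINT x. (B x *\<^sub>R (grad (w (k n)) x - G x)) \<bullet> (?h' (w (k n) x) *\<^sub>R Y x)) \<longlonglongrightarrow> 0"
   using LIMSEQ_subseq_LIMSEQ[OF a k] by (simp add: comp_def)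
  have b: "(%n. LBINT x. ?h' (w (k n) x) * (Y x \<bullet> G x)) \<longlonglongrightarrow> (LBINT x. ?h' (v x) * (Y x \<bullet> G x))"
  proof (rule integral_dominated_convergence[where w = "%x. (\<bar>c\<bar> * e powr (c - 1)) * norm (Y x \<bullet> G x)"])
   show "AE x in lborel. (%n. ?h' (w (k n) x) * (Y x \<bullet> G x)) \<longlonglongrightarrow> ?h' (v x) * (Y x \<bullet> G x)" using kAE
   proof eventually_elim
    case (elim x)
    show ?case
    proof (cases "x \<in> ball 0 R")
     case True
     then have "(%n. (w (k n) x - v x)\<^sup>2) \<longlonglongrightarrow> 0" using elim by (simp add: B_def)
     then have "(%n. \<bar>w (k n) x - v x\<bar>) \<longlonglongrightarrow> 0" using tendsto_real_sqrt by fastforce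
     then have "(%n. w (k n) x - v x) \<longlonglongrightarrow> 0" by (simp add: tendsto_rabs_zero_iff)
     then have "(%n. w (k n) x) \<longlonglongrightarrow> v x" by (simp add: LIM_zero_iff)
     then show ?thesis using vpos[of x] e by (intro tendsto_intros) auto
    next
     case False
     then show ?thesis using Y(2) by simp
    qed
   qed
   show "AE x in lborel. norm (?h' (w (k n) x) * (Y x \<bullet> G x)) <= (\<bar>c\<bar> * e powr (c - 1)) * norm (Y x \<bullet> G x)" for n
   proof (intro AE_I2)
    fix x
    show "norm (?h' (w (k n) x) * (Y x \<bullet> G x)) <= (\<bar>c\<bar> * e powr (c - 1)) * norm (Y x \<bullet> G x)"
     unfolding real_norm_def abs_mult[of "?h' (w (k n) x)" "Y x \<bullet> G x"] by (intro mult_right_mono h'b[OF wpos] abs_ge_zero)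
   qed
  qed (use YG in auto)
  have "(LBINT x. Y x \<bullet> (?h' (w n x) *\<^sub>R grad (w n) x)) =
    (LBINT x. (B x *\<^sub>R (grad (w n) x - G x)) \<bullet> (?h' (w n x) *\<^sub>R Y x)) + (LBINT x. ?h' (w n x) * (Y x \<bullet> G x))" for n
  proof -
   have i1: "integrable lborel (%x. (B x *\<^sub>R (grad (w n) x - G x)) \<bullet> (?h' (w n x) *\<^sub>R Y x))"
    by (rule L2_inner(1)[OF g(1) sqY(1)])
   have i2: "integrable lborel (%x. ?h' (w n x) * (Y x \<bullet> G x))" using L2_inner(1)[OF sqY(1) G(1), of n] by simp
   show ?thesis unfolding Bochner_Integration.integral_add[OF i1 i2, symmetric] using Y(2) by (intro bochner_cong)
     (auto simp: B_def indicator_def inner_diff_left inner_commute algebra_simps)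
  qed
  then show ?thesis using tendsto_add[OF a' b] by (simp add: mult.commute mult.left_commute)
 qed
 have "(%n. (LBINT x. r x * ?h (w (k n) x)) + (LBINT x. Y x \<bullet> (?h' (w (k n) x) *\<^sub>R grad (w (k n)) x)))
   \<longlonglongrightarrow> (LBINT x. r x * ?h (v x)) + (LBINT x. Y x \<bullet> (?h' (v x) *\<^sub>R G x))"
  using tendsto_add[OF LIMSEQ_subseq_LIMSEQ[OF lim1 k] lim2] by (simp add: comp_def)
 then show ?thesis unfolding zero by (simp add: LIMSEQ_const_iff)
qed

end

section \<open>A compact right inverse of the divergence\<close>

text \<open>A subsequence converges almost everywhere, and Fatou's lemma transfers the Cauchy bound
  to the distance from its limit.\<close>

lemma L1_complete:
 fixes h :: "nat => 'a => 'b::{banach, second_countable_topology}"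
 assumes i[measurable]: "!!n. integrable M (h n)"
  and Cauchy: "!!e. 0 < e ==> \<exists>N. \<forall>i\<ge>N. \<forall>j\<ge>N. (\<integral>x. norm (h i x - h j x) \<partial>M) < e"
 obtains \<Phi> where "integrable M \<Phi>" "(%n. \<integral>x. norm (h n x - \<Phi> x) \<partial>M) \<longlonglongrightarrow> 0"
proof -
 obtain r where r: "strict_mono r" and ae: "AE x in M. Cauchy (%i. h (r i) x)" using cauchy_L1_AE_cauchy_subseq[OF i Cauchy] by blast
 have hm[measurable]: "h n \<in> borel_measurable M" for n using i by auto
 define \<Phi> where "\<Phi> x = lim (%k. h (r k) x)" for x
 have \<Phi>m[measurable]: "\<Phi> \<in> borel_measurable M" unfolding \<Phi>_def by measurable
 have lim: "AE x in M. (%k. h (r k) x) \<longlonglongrightarrow> \<Phi> x"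
  using ae by eventually_elim (simp add: \<Phi>_def Cauchy_convergent_iff convergent_LIMSEQ_iff)
 have nn: "(\<integral>\<^sup>+x. ennreal (norm (h n x - \<Phi> x)) \<partial>M) <= ennreal e"
  if e: "0 < e" and N: "\<forall>i\<ge>N. \<forall>j\<ge>N. (\<integral>x. norm (h i x - h j x) \<partial>M) < e" and n: "n \<ge> N" for n N e
 proof -
  have "(\<integral>\<^sup>+x. ennreal (norm (h n x - \<Phi> x)) \<partial>M) = (\<integral>\<^sup>+x. liminf (%k. ennreal (norm (h n x - h (r k) x))) \<partial>M)"
  proof (rule nn_integral_cong_AE)
   show "AE x in M. ennreal (norm (h n x - \<Phi> x)) = liminf (%k. ennreal (norm (h n x - h (r k) x)))" using lim
   proof eventually_elim
    case (elim x)
    have "(%k. ennreal (norm (h n x - h (r k) x))) \<longlonglongrightarrow> ennreal (norm (h n x - \<Phi> x))"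
     by (intro tendsto_intros elim)
    then show ?case by (rule lim_imp_Liminf[OF trivial_limit_sequentially, symmetric])
   qed
  qed
  also have "\<dots> <= liminf (%k. \<integral>\<^sup>+x. ennreal (norm (h n x - h (r k) x)) \<partial>M)"
   by (rule nn_integral_liminf) measurable
  also have "\<dots> <= ennreal e"
  proof (rule Liminf_le)
   have "(\<integral>\<^sup>+x. ennreal (norm (h n x - h (r k) x)) \<partial>M) <= ennreal e" if "k \<ge> N" for k
   proof -
    have "r k \<ge> N" using seq_suble[OF r, of k] that by linarith
    then have "(\<integral>x. norm (h n x - h (r k) x) \<partial>M) < e" using N n by blast
    then show ?thesis using i by (subst nn_integral_eq_integral) (auto intro: ennreal_leI)
   qed
   then show "\<forall>\<^sub>F k in sequentially. (\<integral>\<^sup>+x. ennreal (norm (h n x - h (r k) x)) \<partial>M) <= ennreal e"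
    by (auto simp: eventually_sequentially)
  qed simp
  finally show ?thesis .
 qed
 have di: "integrable M (%x. h n x - \<Phi> x)" if e: "0 < e" and N: "\<forall>i\<ge>N. \<forall>j\<ge>N. (\<integral>x. norm (h i x - h j x) \<partial>M) < e" and n: "n \<ge> N" for n N e
  using nn[OF e N n] by (auto simp: integrable_iff_bounded top.not_eq_extremum le_less_trans ennreal_less_top)
 obtain N1 where N1: "\<forall>i\<ge>N1. \<forall>j\<ge>N1. (\<integral>x. norm (h i x - h j x) \<partial>M) < 1" using Cauchy[of 1] by auto
 have \<Phi>i: "integrable M \<Phi>"
 proof -
  have "integrable M (%x. h N1 x - (h N1 x - \<Phi> x))" by (intro Bochner_Integration.integrable_diff i di[OF _ N1]) auto
  then show ?thesis by simp
 qed
 show ?thesis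
 proof (rule that[OF \<Phi>i], rule LIMSEQ_I)
  fix e :: real assume e: "0 < e"
  obtain N where N: "\<forall>i\<ge>N. \<forall>j\<ge>N. (\<integral>x. norm (h i x - h j x) \<partial>M) < e / 2"
   using Cauchy[of "e / 2"] e by auto
  have "(\<integral>x. norm (h n x - \<Phi> x) \<partial>M) < e" if "n \<ge> N" for n
  proof -
   have "ennreal (\<integral>x. norm (h n x - \<Phi> x) \<partial>M) = (\<integral>\<^sup>+x. ennreal (norm (h n x - \<Phi> x)) \<partial>M)"
    using i \<Phi>i by (subst nn_integral_eq_integral) auto
   also have "\<dots> <= ennreal (e / 2)" using e N that by (intro nn) auto
   finally have "(\<integral>x. norm (h n x - \<Phi> x) \<partial>M) <= e / 2" using e by simp
   then show ?thesis using e by linarith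
  qed
  moreover have "0 <= (\<integral>x. norm (h n x - \<Phi> x) \<partial>M)" for n by simp
  ultimately show "\<exists>no. \<forall>n\<ge>no. norm ((\<integral>x. norm (h n x - \<Phi> x) \<partial>M) - 0) < e" by (intro exI[of _ N]) auto
 qed
qed

text \<open>The convolution of \<open>f\<close> with the image under \<open>T\<close> of the vector
  measure with density \<open>k\<close>. Keeping the parameter \<open>q\<close> replaces a kernel
  that may be singular at the origin by a bounded density on pairs of length and direction.\<close>

definition shift_average ::
  "('p::euclidean_space => 'a::euclidean_space) => ('p => 'a) => ('a => real) => 'a => 'a" where
 "shift_average T k f x = (LBINT q. f (x - T q) *\<^sub>R k q)"

lemma nn_integral_lborel_translate:
 fixes a :: "'a::euclidean_space"
 assumes [measurable]: "f \<in> borel_measurable borel"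
 shows "(LBNN x. f (x - a)) = (LBNN x. f x)" using nn_integral_lborel_affine[of f 1 "- a"] by simp

lemma integral_lborel_translate:
 fixes f :: "'a::euclidean_space => 'b::{banach, second_countable_topology}"
 assumes [measurable]: "f \<in> borel_measurable borel"
 shows "(LBINT x. f (x - a)) = integral\<^sup>L lborel f"
proof -
 have "(LBINT x. f (x - a)) = (LBINT x. f ((0 - x) - a))" by (rule integral_lborel_reflect[symmetric]) measurable
 also have "\<dots> = (LBINT x. f (- a - x))"
 proof -
  have "0 - x - a = - a - x" for x by simp
  then show ?thesis by (simp only:)
 qed
 also have "\<dots> = integral\<^sup>L lborel f" by (rule integral_lborel_reflect) measurable
 finally show ?thesis .
qed

context
 fixes T :: "'p::euclidean_space => 'a::euclidean_space" and k :: "'p => 'a" and f :: "'a => real"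
 assumes T: "T \<in> borel_measurable borel"
  and k: "integrable lborel k" and f: "integrable lborel f"
begin

private lemma meas: "k \<in> borel_measurable borel" "f \<in> borel_measurable borel" using k f by auto

text \<open>Tonelli's theorem and translation invariance: all translates of \<open>f\<close> have
  the same L1 norm. Integrability of the double integrand and the L1 bound for the average follow
  from this identity.\<close>

lemma shift_average_nn:
 "(LBNN x. (LBNN q. ennreal (norm (f (x - T q) *\<^sub>R k q))))
   = ennreal ((LBINT q. norm (k q)) * (LBINT x. \<bar>f x\<bar>))"
proof -
 note [measurable] = T meas
 have "(LBNN x. (LBNN q. ennreal (norm (f (x - T q) *\<^sub>R k q))))
   = (LBNN q. (LBNN x. ennreal (norm (f (x - T q) *\<^sub>R k q))))" by (rule lborel_pair.Fubini') measurable
 also have "\<dots> = (LBNN q. (LBNN x. ennreal \<bar>f x\<bar>) * ennreal (norm (k q)))"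
 proof (rule nn_integral_cong)
  fix q
  have "(LBNN x. ennreal (norm (f (x - T q) *\<^sub>R k q))) = (LBNN x. ennreal \<bar>f (x - T q)\<bar>) * ennreal (norm (k q))"
   by (simp add: ennreal_mult nn_integral_multc)
  also have "(LBNN x. ennreal \<bar>f (x - T q)\<bar>) = (LBNN x. ennreal \<bar>f x\<bar>)" by (rule nn_integral_lborel_translate) measurable
  finally show "(LBNN x. ennreal (norm (f (x - T q) *\<^sub>R k q))) = (LBNN x. ennreal \<bar>f x\<bar>) * ennreal (norm (k q))" .
 qed
 also have "\<dots> = (LBNN x. ennreal \<bar>f x\<bar>) * (LBNN q. ennreal (norm (k q)))" by (rule nn_integral_cmult) measurable
 also have "\<dots> = ennreal ((LBINT q. norm (k q)) * (LBINT x. \<bar>f x\<bar>))"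
  using f k by (subst (1 2) nn_integral_eq_integral) (auto simp: ennreal_mult mult.commute)
 finally show ?thesis .
qed

lemma shift_average_integrable_pair:
 "integrable (lborel \<Otimes>\<^sub>M lborel) (%(x, q). f (x - T q) *\<^sub>R k q)"
proof (rule integrableI_bounded)
 note [measurable] = T meas
 have "(\<integral>\<^sup>+z. ennreal (norm (case z of (x, q) => f (x - T q) *\<^sub>R k q)) \<partial>(lborel \<Otimes>\<^sub>M lborel))
  = (LBNN x. (LBNN q. ennreal (norm (f (x - T q) *\<^sub>R k q))))" by (subst lborel.nn_integral_fst[symmetric]) (auto simp: case_prod_beta')
 then show "(\<integral>\<^sup>+z. ennreal (norm (case z of (x, q) => f (x - T q) *\<^sub>R k q)) \<partial>(lborel \<Otimes>\<^sub>M lborel)) < \<infinity>"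
  unfolding shift_average_nn by simp
 show "(%(x, q). f (x - T q) *\<^sub>R k q) \<in> borel_measurable (lborel \<Otimes>\<^sub>M lborel)" by measurable
qed

lemma integrable_shift_average: "integrable lborel (shift_average T k f)" using lborel_pair.integrable_fst[OF shift_average_integrable_pair]
 unfolding shift_average_def[abs_def] .

lemma AE_shift_average: "AE x in lborel. integrable lborel (%q. f (x - T q) *\<^sub>R k q)"
 using lborel_pair.AE_integrable_fst[OF shift_average_integrable_pair] .

lemma L1_shift_average_le:
 "(LBINT x. norm (shift_average T k f x)) <= (LBINT q. norm (k q)) * (LBINT x. \<bar>f x\<bar>)"
proof -
 note [measurable] = T meas
 have "ennreal (LBINT x. norm (shift_average T k f x)) = (LBNN x. ennreal (norm (shift_average T k f x)))"
  using integrable_shift_average by (subst nn_integral_eq_integral) auto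
 also have "\<dots> <= (LBNN x. (LBNN q. ennreal (norm (f (x - T q) *\<^sub>R k q))))" unfolding shift_average_def
 proof (rule nn_integral_mono_AE)
  show "AE x in lborel. ennreal (norm (LBINT q. f (x - T q) *\<^sub>R k q))
    <= (LBNN q. ennreal (norm (f (x - T q) *\<^sub>R k q)))" using AE_shift_average by eventually_elim (rule integral_norm_bound_ennreal)
 qed
 finally show ?thesis unfolding shift_average_nn by (subst (asm) ennreal_le_iff) auto
qed

text \<open>The adjoint of the averaging operator: Fubini and the substitution
  \<open>y = x - T q\<close> move the average onto the bounded field \<open>g\<close>.\<close>

lemma integral_shift_average_inner:
 assumes g[measurable]: "g \<in> borel_measurable borel" and gC: "!!x. norm (g x) <= C"
 shows "(LBINT x. shift_average T k f x \<bullet> g x) = (LBINT y. f y * (LBINT q. k q \<bullet> g (y + T q)))"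
proof -
 note [measurable] = T meas
 have C: "0 <= C" using gC[of 0] norm_ge_zero order_trans by blast
 have pair: "integrable (lborel \<Otimes>\<^sub>M lborel) (%(x, q). f (x - T q) * (k q \<bullet> g x))"
 proof (rule bochner_bound)
  show "integrable (lborel \<Otimes>\<^sub>M lborel) (%z. C * norm (case z of (x, q) => f (x - T q) *\<^sub>R k q))"
   by (intro integrable_mult_right integrable_norm shift_average_integrable_pair)
  show "AE z in lborel \<Otimes>\<^sub>M lborel. norm (case z of (x, q) => f (x - T q) * (k q \<bullet> g x))
    <= norm (C * norm (case z of (x, q) => f (x - T q) *\<^sub>R k q))"
  proof (intro AE_I2)
   fix z :: "'a \<times> 'p"
   obtain x q where z: "z = (x, q)" by (cases z)
   have "\<bar>k q \<bullet> g x\<bar> <= norm (k q) * C"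
    using Cauchy_Schwarz_ineq2[of "k q" "g x"] mult_left_mono[OF gC[of x], of "norm (k q)"] by simp
   then have "\<bar>f (x - T q)\<bar> * \<bar>k q \<bullet> g x\<bar> <= \<bar>f (x - T q)\<bar> * (norm (k q) * C)"
    by (rule mult_left_mono) simp
   then show "norm (case z of (x, q) => f (x - T q) * (k q \<bullet> g x))
    <= norm (C * norm (case z of (x, q) => f (x - T q) *\<^sub>R k q))" using C by (simp add: z abs_mult mult_ac)
  qed
 qed measurable
 have pair2: "integrable (lborel \<Otimes>\<^sub>M lborel) (%(y, q). f y * (k q \<bullet> g (y + T q)))"
 proof (rule bochner_bound)
  have "integrable (lborel \<Otimes>\<^sub>M lborel) (%(y, q). f y *\<^sub>R k q)"
  proof (rule integrableI_bounded)
   have "(\<integral>\<^sup>+z. ennreal (norm (case z of (y, q) => f y *\<^sub>R k q)) \<partial>(lborel \<Otimes>\<^sub>M lborel))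
    = (LBNN y. ennreal \<bar>f y\<bar> * (LBNN q. ennreal (norm (k q))))"
    by (subst lborel.nn_integral_fst[symmetric]) (auto simp: case_prod_beta' ennreal_mult nn_integral_cmult)
   also have "\<dots> = (LBNN y. ennreal \<bar>f y\<bar>) * (LBNN q. ennreal (norm (k q)))" by (rule nn_integral_multc) measurable
   also have "\<dots> < \<infinity>" using f k by (auto simp: ennreal_mult_less_top integrable_iff_bounded)
   finally show "(\<integral>\<^sup>+z. ennreal (norm (case z of (y, q) => f y *\<^sub>R k q)) \<partial>(lborel \<Otimes>\<^sub>M lborel)) < \<infinity>" .
  qed measurable
  then show "integrable (lborel \<Otimes>\<^sub>M lborel) (%z. C * norm (case z of (y, q) => f y *\<^sub>R k q))"
   by (intro integrable_mult_right integrable_norm)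
  show "AE z in lborel \<Otimes>\<^sub>M lborel. norm (case z of (y, q) => f y * (k q \<bullet> g (y + T q)))
    <= norm (C * norm (case z of (y, q) => f y *\<^sub>R k q))"
  proof (intro AE_I2)
   fix z :: "'a \<times> 'p"
   obtain x q where z: "z = (x, q)" by (cases z)
   have "\<bar>k q \<bullet> g (x + T q)\<bar> <= norm (k q) * C"
    using Cauchy_Schwarz_ineq2[of "k q" "g (x + T q)"] mult_left_mono[OF gC[of "x + T q"], of "norm (k q)"] by simp
   then have "\<bar>f x\<bar> * \<bar>k q \<bullet> g (x + T q)\<bar> <= \<bar>f x\<bar> * (norm (k q) * C)" by (rule mult_left_mono) simp
   then show "norm (case z of (y, q) => f y * (k q \<bullet> g (y + T q)))
    <= norm (C * norm (case z of (y, q) => f y *\<^sub>R k q))" using C by (simp add: z abs_mult mult_ac)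
  qed
 qed measurable
 have "(LBINT x. shift_average T k f x \<bullet> g x) = (LBINT x. (LBINT q. f (x - T q) * (k q \<bullet> g x)))"
 proof (rule integral_cong_AE)
  show "(%x. shift_average T k f x \<bullet> g x) \<in> borel_measurable lborel" using integrable_shift_average by measurable
  show "(%x. LBINT q. f (x - T q) * (k q \<bullet> g x)) \<in> borel_measurable lborel"
   using borel_measurable_integrable[OF lborel_pair.integrable_fst[OF pair]] .
  show "AE x in lborel. shift_average T k f x \<bullet> g x = (LBINT q. f (x - T q) * (k q \<bullet> g x))" using AE_shift_average
  proof eventually_elim
   case (elim x)
   have "shift_average T k f x \<bullet> g x = (LBINT q. (f (x - T q) *\<^sub>R k q) \<bullet> g x)"
    unfolding shift_average_def using elim by (rule integral_inner_left[symmetric])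
   then show ?case by simp
  qed
 qed
 also have "\<dots> = (LBINT q. (LBINT x. f (x - T q) * (k q \<bullet> g x)))" by (rule lborel_pair.Fubini_integral[OF pair, symmetric])
 also have "\<dots> = (LBINT q. (LBINT y. f y * (k q \<bullet> g (y + T q))))"
 proof (rule bochner_cong[OF refl])
  fix q
  show "(LBINT x. f (x - T q) * (k q \<bullet> g x)) = (LBINT y. f y * (k q \<bullet> g (y + T q)))"
   using integral_lborel_translate[of "%y. f y * (k q \<bullet> g (y + T q))" "T q"] by simp
 qed
 also have "\<dots> = (LBINT y. (LBINT q. f y * (k q \<bullet> g (y + T q))))" by (rule lborel_pair.Fubini_integral[OF pair2])
 finally show ?thesis by simp
qed

end

lemma integral_lborel_affine:
 fixes f :: "'a::euclidean_space => 'b::{banach, second_countable_topology}"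
 assumes [measurable]: "f \<in> borel_measurable borel" and c: "c \<noteq> 0"
 shows "integral\<^sup>L lborel f = (\<bar>c\<bar> ^ DIM('a)) *\<^sub>R (LBINT x. f (t + c *\<^sub>R x))"
 by (subst lborel_affine[OF c, of t]) (simp add: integral_density integral_distr)

text \<open>All vectors in the support of the density have every coordinate at least \<open>1\<close>, so rays in these
 directions leave a ball in bounded time; averaging over the directions makes the inverse of the
 divergence compact.\<close>

definition direction_density :: "'a::euclidean_space => real" where
 "direction_density \<theta> = mollifier (1 / 2) (\<theta> - (3 / 2) *\<^sub>R One)"

text \<open>Bounds the norm on the ball of radius 1/2 around \<open>(3 / 2) *\<^sub>R One\<close>,
  which contains all admissible directions; the type argument records the dimension.\<close>

definition direction_bound :: "'a::euclidean_space itself => real" where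
 "direction_bound _ = norm ((3 / 2) *\<^sub>R One :: 'a) + 1 / 2"

lemma smooth_direction_density: "smooth_on UNIV (direction_density :: 'a::euclidean_space => real)"
 using smooth_affine_comp[OF mollifier(1)[of "1/2"], of "- (3 / 2) *\<^sub>R One :: 'a" 1]
 by (simp add: direction_density_def[abs_def] algebra_simps)

lemma direction_density_nonneg: "0 <= direction_density \<theta>" by (simp add: direction_density_def mollifier)

lemma direction_density_measurable: "direction_density \<in> borel_measurable borel"
 by (intro borel_measurable_continuous_onI smooth_on_continuous_on smooth_direction_density)

lemma integrable_direction_density: "integrable lborel (direction_density :: 'a::euclidean_space => real)"
 and integral_direction_density: "integral\<^sup>L lborel (direction_density :: 'a => real) = 1"
proof -
 have m[measurable]: "(mollifier (1 / 2) :: 'a => real) \<in> borel_measurable borel"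
  by (intro borel_measurable_continuous_onI smooth_on_continuous_on mollifier) simp
 show "integral\<^sup>L lborel (direction_density :: 'a => real) = 1"
  unfolding direction_density_def using integral_lborel_translate[OF m] mollifier(5)[of "1/2"] by simp
 then show "integrable lborel (direction_density :: 'a::euclidean_space => real)" using not_integrable_integral_eq by fastforce
qed

lemma direction_density_support:
 fixes \<theta> :: "'a::euclidean_space"
 assumes "direction_density \<theta> \<noteq> 0"
 shows "norm \<theta> <= direction_bound TYPE('a)" "b \<in> Basis ==> 1 <= \<theta> \<bullet> b"
proof -
 have n: "norm (\<theta> - (3 / 2) *\<^sub>R One) < 1 / 2"
  using assms mollifier(3)[of "1 / 2" "\<theta> - (3 / 2) *\<^sub>R One"] by (auto simp: direction_density_def not_le[symmetric])
 show "norm \<theta> <= direction_bound TYPE('a)"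
  using n norm_triangle_sub[of \<theta> "(3 / 2) *\<^sub>R One"] by (simp add: direction_bound_def)
 assume b: "b \<in> Basis"
 have "\<bar>(\<theta> - (3 / 2) *\<^sub>R One) \<bullet> b\<bar> < 1 / 2"
  using Basis_le_norm[OF b, of "\<theta> - (3 / 2) *\<^sub>R One"] n by linarith
 moreover have "((3 / 2) *\<^sub>R One :: 'a) \<bullet> b = 3 / 2" using b by (simp add: inner_sum_left inner_Basis if_distrib cong: if_cong)
 ultimately show "1 <= \<theta> \<bullet> b" unfolding inner_diff_left by linarith
qed

lemma direction_bound_pos: "0 < direction_bound TYPE('a::euclidean_space)" by (simp add: direction_bound_def add_nonneg_pos)

text \<open>The set \<open>A\<close> restricts the length of the ray; varying it splits the inverse
  of the divergence into the contributions of short and long rays.\<close>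

definition ray_weight :: "real set => real \<times> 'a::euclidean_space => 'a" where
 "ray_weight A q = (indicator A (fst q) * direction_density (snd q)) *\<^sub>R snd q"

definition ray :: "real \<times> 'a::euclidean_space => 'a" where
 "ray q = fst q *\<^sub>R snd q"

lemma ray_measurable: "ray \<in> borel_measurable (borel :: (real \<times> 'a::euclidean_space) measure)"
 unfolding ray_def[abs_def] by (intro borel_measurable_continuous_onI continuous_intros)

lemma ray_weight_measurable:
 assumes [measurable]: "A \<in> sets borel"
 shows "ray_weight A \<in> borel_measurable (borel :: (real \<times> 'a::euclidean_space) measure)"
proof -
 note [measurable] = direction_density_measurable[where 'a = 'a]
 have "ray_weight A \<in> borel_measurable (borel \<Otimes>\<^sub>M (borel :: 'a measure))" unfolding ray_weight_def[abs_def] by measurable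
 then show ?thesis by (simp only: borel_prod)
qed

lemma ray_weight_nn:
 assumes A[measurable]: "A \<in> sets borel"
 shows "(LBNN q. ennreal (norm (ray_weight A q :: 'a::euclidean_space)))
   <= ennreal (direction_bound TYPE('a)) * emeasure lborel A"
proof -
 have m: "(%q. ennreal (norm (ray_weight A q :: 'a))) \<in> borel_measurable (lborel \<Otimes>\<^sub>M lborel)"
 proof -
  have [measurable]: "(ray_weight A :: _ => 'a) \<in> borel_measurable (lborel \<Otimes>\<^sub>M lborel)"
   unfolding lborel_prod using ray_weight_measurable[OF A, where 'a = 'a] by (simp only: measurable_lborel2)
  show ?thesis by measurable
 qed
 have "(LBNN q. ennreal (norm (ray_weight A q :: 'a)))
  = (LBNN s. (LBNN \<theta>. ennreal (norm (ray_weight A (s, \<theta>) :: 'a))))" unfolding lborel.nn_integral_fst[OF m] lborel_prod ..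
 also have "\<dots> <= (LBNN s. ennreal (direction_bound TYPE('a)) * indicator A s)"
 proof (rule nn_integral_mono)
  fix s
  have "(LBNN \<theta>. ennreal (norm (ray_weight A (s, \<theta>) :: 'a)))
   <= (\<integral>\<^sup>+\<theta>. (ennreal (direction_bound TYPE('a)) * indicator A s) * ennreal (direction_density \<theta> :: real) \<partial>(lborel :: 'a measure))"
  proof (rule nn_integral_mono)
   fix \<theta> :: 'a
   have "direction_density \<theta> * norm \<theta> <= direction_bound TYPE('a) * direction_density \<theta>"
    using direction_density_support(1)[of \<theta>] direction_density_nonneg[of \<theta>]
    by (cases "direction_density \<theta> = 0") (auto simp: mult.commute intro!: mult_left_mono)
   then have "ennreal (direction_density \<theta> * norm \<theta>) <= ennreal (direction_bound TYPE('a) * direction_density \<theta>)"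
    by (rule ennreal_leI)
   also have "\<dots> = ennreal (direction_bound TYPE('a)) * ennreal (direction_density \<theta>)"
    using direction_bound_pos[where 'a = 'a] by (intro ennreal_mult') (simp add: less_imp_le)
   finally show "ennreal (norm (ray_weight A (s, \<theta>) :: 'a))
     <= (ennreal (direction_bound TYPE('a)) * indicator A s) * ennreal (direction_density \<theta>)"
    using direction_density_nonneg[of \<theta>] by (simp add: ray_weight_def indicator_def)
  qed
  also have "\<dots> = ennreal (direction_bound TYPE('a)) * indicator A s * (\<integral>\<^sup>+\<theta>. ennreal (direction_density \<theta> :: real) \<partial>(lborel :: 'a measure))"
   using direction_density_measurable[where 'a = 'a] by (intro nn_integral_cmult) auto
  also have "(\<integral>\<^sup>+\<theta>. ennreal (direction_density \<theta> :: real) \<partial>(lborel :: 'a measure)) = 1"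
   using integrable_direction_density integral_direction_density direction_density_nonneg by (subst nn_integral_eq_integral) auto
  finally show "(LBNN \<theta>. ennreal (norm (ray_weight A (s, \<theta>) :: 'a))) <= ennreal (direction_bound TYPE('a)) * indicator A s" by simp
 qed
 also have "\<dots> = ennreal (direction_bound TYPE('a)) * emeasure lborel A" by (rule nn_integral_cmult_indicator) simp
 finally show ?thesis .
qed

lemma integrable_ray_weight:
 assumes A: "A \<in> sets borel" "bounded A"
 shows "integrable lborel (ray_weight A :: real \<times> 'a::euclidean_space => 'a)"
  "(LBINT q. norm (ray_weight A q :: 'a)) <= direction_bound TYPE('a) * measure lborel A"
proof -
 have fin: "emeasure lborel A = ennreal (measure lborel A)" using emeasure_bounded_finite[OF A(2)] by (simp add: emeasure_eq_ennreal_measure)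
 have le: "(LBNN q. ennreal (norm (ray_weight A q :: 'a))) <= ennreal (direction_bound TYPE('a) * measure lborel A)"
  using ray_weight_nn[OF A(1), where 'a = 'a] fin direction_bound_pos[where 'a = 'a] by (simp add: ennreal_mult')
 show i: "integrable lborel (ray_weight A :: real \<times> 'a => 'a)"
 proof (rule integrableI_bounded)
  show "ray_weight A \<in> borel_measurable (lborel :: (real \<times> 'a) measure)"
   using ray_weight_measurable[OF A(1), where 'a = 'a] by (simp only: measurable_lborel2)
  show "(LBNN q. ennreal (norm (ray_weight A q :: 'a))) < \<infinity>" using le by (rule le_less_trans) simp
 qed
 have "ennreal (LBINT q. norm (ray_weight A q :: 'a)) <= ennreal (direction_bound TYPE('a) * measure lborel A)"
  using le unfolding nn_integral_eq_integral[OF integrable_norm[OF i] AE_I2[OF norm_ge_zero]] .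
 then show "(LBINT q. norm (ray_weight A q :: 'a)) <= direction_bound TYPE('a) * measure lborel A"
  using direction_bound_pos[where 'a = 'a] by (subst (asm) ennreal_le_iff) (auto simp: less_imp_le)
qed

text \<open>The integral of \<open>f (x - s \<theta>) \<theta>\<close> over lengths \<open>s\<close>
  in \<open>{0..2 * R}\<close> and directions \<theta> with their density. For a single direction
  this is the line integral that inverts the derivative along \<theta>.\<close>

definition div_inverse :: "real => ('a::euclidean_space => real) => 'a => 'a" where
 "div_inverse R f = shift_average ray (ray_weight {0..2 * R}) f"

lemma test_fun_bounds:
 assumes "test_fun U \<phi>"
 obtains L where "0 <= L" "!!x. \<bar>\<phi> x\<bar> <= L" "!!x. norm (grad \<phi> x) <= L"
proof -
 obtain C where "smooth_on UNIV \<phi>" "compact C" "!!x. x \<notin> C ==> \<phi> x = 0"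
  using assms unfolding test_fun_def by blast
 from smooth_compact_support_bounds[OF this] show ?thesis using that by metis
qed

lemma smooth_grad_measurable: "smooth_on UNIV \<phi> ==> grad \<phi> \<in> borel_measurable borel" unfolding grad_def
 by (intro borel_measurable_continuous_onI continuous_intros smooth_on_continuous_on smooth_on_pderiv_at)

lemma smooth_grad_continuous_on: "smooth_on UNIV \<phi> ==> continuous_on A (grad \<phi>)"
 unfolding grad_def by (intro continuous_intros smooth_on_continuous_on smooth_on_pderiv_at)

lemma integrable_inner_shift:
 fixes k T :: "'p::euclidean_space => 'a::euclidean_space" and g :: "'a => 'a"
 assumes k: "integrable lborel k" and T[measurable]: "T \<in> borel_measurable borel"
  and g[measurable]: "g \<in> borel_measurable borel" and L: "!!x. norm (g x) <= L"
 shows "integrable lborel (%q. k q \<bullet> g (y + T q))"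
proof (rule bochner_bound)
 have [measurable]: "k \<in> borel_measurable borel" using k by auto
 show "integrable lborel (%q. L * norm (k q))" by (intro integrable_mult_right integrable_norm k)
 show "AE q in lborel. norm (k q \<bullet> g (y + T q)) <= norm (L * norm (k q))"
 proof (intro AE_I2)
  fix q
  have "\<bar>k q \<bullet> g (y + T q)\<bar> <= norm (k q) * norm (g (y + T q))" by (rule Cauchy_Schwarz_ineq2)
  also have "\<dots> <= norm (k q) * L" by (intro mult_left_mono L) simp
  finally show "norm (k q \<bullet> g (y + T q)) <= norm (L * norm (k q))" by (simp add: mult.commute)
 qed
 have [measurable]: "(%q. g (y + T q)) \<in> borel_measurable borel"
  by (rule measurable_compose[OF borel_measurable_add[OF borel_measurable_const T] g])
 show "(%q. k q \<bullet> g (y + T q)) \<in> borel_measurable lborel" by measurable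
qed

text \<open>Along a ray the integrand is the derivative of \<open>\<phi> (y + s \<theta>)\<close> in
  \<open>s\<close>, so each direction contributes
  \<open>\<phi> (y + 2 R \<theta>) - \<phi> y\<close>. The end point lies outside the ball, and the
  directions have total mass 1.\<close>

lemma ray_weight_grad:
 fixes \<phi> :: "'a::euclidean_space => real"
 assumes R: "0 < R" and tf: "test_fun (ball 0 R) \<phi>" and y: "y \<in> ball 0 R"
 shows "(LBINT q. ray_weight {0..2 * R} q \<bullet> grad \<phi> (y + ray q)) = - \<phi> y"
proof -
 have sm: "smooth_on UNIV \<phi>" and out: "!!x. x \<notin> ball 0 R ==> \<phi> x = 0" using tf unfolding test_fun_def by blast+
 obtain L where L: "!!x. norm (grad \<phi> x) <= L" using test_fun_bounds[OF tf] by metis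
 let ?h = "%(s, \<theta>). ray_weight {0..2 * R} (s, \<theta>) \<bullet> grad \<phi> (y + s *\<^sub>R \<theta>)"
 have int: "integrable (lborel \<Otimes>\<^sub>M lborel) ?h"
  using integrable_inner_shift[OF integrable_ray_weight(1) ray_measurable smooth_grad_measurable[OF sm] L, of "{0..2 * R}" y]
  by (simp add: lborel_prod ray_def case_prod_beta')
 have "(LBINT q. ray_weight {0..2 * R} q \<bullet> grad \<phi> (y + ray q)) = integral\<^sup>L (lborel \<Otimes>\<^sub>M lborel) ?h"
  by (simp add: lborel_prod ray_def case_prod_beta')
 also have "\<dots> = (LBINT \<theta>. (LBINT s. ray_weight {0..2 * R} (s, \<theta>) \<bullet> grad \<phi> (y + s *\<^sub>R \<theta>)))"
  using lborel_pair.integral_snd[of "%s \<theta>. ray_weight {0..2 * R} (s, \<theta>) \<bullet> grad \<phi> (y + s *\<^sub>R \<theta>)"] int by simp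
 also have "\<dots> = (\<integral>\<theta>. - \<phi> y * direction_density \<theta> \<partial>(lborel :: 'a measure))"
 proof (rule bochner_cong[OF refl])
  fix \<theta> :: 'a
  have der: "((%s. \<phi> (y + s *\<^sub>R \<theta>)) has_vector_derivative (grad \<phi> (y + s *\<^sub>R \<theta>) \<bullet> \<theta>)) (at s within {0..2 * R})" for s
  proof -
   have "((%s. y + s *\<^sub>R \<theta>) has_derivative (%h. h *\<^sub>R \<theta>)) (at s)" by (auto intro!: derivative_eq_intros)
   from has_derivative_compose[OF this smooth_has_derivative_grad[OF sm]]
   have "((%s. \<phi> (y + s *\<^sub>R \<theta>)) has_derivative (%h. h *\<^sub>R (grad \<phi> (y + s *\<^sub>R \<theta>) \<bullet> \<theta>))) (at s)" by simp
   then show ?thesis unfolding has_vector_derivative_def by (rule has_derivative_at_withinI)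
  qed
  have "(LBINT s. indicator {0..2 * R} s *\<^sub>R (grad \<phi> (y + s *\<^sub>R \<theta>) \<bullet> \<theta>)) = \<phi> (y + (2 * R) *\<^sub>R \<theta>) - \<phi> (y + 0 *\<^sub>R \<theta>)"
   using R by (intro integral_FTC_Icc der continuous_intros continuous_on_compose2[OF smooth_grad_continuous_on[OF sm]]) auto
  moreover have "(%s. ray_weight {0..2 * R} (s, \<theta>) \<bullet> grad \<phi> (y + s *\<^sub>R \<theta>))
    = (%s. direction_density \<theta> * (indicator {0..2 * R} s *\<^sub>R (grad \<phi> (y + s *\<^sub>R \<theta>) \<bullet> \<theta>)))"
   by (auto simp: ray_weight_def inner_commute fun_eq_iff)
  ultimately have "(LBINT s. ray_weight {0..2 * R} (s, \<theta>) \<bullet> grad \<phi> (y + s *\<^sub>R \<theta>))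
   = direction_density \<theta> * (\<phi> (y + (2 * R) *\<^sub>R \<theta>) - \<phi> (y + 0 *\<^sub>R \<theta>))"
   by (simp only: integral_mult_right_zero)
  then have "(LBINT s. ray_weight {0..2 * R} (s, \<theta>) \<bullet> grad \<phi> (y + s *\<^sub>R \<theta>))
   = direction_density \<theta> * (\<phi> (y + (2 * R) *\<^sub>R \<theta>) - \<phi> y)" by simp
  moreover have "direction_density \<theta> * \<phi> (y + (2 * R) *\<^sub>R \<theta>) = 0"
  proof (cases "direction_density \<theta> = 0")
   case False
   obtain b :: 'a where b: "b \<in> Basis" using nonempty_Basis by blast
   \<comment> \<open>One coordinate suffices: it starts above \<open>- R\<close> and grows by at
     least \<open>2 * R\<close>.\<close>
   have "2 * R * 1 <= 2 * R * (\<theta> \<bullet> b)" using R direction_density_support(2)[OF False b] by (intro mult_left_mono) auto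
   moreover have "- R < y \<bullet> b" using Basis_le_norm[OF b, of y] y by (auto simp: abs_le_iff)
   ultimately have "R < (y + (2 * R) *\<^sub>R \<theta>) \<bullet> b" by (simp add: inner_add_left)
   then have "R < norm (y + (2 * R) *\<^sub>R \<theta>)" using Basis_le_norm[OF b, of "y + (2 * R) *\<^sub>R \<theta>"] by linarith
   then show ?thesis using out by simp
  qed simp
  ultimately show "(LBINT s. ray_weight {0..2 * R} (s, \<theta>) \<bullet> grad \<phi> (y + s *\<^sub>R \<theta>)) = - \<phi> y * direction_density \<theta>"
   by (simp add: right_diff_distrib)
 qed
 finally show ?thesis by (simp add: integral_direction_density)
qed

context
 fixes R :: real and f :: "'a::euclidean_space => real"
 assumes R: "0 < R" and f: "integrable lborel f"
begin

lemma integrable_div_inverse: "integrable lborel (div_inverse R f)"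
 unfolding div_inverse_def using f by (intro integrable_shift_average integrable_ray_weight ray_measurable) auto

lemma div_inverse_L1: "(LBINT x. norm (div_inverse R f x)) <= direction_bound TYPE('a) * (2 * R) * (LBINT x. \<bar>f x\<bar>)"
proof -
 have "(LBINT x. norm (div_inverse R f x)) <= (LBINT q. norm (ray_weight {0..2 * R} q :: 'a)) * (LBINT x. \<bar>f x\<bar>)"
  unfolding div_inverse_def using f by (intro L1_shift_average_le integrable_ray_weight ray_measurable) auto
 also have "\<dots> <= direction_bound TYPE('a) * (2 * R) * (LBINT x. \<bar>f x\<bar>)"
  using integrable_ray_weight(2)[of "{0..2 * R}", where 'a = 'a] R by (intro mult_right_mono) auto
 finally show ?thesis .
qed

text \<open>The adjoint of the averaging operator sends \<open>grad \<phi>\<close> to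
  \<open>- \<phi>\<close> on the ball, and \<open>f\<close> vanishes elsewhere.\<close>

lemma div_inverse_test:
 assumes zero: "!!x. x \<notin> ball 0 R ==> f x = 0" and tf: "test_fun (ball 0 R) \<phi>"
 shows "(LBINT x. f x * \<phi> x) = - (LBINT x. div_inverse R f x \<bullet> grad \<phi> x)"
proof -
 obtain L where L: "!!x. norm (grad \<phi> x) <= L" using test_fun_bounds[OF tf] by metis
 have m: "grad \<phi> \<in> borel_measurable borel" using tf by (auto simp: test_fun_def intro: smooth_grad_measurable)
 have "(LBINT x. div_inverse R f x \<bullet> grad \<phi> x)
  = (LBINT y. f y * (LBINT q. ray_weight {0..2 * R} q \<bullet> grad \<phi> (y + ray q)))" unfolding div_inverse_def
  using f m L by (intro integral_shift_average_inner[where C = L] integrable_ray_weight ray_measurable) auto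
 also have "\<dots> = (LBINT y. - (f y * \<phi> y))"
 proof (intro bochner_cong refl)
  fix y
  show "f y * (LBINT q. ray_weight {0..2 * R} q \<bullet> grad \<phi> (y + ray q)) = - (f y * \<phi> y)"
   using ray_weight_grad[OF R tf, of y] zero[of y] by (cases "y \<in> ball 0 R") auto
 qed
 finally show ?thesis by simp
qed

end

section \<open>Compactness: long rays regularise, short rays contribute little\<close>

definition direction_field :: "'a::euclidean_space => 'a" where
 "direction_field \<theta> = direction_density \<theta> *\<^sub>R \<theta>"

text \<open>The density is Lipschitz with compact support. If neither point lies within
  \<open>direction_bound\<close>, both values vanish; otherwise the factor \<theta> is evaluated at
  a point where its norm is bounded.\<close>

lemma direction_field_lipschitz:
 obtains L where "0 <= L" "!!x y :: 'a::euclidean_space. norm (direction_field x - direction_field y) <= L * norm (x - y)"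
  "!!x :: 'a. norm (direction_field x) <= L"
proof -
 let ?C = "direction_bound TYPE('a)"
 have C: "0 <= ?C" using direction_bound_pos[where 'a = 'a] by simp
 have "direction_density x = 0" if "x \<notin> cball 0 ?C" for x :: 'a using direction_density_support(1)[of x] that by auto
 from smooth_compact_support_bounds[OF smooth_direction_density compact_cball this]
 obtain L where L: "0 <= L" "!!x::'a. \<bar>direction_density x\<bar> <= L"
  "!!x y::'a. \<bar>direction_density x - direction_density y\<bar> <= L * norm (x - y)" by metis
 have lip: "norm (direction_field x - direction_field y) <= (L * ?C + L) * norm (x - y)"
  if y: "norm y <= ?C" for x y :: 'a
 proof -
  have "direction_field x - direction_field y = (direction_density x - direction_density y) *\<^sub>R y + direction_density x *\<^sub>R (x - y)"
   by (simp add: direction_field_def algebra_simps)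
  then have "norm (direction_field x - direction_field y)
    <= \<bar>direction_density x - direction_density y\<bar> * norm y + \<bar>direction_density x\<bar> * norm (x - y)"
   by (metis norm_scaleR norm_triangle_ineq)
  also have "\<dots> <= (L * norm (x - y)) * ?C + L * norm (x - y)" using L y C by (intro add_mono mult_mono) auto
  finally show ?thesis by (simp add: algebra_simps)
 qed
 show ?thesis
 proof (rule that[of "L * ?C + L"])
  show "0 <= L * ?C + L" using L(1) C by simp
  show "norm (direction_field x - direction_field y) <= (L * ?C + L) * norm (x - y)" for x y :: 'a
  proof (cases "norm y <= ?C")
   case True
   then show ?thesis by (rule lip)
  next
   case False
   then have y0: "direction_field y = 0" using direction_density_support(1)[of y] by (auto simp: direction_field_def)
   show ?thesis
   proof (cases "norm x <= ?C")
    case True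
    then show ?thesis using lip[OF True, of y] by (simp add: norm_minus_commute)
   next
    case False
    then have "direction_field x = 0" using direction_density_support(1)[of x] by (auto simp: direction_field_def)
    then show ?thesis using y0 L(1) C by simp
   qed
  qed
  show "norm (direction_field x) <= L * ?C + L" for x :: 'a
  proof (cases "direction_density x = 0")
   case False
   then have "\<bar>direction_density x\<bar> * norm x <= L * ?C" using direction_density_support(1)[OF False] L C by (intro mult_mono) auto
   then show ?thesis using L(1) by (simp add: direction_field_def)
  qed (use L(1) C in \<open>simp add: direction_field_def\<close>)
 qed
qed

lemma direction_field_measurable: "direction_field \<in> borel_measurable borel" unfolding direction_field_def[abs_def]
 by (intro borel_measurable_scaleR direction_density_measurable) simp

text \<open>The part of \<open>div_inverse\<close> that comes from rays of length at least \<open>\<delta>\<close>, as a superposition of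
 convolutions with rescaled Lipschitz kernels; it is Lipschitz continuous.\<close>

definition ray_kernel :: "real => ('a::euclidean_space => real) => 'a => 'a" where
 "ray_kernel s f x = (1 / s ^ DIM('a)) *\<^sub>R (LBINT y. f y *\<^sub>R direction_field ((1 / s) *\<^sub>R (x - y)))"

definition regular_part :: "real => real => ('a::euclidean_space => real) => 'a => 'a" where
 "regular_part S \<delta> f x = (LBINT s. indicator {\<delta>..S} s *\<^sub>R ray_kernel s f x)"

context
 fixes f :: "'a::euclidean_space => real" and \<delta> S :: real
 assumes f: "integrable lborel f" and \<delta>: "0 < \<delta>" "\<delta> <= S"
begin

private lemma fm: "f \<in> borel_measurable borel" using f by auto

lemma ray_kernel_integrable: 
 "integrable lborel (%y. f y *\<^sub>R direction_field ((1 / s) *\<^sub>R (x - y)))"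
proof -
 obtain L where L: "!!x :: 'a. norm (direction_field x) <= L" using direction_field_lipschitz by metis
 note [measurable] = fm direction_field_measurable
 show ?thesis
 proof (rule bochner_bound[of lborel "%y. L * norm (f y)"])
  show "AE y in lborel. norm (f y *\<^sub>R direction_field ((1 / s) *\<^sub>R (x - y))) <= norm (L * norm (f y))"
   using mult_left_mono[OF L abs_ge_zero] order_trans[OF norm_ge_zero L] by (intro AE_I2) (simp add: abs_mult mult.commute)
  show "(%y. f y *\<^sub>R direction_field ((1 / s) *\<^sub>R (x - y))) \<in> borel_measurable lborel" by measurable
 qed (use f in auto)
qed

lemma ray_kernel_measurable: "(%s. ray_kernel s f x) \<in> borel_measurable lborel"
proof -
 note [measurable] = fm direction_field_measurable
 show ?thesis unfolding ray_kernel_def by measurable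
qed

text \<open>Lengths stay above \<delta>, so the factors \<open>1 / s ^ DIM('a)\<close> and
  \<open>1 / s\<close> that come from rescaling are bounded.\<close>

lemma ray_kernel_bounds:
 assumes L: "0 <= L" "!!x y :: 'a. norm (direction_field x - direction_field y) <= L * norm (x - y)"
  "!!x :: 'a. norm (direction_field x) <= L" and s: "\<delta> <= s"
 shows "norm (ray_kernel s f x) <= (1 / \<delta> ^ DIM('a)) * L * (LBINT y. \<bar>f y\<bar>)"
  "norm (ray_kernel s f x - ray_kernel s f z) <= (1 / \<delta> ^ DIM('a)) * (L / \<delta>) * norm (x - z) * (LBINT y. \<bar>f y\<bar>)"
proof -
 have s0: "0 < s" using s \<delta> by simp
 have pw: "1 / s ^ DIM('a) <= 1 / \<delta> ^ DIM('a)" using s \<delta> s0 by (intro divide_left_mono power_mono) auto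
 have fa: "integrable lborel (%y. \<bar>f y\<bar>)" using f by simp
 have fnn: "0 <= (LBINT y. \<bar>f y\<bar>)" by simp
 have "norm (LBINT y. f y *\<^sub>R direction_field ((1 / s) *\<^sub>R (x - y))) <= (LBINT y. L * \<bar>f y\<bar>)"
 proof (rule Bochner_Integration.integral_norm_bound_integral[OF ray_kernel_integrable])
  show "norm (f y *\<^sub>R direction_field ((1 / s) *\<^sub>R (x - y))) <= L * \<bar>f y\<bar>" for y
   using mult_left_mono[OF L(3) abs_ge_zero] by (simp add: mult.commute)
 qed (use fa in auto)
 then have *: "norm (LBINT y. f y *\<^sub>R direction_field ((1 / s) *\<^sub>R (x - y))) <= L * (LBINT y. \<bar>f y\<bar>)" by simp
 have "norm (ray_kernel s f x) = (1 / s ^ DIM('a)) * norm (LBINT y. f y *\<^sub>R direction_field ((1 / s) *\<^sub>R (x - y)))"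
  using s0 by (simp add: ray_kernel_def)
 also have "\<dots> <= (1 / \<delta> ^ DIM('a)) * (L * (LBINT y. \<bar>f y\<bar>))" using pw * \<delta> by (intro mult_mono) auto
 finally show "norm (ray_kernel s f x) <= (1 / \<delta> ^ DIM('a)) * L * (LBINT y. \<bar>f y\<bar>)" by simp
 have "norm ((LBINT y. f y *\<^sub>R direction_field ((1 / s) *\<^sub>R (x - y))) - (LBINT y. f y *\<^sub>R direction_field ((1 / s) *\<^sub>R (z - y))))
   = norm (LBINT y. f y *\<^sub>R direction_field ((1 / s) *\<^sub>R (x - y)) - f y *\<^sub>R direction_field ((1 / s) *\<^sub>R (z - y)))"
  by (subst Bochner_Integration.integral_diff[OF ray_kernel_integrable ray_kernel_integrable]) simp
 also have "\<dots> <= (LBINT y. (L / \<delta>) * norm (x - z) * \<bar>f y\<bar>)"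
 proof (rule Bochner_Integration.integral_norm_bound_integral)
  fix y
  have "norm (direction_field ((1 / s) *\<^sub>R (x - y)) - direction_field ((1 / s) *\<^sub>R (z - y)))
    <= L * norm ((1 / s) *\<^sub>R (x - y) - (1 / s) *\<^sub>R (z - y))" by (rule L(2))
  also have "\<dots> = (L / s) * norm (x - z)" using s0 by (simp flip: scaleR_diff_right)
  also have "\<dots> <= (L / \<delta>) * norm (x - z)" using L(1) s \<delta> s0 by (intro mult_right_mono divide_left_mono) auto
  finally have "\<bar>f y\<bar> * norm (direction_field ((1 / s) *\<^sub>R (x - y)) - direction_field ((1 / s) *\<^sub>R (z - y)))
    <= \<bar>f y\<bar> * ((L / \<delta>) * norm (x - z))" by (rule mult_left_mono) simp
  then show "norm (f y *\<^sub>R direction_field ((1 / s) *\<^sub>R (x - y)) - f y *\<^sub>R direction_field ((1 / s) *\<^sub>R (z - y)))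
    <= (L / \<delta>) * norm (x - z) * \<bar>f y\<bar>" by (simp add: mult.commute flip: scaleR_diff_right)
 qed (intro Bochner_Integration.integrable_diff ray_kernel_integrable integrable_mult_right fa)+
 finally have **: "norm ((LBINT y. f y *\<^sub>R direction_field ((1 / s) *\<^sub>R (x - y))) - (LBINT y. f y *\<^sub>R direction_field ((1 / s) *\<^sub>R (z - y))))
   <= (L / \<delta>) * norm (x - z) * (LBINT y. \<bar>f y\<bar>)" by simp
 have "norm (ray_kernel s f x - ray_kernel s f z) = (1 / s ^ DIM('a)) *
   norm ((LBINT y. f y *\<^sub>R direction_field ((1 / s) *\<^sub>R (x - y))) - (LBINT y. f y *\<^sub>R direction_field ((1 / s) *\<^sub>R (z - y))))"
  using s0 by (simp add: ray_kernel_def flip: scaleR_diff_right)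
 also have "\<dots> <= (1 / \<delta> ^ DIM('a)) * ((L / \<delta>) * norm (x - z) * (LBINT y. \<bar>f y\<bar>))"
  using pw ** \<delta> by (intro mult_mono) auto
 finally show "norm (ray_kernel s f x - ray_kernel s f z) <= (1 / \<delta> ^ DIM('a)) * (L / \<delta>) * norm (x - z) * (LBINT y. \<bar>f y\<bar>)"
  by (simp add: mult.assoc)
qed

lemma regular_part_integrable: "integrable lborel (%s. indicator {\<delta>..S} s *\<^sub>R ray_kernel s f x)"
proof -
 obtain L where L: "0 <= L" "!!x y :: 'a. norm (direction_field x - direction_field y) <= L * norm (x - y)"
  "!!x :: 'a. norm (direction_field x) <= L" using direction_field_lipschitz by metis
 let ?B = "(1 / \<delta> ^ DIM('a)) * L * (LBINT y. \<bar>f y\<bar>)"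
 show ?thesis
 proof (rule bochner_bound[of lborel "%s. ?B * indicator {\<delta>..S} s"])
  show "AE s in lborel. norm (indicator {\<delta>..S} s *\<^sub>R ray_kernel s f x) <= norm (?B * indicator {\<delta>..S} s :: real)"
   using order_trans[OF ray_kernel_bounds(1)[OF L] abs_ge_self] by (intro AE_I2) (auto simp: indicator_def)
  show "(%s. indicator {\<delta>..S} s *\<^sub>R ray_kernel s f x) \<in> borel_measurable lborel"
   by (intro borel_measurable_scaleR ray_kernel_measurable) simp
 qed (intro integrable_mult_right integrable_real_indicator; simp add: emeasure_lborel_Icc_eq)
qed

lemma regular_part_bounds:
 assumes L: "0 <= L" "!!x y :: 'a. norm (direction_field x - direction_field y) <= L * norm (x - y)"
  "!!x :: 'a. norm (direction_field x) <= L"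
 shows "norm (regular_part S \<delta> f x) <= S * ((1 / \<delta> ^ DIM('a)) * L * (LBINT y. \<bar>f y\<bar>))"
  "norm (regular_part S \<delta> f x - regular_part S \<delta> f z)
    <= S * ((1 / \<delta> ^ DIM('a)) * (L / \<delta>) * norm (x - z) * (LBINT y. \<bar>f y\<bar>))"
proof -
 have ii: "integrable lborel (indicator {\<delta>..S} :: real => real)"
  by (intro integrable_real_indicator) (simp_all add: emeasure_lborel_Icc_eq)
 have S: "(LBINT s. B * indicator {\<delta>..S} s) <= S * B" if "0 <= B" for B :: real
  using that \<delta> by (simp add: mult.commute mult_left_mono)
 let ?B = "(1 / \<delta> ^ DIM('a)) * L * (LBINT y. \<bar>f y\<bar>)"
 let ?D = "(1 / \<delta> ^ DIM('a)) * (L / \<delta>) * norm (x - z) * (LBINT y. \<bar>f y\<bar>)"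
 have nn: "0 <= ?B" "0 <= ?D" using L(1) \<delta> by auto
 have "norm (regular_part S \<delta> f x) <= (LBINT s. ?B * indicator {\<delta>..S} s)" unfolding regular_part_def
 proof (rule Bochner_Integration.integral_norm_bound_integral[OF regular_part_integrable])
  show "norm (indicator {\<delta>..S} s *\<^sub>R ray_kernel s f x) <= ?B * indicator {\<delta>..S} s" for s
   using ray_kernel_bounds(1)[OF L, of s x] by (auto simp: indicator_def)
 qed (intro integrable_mult_right ii)
 then show "norm (regular_part S \<delta> f x) <= S * ?B" using S[OF nn(1)] by linarith
 have "norm (regular_part S \<delta> f x - regular_part S \<delta> f z)
   = norm (LBINT s. indicator {\<delta>..S} s *\<^sub>R ray_kernel s f x - indicator {\<delta>..S} s *\<^sub>R ray_kernel s f z)"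
  unfolding regular_part_def by (subst Bochner_Integration.integral_diff[OF regular_part_integrable regular_part_integrable]) simp
 also have "\<dots> <= (LBINT s. ?D * indicator {\<delta>..S} s)"
 proof (rule Bochner_Integration.integral_norm_bound_integral)
  show "norm (indicator {\<delta>..S} s *\<^sub>R ray_kernel s f x - indicator {\<delta>..S} s *\<^sub>R ray_kernel s f z) <= ?D * indicator {\<delta>..S} s" for s
   using ray_kernel_bounds(2)[OF L, of s x z] by (auto simp: indicator_def)
 qed (intro Bochner_Integration.integrable_diff regular_part_integrable integrable_mult_right ii)+
 finally show "norm (regular_part S \<delta> f x - regular_part S \<delta> f z) <= S * ?D" using S[OF nn(2)] by linarith
qed

text \<open>For a fixed length \<open>s\<close> the substitution \<open>y = x - s \<theta>\<close>
  turns the average over directions into a convolution, with Jacobian \<open>s ^ DIM('a)\<close>.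
  Here it matters that the directions have a density and do not form a single line.\<close>

lemma AE_regular_part:
 "AE x in lborel. shift_average ray (ray_weight {\<delta>..S}) f x = regular_part S \<delta> f x"
proof -
 note [measurable] = fm direction_field_measurable
 have kint: "integrable lborel (ray_weight {\<delta>..S} :: _ => 'a)" by (rule integrable_ray_weight) auto
 show ?thesis using AE_shift_average[OF ray_measurable kint f]
 proof eventually_elim
  case (elim x)
  let ?h = "%(s, \<theta>). f (x - s *\<^sub>R \<theta>) *\<^sub>R (ray_weight {\<delta>..S} (s, \<theta>) :: 'a)"
  have int: "integrable (lborel \<Otimes>\<^sub>M lborel) ?h" using elim by (simp add: lborel_prod ray_def case_prod_beta')
  have "shift_average ray (ray_weight {\<delta>..S}) f x = integral\<^sup>L (lborel \<Otimes>\<^sub>M lborel) ?h"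
   by (simp add: shift_average_def lborel_prod ray_def case_prod_beta')
  also have "\<dots> = (LBINT s. (LBINT \<theta>. f (x - s *\<^sub>R \<theta>) *\<^sub>R (ray_weight {\<delta>..S} (s, \<theta>) :: 'a)))"
   using lborel_pair.integral_fst[of "%s \<theta>. f (x - s *\<^sub>R \<theta>) *\<^sub>R (ray_weight {\<delta>..S} (s, \<theta>) :: 'a)"] int by simp
  also have "\<dots> = regular_part S \<delta> f x" unfolding regular_part_def
  proof (rule bochner_cong[OF refl])
   fix s :: real
   show "(LBINT \<theta>. f (x - s *\<^sub>R \<theta>) *\<^sub>R (ray_weight {\<delta>..S} (s, \<theta>) :: 'a)) = indicator {\<delta>..S} s *\<^sub>R ray_kernel s f x"
   proof (cases "s \<in> {\<delta>..S}")
    case True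
    then have s: "0 < s" using \<delta> by auto
    have m: "(%y. f y *\<^sub>R direction_field ((1 / s) *\<^sub>R (x - y))) \<in> borel_measurable borel"
     using ray_kernel_integrable by auto
    have "(LBINT y. f y *\<^sub>R direction_field ((1 / s) *\<^sub>R (x - y)))
      = (\<bar>- s\<bar> ^ DIM('a)) *\<^sub>R (LBINT \<theta>. f (x + (- s) *\<^sub>R \<theta>) *\<^sub>R direction_field ((1 / s) *\<^sub>R (x - (x + (- s) *\<^sub>R \<theta>))))"
     using integral_lborel_affine[OF m, of "- s" x] s by simp
    also have "\<dots> = (s ^ DIM('a)) *\<^sub>R (LBINT \<theta>. f (x - s *\<^sub>R \<theta>) *\<^sub>R direction_field \<theta>)"
     using s by simp
    finally show ?thesis using s True by (simp add: ray_kernel_def ray_weight_def direction_field_def)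
   qed (simp add: ray_weight_def)
  qed
  finally show ?case .
 qed
qed

end

text \<open>The rays shorter than \<delta> have total weight of order \<delta> and thus contribute
  little in L1. The half-open interval makes the weights of short and long rays add up
  exactly.\<close>

lemma shift_average_remainder:
 fixes f :: "'a::euclidean_space => real"
 assumes f: "integrable lborel f" and \<delta>: "0 < \<delta>" "\<delta> <= S"
 defines "E \<equiv> shift_average ray (ray_weight {0..<\<delta>}) f"
 shows "integrable lborel E" "(LBINT x. norm (E x)) <= direction_bound TYPE('a) * \<delta> * (LBINT x. \<bar>f x\<bar>)"
  "AE x in lborel. shift_average ray (ray_weight {0..S}) f x = regular_part S \<delta> f x + E x"
proof -
 have k: "integrable lborel (ray_weight {0..<\<delta>} :: _ => 'a)" "integrable lborel (ray_weight {\<delta>..S} :: _ => 'a)"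
  by (auto intro!: integrable_ray_weight)
 show "integrable lborel E" unfolding E_def by (intro integrable_shift_average ray_measurable k f)
 have "(LBINT x. norm (E x)) <= (LBINT q. norm (ray_weight {0..<\<delta>} q :: 'a)) * (LBINT x. \<bar>f x\<bar>)"
  unfolding E_def by (intro L1_shift_average_le ray_measurable k f)
 also have "\<dots> <= direction_bound TYPE('a) * \<delta> * (LBINT x. \<bar>f x\<bar>)"
  using integrable_ray_weight(2)[of "{0..<\<delta>}", where 'a = 'a] \<delta> by (intro mult_right_mono) auto
 finally show "(LBINT x. norm (E x)) <= direction_bound TYPE('a) * \<delta> * (LBINT x. \<bar>f x\<bar>)" .
 show "AE x in lborel. shift_average ray (ray_weight {0..S}) f x = regular_part S \<delta> f x + E x"
  using AE_shift_average[OF ray_measurable k(1) f] AE_shift_average[OF ray_measurable k(2) f] AE_regular_part[OF f \<delta>]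
 proof eventually_elim
  case (elim x)
  have "ray_weight {0..S} q = ray_weight {0..<\<delta>} q + (ray_weight {\<delta>..S} q :: 'a)" for q
   using \<delta> by (cases "fst q < \<delta>") (auto simp: ray_weight_def indicator_def)
  then have "shift_average ray (ray_weight {0..S}) f x = E x + shift_average ray (ray_weight {\<delta>..S}) f x"
   unfolding shift_average_def E_def using elim(1,2) by (simp add: scaleR_add_right)
  then show ?case using elim(3) by simp
 qed
qed

text \<open>For each cut-off \<open>\<delta> j\<close> the long rays give bounded and equicontinuous
  functions, to which Arzela-Ascoli applies; a diagonal sequence serves all \<open>j\<close> at
  once. The short rays are small uniformly in \<open>n\<close>, so the fields form a Cauchy sequence
  in L1 of the ball.\<close>

lemma div_inverse_compact:
 fixes f :: "nat => 'a::euclidean_space => real"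
 assumes R: "0 < R" and f: "!!n. integrable lborel (f n)" and M: "!!n. (LBINT x. \<bar>f n x\<bar>) <= M"
 obtains r :: "nat => nat" and \<Phi> :: "'a => 'a" where "strict_mono r" "integrable lborel \<Phi>"
  "(%n. LBINT x. norm (indicator (ball 0 R) x *\<^sub>R div_inverse R (f (r n)) x - \<Phi> x)) \<longlonglongrightarrow> 0"
proof -
 have M0: "0 <= M" using M[of 0] by (rule order_trans[rotated]) simp
 \<comment> \<open>Tends to 0 and never exceeds \<open>2 * R\<close>, the largest cut-off for which
   the splitting makes sense.\<close>
 define \<delta> where "\<delta> j = R / (real j + 1)" for j :: nat
 have \<delta>: "0 < \<delta> j" "\<delta> j <= 2 * R" for j using R by (auto simp: \<delta>_def field_simps)
 obtain L where L: "0 <= L" "!!x y :: 'a. norm (direction_field x - direction_field y) <= L * norm (x - y)"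
  "!!x :: 'a. norm (direction_field x) <= L" using direction_field_lipschitz by metis
 define g where "g j n = regular_part (2 * R) (\<delta> j) (f n)" for j n
 \<comment> \<open>Being uniformly Cauchy passes to subsequences without reference to a limit
   function, as the diagonal construction requires.\<close>
 define P where "P j s \<longleftrightarrow> (\<forall>e>0. \<exists>N. \<forall>m\<ge>N. \<forall>n\<ge>N. \<forall>x\<in>cball 0 R. norm (g j (s m) x - g j (s n) x) < e)"
  for j and s :: "nat => nat"
 have "subseqs P"
 proof
  fix j and s :: "nat => nat" assume "strict_mono s"
  define D where "D = 2 * R * ((1 / \<delta> j ^ DIM('a)) * (L / \<delta> j) * M)"
  have D0: "0 <= D" using R L(1) M0 \<delta>[of j] by (simp add: D_def)
  have lip: "norm (g j n x - g j n y) <= D * norm (x - y)" for n x y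
  proof -
   have "norm (g j n x - g j n y) <= 2 * R * ((1 / \<delta> j ^ DIM('a)) * (L / \<delta> j) * norm (x - y) * (LBINT y. \<bar>f n y\<bar>))"
    unfolding g_def by (rule regular_part_bounds(2)[OF f \<delta> L])
   also have "\<dots> <= 2 * R * ((1 / \<delta> j ^ DIM('a)) * (L / \<delta> j) * norm (x - y) * M)"
    using R L(1) \<delta>[of j] M by (intro mult_left_mono) auto
   finally show ?thesis by (simp add: D_def mult_ac)
  qed
  have bd: "norm (g j n x) <= 2 * R * ((1 / \<delta> j ^ DIM('a)) * L * M)" for n x
  proof -
   have "norm (g j n x) <= 2 * R * ((1 / \<delta> j ^ DIM('a)) * L * (LBINT y. \<bar>f n y\<bar>))"
    unfolding g_def by (rule regular_part_bounds(1)[OF f \<delta> L])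
   also have "\<dots> <= 2 * R * ((1 / \<delta> j ^ DIM('a)) * L * M)" using R L(1) \<delta>[of j] M by (intro mult_left_mono) auto
   finally show ?thesis .
  qed
  obtain h and k :: "nat => nat" where k: "strict_mono k"
   and conv: "!!e. 0 < e ==> \<exists>N. \<forall>n x. n \<ge> N \<and> x \<in> cball 0 R --> norm (g j (s (k n)) x - h x) < e"
  proof (rule Arzela_Ascoli[of "cball 0 R" "%n. g j (s n)" "2 * R * ((1 / \<delta> j ^ DIM('a)) * L * M)"])
   show "compact (cball (0::'a) R)" by simp
   show "\<exists>d. 0 < d \<and> (\<forall>n y. y \<in> cball 0 R \<and> norm (x - y) < d --> norm (g j (s n) x - g j (s n) y) < e)"
    if "x \<in> cball 0 R" "0 < e" for x e
   proof (intro exI[of _ "e / (D + 1)"] conjI allI impI)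
    show "0 < e / (D + 1)" using D0 that by simp
    fix n y assume y: "y \<in> cball 0 R \<and> norm (x - y) < e / (D + 1)"
    have "norm (g j (s n) x - g j (s n) y) <= (D + 1) * norm (x - y)" using lip[of "s n" x y] by (simp add: distrib_right add_increasing2)
    also have "\<dots> < e" using y D0 by (simp add: field_simps)
    finally show "norm (g j (s n) x - g j (s n) y) < e" .
   qed
  qed (use bd in auto)
  have "P j (s \<circ> k)" unfolding P_def
  proof (intro allI impI)
   fix e :: real assume "0 < e"
   then obtain N where N: "!!n x. n \<ge> N ==> x \<in> cball 0 R ==> norm (g j (s (k n)) x - h x) < e / 2"
    using conv[of "e / 2"] by auto
   have "norm (g j (s (k m)) x - g j (s (k n)) x) < e" if "m \<ge> N" "n \<ge> N" "x \<in> cball 0 R" for m n x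
    using N[OF that(1,3)] N[OF that(2,3)] norm_triangle_ineq4[of "g j (s (k m)) x - h x" "g j (s (k n)) x - h x"] by simp
   then show "\<exists>N. \<forall>m\<ge>N. \<forall>n\<ge>N. \<forall>x\<in>cball 0 R. norm (g j ((s \<circ> k) m) x - g j ((s \<circ> k) n) x) < e"
    by (intro exI[of _ N]) auto
  qed
  then show "\<exists>r'. strict_mono r' \<and> P j (s \<circ> r')" using k by blast
 qed
 then interpret subseqs P .
 \<comment> \<open>The diagonal sequence is a subsequence of the one selected for \<open>j\<close>
   only after its first terms, hence the shift by \<open>Suc j\<close>.\<close>
 have diag: "P j (diagseq \<circ> ((+) (Suc j)))" for j
 proof (rule diagseq_holds)
  fix r s :: "nat => nat" and n assume r: "strict_mono r" and "P n s"
  show "P n (s \<circ> r)" unfolding P_def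
  proof (intro allI impI)
   fix e :: real assume "0 < e"
   then obtain N where N: "\<forall>a\<ge>N. \<forall>b\<ge>N. \<forall>x\<in>cball 0 R. norm (g n (s a) x - g n (s b) x) < e"
    using \<open>P n s\<close> unfolding P_def by blast
   have "r a \<ge> N" if "a \<ge> N" for a using seq_suble[OF r, of a] that by linarith
   then show "\<exists>N. \<forall>a\<ge>N. \<forall>b\<ge>N. \<forall>x\<in>cball 0 R. norm (g n ((s \<circ> r) a) x - g n ((s \<circ> r) b) x) < e"
    using N by (intro exI[of _ N]) auto
  qed
 qed
 define d where "d = diagseq"
 have d: "strict_mono d" unfolding d_def by (rule subseq_diagseq)
 have dP: "\<exists>N. \<forall>m\<ge>N. \<forall>n\<ge>N. \<forall>x\<in>cball 0 R. norm (g j (d m) x - g j (d n) x) < e" if "0 < e" for j and e :: real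
 proof -
  obtain N where N: "!!m n x. m \<ge> N ==> n \<ge> N ==> x \<in> cball 0 R ==> norm (g j (d (Suc j + m)) x - g j (d (Suc j + n)) x) < e"
   using diag[of j] \<open>0 < e\<close> unfolding P_def d_def comp_def by meson
  have "norm (g j (d m) x - g j (d n) x) < e" if "m \<ge> N + Suc j" "n \<ge> N + Suc j" "x \<in> cball 0 R" for m n x
   using N[of "m - Suc j" "n - Suc j" x] that by simp
  then show ?thesis by blast
 qed
 define h where "h n x = indicator (ball 0 R) x *\<^sub>R div_inverse R (f (d n)) x" for n x
 have hi: "integrable lborel (h n)" for n unfolding h_def[abs_def] by (intro integrable_mult_indicator integrable_div_inverse R f) auto
 let ?C = "direction_bound TYPE('a)" and ?b = "measure lborel (ball (0::'a) R)"
 have C: "0 < ?C" by (rule direction_bound_pos)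
 have ib: "integrable lborel (indicator (ball (0::'a) R) :: 'a => real)" by (rule integrable_indicator_bounded) auto
 have Cauchy: "\<exists>N. \<forall>m\<ge>N. \<forall>n\<ge>N. (LBINT x. norm (h m x - h n x)) < e" if e: "0 < e" for e :: real
 proof -
  \<comment> \<open>Half of \<open>e\<close> pays for the two remainders from short rays, the other
    half for the uniform distance \<omega> on the ball.\<close>
  have "(%j. 2 * (?C * (R * (1 / real (Suc j))) * M)) \<longlonglongrightarrow> 2 * (?C * (R * 0) * M)"
   by (intro tendsto_intros LIMSEQ_Suc lim_1_over_n)
  then have "\<forall>\<^sub>F j in sequentially. 2 * (?C * (R * (1 / real (Suc j))) * M) < e / 2" using e by (intro order_tendstoD(2)[of _ 0]) auto
  then obtain j where "2 * (?C * (R * (1 / real (Suc j))) * M) < e / 2" using eventually_happens' sequentially_bot by blast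
  then have j: "2 * (?C * \<delta> j * M) < e / 2" by (simp add: \<delta>_def add.commute)
  define vol where "vol = ?b"
  have b0: "0 <= vol" by (simp add: vol_def)
  define \<omega> where "\<omega> = e / (2 * (vol + 1))"
  have "0 < \<omega>" using e b0 by (simp add: \<omega>_def)
  moreover have "\<omega> * vol <= e / 2"
  proof -
   have "\<omega> * vol = e / 2 * (vol / (vol + 1))" using b0 by (simp add: \<omega>_def)
   also have "\<dots> <= e / 2 * 1" using e b0 by (intro mult_left_mono) auto
   finally show ?thesis by simp
  qed
  ultimately have w: "0 < \<omega>" "\<omega> * ?b <= e / 2" by (simp_all add: vol_def)
  obtain N where N: "!!m n x. m \<ge> N ==> n \<ge> N ==> x \<in> cball 0 R ==> norm (g j (d m) x - g j (d n) x) < \<omega>"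
   using dP[OF w(1), of j] by blast
  define E where "E n = shift_average ray (ray_weight {0..<\<delta> j}) (f (d n))" for n
  have rem: "integrable lborel (E i)" "(LBINT x. norm (E i x)) <= ?C * \<delta> j * (LBINT x. \<bar>f (d i) x\<bar>)"
   "AE x in lborel. shift_average ray (ray_weight {0..2 * R}) (f (d i)) x = regular_part (2 * R) (\<delta> j) (f (d i)) x + E i x" for i
   unfolding E_def by (rule shift_average_remainder[OF f \<delta>])+
  have "(LBINT x. norm (h m x - h n x)) < e" if mn: "m \<ge> N" "n \<ge> N" for m n
  proof -
   have EM: "(LBINT x. norm (E n x)) <= ?C * \<delta> j * M" for n using rem(2)[of n] M[of "d n"] C \<delta>[of j]
    by (meson mult_left_mono mult_nonneg_nonneg less_imp_le order_trans)
   have Ei: "integrable lborel (E n)" for n by (rule rem(1))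
   have "(LBINT x. norm (h m x - h n x)) <= (LBINT x. \<omega> * indicator (ball 0 R) x + norm (E m x) + norm (E n x))"
   proof (rule integral_mono_AE)
    show "integrable lborel (%x. norm (h m x - h n x))" using hi by auto
    show "integrable lborel (%x. \<omega> * indicator (ball 0 R) x + norm (E m x) + norm (E n x))" using ib Ei by auto
    show "AE x in lborel. norm (h m x - h n x) <= \<omega> * indicator (ball 0 R) x + norm (E m x) + norm (E n x)"
     using rem(3)[of m] rem(3)[of n]
    proof eventually_elim
     case (elim x)
     show ?case
     proof (cases "x \<in> ball 0 R")
      case True
      have "h m x - h n x = (g j (d m) x - g j (d n) x) + E m x - E n x" using True elim by (simp add: h_def div_inverse_def g_def)
      then have "norm (h m x - h n x) <= norm (g j (d m) x - g j (d n) x) + norm (E m x) + norm (E n x)"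
       using norm_triangle_ineq4[of "(g j (d m) x - g j (d n) x) + E m x" "E n x"]
        norm_triangle_ineq[of "g j (d m) x - g j (d n) x" "E m x"] by simp
      then show ?thesis using N[OF mn, of x] True by simp
     qed (simp add: h_def)
    qed
   qed
   also have "\<dots> = \<omega> * ?b + (LBINT x. norm (E m x)) + (LBINT x. norm (E n x))" using ib Ei by simp
   also have "\<dots> < e" using w(2) EM[of m] EM[of n] j by linarith
   finally show ?thesis .
  qed
  then show ?thesis by blast
 qed
 obtain \<Phi> where "integrable lborel \<Phi>" "(%n. LBINT x. norm (h n x - \<Phi> x)) \<longlonglongrightarrow> 0"
  using L1_complete[of lborel h, OF hi Cauchy] by blast
 then show ?thesis using d that unfolding h_def by blast
qed

section \<open>Divergences of integrable fields as distributions\<close>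

lemma test_fun_linear:
 fixes \<phi> \<psi> :: "'a::euclidean_space => real"
 assumes "test_fun U \<phi>" "test_fun U \<psi>"
 shows "test_fun U (%x. a * \<phi> x + b * \<psi> x)" (is ?t)
  and "grad (%x. a * \<phi> x + b * \<psi> x) x = a *\<^sub>R grad \<phi> x + b *\<^sub>R grad \<psi> x" (is ?g)
proof -
 obtain C D where sm: "smooth_on UNIV \<phi>" "smooth_on UNIV \<psi>" and C: "compact C" "C \<subseteq> U" "!!x. x \<notin> C ==> \<phi> x = 0"
  and D: "compact D" "D \<subseteq> U" "!!x. x \<notin> D ==> \<psi> x = 0" using assms unfolding test_fun_def by blast
 show ?t unfolding test_fun_def using C D by (intro conjI smooth_add smooth_cmult sm exI[of _ "C \<union> D"]) auto
 show ?g
 proof (rule grad_eqI)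
  have "((%x. a * \<phi> x + b * \<psi> x) has_derivative (%k. a * (grad \<phi> x \<bullet> k) + b * (grad \<psi> x \<bullet> k))) (at x)"
   by (intro has_derivative_add has_derivative_mult_right smooth_has_derivative_grad sm)
  moreover have "(%k. a * (grad \<phi> x \<bullet> k) + b * (grad \<psi> x \<bullet> k)) = (\<bullet>) (a *\<^sub>R grad \<phi> x + b *\<^sub>R grad \<psi> x)"
   by (auto simp: inner_add_left)
  ultimately show "((%x. a * \<phi> x + b * \<psi> x) has_derivative (\<bullet>) (a *\<^sub>R grad \<phi> x + b *\<^sub>R grad \<psi> x)) (at x)"
   by simp
 qed
qed

lemma set_integrable_inner_grad:
 fixes F :: "'a::euclidean_space => 'a"
 assumes F: "L1_on U F" and sm: "smooth_on UNIV \<phi>" and L: "!!x. x \<in> U ==> norm (grad \<phi> x) <= L"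
 shows "set_integrable lebesgue U (%x. F x \<bullet> grad \<phi> x)"
  "\<bar>LINT x:U|lebesgue. F x \<bullet> grad \<phi> x\<bar> <= L * L1_norm U F"
proof -
 let ?G = "%x. indicator U x *\<^sub>R F x"
 have G: "integrable lebesgue ?G" using F unfolding L1_on_def set_integrable_def .
 have gm: "grad \<phi> \<in> borel_measurable lebesgue" using smooth_grad_measurable[OF sm] by (auto intro: measurable_completion)
 have eq: "(%x. indicator U x *\<^sub>R (F x \<bullet> grad \<phi> x)) = (%x. ?G x \<bullet> grad \<phi> x)" by simp
 have le: "norm (?G x \<bullet> grad \<phi> x) <= L * norm (?G x)" for x
 proof (cases "x \<in> U")
  case True
  have "\<bar>F x \<bullet> grad \<phi> x\<bar> <= norm (F x) * L"
   using Cauchy_Schwarz_ineq2[of "F x" "grad \<phi> x"] mult_left_mono[OF L[OF True], of "norm (F x)"] by simp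
  then show ?thesis using True by (simp add: mult.commute)
 qed simp
 have iL: "integrable lebesgue (%x. L * norm (?G x))" using G by (intro integrable_mult_right integrable_norm)
 have i: "integrable lebesgue (%x. ?G x \<bullet> grad \<phi> x)"
 proof (rule bochner_bound[OF iL])
  show "(%x. ?G x \<bullet> grad \<phi> x) \<in> borel_measurable lebesgue"
   by (rule borel_measurable_inner[OF borel_measurable_integrable[OF G] gm])
  show "AE x in lebesgue. norm (?G x \<bullet> grad \<phi> x) <= norm (L * norm (?G x))" using le by (intro AE_I2 order_trans[OF le]) simp
 qed
 then show "set_integrable lebesgue U (%x. F x \<bullet> grad \<phi> x)" unfolding set_integrable_def eq .
 have "norm (\<integral>x. ?G x \<bullet> grad \<phi> x \<partial>lebesgue) <= (\<integral>x. L * norm (?G x) \<partial>lebesgue)"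
  by (rule Bochner_Integration.integral_norm_bound_integral[OF i iL le])
 also have "\<dots> = L * L1_norm U F" unfolding L1_norm_def set_lebesgue_integral_def by (simp add: indicator_def if_distrib cong: if_cong)
 finally show "\<bar>LINT x:U|lebesgue. F x \<bullet> grad \<phi> x\<bar> <= L * L1_norm U F" unfolding set_lebesgue_integral_def eq by simp
qed

lemma Wm11_norm_le: "L1_on U F ==> is_div_on U \<mu> F ==> Wm11_norm U \<mu> <= ennreal (L1_norm U F)"
 unfolding Wm11_norm_def by (rule INF_lower) simp

text \<open>The divergence of an L1 field is a distribution of order at most one: the bound involves
  only first derivatives of the test function.\<close>

lemma Wm11I:
 fixes F :: "'a::euclidean_space => 'a"
 assumes F: "L1_on U F" and div: "is_div_on U \<mu> F"
 shows "\<mu> \<in> Wm11 U"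
proof -
 have "Wm11_norm U \<mu> < \<infinity>" using Wm11_norm_le[OF F div] by (rule le_less_trans) simp
 moreover have "distribution_on U \<mu>" unfolding distribution_on_def
 proof (intro conjI allI impI)
  fix \<phi> \<psi> :: "'a => real" and a b
  assume t: "test_fun U \<phi> \<and> test_fun U \<psi>"
  obtain L L' where L: "!!x. norm (grad \<phi> x) <= L" "!!x. norm (grad \<psi> x) <= L'" using test_fun_bounds t by metis
  have sm: "smooth_on UNIV \<phi>" "smooth_on UNIV \<psi>" using t by (auto simp: test_fun_def)
  note i = set_integrable_inner_grad(1)[OF F sm(1) L(1)] set_integrable_inner_grad(1)[OF F sm(2) L(2)]
  have "\<mu> (%x. a * \<phi> x + b * \<psi> x) = - (LINT x:U|lebesgue. F x \<bullet> grad (%x. a * \<phi> x + b * \<psi> x) x)"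
   using div test_fun_linear(1) t unfolding is_div_on_def by blast
  also have "\<dots> = - (LINT x:U|lebesgue. a * (F x \<bullet> grad \<phi> x) + b * (F x \<bullet> grad \<psi> x))"
   using test_fun_linear(2)[of U \<phi> \<psi> a b] t by (simp add: inner_add_right)
  also have "\<dots> = - (a * (LINT x:U|lebesgue. F x \<bullet> grad \<phi> x) + b * (LINT x:U|lebesgue. F x \<bullet> grad \<psi> x))"
   using i by (subst set_integral_add(2)) auto
  also have "\<dots> = a * \<mu> \<phi> + b * \<mu> \<psi>" using div t unfolding is_div_on_def by (simp add: algebra_simps)
  finally show "\<mu> (%x. a * \<phi> x + b * \<psi> x) = a * \<mu> \<phi> + b * \<mu> \<psi>" .
 next
  fix C :: "'a set"
  show "\<exists>A N. \<forall>\<phi> M. test_fun U \<phi> \<and> (\<forall>x. x \<notin> C --> \<phi> x = 0) \<and>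
    (\<forall>bs x. set bs \<subseteq> Basis \<and> length bs <= N --> \<bar>iter_pderiv bs \<phi> x\<bar> <= M) --> \<bar>\<mu> \<phi>\<bar> <= A * M"
  proof (intro exI allI impI)
   fix \<phi> M
   assume t: "test_fun U \<phi> \<and> (\<forall>x. x \<notin> C --> \<phi> x = 0) \<and>
    (\<forall>bs x. set bs \<subseteq> Basis \<and> length bs <= 1 --> \<bar>iter_pderiv bs \<phi> x\<bar> <= M)"
   have "\<bar>pderiv_at b \<phi> x\<bar> <= M" if "b \<in> Basis" for b x
    using t that by (metis One_nat_def empty_set iter_pderiv.simps length_Cons list.size(3) list.simps(15) order_refl singletonD subsetI)
   then have g: "norm (grad \<phi> x) <= real DIM('a) * M" for x
    unfolding grad_def by (intro order_trans[OF norm_sum] order_trans[OF sum_bounded_above[where K = M]]) auto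
   have "\<bar>\<mu> \<phi>\<bar> = \<bar>LINT x:U|lebesgue. F x \<bullet> grad \<phi> x\<bar>" using div t unfolding is_div_on_def by simp
   also have "\<dots> <= real DIM('a) * M * L1_norm U F" using t g by (intro set_integrable_inner_grad(2)[OF F]) (auto simp: test_fun_def)
   finally show "\<bar>\<mu> \<phi>\<bar> <= (real DIM('a) * L1_norm U F) * M" by (simp add: mult_ac)
  qed
 qed
 ultimately show ?thesis by (simp add: Wm11_def)
qed

section \<open>Regularised free energy\<close>

text \<open>The derivative \<open>m / (m - 1) * s powr (m - 1)\<close> of the entropy, expressed
  through \<open>u = s powr m\<close> and with \<open>u\<close> shifted by \<open>e\<close>. Its own
  derivative in \<open>u\<close> is \<open>(u + e) powr (- 1 / m)\<close>.\<close>

definition entropy_deriv :: "real => real => real => real" where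
 "entropy_deriv m e u = m / (m - 1) * (u + e) powr ((m - 1) / m)"

text \<open>A regularisation of the entropy \<open>s powr m / (m - 1)\<close> whose derivative, as a function of the
 Sobolev quantity \<open>s powr m\<close>, is smooth up to \<open>0\<close>.\<close>

definition entropy :: "real => real => real => real" where
 "entropy m e s = integral {0..s} (%x. entropy_deriv m e (x powr m))"

context
 fixes m e :: real
 assumes m: "0 < m" "m < 1" and e: "0 < e"
begin

lemma entropy_deriv_mono: "0 <= u ==> u <= u' ==> entropy_deriv m e u <= entropy_deriv m e u'"
proof -
 assume u: "0 <= u" "u <= u'"
 have "(u' + e) powr ((m - 1) / m) <= (u + e) powr ((m - 1) / m)" using u e m by (intro powr_mono2') (auto simp: divide_le_0_iff)
 then show ?thesis unfolding entropy_deriv_def using m by (intro mult_left_mono_neg) (auto simp: divide_le_0_iff)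
qed

lemma entropy_deriv_nonpos: "entropy_deriv m e u <= 0"
 unfolding entropy_deriv_def using m by (intro mult_nonpos_nonneg) (auto simp: divide_le_0_iff)

lemma entropy_deriv_abs_le: "0 <= u ==> \<bar>entropy_deriv m e u\<bar> <= \<bar>entropy_deriv m e 0\<bar>"
 using entropy_deriv_mono[of 0 u] entropy_deriv_nonpos[of u] entropy_deriv_nonpos[of 0] by simp

lemma entropy_deriv_continuous: "continuous_on {0..} (%x. entropy_deriv m e (x powr m))"
proof -
 have c: "continuous_on {0..} (%x::real. x powr m)" using m by (intro continuous_on_powr' continuous_intros) auto
 have "x powr m + e \<noteq> 0" for x :: real using e powr_ge_zero[of x m] by linarith
 then show ?thesis unfolding entropy_deriv_def by (intro continuous_intros c) auto
qed

lemma entropy_deriv_integrable: "0 <= a ==> (%x. entropy_deriv m e (x powr m)) integrable_on {a..b}"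
 by (rule integrable_continuous_real) (auto intro: continuous_on_subset[OF entropy_deriv_continuous])

lemma entropy_diff:
 assumes "0 <= s" "s <= s'"
 shows "entropy m e s' - entropy m e s = integral {s..s'} (%x. entropy_deriv m e (x powr m))" unfolding entropy_def
 using Henstock_Kurzweil_Integration.integral_combine[OF assms entropy_deriv_integrable] by simp

text \<open>The tangent is taken at \<open>s'\<close>, the end of the step, so that the change of
  the entropy is bounded from above by the derivative at the new state.\<close>

lemma entropy_convex:
 assumes "0 <= s" "0 <= s'"
 shows "entropy m e s' - entropy m e s <= entropy_deriv m e (s' powr m) * (s' - s)"
proof (cases "s <= s'")
 case True
 have "integral {s..s'} (%x. entropy_deriv m e (x powr m)) <= integral {s..s'} (%x. entropy_deriv m e (s' powr m))"
  using assms m True by (intro integral_le entropy_deriv_integrable entropy_deriv_mono powr_mono2) auto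
 then show ?thesis using entropy_diff[OF assms(1) True] True by (simp add: mult.commute)
next
 case False
 then have s: "s' <= s" by simp
 have "integral {s'..s} (%x. entropy_deriv m e (s' powr m)) <= integral {s'..s} (%x. entropy_deriv m e (x powr m))"
  using assms m s by (intro integral_le entropy_deriv_integrable entropy_deriv_mono powr_mono2) auto
 then show ?thesis using entropy_diff[OF assms(2) s] s by (simp add: algebra_simps)
qed

lemma entropy_lipschitz:
 assumes "0 <= s" "0 <= s'"
 shows "\<bar>entropy m e s' - entropy m e s\<bar> <= \<bar>entropy_deriv m e 0\<bar> * \<bar>s' - s\<bar>"
proof -
 have "entropy m e s' - entropy m e s <= \<bar>entropy_deriv m e 0\<bar> * \<bar>s' - s\<bar>" if "0 <= s" "0 <= s'" for s s'
 proof -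
  have "entropy m e s' - entropy m e s <= \<bar>entropy_deriv m e (s' powr m) * (s' - s)\<bar>" using entropy_convex[OF that] by simp
  also have "\<dots> <= \<bar>entropy_deriv m e 0\<bar> * \<bar>s' - s\<bar>"
   unfolding abs_mult by (intro mult_right_mono entropy_deriv_abs_le) auto
  finally show ?thesis .
 qed
 from this[OF assms] this[OF assms(2,1)] show ?thesis by (simp add: abs_le_iff abs_minus_commute)
qed

lemma entropy_0: "entropy m e 0 = 0" "s <= 0 ==> entropy m e s = 0"
proof -
 show *: "entropy m e 0 = 0" by (simp add: entropy_def)
 show "entropy m e s = 0" if "s <= 0" using that * by (cases "s = 0") (auto simp: entropy_def)
qed

lemma entropy_abs_le: "0 <= s ==> \<bar>entropy m e s\<bar> <= \<bar>entropy_deriv m e 0\<bar> * s"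
 using entropy_lipschitz[of 0 s] by (simp add: entropy_0)

lemma entropy_measurable: "entropy m e \<in> borel_measurable borel"
proof -
 have "entropy m e s = entropy m e (max 0 s)" for s using entropy_0 by (auto simp: max_def)
 moreover have "(%s. entropy m e (max 0 s)) \<in> borel_measurable borel"
 proof (rule borel_measurable_continuous_onI)
  have "\<bar>entropy_deriv m e 0\<bar>-lipschitz_on UNIV (%s. entropy m e (max 0 s))"
  proof (rule lipschitz_onI)
   fix x y :: real
   have "\<bar>entropy m e (max 0 x) - entropy m e (max 0 y)\<bar> <= \<bar>entropy_deriv m e 0\<bar> * \<bar>max 0 x - max 0 y\<bar>"
    by (rule entropy_lipschitz) auto
   also have "\<dots> <= \<bar>entropy_deriv m e 0\<bar> * \<bar>x - y\<bar>" by (intro mult_left_mono) auto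
   finally show "dist (entropy m e (max 0 x)) (entropy m e (max 0 y)) <= \<bar>entropy_deriv m e 0\<bar> * dist x y"
    by (simp add: dist_real_def)
  qed simp
  then show "continuous_on UNIV (%s. entropy m e (max 0 s))" using lipschitz_on_continuous_on by blast
 qed
 ultimately show ?thesis by simp
qed

text \<open>The regularised derivative lies above the singular one,
  \<open>m / (m - 1) * x powr (m - 1)\<close>, which is integrable at 0 because
  \<open>m > 0\<close>. The integral of the latter is \<open>- (s powr m / (1 - m))\<close>, and
  \<open>s powr m <= 1 + s\<close> because \<open>m < 1\<close>. The bound is uniform in
  \<open>e\<close>.\<close>

lemma entropy_lower_bound:
 assumes s: "0 <= s"
 shows "- ((1 + s) / (1 - m)) <= entropy m e s"
proof -
 have i: "((%x. m / (m - 1) * x powr (m - 1)) has_integral m / (m - 1) * (s powr (m - 1 + 1) / (m - 1 + 1))) {0..s}"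
  using m s by (intro has_integral_mult_right has_integral_powr_from_0) auto
 have i2: "((%x. entropy_deriv m e (x powr m)) has_integral entropy m e s) {0..s}"
  unfolding entropy_def using entropy_deriv_integrable[of 0 s] by (simp add: has_integral_integral)
 \<comment> \<open>The convention \<open>0 powr (m - 1) = 0\<close> would break the comparison at
   \<open>x = 0\<close>, so the integrand is altered at this single point.\<close>
 have i3: "((%x. if x = 0 then entropy_deriv m e 0 else m / (m - 1) * x powr (m - 1)) has_integral
   m / (m - 1) * (s powr (m - 1 + 1) / (m - 1 + 1))) {0..s}" by (rule has_integral_spike_finite[OF _ _ i, of "{0}"]) auto
 have "m / (m - 1) * (s powr (m - 1 + 1) / (m - 1 + 1)) <= entropy m e s"
 proof (rule has_integral_le[OF i3 i2])
  fix x assume x: "x \<in> {0..s}"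
  show "(if x = 0 then entropy_deriv m e 0 else m / (m - 1) * x powr (m - 1)) <= entropy_deriv m e (x powr m)"
  proof (cases "x = 0")
   case False
   then have x0: "0 < x" using x by simp
   have "(x powr m + e) powr ((m - 1) / m) <= (x powr m) powr ((m - 1) / m)" using x0 e m by (intro powr_mono2') (auto simp: divide_le_0_iff)
   also have "\<dots> = x powr (m - 1)" using m by (simp add: powr_powr)
   finally have "m / (m - 1) * x powr (m - 1) <= m / (m - 1) * (x powr m + e) powr ((m - 1) / m)"
    using m by (intro mult_left_mono_neg) (auto simp: divide_le_0_iff)
   then show ?thesis using False by (simp add: entropy_deriv_def)
  qed simp
 qed
 moreover have "m / (m - 1) * (s powr (m - 1 + 1) / (m - 1 + 1)) = - (s powr m / (1 - m))" using m by (simp add: field_simps)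
 moreover have "s powr m <= 1 + s"
 proof (cases "s <= 1")
  case True
  have "s powr m <= 1" using True s m by (intro powr_le1) auto
  then show ?thesis using s by simp
 next
  case False
  then have "s powr m <= s powr 1" using m by (intro powr_mono) auto
  then show ?thesis using False by simp
 qed
 then have "s powr m / (1 - m) <= (1 + s) / (1 - m)" using m by (intro divide_right_mono) auto
 ultimately show ?thesis by linarith
qed

end

text \<open>This monotonicity, together with the uniform lower bound, gives the regularised energies
  a limit as \<open>e\<close> tends to 0.\<close>

lemma entropy_mono_eps:
 assumes m: "0 < m" "m < 1" and e: "0 < e" "e <= e'"  and s: "0 <= s"
 shows "entropy m e s <= entropy m e' s" unfolding entropy_def
proof (rule integral_le)
 fix x assume "x \<in> {0..s}"
 have "(x powr m + e') powr ((m - 1) / m) <= (x powr m + e) powr ((m - 1) / m)"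
  using e m by (intro powr_mono2') (auto simp: divide_le_0_iff intro: add_nonneg_pos)
 then show "entropy_deriv m e (x powr m) <= entropy_deriv m e' (x powr m)"
  unfolding entropy_deriv_def using m by (intro mult_left_mono_neg) (auto simp: divide_le_0_iff)
qed (use assms in \<open>auto intro!: entropy_deriv_integrable\<close>)

text \<open>Here \<open>s\<close> is the density and \<open>(s powr m + e) powr (1 / m)\<close> its
  regularisation. The mean value theorem for the power \<open>1 / m\<close>, which exceeds 1, bounds
  the excess by \<open>e\<close> times a constant that depends only on \<open>m\<close> and the
  upper bound \<open>N\<close>.\<close>

lemma add_powr_diff_le:
 fixes m e N s :: real
 assumes m: "0 < m" "m < 1" and e: "0 < e" "e <= 1" and s: "0 <= s" "s <= N"
 shows "s <= (s powr m + e) powr (1 / m)" "(s powr m + e) powr (1 / m) - s <= e * (1 / m * (N powr m + 1) powr (1 / m - 1))"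
proof -
 have id: "(s powr m) powr (1 / m) = s" using m s by (simp add: powr_powr)
 show "s <= (s powr m + e) powr (1 / m)" using powr_mono2[of "1 / m" "s powr m" "s powr m + e"] e m unfolding id by simp
 have "\<bar>(s powr m + e) powr (1 / m) - (s powr m) powr (1 / m)\<bar> <= (1 / m * (N powr m + 1) powr (1 / m - 1)) * \<bar>(s powr m + e) - s powr m\<bar>"
 proof -
  have "norm ((s powr m + e) powr (1 / m) - (s powr m) powr (1 / m)) <= (1 / m * (N powr m + 1) powr (1 / m - 1)) * norm ((s powr m + e) - s powr m)"
  \<comment> \<open>The derivative rule for powers requires a positive base; at \<open>s = 0\<close>
    the excess \<open>e powr (1 / m)\<close> is estimated directly.\<close>
  proof (cases "s = 0")
   case True
   have "e powr (1 / m) = e * e powr (1 / m - 1)" using e by (simp add: powr_diff)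
   also have "\<dots> <= e * (1 / m * (N powr m + 1) powr (1 / m - 1))"
   proof (rule mult_left_mono)
    have "e powr (1 / m - 1) <= 1 * (N powr m + 1) powr (1 / m - 1)" using e m by (simp add: powr_mono2 add_increasing)
    also have "\<dots> <= 1 / m * (N powr m + 1) powr (1 / m - 1)" using m by (intro mult_right_mono) auto
    finally show "e powr (1 / m - 1) <= 1 / m * (N powr m + 1) powr (1 / m - 1)" .
   qed (use e in simp)
   finally show ?thesis using True e by (simp add: mult.commute)
  next
   case False
   then have s0: "0 < s powr m" using s by simp
   show ?thesis
   proof (rule field_differentiable_bound[of "{s powr m..s powr m + e}" "%u. u powr (1 / m)" "%u. 1 / m * u powr (1 / m - 1)"])
    fix u assume u: "u \<in> {s powr m..s powr m + e}"
    then have u0: "0 < u" using s0 unfolding atLeastAtMost_iff by linarith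
    show "((%u. u powr (1 / m)) has_field_derivative 1 / m * u powr (1 / m - 1)) (at u within {s powr m..s powr m + e})"
     by (rule has_field_derivative_at_within[OF has_real_derivative_powr[OF u0]])
    have "s powr m <= N powr m" using s m by (intro powr_mono2) auto
    then have "u powr (1 / m - 1) <= (N powr m + 1) powr (1 / m - 1)" using u u0 e m by (intro powr_mono2) auto
    then show "norm (1 / m * u powr (1 / m - 1)) <= 1 / m * (N powr m + 1) powr (1 / m - 1)" using m by (simp add: divide_right_mono)
   qed (use e in auto)
  qed
  then show ?thesis by simp
 qed
 then show "(s powr m + e) powr (1 / m) - s <= e * (1 / m * (N powr m + 1) powr (1 / m - 1))" unfolding id using e by (simp add: mult.commute)
qed

text \<open>With \<open>a = 1 / \<rho>\<^sub>\<epsilon>\<close> this is the completion of the square behind the dissipation estimate; no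
 information on the gradient on the set \<open>q = 0\<close> is needed.\<close>

lemma dissipation_pointwise:
 fixes G A :: "'a::real_inner"
 assumes a: "0 < a" and q: "0 <= q" "q <= 1 / a"
 shows "1 / 2 * (a * (norm (G + q *\<^sub>R A))\<^sup>2) - 1 / 2 * (1 / a - q) * (norm A)\<^sup>2 <= (G + q *\<^sub>R A) \<bullet> (a *\<^sub>R G + A)"
proof -
 \<comment> \<open>\<theta> is the ratio of the mobility to its regularisation; where it equals 1,
   the pairing is exactly \<open>a * (norm J)\<^sup>2\<close>.\<close>
 define J \<theta> where "J = G + q *\<^sub>R A" and "\<theta> = a * q"
 have th: "0 <= \<theta>" "\<theta> <= 1" using a q by (auto simp: \<theta>_def field_simps)
 have "a *\<^sub>R G + A = a *\<^sub>R J + (1 - \<theta>) *\<^sub>R A" by (simp add: J_def \<theta>_def algebra_simps)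
 then have eq: "J \<bullet> (a *\<^sub>R G + A) = a * (norm J)\<^sup>2 + (1 - \<theta>) * (J \<bullet> A)"
  by (simp add: inner_add_right power2_norm_eq_inner)
 \<comment> \<open>Expanding this square bounds the mixed term from below;
   \<open>(1 - \<theta>)\<^sup>2 <= 1 - \<theta>\<close> then produces the factor
   \<open>1 / a - q\<close>.\<close>
 have "0 <= (norm (a *\<^sub>R J + (1 - \<theta>) *\<^sub>R A))\<^sup>2" by simp
 also have "\<dots> = a * (a * (norm J)\<^sup>2 + 2 * ((1 - \<theta>) * (J \<bullet> A))) + (1 - \<theta>)\<^sup>2 * (norm A)\<^sup>2"
  unfolding power2_norm_eq_inner by (simp add: inner_add_left inner_add_right inner_commute power2_eq_square algebra_simps)
 also have "\<dots> <= a * (a * (norm J)\<^sup>2 + 2 * ((1 - \<theta>) * (J \<bullet> A))) + (1 - \<theta>) * (norm A)\<^sup>2"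
  using th by (intro add_left_mono mult_right_mono) (auto simp: power2_eq_square mult_left_le)
 also have "(1 - \<theta>) * (norm A)\<^sup>2 = a * ((1 / a - q) * (norm A)\<^sup>2)" using a by (simp add: \<theta>_def field_simps)
 finally have "0 <= a * (a * (norm J)\<^sup>2 + 2 * ((1 - \<theta>) * (J \<bullet> A)) + (1 / a - q) * (norm A)\<^sup>2)"
  by (simp add: distrib_left)
 then have "0 <= a * (norm J)\<^sup>2 + 2 * ((1 - \<theta>) * (J \<bullet> A)) + (1 / a - q) * (norm A)\<^sup>2"
  using a by (simp add: zero_le_mult_iff)
 moreover have "1 / 2 * (1 / a - q) * (norm A)\<^sup>2 = 1 / 2 * ((1 / a - q) * (norm A)\<^sup>2)" by simp
 ultimately show ?thesis unfolding J_def[symmetric] eq by linarith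
qed

section \<open>Interaction potential and free energy\<close>

definition potential :: "('a::euclidean_space \<times> 'a => real) => ('a => real) => 'a => real" where
 "potential K f x = (LBINT y. K (x, y) * f y)"

definition free_energy ::
  "real => ('a::euclidean_space => real) => ('a \<times> 'a => real) => real => ('a => real) => real" where
 "free_energy m V K e f = (LBINT x. entropy m e (f x) + V x * f x + 1 / 2 * (f x * potential K f x))"

lemma section_measurable:
 fixes f :: "'a::euclidean_space \<times> 'b::euclidean_space => 'c::{second_countable_topology, real_normed_vector}"
 assumes "f \<in> borel_measurable borel"
 shows "(%y. f (x, y)) \<in> borel_measurable borel" "(%x. f (x, y)) \<in> borel_measurable borel"
  "f \<in> borel_measurable (lborel \<Otimes>\<^sub>M lborel)" "(%(y, x). f (x, y)) \<in> borel_measurable (lborel \<Otimes>\<^sub>M lborel)"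
proof -
 show *: "f \<in> borel_measurable (lborel \<Otimes>\<^sub>M lborel)" unfolding lborel_prod using assms by (simp only: measurable_lborel2)
 then show "(%(y, x). f (x, y)) \<in> borel_measurable (lborel \<Otimes>\<^sub>M lborel)" by measurable
 show "(%y. f (x, y)) \<in> borel_measurable borel" using measurable_Pair2[OF *, of x] by simp
 show "(%x. f (x, y)) \<in> borel_measurable borel" using measurable_Pair1[OF *, of y] by simp
qed

lemma integrable_mult_bounded:
 fixes f g :: "'a::euclidean_space => real"
 assumes f: "integrable lborel f" and g: "g \<in> borel_measurable borel" "!!x. \<bar>g x\<bar> <= D"
 shows "integrable lborel (%x. f x * g x)" "\<bar>LBINT x. f x * g x\<bar> <= D * (LBINT x. \<bar>f x\<bar>)"
proof -
 have le: "norm (f x * g x) <= D * \<bar>f x\<bar>" for x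
  using mult_right_mono[OF g(2)[of x], of "\<bar>f x\<bar>"] by (simp add: abs_mult mult.commute)
 have iD: "integrable lborel (%x. D * \<bar>f x\<bar>)" using f by simp
 show i: "integrable lborel (%x. f x * g x)"
 proof (rule bochner_bound[OF iD])
  show "(%x. f x * g x) \<in> borel_measurable lborel" using f g(1) by measurable
 qed (intro AE_I2 order_trans[OF le], simp)
 show "\<bar>LBINT x. f x * g x\<bar> <= D * (LBINT x. \<bar>f x\<bar>)"
  using Bochner_Integration.integral_norm_bound_integral[OF i iD le] by simp
qed

context
 fixes V :: "'a::euclidean_space => real" and K :: "'a \<times> 'a => real" and m e C R :: real
 assumes m: "0 < m" "m < 1" and e: "0 < e"
  and V: "V \<in> borel_measurable borel" "!!x. 0 <= V x" "!!x. V x <= C"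
  and K: "K \<in> borel_measurable borel" "!!z. 0 <= K z" "!!z. K z <= C" "!!x y. K (x, y) = K (y, x)"
begin

private lemma C0: "0 <= C" using V(2,3)[of 0] by linarith

lemma potential_integrand:
 assumes f: "integrable lborel f"
 shows "integrable lborel (%y. K (x, y) * f y)"
proof (rule bochner_bound[of lborel "%y. C * norm (f y)"])
 note [measurable] = section_measurable(1)[OF K(1)]
 show "(%y. K (x, y) * f y) \<in> borel_measurable lborel" using f by measurable
 show "AE y in lborel. norm (K (x, y) * f y) <= norm (C * norm (f y))"
  using K(2,3) C0 by (intro AE_I2) (auto simp: abs_mult intro!: mult_right_mono)
qed (use f in auto)

lemma potential_abs_le:
 assumes f: "integrable lborel f"
 shows "\<bar>potential K f x\<bar> <= C * (LBINT y. \<bar>f y\<bar>)"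
proof -
 have "norm (potential K f x) <= (LBINT y. C * \<bar>f y\<bar>)" unfolding potential_def
 proof (rule Bochner_Integration.integral_norm_bound_integral[OF potential_integrand[OF f]])
  show "norm (K (x, y) * f y) <= C * \<bar>f y\<bar>" for y using K(2,3)[of "(x, y)"] by (simp add: abs_mult mult_right_mono)
 qed (use f in auto)
 then show ?thesis by simp
qed

lemma potential_measurable:
 assumes f: "integrable lborel f"
 shows "potential K f \<in> borel_measurable borel"
proof -
 note [measurable] = section_measurable(3)[OF K(1)]
 have [measurable]: "f \<in> borel_measurable borel" using f by auto
 have "(%x. LBINT y. K (x, y) * f y) \<in> borel_measurable lborel" by (rule lborel.borel_measurable_lebesgue_integral) measurable
 then show ?thesis unfolding potential_def[abs_def] by simp
qed

lemma potential_nonneg: "(!!y. 0 <= f y) ==> 0 <= potential K f x"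
 unfolding potential_def using K(2) by (intro Bochner_Integration.integral_nonneg) simp

lemma potential_linear:
 assumes "integrable lborel f" "integrable lborel g"
 shows "potential K (%y. a * f y + b * g y) x = a * potential K f x + b * potential K g x"
proof -
 have "potential K (%y. a * f y + b * g y) x = (LBINT y. a * (K (x, y) * f y) + b * (K (x, y) * g y))"
  unfolding potential_def by (intro bochner_cong) (auto simp: algebra_simps)
 also have "\<dots> = a * potential K f x + b * potential K g x"
  unfolding potential_def using potential_integrand[OF assms(1)] potential_integrand[OF assms(2)] by simp
 finally show ?thesis .
qed

lemma potential_symmetric:
 assumes f: "integrable lborel f" and g: "integrable lborel g"
 shows "(LBINT x. f x * potential K g x) = (LBINT x. g x * potential K f x)"
proof -
 note [measurable] = section_measurable(3)[OF K(1)]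
 have [measurable]: "f \<in> borel_measurable borel" "g \<in> borel_measurable borel" using f g by auto
 have i: "integrable (lborel \<Otimes>\<^sub>M lborel) (%(x, y). f x * (K (x, y) * g y))"
 proof (rule integrableI_bounded)
  have "(\<integral>\<^sup>+z. ennreal (norm (case z of (x, y) => f x * (K (x, y) * g y))) \<partial>(lborel \<Otimes>\<^sub>M lborel))
    <= (\<integral>\<^sup>+z. ennreal (C * \<bar>f (fst z)\<bar>) * ennreal \<bar>g (snd z)\<bar> \<partial>(lborel \<Otimes>\<^sub>M lborel))"
  proof (rule nn_integral_mono)
   fix z :: "'a \<times> 'a"
   have "\<bar>f (fst z)\<bar> * (K z * \<bar>g (snd z)\<bar>) <= \<bar>f (fst z)\<bar> * (C * \<bar>g (snd z)\<bar>)"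
    using K(3) by (intro mult_left_mono mult_right_mono) auto
   then have "norm (case z of (x, y) => f x * (K (x, y) * g y)) <= C * \<bar>f (fst z)\<bar> * \<bar>g (snd z)\<bar>"
    using K(2)[of z] by (simp add: case_prod_beta' abs_mult mult_ac)
   then show "ennreal (norm (case z of (x, y) => f x * (K (x, y) * g y))) <= ennreal (C * \<bar>f (fst z)\<bar>) * ennreal \<bar>g (snd z)\<bar>"
    using C0 by (subst ennreal_mult[symmetric]) (auto intro: ennreal_leI)
  qed
  also have "\<dots> = (LBNN x. (LBNN y. ennreal (C * \<bar>f x\<bar>) * ennreal \<bar>g y\<bar>))"
   by (subst lborel.nn_integral_fst[symmetric]) auto
  also have "\<dots> = (LBNN x. ennreal (C * \<bar>f x\<bar>)) * (LBNN y. ennreal \<bar>g y\<bar>)"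
   by (simp add: nn_integral_cmult nn_integral_multc)
  also have "\<dots> = ennreal (C * (LBINT x. \<bar>f x\<bar>)) * ennreal (LBINT y. \<bar>g y\<bar>)"
   using f g C0 by (subst (1 2) nn_integral_eq_integral) auto
  also have "\<dots> < \<infinity>" by (simp add: ennreal_mult_less_top)
  finally show "(\<integral>\<^sup>+z. ennreal (norm (case z of (x, y) => f x * (K (x, y) * g y))) \<partial>(lborel \<Otimes>\<^sub>M lborel)) < \<infinity>" .
 qed measurable
 have "(LBINT x. f x * potential K g x) = (LBINT x. (LBINT y. f x * (K (x, y) * g y)))" unfolding potential_def by simp
 also have "\<dots> = (LBINT y. (LBINT x. f x * (K (x, y) * g y)))" by (rule lborel_pair.Fubini_integral[OF i, symmetric])
 also have "\<dots> = (LBINT y. g y * potential K f y)" unfolding potential_def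
  by (subst integral_mult_right_zero[symmetric]) (simp add: K(4) mult_ac)
 finally show ?thesis .
qed

lemma free_energy_integrable:
 assumes f: "integrable lborel f" "!!x. 0 <= f x"
 shows "integrable lborel (%x. entropy m e (f x))" "integrable lborel (%x. V x * f x)"
  "integrable lborel (%x. f x * potential K f x)"
proof -
 have fm[measurable]: "f \<in> borel_measurable borel" using f by auto
 show "integrable lborel (%x. entropy m e (f x))"
 proof (rule bochner_bound[of lborel "%x. \<bar>entropy_deriv m e 0\<bar> * f x"])
  show "(%x. entropy m e (f x)) \<in> borel_measurable lborel" using measurable_compose[OF fm entropy_measurable[OF m e]] by simp
  show "AE x in lborel. norm (entropy m e (f x)) <= norm (\<bar>entropy_deriv m e 0\<bar> * f x)"
   using entropy_abs_le[OF m e f(2)] f(2) by (intro AE_I2) (simp add: abs_mult)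
 qed (use f in auto)
 show "integrable lborel (%x. V x * f x)" using integrable_mult_bounded(1)[OF f(1) V(1), of C] V(2,3) by (simp add: mult.commute)
 show "integrable lborel (%x. f x * potential K f x)"
  by (rule integrable_mult_bounded(1)[OF f(1) potential_measurable[OF f(1)] potential_abs_le[OF f(1)]])
qed

text \<open>Polarisation: for a symmetric kernel the difference of the quadratic parts is exactly
  the pairing of \<open>g - f\<close> with the potential of the mean of \<open>f\<close> and
  \<open>g\<close>.\<close>

lemma free_energy_diff:
 assumes f: "integrable lborel f" "!!x. 0 <= f x" and g: "integrable lborel g" "!!x. 0 <= g x"
 shows "free_energy m V K e g - free_energy m V K e f = (LBINT x. entropy m e (g x) - entropy m e (f x)) + (LBINT x. V x * (g x - f x))
   + (LBINT x. (g x - f x) * potential K (%y. (f y + g y) / 2) x)"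
proof -
 note fi = free_energy_integrable[OF f] and gi = free_energy_integrable[OF g]
 note fp = integrable_mult_bounded(1)[OF f(1) potential_measurable[OF g(1)] potential_abs_le[OF g(1)]]
 note gp = integrable_mult_bounded(1)[OF g(1) potential_measurable[OF f(1)] potential_abs_le[OF f(1)]]
 have E: "free_energy m V K e h = (LBINT x. entropy m e (h x)) + (LBINT x. V x * h x)
   + 1 / 2 * (LBINT x. h x * potential K h x)" if "integrable lborel h" "!!x. 0 <= h x" for h
  unfolding free_energy_def using free_energy_integrable[OF that] by simp
 have "(g x - f x) * potential K (%y. (f y + g y) / 2) x =
   1 / 2 * (g x * potential K g x) - 1 / 2 * (f x * potential K f x) + 1 / 2 * (g x * potential K f x) - 1 / 2 * (f x * potential K g x)" for x
 proof -
  have eq: "potential K (%y. (f y + g y) / 2) x = (potential K f x + potential K g x) / 2"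
   using potential_linear[OF f(1) g(1), of "1 / 2" "1 / 2" x] by (simp add: add_divide_distrib)
  show ?thesis unfolding eq by (simp add: field_simps)
 qed
 then have "(LBINT x. (g x - f x) * potential K (%y. (f y + g y) / 2) x) =
   1 / 2 * (LBINT x. g x * potential K g x) - 1 / 2 * (LBINT x. f x * potential K f x)" using fi gi fp gp potential_symmetric[OF f(1) g(1)] by simp
 moreover have "(LBINT x. entropy m e (g x) - entropy m e (f x)) = (LBINT x. entropy m e (g x)) - (LBINT x. entropy m e (f x))" using fi gi by simp
 moreover have "(LBINT x. V x * (g x - f x)) = (LBINT x. V x * g x) - (LBINT x. V x * f x)" using fi gi by (simp add: right_diff_distrib)
 ultimately show ?thesis using E[OF f] E[OF g] by simp
qed

text \<open>Only the entropy is estimated, by its tangent inequality at \<open>g\<close>; the two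
  potential terms are exact.\<close>

lemma free_energy_convex:
 assumes f: "integrable lborel f" "!!x. 0 <= f x" and g: "integrable lborel g" "!!x. 0 <= g x"
 shows "free_energy m V K e g - free_energy m V K e f <= (LBINT x. (g x - f x) * entropy_deriv m e (g x powr m)) + (LBINT x. V x * (g x - f x))
   + (LBINT x. (g x - f x) * potential K (%y. (f y + g y) / 2) x)"
proof -
 have [measurable]: "f \<in> borel_measurable borel" "g \<in> borel_measurable borel" using f g by auto
 have "(LBINT x. entropy m e (g x) - entropy m e (f x)) <= (LBINT x. (g x - f x) * entropy_deriv m e (g x powr m))"
 proof (rule integral_mono)
  show "integrable lborel (%x. entropy m e (g x) - entropy m e (f x))"
   using free_energy_integrable(1)[OF f] free_energy_integrable(1)[OF g] by simp
  show "integrable lborel (%x. (g x - f x) * entropy_deriv m e (g x powr m))"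
  proof (rule integrable_mult_bounded(1))
   show "(%x. entropy_deriv m e (g x powr m)) \<in> borel_measurable borel" unfolding entropy_deriv_def by measurable
   show "\<bar>entropy_deriv m e (g x powr m)\<bar> <= \<bar>entropy_deriv m e 0\<bar>" for x by (rule entropy_deriv_abs_le[OF m e]) simp
  qed (use f g in auto)
  show "entropy m e (g x) - entropy m e (f x) <= (g x - f x) * entropy_deriv m e (g x powr m)" for x
   using entropy_convex[OF m e f(2) g(2), of x x] by (simp add: mult.commute)
 qed
 then show ?thesis using free_energy_diff[OF f g] by simp
qed

text \<open>The constant degenerates as \<open>e\<close> tends to 0, which is harmless: it serves
  for the continuity of the energy in time at fixed \<open>e\<close>.\<close>

lemma free_energy_lipschitz:
 assumes f: "integrable lborel f" "!!x. 0 <= f x" and g: "integrable lborel g" "!!x. 0 <= g x"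
  and M: "(LBINT x. f x) <= M" "(LBINT x. g x) <= M"
 shows "\<bar>free_energy m V K e g - free_energy m V K e f\<bar> <= (\<bar>entropy_deriv m e 0\<bar> + C + C * M) * (LBINT x. \<bar>g x - f x\<bar>)"
proof -
 have d: "integrable lborel (%x. g x - f x)" using f g by simp
 have h: "integrable lborel (%x. (f x + g x) / 2)" using f g by simp
 have "\<bar>LBINT x. entropy m e (g x) - entropy m e (f x)\<bar> <= (LBINT x. \<bar>entropy_deriv m e 0\<bar> * \<bar>g x - f x\<bar>)"
  using free_energy_integrable(1)[OF f] free_energy_integrable(1)[OF g] d entropy_lipschitz[OF m e f(2) g(2)]
  by (intro Bochner_Integration.integral_norm_bound_integral[of lborel "%x. entropy m e (g x) - entropy m e (f x)", simplified real_norm_def]) auto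
 moreover have "\<bar>LBINT x. V x * (g x - f x)\<bar> <= C * (LBINT x. \<bar>g x - f x\<bar>)"
  using integrable_mult_bounded(2)[OF d V(1), of C] V(2,3) by (simp add: mult.commute)
 moreover have "\<bar>LBINT x. (g x - f x) * potential K (%y. (f y + g y) / 2) x\<bar> <= C * M * (LBINT x. \<bar>g x - f x\<bar>)"
 proof -
  have "(LBINT x. \<bar>(f x + g x) / 2\<bar>) = ((LBINT x. f x) + (LBINT x. g x)) / 2" using f g by (simp add: add_nonneg_nonneg)
  then have "C * (LBINT x. \<bar>(f x + g x) / 2\<bar>) <= C * M" using M C0 by (intro mult_left_mono) auto
  then have "\<bar>potential K (%y. (f y + g y) / 2) x\<bar> <= C * M" for x using potential_abs_le[OF h, of x] by linarith
  then show ?thesis by (rule integrable_mult_bounded(2)[OF d potential_measurable[OF h]])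
 qed
 ultimately show ?thesis unfolding free_energy_diff[OF f g] by (simp add: distrib_right abs_le_iff)
qed

lemma free_energy_lower_bound:
 assumes f: "integrable lborel f" "!!x. 0 <= f x" "!!x. x \<notin> ball 0 R ==> f x = 0"
 shows "- ((measure lborel (ball (0::'a) R) + (LBINT x. f x)) / (1 - m)) <= free_energy m V K e f"
proof -
 have ib: "integrable lborel (indicator (ball (0::'a) R) :: 'a => real)" by (rule integrable_indicator_bounded) auto
 note fi = free_energy_integrable[OF f(1,2)]
 have "- ((measure lborel (ball (0::'a) R) + (LBINT x. f x)) / (1 - m))
   = (LBINT x. - ((indicator (ball 0 R) x + f x) / (1 - m)))" using ib f(1) by simp
 also have "\<dots> <= (LBINT x. entropy m e (f x) + V x * f x + 1 / 2 * (f x * potential K f x))"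
 proof (rule integral_mono)
  show "integrable lborel (%x. - ((indicator (ball 0 R) x + f x) / (1 - m)))" using ib f(1) by simp
  show "integrable lborel (%x. entropy m e (f x) + V x * f x + 1 / 2 * (f x * potential K f x))" using fi by simp
  fix x
  have "- ((indicator (ball 0 R) x + f x) / (1 - m)) <= entropy m e (f x)"
  proof (cases "x \<in> ball 0 R")
   case True
   then show ?thesis using entropy_lower_bound[OF m e f(2), of x] by simp
  next
   case False
   then show ?thesis using f(3) entropy_0(1)[OF m e] by simp
  qed
  moreover have "0 <= V x * f x" "0 <= f x * potential K f x" using V(2) f(2) potential_nonneg by auto
  ultimately show "- ((indicator (ball 0 R) x + f x) / (1 - m)) <= entropy m e (f x) + V x * f x + 1 / 2 * (f x * potential K f x)" by simp
 qed
 finally show ?thesis unfolding free_energy_def .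
qed

end

lemma free_energy_mono_eps:
 fixes V :: "'a::euclidean_space => real"
 assumes m: "0 < m" "m < 1" and e: "0 < e" "e <= e'"
  and V: "V \<in> borel_measurable borel" "!!x. 0 <= V x" "!!x. V x <= C"
  and K: "K \<in> borel_measurable borel" "!!z. 0 <= K z" "!!z. K z <= C" "!!x y. K (x, y) = K (y, x)"
  and f: "integrable lborel f" "!!x. 0 <= f x"
 shows "free_energy m V K e f <= free_energy m V K e' f"
proof -
 have e': "0 < e'" using e by simp
 show ?thesis unfolding free_energy_def
  using free_energy_integrable[OF m e(1) V K f] free_energy_integrable[OF m e' V K f] entropy_mono_eps[OF m e f(2)] by (intro integral_mono) auto
qed

section \<open>The flow and its energy dissipation\<close>

definition drift_K :: "(real \<times> 'a::euclidean_space => real) => ('a \<times> 'a => 'a) => real \<times> 'a => 'a" where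
 "drift_K q k z = (LBINT y. q (fst z, y) *\<^sub>R k (snd z, y))"

text \<open>With this sign the time derivative of the density is the divergence of the flux.\<close>

definition flux ::
  "(real \<times> 'a::euclidean_space => real) => (real \<times> 'a => 'a) => ('a => 'a) => ('a \<times> 'a => 'a) => real \<times> 'a => 'a" where
 "flux q G gV k z = G z + q z *\<^sub>R (gV (snd z) + drift_K q k z)"

text \<open>The strong solution on the time interval \<open>[0, T]\<close> in terms of Borel representatives: \<open>r t\<close> is
 the density at time \<open>t\<close>, \<open>q\<close> the density as a function of time and space, \<open>G\<close> the gradient of
 \<open>q powr m\<close>, and \<open>gV\<close>, \<open>k\<close> the gradients of the potentials.\<close>

locale flow_data =
 fixes m R T N C :: real
  and r :: "real => 'a::euclidean_space => real"
  and q :: "real \<times> 'a => real" and G :: "real \<times> 'a => 'a"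
  and V :: "'a => real" and gV :: "'a => 'a" and K :: "'a \<times> 'a => real" and k :: "'a \<times> 'a => 'a"
 assumes m: "0 < m" "m < 1" and R: "0 < R"
  and r_int: "!!t. 0 <= t ==> t <= T ==> integrable lborel (r t)"
  and r_nonneg: "!!t x. 0 <= r t x" and r_zero: "!!t x. x \<notin> ball 0 R ==> r t x = 0"
  and r_cont: "!!s. s \<in> {0..T} ==> ((%t. LBINT x. \<bar>r t x - r s x\<bar>) \<longlongrightarrow> 0) (at s within {0..T})"
  and q_meas: "q \<in> borel_measurable borel" and q_nonneg: "!!z. 0 <= q z" and q_le: "!!z. q z <= N"
  and q_zero: "!!z. z \<notin> {0<..<T} \<times> ball 0 R ==> q z = 0"
  and q_r: "AE t in lborel. t \<in> {0<..<T} --> (AE x in lborel. q (t, x) = r t x)"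
  and G_sq: "square_integrable G" and G_zero: "!!z. z \<notin> {0<..<T} \<times> ball 0 R ==> G z = 0"
  and G_weak: "AE t in lborel. t \<in> {0<..<T} --> has_weak_grad (ball 0 R) (%x. q (t, x) powr m) (%x. G (t, x))"
  and V: "V \<in> borel_measurable borel" "!!x. 0 <= V x" "!!x. V x <= C" "!!x. x \<notin> ball 0 R ==> V x = 0"
  and gV: "gV \<in> borel_measurable borel" "!!x. norm (gV x) <= C" "!!x. x \<notin> ball 0 R ==> gV x = 0"
  and V_weak: "has_weak_grad (ball 0 R) V gV"
  and K: "K \<in> borel_measurable borel" "!!z. 0 <= K z" "!!z. K z <= C" "!!x y. K (x, y) = K (y, x)"
  and K_zero: "!!x y. x \<notin> ball 0 R ==> K (x, y) = 0"
  and k: "k \<in> borel_measurable borel" "!!z. norm (k z) <= C" "!!x y. x \<notin> ball 0 R ==> k (x, y) = 0"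
  and K_weak: "!!f. integrable lborel f ==> (!!x. x \<notin> ball 0 R ==> f x = 0) ==>
    has_weak_grad (ball 0 R) (potential K f) (%x. LBINT y. f y *\<^sub>R k (x, y))"
begin

abbreviation "J \<equiv> flux q G gV k"
abbreviation "W \<equiv> drift_K q k"

text \<open>The drift, cut off to the space-time cylinder so that it is square integrable over the
  whole space. Since \<open>q\<close> vanishes outside the cylinder, the flux is still
  \<open>G z + q z *\<^sub>R A z\<close>.\<close>

definition A :: "real \<times> 'a => 'a" where
 "A z = indicator ({0<..<T} \<times> ball 0 R) z *\<^sub>R (gV (snd z) + W z)"

text \<open>Formally the spatial gradient of \<open>entropy_deriv m e (q z powr m)\<close>, by the
  chain rule.\<close>

definition P :: "real => real \<times> 'a => 'a" where
 "P e z = (q z powr m + e) powr (- 1 / m) *\<^sub>R G z"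

lemma cyl_borel [measurable]: "{0<..<T} \<times> ball (0::'a) R \<in> sets borel" by (intro borel_open open_Times) auto

lemma cyl_bounded: "bounded ({0<..<T} \<times> ball (0::'a) R)" by (intro bounded_Times) auto

lemma N_nonneg: "0 <= N" using q_nonneg[of 0] q_le[of 0] by linarith

lemma fst_snd_borel: "fst \<in> borel_measurable (borel :: (real \<times> 'a) measure)"
 "snd \<in> borel_measurable (borel :: (real \<times> 'a) measure)" by (intro borel_measurable_continuous_onI continuous_intros)+

lemma W_integrand: "integrable lborel (%y. q (t, y) *\<^sub>R k (x, y))"
proof (rule square_integrable_imp_integrable[where S = "ball 0 R"])
 show "square_integrable (%y. q (t, y) *\<^sub>R k (x, y))"
 proof (rule square_integrable_bounded[where S = "ball 0 R" and C = "N * C"])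
  show "(%y. q (t, y) *\<^sub>R k (x, y)) \<in> borel_measurable borel"
   using section_measurable(1)[OF q_meas] section_measurable(1)[OF k(1)] by (intro borel_measurable_scaleR)
  show "norm (q (t, y) *\<^sub>R k (x, y)) <= N * C" for y
   using q_nonneg[of "(t, y)"] q_le[of "(t, y)"] k(2)[of "(x, y)"] N_nonneg by (auto intro: mult_mono)
 qed (auto simp: q_zero)
qed (auto simp: q_zero)

lemma W_meas: "W \<in> borel_measurable borel"
proof -
 have 1: "(%w. (fst (fst w), snd w)) \<in> (lborel :: (real \<times> 'a) measure) \<Otimes>\<^sub>M lborel \<rightarrow>\<^sub>M (borel :: (real \<times> 'a) measure)"
  by (intro borel_measurable_Pair measurable_compose[OF measurable_fst] ; simp add: fst_snd_borel)
 have 2: "(%w. (snd (fst w), snd w)) \<in> (lborel :: (real \<times> 'a) measure) \<Otimes>\<^sub>M lborel \<rightarrow>\<^sub>M (borel :: ('a \<times> 'a) measure)"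
  by (intro borel_measurable_Pair measurable_compose[OF measurable_fst] ; simp add: fst_snd_borel)
 have "(%z. LBINT y. q (fst z, y) *\<^sub>R k (snd z, y)) \<in> borel_measurable (lborel :: (real \<times> 'a) measure)"
 proof (rule lborel.borel_measurable_lebesgue_integral)
  show "(%(z, y). q (fst z, y) *\<^sub>R k (snd z, y)) \<in> borel_measurable ((lborel :: (real \<times> 'a) measure) \<Otimes>\<^sub>M lborel)"
   using measurable_compose[OF 1 q_meas] measurable_compose[OF 2 k(1)] unfolding case_prod_beta' by (intro borel_measurable_scaleR)
 qed
 then show ?thesis by (simp add: drift_K_def[abs_def])
qed

lemma W_le: "norm (W z) <= N * C * measure lborel (ball (0::'a) R)"
proof -
 have ib: "integrable lborel (indicator (ball (0::'a) R) :: 'a => real)" by (rule integrable_indicator_bounded) auto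
 have "norm (W z) <= (LBINT y. (N * C) * indicator (ball (0::'a) R) y)" unfolding drift_K_def
 proof (rule Bochner_Integration.integral_norm_bound_integral[OF W_integrand])
  show "norm (q (fst z, y) *\<^sub>R k (snd z, y)) <= (N * C) * indicator (ball (0::'a) R) y" for y
  proof (cases "y \<in> ball 0 R")
   case True
   then show ?thesis using q_nonneg[of "(fst z, y)"] q_le[of "(fst z, y)"] k(2)[of "(snd z, y)"] N_nonneg by (auto intro: mult_mono)
  qed (simp add: q_zero)
 qed (intro integrable_mult_right ib)
 then show ?thesis by simp
qed

lemma A_sq: "square_integrable A"
proof (rule square_integrable_bounded[where S = "{0<..<T} \<times> ball (0::'a) R" and C = "C + N * C * measure lborel (ball (0::'a) R)"])
 have 1: "(%z. gV (snd z)) \<in> borel_measurable (borel :: (real \<times> 'a) measure)"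
  by (rule measurable_compose[OF fst_snd_borel(2) gV(1)])
 show "A \<in> borel_measurable borel" unfolding A_def[abs_def] using 1 W_meas
  by (intro borel_measurable_scaleR borel_measurable_add borel_measurable_indicator cyl_borel)
 show "norm (A z) <= C + N * C * measure lborel (ball (0::'a) R)" for z
 proof -
  have le: "norm (gV (snd z) + W z) <= C + N * C * measure lborel (ball (0::'a) R)" by (intro norm_triangle_mono gV W_le)
  show ?thesis
  proof (cases "z \<in> {0<..<T} \<times> ball 0 R")
   case True
   then show ?thesis using le by (simp add: A_def)
  next
   case False
   then have "A z = 0" by (simp add: A_def)
   then show ?thesis using order_trans[OF norm_ge_zero le] by simp
  qed
 qed
qed (auto simp: A_def cyl_bounded)

lemma J_eq: "J z = G z + q z *\<^sub>R A z" using q_zero[of z] by (cases "z \<in> {0<..<T} \<times> ball 0 R") (auto simp: flux_def A_def)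

lemma J_zero: "z \<notin> {0<..<T} \<times> ball 0 R ==> J z = 0" by (simp add: J_eq A_def G_zero)

lemma J_sq: "square_integrable J"
proof -
 have "square_integrable (%z. q z *\<^sub>R A z)" by (rule square_integrable_scaleR(1)[OF A_sq q_meas, of N]) (use q_nonneg q_le in auto)
 from square_integrable_add(1)[OF G_sq this] show ?thesis unfolding J_eq[abs_def] .
qed

lemma P_sq: 
 assumes e: "0 < e"
 shows "square_integrable (P e)" unfolding P_def[abs_def]
proof (rule square_integrable_scaleR(1)[OF G_sq, of _ "e powr (- 1 / m)"])
 note [measurable] = q_meas
 show "(%z. (q z powr m + e) powr (- 1 / m)) \<in> borel_measurable borel" by measurable
 show "\<bar>(q z powr m + e) powr (- 1 / m)\<bar> <= e powr (- 1 / m)" for z using m e by (auto intro!: powr_mono2' simp: divide_le_0_iff)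
qed

lemma J_meas: "J \<in> borel_measurable borel" using J_sq by (rule square_integrable_measurable)

lemma section_square_integrable:
 fixes f :: "real \<times> 'a => 'b::euclidean_space"
 assumes f: "square_integrable f"
 shows "AE t in lborel. square_integrable (%x. f (t, x))" 
proof -
 have "integrable (lborel \<Otimes>\<^sub>M lborel) (%(t, x). (norm (f (t, x)))\<^sup>2)"
  unfolding lborel_prod using square_integrableD[OF f] by (simp add: case_prod_beta')
 from lborel_pair.AE_integrable_fst[OF this] show ?thesis
  by eventually_elim (simp add: square_integrable_def section_measurable(1)[OF square_integrable_measurable[OF f]])
qed

lemma Fubini_inner:
 fixes f g :: "real \<times> 'a => 'a"
 assumes f: "square_integrable f" and g: "square_integrable g"
 shows "integrable lborel (%t. LBINT x. f (t, x) \<bullet> g (t, x))"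
  "(LBINT z. f z \<bullet> g z) = (LBINT t. (LBINT x. f (t, x) \<bullet> g (t, x)))"
  "(LBINT z. f z \<bullet> g z) = (LBINT x. (LBINT t. f (t, x) \<bullet> g (t, x)))"
proof -
 have i: "integrable (lborel \<Otimes>\<^sub>M lborel) (%(t, x). f (t, x) \<bullet> g (t, x))"
  unfolding lborel_prod using L2_inner(1)[OF f g] by (simp add: case_prod_beta')
 show "integrable lborel (%t. LBINT x. f (t, x) \<bullet> g (t, x))" by (rule lborel_pair.integrable_fst[OF i])
 have "(LBINT z. f z \<bullet> g z) = integral\<^sup>L (lborel \<Otimes>\<^sub>M lborel) (%(t, x). f (t, x) \<bullet> g (t, x))"
  unfolding lborel_prod by (simp add: case_prod_beta')
 then show "(LBINT z. f z \<bullet> g z) = (LBINT t. (LBINT x. f (t, x) \<bullet> g (t, x)))"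
  "(LBINT z. f z \<bullet> g z) = (LBINT x. (LBINT t. f (t, x) \<bullet> g (t, x)))"
  using lborel_pair.integral_fst[OF i] lborel_pair.integral_snd[OF i] by auto
qed

definition Jint :: "real => real => 'a => 'a" where
 "Jint t1 t2 x = (LBINT s. indicator {t1<..t2} s *\<^sub>R J (s, x))"

lemma Jcut_sq: "square_integrable (%z. indicator {t1<..t2} (fst z) *\<^sub>R J z)" by (rule square_integrable_scaleR(1)[OF J_sq, of _ 1])
  (auto simp: indicator_def intro!: measurable_compose[OF fst_snd_borel(1)])

lemma J_integrable: "integrable lborel J" by (rule square_integrable_imp_integrable[OF J_sq _ cyl_bounded cyl_borel]) (rule J_zero)

lemma Jcut_integrable_pair: "integrable (lborel \<Otimes>\<^sub>M lborel) (%(s, x). indicator {t1<..t2} s *\<^sub>R J (s, x))"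
proof -
 have "integrable lborel (%z. indicator {t1<..t2} (fst z) *\<^sub>R J z)"
  by (rule square_integrable_imp_integrable[OF Jcut_sq _ cyl_bounded cyl_borel]) (simp add: J_zero)
 then show ?thesis unfolding lborel_prod by (simp add: case_prod_beta')
qed

lemma Jint_meas: "Jint t1 t2 \<in> borel_measurable borel" using borel_measurable_integrable[OF lborel_pair.integrable_snd[OF Jcut_integrable_pair]]
 unfolding Jint_def[abs_def] by simp

lemma Jint_zero: "x \<notin> ball 0 R ==> Jint t1 t2 x = 0" by (simp add: Jint_def J_zero)

lemma Jint_integrable: "integrable lborel (Jint t1 t2)" using lborel_pair.integrable_snd[OF Jcut_integrable_pair] unfolding Jint_def[abs_def] .

text \<open>Cauchy-Schwarz in time: the square of the time integral is at most the length of the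
  interval times the time integral of the square.\<close>

lemma Jint_sq: "square_integrable (Jint t1 t2)"
proof (rule square_integrableI_nn[OF Jint_meas])
 note [measurable] = section_measurable[OF J_meas]
 have "ennreal ((norm (Jint t1 t2 x))\<^sup>2) <= emeasure lborel {t1<..t2} * (LBNN s. ennreal ((norm (J (s, x)))\<^sup>2))" for x
 proof -
  have "ennreal (norm (Jint t1 t2 x)) <= (LBNN s. ennreal (norm (indicator {t1<..t2} s *\<^sub>R J (s, x))))" unfolding Jint_def
  proof (cases "integrable lborel (%s. indicator {t1<..t2} s *\<^sub>R J (s, x))")
   case True
   then show "ennreal (norm (LBINT s. indicator {t1<..t2} s *\<^sub>R J (s, x)))
     <= (LBNN s. ennreal (norm (indicator {t1<..t2} s *\<^sub>R J (s, x))))" by (rule integral_norm_bound_ennreal)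
  qed (simp add: not_integrable_integral_eq)
  also have "\<dots> = (LBNN s. indicator {t1<..t2} s * ennreal (norm (J (s, x))))" by (intro nn_integral_cong) (auto simp: indicator_def)
  finally have "(ennreal (norm (Jint t1 t2 x)))\<^sup>2 <= (LBNN s. indicator {t1<..t2} s * ennreal (norm (J (s, x))))\<^sup>2"
   by (intro power_mono) auto
  also have "\<dots> <= (LBNN s. (indicator {t1<..t2} s)\<^sup>2) * (LBNN s. (ennreal (norm (J (s, x))))\<^sup>2)"
   by (rule Cauchy_Schwarz_nn_integral) measurable
  also have "(LBNN s. (indicator {t1<..t2} s)\<^sup>2) = (\<integral>\<^sup>+s. indicator {t1<..t2} s \<partial>(lborel :: real measure))"
   by (intro nn_integral_cong) (auto simp: indicator_def)
  finally show ?thesis by (simp add: ennreal_power)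
 qed
 then have "(LBNN x. ennreal ((norm (Jint t1 t2 x))\<^sup>2))
   <= (LBNN x. emeasure lborel {t1<..t2} * (LBNN s. ennreal ((norm (J (s, x)))\<^sup>2)))" by (intro nn_integral_mono)
 also have "\<dots> = emeasure lborel {t1<..t2} * (LBNN x. (LBNN s. ennreal ((norm (J (s, x)))\<^sup>2)))" by (rule nn_integral_cmult) measurable
 also have "(LBNN x. (LBNN s. ennreal ((norm (J (s, x)))\<^sup>2))) = (\<integral>\<^sup>+z. ennreal ((norm (J z))\<^sup>2) \<partial>(lborel \<Otimes>\<^sub>M lborel))"
  using lborel_pair.nn_integral_snd[of "%z. ennreal ((norm (J z))\<^sup>2)"] by measurable
 also have "\<dots> = ennreal (L2_sqnorm J)" unfolding lborel_prod by (rule nn_L2_sqnorm[OF J_sq])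
 also have "emeasure lborel {t1<..t2} * ennreal (L2_sqnorm J) < \<infinity>" by (cases "t1 <= t2") (auto simp: ennreal_mult_less_top)
 finally show "(LBNN x. ennreal ((norm (Jint t1 t2 x))\<^sup>2)) < \<infinity>" .
qed

lemma space_field_sq:
 fixes Q :: "'a => 'a" and t1 t2 :: real
 assumes Q: "square_integrable Q"
 shows "square_integrable (%z. indicator {t1<..t2} (fst z) *\<^sub>R Q (snd z))"
proof (rule square_integrableI_nn)
 have Qm: "Q \<in> borel_measurable borel" using Q by (rule square_integrable_measurable)
 show fm: "(%z. indicator {t1<..t2} (fst z) *\<^sub>R Q (snd z)) \<in> borel_measurable borel"
 proof (rule borel_measurable_scaleR)
  show "(%z. indicator {t1<..t2} (fst z) :: real) \<in> borel_measurable (borel :: (real \<times> 'a) measure)"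
   by (rule measurable_compose[OF fst_snd_borel(1)]) auto
  show "(%z. Q (snd z)) \<in> borel_measurable (borel :: (real \<times> 'a) measure)" by (rule measurable_compose[OF fst_snd_borel(2) Qm])
 qed
 note [measurable] = section_measurable(3)[OF fm] Qm
 have "(LBNN z. ennreal ((norm (indicator {t1<..t2} (fst z) *\<^sub>R Q (snd z)))\<^sup>2))
   = (LBNN s. (LBNN x. ennreal ((norm (indicator {t1<..t2} s *\<^sub>R Q x))\<^sup>2)))"
  unfolding lborel_prod[symmetric] by (subst lborel.nn_integral_fst[symmetric]) auto
 also have "\<dots> = (LBNN s. ennreal (L2_sqnorm Q) * indicator {t1<..t2} s)"
  by (intro nn_integral_cong) (auto simp: indicator_def nn_L2_sqnorm[OF Q])
 also have "\<dots> = ennreal (L2_sqnorm Q) * emeasure lborel {t1<..t2}" by (rule nn_integral_cmult_indicator) simp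
 also have "\<dots> < \<infinity>" by (cases "t1 <= t2") (auto simp: ennreal_mult_less_top)
 finally show "(LBNN z. ennreal ((norm (indicator {t1<..t2} (fst z) *\<^sub>R Q (snd z)))\<^sup>2)) < \<infinity>" .
qed

text \<open>Fubini for the flux against a field that is constant in time. The indicator is put on
  both factors so that each is square integrable on space-time.\<close>

lemma Jint_inner:
 fixes Q :: "'a => 'a"
 assumes Q: "square_integrable Q"
 shows "(LBINT x. Jint t1 t2 x \<bullet> Q x) = (LBINT s. indicator {t1<..t2} s * (LBINT x. J (s, x) \<bullet> Q x))"
  "integrable lborel (%s. indicator {t1<..t2} s * (LBINT x. J (s, x) \<bullet> Q x))"
proof -
 let ?f = "%z. indicator {t1<..t2} (fst z) *\<^sub>R J z" and ?g = "%z. indicator {t1<..t2} (fst z) *\<^sub>R Q (snd z)"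
 note F = Fubini_inner[OF Jcut_sq[of t1 t2] space_field_sq[OF Q, of t1 t2]]
 have e1: "(LBINT x. (indicator {t1<..t2} s *\<^sub>R J (s, x)) \<bullet> (indicator {t1<..t2} s *\<^sub>R Q x))
   = indicator {t1<..t2} s * (LBINT x. J (s, x) \<bullet> Q x)" for s by (auto simp: indicator_def)
 show "integrable lborel (%s. indicator {t1<..t2} s * (LBINT x. J (s, x) \<bullet> Q x))" using F(1) by (simp only: fst_conv snd_conv e1)
 have "(LBINT x. Jint t1 t2 x \<bullet> Q x) = (LBINT x. (LBINT t. (indicator {t1<..t2} t *\<^sub>R J (t, x)) \<bullet> (indicator {t1<..t2} t *\<^sub>R Q x)))"
 proof (rule integral_cong_AE)
  show "AE x in lborel. Jint t1 t2 x \<bullet> Q x = (LBINT t. (indicator {t1<..t2} t *\<^sub>R J (t, x)) \<bullet> (indicator {t1<..t2} t *\<^sub>R Q x))"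
   using lborel_pair.AE_integrable_snd[OF Jcut_integrable_pair[of t1 t2]]
  proof eventually_elim
   case (elim x)
   have "Jint t1 t2 x \<bullet> Q x = (LBINT t. (indicator {t1<..t2} t *\<^sub>R J (t, x)) \<bullet> Q x)"
    unfolding Jint_def using elim by (rule integral_inner_left[symmetric])
   also have "\<dots> = (LBINT t. (indicator {t1<..t2} t *\<^sub>R J (t, x)) \<bullet> (indicator {t1<..t2} t *\<^sub>R Q x))"
    by (intro bochner_cong) (auto simp: indicator_def)
   finally show ?case .
  qed
  show "(%x. Jint t1 t2 x \<bullet> Q x) \<in> borel_measurable lborel" using Jint_meas square_integrable_measurable[OF Q] by measurable
  have "integrable (lborel \<Otimes>\<^sub>M lborel) (%(t, x). (indicator {t1<..t2} t *\<^sub>R J (t, x)) \<bullet> (indicator {t1<..t2} t *\<^sub>R Q x))"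
   unfolding lborel_prod using L2_inner(1)[OF Jcut_sq[of t1 t2] space_field_sq[OF Q, of t1 t2]] by (simp only: case_prod_beta' prod.collapse)
  from borel_measurable_integrable[OF lborel_pair.integrable_snd[OF this]]
  show "(%x. LBINT t. (indicator {t1<..t2} t *\<^sub>R J (t, x)) \<bullet> (indicator {t1<..t2} t *\<^sub>R Q x)) \<in> borel_measurable lborel" .
 qed
 also have "\<dots> = (LBINT s. indicator {t1<..t2} s * (LBINT x. J (s, x) \<bullet> Q x))" using F(2,3) by (simp only: fst_conv snd_conv e1)
 finally show "(LBINT x. Jint t1 t2 x \<bullet> Q x) = (LBINT s. indicator {t1<..t2} s * (LBINT x. J (s, x) \<bullet> Q x))" .
qed

end

text \<open>The weak equation after integration in time. The test functions are smooth on the whole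
  space without any condition on the boundary of the ball, which is how the no-flux condition
  enters.\<close>

locale dissipative_flow = flow_data +
 assumes flow_eq: "!!\<psi> t. smooth_on UNIV \<psi> ==> 0 <= t ==> t <= T ==>
    (LBINT x. r t x * \<psi> x) = (LBINT x. r 0 x * \<psi> x) -
     (LBINT s. indicator {0..t} s * (LBINT x. flux q G gV k (s, x) \<bullet> grad \<psi> x))"

lemma bounded_on_ball_field:
 fixes g :: "'a::euclidean_space => 'b::euclidean_space"
 assumes g: "continuous_on UNIV g"
 shows "square_integrable (%x. indicator (ball 0 R) x *\<^sub>R g x)"
  "\<exists>D. \<forall>x. norm (indicator (ball 0 R) x *\<^sub>R g x) <= D"
proof -
 have [measurable]: "g \<in> borel_measurable borel" using g by (rule borel_measurable_continuous_onI)
 obtain D where D: "!!x. x \<in> cball 0 R ==> norm (g x) <= D"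
  using compact_imp_bounded[OF compact_continuous_image[OF continuous_on_subset[OF g subset_UNIV] compact_cball]] unfolding bounded_iff by blast
 have le: "norm (indicator (ball 0 R) x *\<^sub>R g x) <= max 0 D" for x using D[of x] by (auto simp: indicator_def)
 then show "\<exists>D. \<forall>x. norm (indicator (ball 0 R) x *\<^sub>R g x) <= D" by blast
 show "square_integrable (%x. indicator (ball 0 R) x *\<^sub>R g x)"
  by (rule square_integrable_bounded[where S = "ball 0 R", OF _ _ le]) auto
qed

section \<open>Energy difference between two times\<close>

context dissipative_flow
begin

lemma smooth_identity:
 assumes sm: "smooth_on UNIV \<psi>" and t: "0 <= t1" "t1 <= t2" "t2 <= T"
 shows "(LBINT x. (r t2 x - r t1 x) * \<psi> x) = - (LBINT x. Jint t1 t2 x \<bullet> grad \<psi> x)"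
proof -
 let ?g = "%x. indicator (ball 0 R) x *\<^sub>R grad \<psi> x"
 have gsq: "square_integrable ?g" by (rule bounded_on_ball_field(1)[OF smooth_grad_continuous_on[OF sm]])
 have Jg: "(LBINT x. J (s, x) \<bullet> grad \<psi> x) = (LBINT x. J (s, x) \<bullet> ?g x)" for s
  by (intro bochner_cong) (auto simp: indicator_def J_zero)
 let ?j = "%s. LBINT x. J (s, x) \<bullet> ?g x"
 have i: "integrable lborel (%s. indicator {a<..b} s * ?j s)" for a b by (rule Jint_inner(2)[OF gsq])
 have r\<psi>: "integrable lborel (%x. r t x * \<psi> x)" if "0 <= t" "t <= T" for t
 proof -
  obtain D where D: "\<forall>x. norm (indicator (ball 0 R) x *\<^sub>R \<psi> x) <= D"
   using bounded_on_ball_field(2)[OF smooth_on_continuous_on[OF sm]] by blast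
  have "integrable lborel (%x. r t x * (indicator (ball 0 R) x *\<^sub>R \<psi> x))"
   using D square_integrable_measurable[OF bounded_on_ball_field(1)[OF smooth_on_continuous_on[OF sm]]]
   by (intro integrable_mult_bounded(1)[OF r_int[OF that]]) auto
  moreover have "(%x. r t x * (indicator (ball 0 R) x *\<^sub>R \<psi> x)) = (%x. r t x * \<psi> x)"
   using r_zero by (auto simp: indicator_def fun_eq_iff)
  ultimately show ?thesis by simp
 qed
 have eq: "(LBINT x. r t x * \<psi> x) = (LBINT x. r 0 x * \<psi> x) - (LBINT s. indicator {0<..t} s * ?j s)"
  if "0 <= t" "t <= T" for t
 proof -
  \<comment> \<open>A single time is a null set, and with half-open intervals the integrals up to
    \<open>t1\<close> and \<open>t2\<close> subtract exactly.\<close>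
  have "(LBINT s. indicator {0..t} s * ?j s) = (LBINT s. indicator {0<..t} s * ?j s)"
  proof (rule integral_cong_AE)
   have 1: "AE s in lborel. s \<noteq> (0::real)" by (rule AE_lborel_singleton)
   show "AE s in lborel. indicator {0..t} s * ?j s = indicator {0<..t} s * ?j s" using 1 by eventually_elim (auto simp: indicator_def)
   show m: "(%s. indicator {0<..t} s * ?j s) \<in> borel_measurable lborel" using i by (rule borel_measurable_integrable)
   have "(%s. indicator {0..t} s * (indicator {-1<..t} s * ?j s)) \<in> borel_measurable lborel"
    by (intro borel_measurable_times borel_measurable_integrable[OF i]) auto
   moreover have "(%s. indicator {0..t} s * (indicator {-1<..t} s * ?j s)) = (%s. indicator {0..t} s * ?j s)"
    by (auto simp: indicator_def fun_eq_iff)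
   ultimately show "(%s. indicator {0..t} s * ?j s) \<in> borel_measurable lborel" by simp
  qed
  then show ?thesis using flow_eq[OF sm that] unfolding Jg by simp
 qed
 have "(LBINT x. (r t2 x - r t1 x) * \<psi> x) = (LBINT x. r t2 x * \<psi> x) - (LBINT x. r t1 x * \<psi> x)"
  using r\<psi>[of t1] r\<psi>[of t2] t by (simp add: left_diff_distrib)
 also have "\<dots> = (LBINT s. indicator {0<..t1} s * ?j s) - (LBINT s. indicator {0<..t2} s * ?j s)" using eq[of t1] eq[of t2] t by simp
 also have "\<dots> = (LBINT s. indicator {0<..t1} s * ?j s - indicator {0<..t2} s * ?j s)"
  by (rule Bochner_Integration.integral_diff[symmetric, OF i i])
 also have "\<dots> = (LBINT s. - (indicator {t1<..t2} s * ?j s))" using t by (intro bochner_cong) (auto simp: indicator_def)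
 also have "\<dots> = - (LBINT x. Jint t1 t2 x \<bullet> ?g x)" using Jint_inner(1)[OF gsq, of t1 t2] by simp
 also have "(LBINT x. Jint t1 t2 x \<bullet> ?g x) = (LBINT x. Jint t1 t2 x \<bullet> grad \<psi> x)"
  by (intro bochner_cong) (auto simp: indicator_def Jint_zero)
 finally show ?thesis .
qed

lemma grad_const: "grad (%x::'a. c) x = 0" by (rule grad_eqI) (simp add: inner_zero_left[abs_def])

definition mass :: real where "mass = (LBINT x. r 0 x)"

text \<open>The constant 1 is an admissible test function, because nothing is required at the
  boundary, and its gradient vanishes.\<close>

lemma mass_conserved:
 assumes "0 <= t" "t <= T"
 shows "(LBINT x. r t x) = mass" using smooth_identity[OF smooth_const[of 1], of 0 t] assms r_int[of t] r_int[of 0]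
 by (simp add: mass_def grad_const)

text \<open>Functions on space-time are meaningful on slices only for almost every time; these are
  the times at which the slices can be used.\<close>

definition good :: "real => bool" where
 "good t \<longleftrightarrow> t \<in> {0<..<T} \<and> (AE x in lborel. q (t, x) = r t x) \<and>
   has_weak_grad (ball 0 R) (%x. q (t, x) powr m) (%x. G (t, x)) \<and> square_integrable (%x. G (t, x))"

lemma AE_good: "AE t in lborel. t \<in> {0<..<T} --> good t" using q_r G_weak section_square_integrable[OF G_sq]
 by eventually_elim (auto simp: good_def)

lemma section_bounded_sq:
 assumes f: "f \<in> borel_measurable borel" "!!x. \<bar>f x\<bar> <= D" "!!x::'a. x \<notin> ball 0 R ==> f x = (0::real)"
 shows "square_integrable f" by (rule square_integrable_bounded[where S = "ball 0 R" and C = D]) (use f in auto)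

text \<open>The increment \<open>d\<close> of the density is the divergence of
  \<open>Jint t1 t2\<close>. Convexity bounds the energy difference by pairing \<open>d\<close> with
  the entropy derivative at \<open>t2\<close>, with \<open>V\<close> and with the potential of the
  mean density, and each pairing becomes one of \<open>Jint\<close> with a gradient. The drift is
  therefore averaged over both times, while the entropy part is taken at \<open>t2\<close>
  only.\<close>

lemma step_inequality:
 assumes t1: "good t1" and t2: "good t2" and t: "t1 < t2" and e: "0 < e"
 shows "free_energy m V K e (r t2) - free_energy m V K e (r t1) <=
  - (LBINT x. Jint t1 t2 x \<bullet> (P e (t2, x) + (1 / 2) *\<^sub>R (A (t1, x) + A (t2, x))))"
proof -
 have T12: "0 < t1" "t1 < T" "0 < t2" "t2 < T" using t1 t2 by (auto simp: good_def)
 \<comment> \<open>The slices of \<open>q\<close> are bounded everywhere and agree almost everywhere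
   with the densities \<open>r t1\<close> and \<open>r t2\<close>, which are given only as
   integrable functions.\<close>
 define f1 f2 where "f1 = (%x. q (t1, x))" and "f2 = (%x. q (t2, x))"
 have fm[measurable]: "f1 \<in> borel_measurable borel" "f2 \<in> borel_measurable borel"
  unfolding f1_def f2_def by (rule section_measurable(1)[OF q_meas])+
 have f0: "f1 x = 0" "f2 x = 0" if "x \<notin> ball 0 R" for x using that by (auto simp: f1_def f2_def q_zero)
 have fnn: "0 <= f1 x" "0 <= f2 x" for x by (auto simp: f1_def f2_def q_nonneg)
 have fN: "f1 x <= N" "f2 x <= N" for x by (auto simp: f1_def f2_def q_le)
 have fsq: "square_integrable f1" "square_integrable f2" using fnn fN f0 by (auto intro!: section_bounded_sq[where D = N])
 have fi: "integrable lborel f1" "integrable lborel f2" using f0 by (auto intro!: square_integrable_imp_integrable[where S = "ball 0 R"] fsq)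
 have ae: "AE x in lborel. r t1 x = f1 x" "AE x in lborel. r t2 x = f2 x" using t1 t2 by (auto simp: good_def f1_def f2_def)
 have ri: "integrable lborel (r t1)" "integrable lborel (r t2)" using T12 by (auto intro!: r_int)
 define Y where "Y = Jint t1 t2"
 define d where "d x = f2 x - f1 x" for x
 have dsq: "square_integrable d" unfolding d_def[abs_def] by (rule square_integrable_diff(1)[OF fsq(2,1)])
 have d0: "d x = 0" if "x \<notin> ball 0 R" for x using f0[OF that] by (simp add: d_def)
 have Ysq: "square_integrable Y" unfolding Y_def by (rule Jint_sq)
 have Y0: "Y x = 0" if "x \<notin> ball 0 R" for x unfolding Y_def by (rule Jint_zero[OF that])
 have eq: "(LBINT x. d x * \<psi> x) = - (LBINT x. Y x \<bullet> grad \<psi> x)" if sm: "smooth_on UNIV \<psi>" for \<psi>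
 proof -
  have [measurable]: "\<psi> \<in> borel_measurable borel" by (intro borel_measurable_continuous_onI smooth_on_continuous_on sm)
  have "(LBINT x. d x * \<psi> x) = (LBINT x. (r t2 x - r t1 x) * \<psi> x)"
  proof (rule integral_cong_AE)
   show "AE x in lborel. d x * \<psi> x = (r t2 x - r t1 x) * \<psi> x" using ae by eventually_elim (simp add: d_def)
  qed (use ri in \<open>auto simp: d_def[abs_def]\<close>)
  then show ?thesis unfolding Y_def using smooth_identity[OF sm, of t1 t2] t T12 by simp
 qed
 have mean0: "(LBINT x. d x) = 0" using eq[OF smooth_const[of 1]] by (simp add: grad_const)
 have di: "integrable lborel d" using fi by (simp add: d_def[abs_def])
 \<comment> \<open>With this exponent \<open>?c - 1 = - 1 / m\<close>, so that the gradient of the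
   test function is a multiple of \<open>P e\<close>.\<close>
 let ?c = "(m - 1) / m"
 have c: "?c \<noteq> 0" "?c <= 1" "?c - 1 = - 1 / m" using m by (auto simp: field_simps)
 have id1: "(LBINT x. d x * entropy_deriv m e (f2 x powr m)) = - (LBINT x. Y x \<bullet> P e (t2, x))"
 proof -
  have "(LBINT x. d x * (f2 x powr m + e) powr ?c) = - (LBINT x. Y x \<bullet> ((?c * (f2 x powr m + e) powr (?c - 1)) *\<^sub>R G (t2, x)))"
  proof (rule div_identity_powr[OF R, where v = "%x. f2 x powr m" and G = "%x. G (t2, x)"])
   show "square_integrable (%x. f2 x powr m)"
   proof (rule section_bounded_sq[where D = "N powr m"])
    show "\<bar>f2 x powr m\<bar> <= N powr m" for x using fnn fN m by (simp add: powr_mono2)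
   qed (use f0 m in auto)
   show "has_weak_grad (ball 0 R) (%x. f2 x powr m) (%x. G (t2, x))" "square_integrable (%x. G (t2, x))"
    using t2 by (auto simp: good_def f2_def)
  qed (use f0 m c e dsq d0 Ysq Y0 eq G_zero in auto)
  then have "(LBINT x. d x * (f2 x powr m + e) powr ?c) = - (?c * (LBINT x. Y x \<bullet> P e (t2, x)))"
   unfolding c(3) P_def f2_def by (simp add: mult.assoc)
  moreover have "(LBINT x. d x * entropy_deriv m e (f2 x powr m)) = m / (m - 1) * (LBINT x. d x * (f2 x powr m + e) powr ?c)"
   unfolding entropy_deriv_def by (subst integral_mult_right_zero[symmetric]) (simp add: mult_ac)
  ultimately show ?thesis using m by simp
 qed
 have idl: "(LBINT x. d x * v x) = - (LBINT x. Y x \<bullet> H x)"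
  if v: "square_integrable v" "!!x. x \<notin> ball 0 R ==> v x = 0" "!!x. 0 <= v x"
   and H: "square_integrable H" "!!x. x \<notin> ball 0 R ==> H x = 0" and w: "has_weak_grad (ball 0 R) v H" for v H
 proof -
  \<comment> \<open>A linear test function is the case of exponent 1 and shift 1 of the power rule;
    the shift drops out because \<open>d\<close> has integral 0.\<close>
  have "(LBINT x. d x * (v x + 1) powr 1) = - (LBINT x. Y x \<bullet> ((1 * (v x + 1) powr (1 - 1)) *\<^sub>R H x))"
   by (rule div_identity_powr[OF R v(1,2) H w v(3) order_refl zero_less_one dsq d0 Ysq Y0 eq])
  moreover have "(v x + 1) powr 1 = v x + 1" "(v x + 1) powr 0 = 1" for x using v(3)[of x] by auto
  moreover have "integrable lborel (%x. d x * v x)" using L2_inner(1)[OF dsq v(1)] by simp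
  ultimately show ?thesis using di mean0 by (simp add: distrib_left)
 qed
 have id2: "(LBINT x. d x * V x) = - (LBINT x. Y x \<bullet> gV x)"
 proof (rule idl)
  show "square_integrable V" using V by (intro section_bounded_sq[where D = C]) auto
  show "square_integrable gV" using gV by (intro square_integrable_bounded[where S = "ball 0 R" and C = C]) auto
 qed (use V gV V_weak in auto)
 let ?f = "%y. (f1 y + f2 y) / 2" and ?H = "%x. (1 / 2) *\<^sub>R (W (t1, x) + W (t2, x))"
 have hi: "integrable lborel ?f" using fi by simp
 have id3: "(LBINT x. d x * potential K ?f x) = - (LBINT x. Y x \<bullet> ?H x)"
 proof (rule idl)
  show "square_integrable (potential K ?f)"
   by (rule section_bounded_sq[OF potential_measurable[OF m e V(1-3) K hi] potential_abs_le[OF m e V(1-3) K hi]])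
    (use K_zero in \<open>auto simp: potential_def\<close>)
  have "(LBINT y. ?f y *\<^sub>R k (x, y)) = ?H x" for x
  proof -
   have "(LBINT y. ?f y *\<^sub>R k (x, y)) = (LBINT y. (1 / 2) *\<^sub>R (q (t1, y) *\<^sub>R k (x, y) + q (t2, y) *\<^sub>R k (x, y)))"
    by (intro bochner_cong) (auto simp: f1_def f2_def scaleR_add_left[symmetric])
   then show ?thesis using W_integrand by (simp add: drift_K_def)
  qed
  then show "has_weak_grad (ball 0 R) (potential K ?f) ?H" using K_weak[OF hi] f0 by simp
  show "?H x = 0" if "x \<notin> ball 0 R" for x using that by (simp add: drift_K_def k(3))
  have Wm: "(%x. W (t, x)) \<in> borel_measurable borel" for t by (rule section_measurable(1)[OF W_meas])
  show "square_integrable ?H"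
  proof (rule square_integrable_bounded[where S = "ball 0 R" and C = "N * C * measure lborel (ball (0::'a) R)"])
   show "?H \<in> borel_measurable borel" using Wm by (intro borel_measurable_scaleR borel_measurable_add) auto
   show "norm (?H x) <= N * C * measure lborel (ball (0::'a) R)" for x
    using norm_triangle_ineq[of "W (t1, x)" "W (t2, x)"] W_le[of "(t1, x)"] W_le[of "(t2, x)"] by simp
  qed (use \<open>!!x. x \<notin> ball 0 R ==> ?H x = 0\<close> in auto)
 qed (use K_zero potential_nonneg[OF m e V(1-3) K] fnn in \<open>auto simp: potential_def\<close>)
 have Asq: "square_integrable (%x. A (t, x))" for t
 proof (rule square_integrable_bounded[where S = "ball 0 R" and C = "C + N * C * measure lborel (ball (0::'a) R)"])
  show "(%x. A (t, x)) \<in> borel_measurable borel" by (rule section_measurable(1)[OF square_integrable_measurable[OF A_sq]])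
  have "norm (gV x + W (t, x)) <= C + N * C * measure lborel (ball (0::'a) R)" for x by (intro norm_triangle_mono gV W_le)
  then show "norm (A (t, x)) <= C + N * C * measure lborel (ball (0::'a) R)" for x
   using order_trans[OF norm_ge_zero] by (cases "(t, x) \<in> {0<..<T} \<times> ball 0 R") (simp_all only: A_def indicator_simps fst_conv snd_conv scaleR_one scaleR_zero_left norm_zero, auto)
 qed (auto simp: A_def)
 have Psq: "square_integrable (%x. P e (t2, x))" unfolding P_def
 proof (rule square_integrable_scaleR(1)[where C = "e powr (- 1 / m)"])
  show "square_integrable (%x. G (t2, x))" using t2 by (simp add: good_def)
  show "(%x. (q (t2, x) powr m + e) powr (- 1 / m)) \<in> borel_measurable borel" using fm(2) unfolding f2_def by measurable
  show "\<bar>(q (t2, x) powr m + e) powr (- 1 / m)\<bar> <= e powr (- 1 / m)" for x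
   using m e by (auto intro!: powr_mono2' simp: divide_le_0_iff)
 qed
 let ?Q = "%x. P e (t2, x) + (1 / 2) *\<^sub>R (A (t1, x) + A (t2, x))"
 have Hsq: "square_integrable (%x. (1 / 2) *\<^sub>R (A (t1, x) + A (t2, x)))"
  by (rule square_integrable_scaleR(1)[of _ _ "1 / 2"]) (use square_integrable_add(1)[OF Asq Asq] in auto)
 have YQ: "(LBINT x. Y x \<bullet> ?Q x) = (LBINT x. Y x \<bullet> P e (t2, x)) + (LBINT x. Y x \<bullet> gV x) + (LBINT x. Y x \<bullet> ?H x)"
 proof -
  have gVsq: "square_integrable gV" using gV by (intro square_integrable_bounded[where S = "ball 0 R" and C = C]) auto
  have Y2: "Y x \<bullet> ((1 / 2) *\<^sub>R (A (t1, x) + A (t2, x))) = Y x \<bullet> gV x + Y x \<bullet> ?H x" for x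
   using T12 by (cases "x \<in> ball 0 R") (auto simp: A_def Y0 inner_add_right)
  have i1: "integrable lborel (%x. Y x \<bullet> P e (t2, x))" by (rule L2_inner(1)[OF Ysq Psq])
  have i2: "integrable lborel (%x. Y x \<bullet> gV x)" by (rule L2_inner(1)[OF Ysq gVsq])
  have "integrable lborel (%x. Y x \<bullet> ((1 / 2) *\<^sub>R (A (t1, x) + A (t2, x))))" by (rule L2_inner(1)[OF Ysq Hsq])
  then have i12: "integrable lborel (%x. Y x \<bullet> gV x + Y x \<bullet> ?H x)" unfolding Y2 .
  have "integrable lborel (%x. (Y x \<bullet> gV x + Y x \<bullet> ?H x) - Y x \<bullet> gV x)"
   by (rule Bochner_Integration.integrable_diff[OF i12 i2])
  then have i3: "integrable lborel (%x. Y x \<bullet> ?H x)" by simp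
  have "(LBINT x. Y x \<bullet> ?Q x) = (LBINT x. Y x \<bullet> P e (t2, x) + (Y x \<bullet> gV x + Y x \<bullet> ?H x))"
   by (simp only: inner_add_right[of "Y _" "P e _"] Y2)
  also have "\<dots> = (LBINT x. Y x \<bullet> P e (t2, x)) + ((LBINT x. Y x \<bullet> gV x) + (LBINT x. Y x \<bullet> ?H x))"
   by (simp only: Bochner_Integration.integral_add i1 i2 i3 i12)
  finally show ?thesis by simp
 qed
 have FE: "free_energy m V K e (r t) = free_energy m V K e f" if ae: "AE x in lborel. r t x = f x" 
  and "integrable lborel (r t)" "integrable lborel f" "!!x. 0 <= f x" for t f
 proof -
  have pot: "potential K (r t) x = potential K f x" for x unfolding potential_def
  proof (rule integral_cong_AE)
   show "AE y in lborel. K (x, y) * r t y = K (x, y) * f y" using ae by eventually_elim simp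
  qed (use that section_measurable(1)[OF K(1)] in auto)
  have "integrable lborel (%x. entropy m e (r t x) + V x * r t x + 1 / 2 * (r t x * potential K (r t) x))"
   using free_energy_integrable[OF m e V(1-3) K that(2) r_nonneg] by simp
  moreover have "integrable lborel (%x. entropy m e (f x) + V x * f x + 1 / 2 * (f x * potential K f x))"
   using free_energy_integrable[OF m e V(1-3) K that(3,4)] by simp
  ultimately show ?thesis unfolding free_energy_def
  proof (intro integral_cong_AE borel_measurable_integrable)
   show "AE x in lborel. entropy m e (r t x) + V x * r t x + 1 / 2 * (r t x * potential K (r t) x) =
     entropy m e (f x) + V x * f x + 1 / 2 * (f x * potential K f x)" using ae by eventually_elim (simp add: pot)
  qed
 qed
 have "free_energy m V K e (r t2) - free_energy m V K e (r t1) = free_energy m V K e f2 - free_energy m V K e f1"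
  using FE[OF ae(1) ri(1) fi(1) fnn(1)] FE[OF ae(2) ri(2) fi(2) fnn(2)] by simp
 also have "\<dots> <= (LBINT x. d x * entropy_deriv m e (f2 x powr m)) + (LBINT x. d x * V x) + (LBINT x. d x * potential K ?f x)"
  using free_energy_convex[OF m e V(1-3) K fi(1) fnn(1) fi(2) fnn(2)] by (simp add: d_def mult.commute)
 also have "\<dots> = - (LBINT x. Y x \<bullet> ?Q x)" unfolding id1 id2 id3 YQ by simp
 finally show ?thesis unfolding Y_def .
qed

end

section \<open>Translation and averaging in time\<close>

lemma time_shift_L2:
 fixes f :: "real \<times> 'a::euclidean_space => 'b::euclidean_space"
 assumes f: "square_integrable f"
 shows "square_integrable (%z. f (z + (\<sigma>, 0)))" "L2_sqnorm (%z. f (z + (\<sigma>, 0))) = L2_sqnorm f"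
proof -
 have fm: "f \<in> borel_measurable borel" using f by (rule square_integrable_measurable)
 have fm2: "(%z. (norm (f z))\<^sup>2) \<in> borel_measurable borel" using fm by measurable
 have T: "(%z. z + (\<sigma>, 0)) \<in> borel_measurable (borel :: (real \<times> 'a) measure)"
  by (intro borel_measurable_continuous_onI continuous_intros)
 have gm: "(%z. f (z + (\<sigma>, 0))) \<in> borel_measurable borel" by (rule measurable_compose[OF T fm])
 have "(LBNN z. ennreal ((norm (f (z - - (\<sigma>, 0))))\<^sup>2)) = (LBNN z. ennreal ((norm (f z))\<^sup>2))"
  by (rule nn_integral_lborel_translate[OF measurable_compose[OF fm2 measurable_ennreal]])
 moreover have "z - - (\<sigma>, 0) = z + (\<sigma>, 0)" for z :: "real \<times> 'a" by (simp only: diff_minus_eq_add)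
 ultimately have nn: "(LBNN z. ennreal ((norm (f (z + (\<sigma>, 0))))\<^sup>2)) = ennreal (L2_sqnorm f)" using nn_L2_sqnorm[OF f] by (simp only:)
 show sq: "square_integrable (%z. f (z + (\<sigma>, 0)))" by (rule square_integrableI_nn[OF gm]) (simp add: nn)
 show "L2_sqnorm (%z. f (z + (\<sigma>, 0))) = L2_sqnorm f" using nn nn_L2_sqnorm[OF sq] by (simp add: L2_sqnorm_nonneg)
qed

text \<open>Translation in time preserves the measure and moves every point by
  \<open>\<bar>\<sigma>\<bar>\<close>, so the result on maps close to the identity applies.\<close>

lemma time_shift_continuous:
 fixes f :: "real \<times> 'a::euclidean_space => 'b::euclidean_space"
 assumes f: "square_integrable f" and S: "bounded S" "S \<in> sets borel" and \<nu>: "0 < \<nu>"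
 shows "\<exists>\<delta>>0. \<forall>\<sigma>. \<bar>\<sigma>\<bar> < \<delta> --> square_integrable (%z. indicator S z *\<^sub>R (f (z + (\<sigma>, 0)) - f z)) \<and>
  L2_sqnorm (%z. indicator S z *\<^sub>R (f (z + (\<sigma>, 0)) - f z)) <= \<nu>"
proof -
 have fm: "f \<in> borel_measurable borel" using f by (rule square_integrable_measurable)
 have fin: "(LBNN z. ennreal ((norm (f z))\<^sup>2)) < \<infinity>" by (simp add: nn_L2_sqnorm[OF f])
 obtain \<delta> where \<delta>: "0 < \<delta>" and near: "!!T. T \<in> borel_measurable borel ==>
    (!!g. g \<in> borel_measurable borel ==> (LBNN x. g (T x)) <= 2 * (LBNN x. g x)) ==>
    (!!x. x \<in> S ==> dist (T x) x < \<delta>) ==>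
    (LBNN x. indicator S x * ennreal ((norm (f (T x) - f x))\<^sup>2)) <= ennreal \<nu>"
 proof (rule L2_comp_near_id[OF fm fin \<nu> S(2,1)], goal_cases)
  case (1 \<delta>)
  show ?case
  proof (rule that[OF 1(2)])
   fix T :: "real \<times> 'a => real \<times> 'a"
   assume *: "T \<in> borel_measurable borel" "!!g. g \<in> borel_measurable borel ==> (LBNN x. g (T x)) <= 2 * (LBNN x. g x)"
    "!!x. x \<in> S ==> dist (T x) x < \<delta>"
   show "(LBNN x. indicator S x * ennreal ((norm (f (T x) - f x))\<^sup>2)) <= ennreal \<nu>" by (rule 1(3)) (fact *)+
  qed
 qed
 have sq: "square_integrable (%z. indicator S z *\<^sub>R (f (z + (\<sigma>, 0)) - f z))" for \<sigma>
  by (rule square_integrable_scaleR(1)[OF square_integrable_diff(1)[OF time_shift_L2(1)[OF f] f], of _ 1])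
   (use S in \<open>auto simp: indicator_def\<close>)
 have "L2_sqnorm (%z. indicator S z *\<^sub>R (f (z + (\<sigma>, 0)) - f z)) <= \<nu>" if s: "\<bar>\<sigma>\<bar> < \<delta>" for \<sigma>
 proof -
  have "(LBNN z. indicator S z * ennreal ((norm (f (z + (\<sigma>, 0)) - f z))\<^sup>2)) <= ennreal \<nu>"
  proof (rule near)
   show "(%z. z + (\<sigma>, 0)) \<in> borel_measurable (borel :: (real \<times> 'a) measure)"
    by (intro borel_measurable_continuous_onI continuous_intros)
   show "(LBNN z. g (z + (\<sigma>, 0))) <= 2 * (LBNN z. g z)" if g: "g \<in> borel_measurable borel" for g :: "real \<times> 'a => ennreal"
   proof -
    have "(LBNN z. g (z + (\<sigma>, 0))) = 1 * (LBNN z. g z)"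
     using nn_integral_lborel_translate[OF g, of "- (\<sigma>, 0)"] by (simp only: diff_minus_eq_add mult_1)
    also have "\<dots> <= 2 * (LBNN z. g z)" by (intro mult_right_mono) auto
    finally show ?thesis .
   qed
   show "dist (z + (\<sigma>, 0)) z < \<delta>" for z :: "real \<times> 'a" using s by (simp add: dist_norm norm_Pair)
  qed
  moreover have "indicator S z * ennreal ((norm (f (z + (\<sigma>, 0)) - f z))\<^sup>2)
    = ennreal ((norm (indicator S z *\<^sub>R (f (z + (\<sigma>, 0)) - f z)))\<^sup>2)" for z by (auto simp: indicator_def)
  ultimately have "ennreal (L2_sqnorm (%z. indicator S z *\<^sub>R (f (z + (\<sigma>, 0)) - f z))) <= ennreal \<nu>"
   by (simp only: nn_L2_sqnorm[OF sq])
  then show ?thesis using \<nu> by simp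
 qed
 then show ?thesis using \<delta> sq by blast
qed

context dissipative_flow
begin

abbreviation "FE e t \<equiv> free_energy m V K e (r t)"

lemma FE_lipschitz:
 assumes e: "0 < e" and t: "s \<in> {0..T}" "t \<in> {0..T}"
 shows "\<bar>FE e t - FE e s\<bar> <= (\<bar>entropy_deriv m e 0\<bar> + C + C * mass) * (LBINT x. \<bar>r t x - r s x\<bar>)"
 using t by (intro free_energy_lipschitz[OF m e V(1-3) K]) (auto simp: r_int r_nonneg mass_conserved)

lemma FE_continuous:
 assumes e: "0 < e"
 shows "continuous_on {0..T} (FE e)" unfolding continuous_on_def
proof
 fix s assume s: "s \<in> {0..T}"
 let ?L = "\<bar>entropy_deriv m e 0\<bar> + C + C * mass"
 have "((%t. FE e t - FE e s) \<longlongrightarrow> 0) (at s within {0..T})"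
 proof (rule Lim_null_comparison)
  show "\<forall>\<^sub>F t in at s within {0..T}. norm (FE e t - FE e s) <= ?L * (LBINT x. \<bar>r t x - r s x\<bar>)"
   using FE_lipschitz[OF e s] by (auto simp: eventually_at_filter)
  show "((%t. ?L * (LBINT x. \<bar>r t x - r s x\<bar>)) \<longlongrightarrow> 0) (at s within {0..T})"
   using tendsto_mult_right_zero[OF r_cont[OF s]] by simp
 qed
 then show "(FE e \<longlongrightarrow> FE e s) (at s within {0..T})" by (simp add: LIM_zero_iff)
qed

lemma FE_integrable:
 assumes e: "0 < e" and ab: "0 <= a" "b <= T"
 shows "integrable lborel (%t. indicator {a<..b} t * FE e t)"
proof -
 have "integrable lborel (%t. indicator {0..T} t *\<^sub>R FE e t)" by (rule borel_integrable_compact[OF compact_Icc FE_continuous[OF e]])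
 then have "integrable lborel (%t. indicator {a<..b} t *\<^sub>R (indicator {0..T} t *\<^sub>R FE e t))"
  by (rule integrable_mult_indicator[rotated]) auto
 moreover have "(%t. indicator {a<..b} t *\<^sub>R (indicator {0..T} t *\<^sub>R FE e t)) = (%t. indicator {a<..b} t * FE e t)"
  using ab by (auto simp: indicator_def fun_eq_iff)
 ultimately show ?thesis by simp
qed

text \<open>Shifting the interval makes the two integrals telescope: only intervals of length
  \<open>h\<close> at both ends remain.\<close>

lemma FE_shift:
 assumes e: "0 < e" and ab: "0 <= a" "a <= b" "0 <= h" "b + h <= T"
 shows "integrable lborel (%t. indicator {a<..b} t * (FE e (t + h) - FE e t))"
  "(LBINT t. indicator {a<..b} t * (FE e (t + h) - FE e t)) = (LBINT t. indicator {b<..b+h} t * FE e t) - (LBINT t. indicator {a<..a+h} t * FE e t)"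
proof -
 note i = FE_integrable[OF e]
 have i1: "integrable lborel (%t. indicator {a+h<..b+h} t * FE e t)" using ab by (intro i) auto
 have sh: "indicator {a+h<..b+h} (h + 1 * t) * FE e (h + 1 * t) = indicator {a<..b} t * FE e (t + h)" for t by (auto simp: indicator_def add.commute)
 have i2: "integrable lborel (%t. indicator {a<..b} t * FE e (t + h))"
  using lborel_integrable_real_affine[OF i1, of 1 h] unfolding sh by simp
 have i3: "integrable lborel (%t. indicator {a<..b} t * FE e t)" using ab by (intro i) auto
 show "integrable lborel (%t. indicator {a<..b} t * (FE e (t + h) - FE e t))" using i2 i3 by (simp add: right_diff_distrib)
 have "(LBINT t. indicator {a<..b} t * (FE e (t + h) - FE e t)) =
   (LBINT t. indicator {a<..b} t * FE e (t + h)) - (LBINT t. indicator {a<..b} t * FE e t)" using i2 i3 by (simp add: right_diff_distrib)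
 also have "(LBINT t. indicator {a<..b} t * FE e (t + h)) = (LBINT t. indicator {a+h<..b+h} t * FE e t)"
  using lborel_integral_real_affine[of 1 "%t. indicator {a+h<..b+h} t * FE e t" h] unfolding sh by simp
 also have "\<dots> - (LBINT t. indicator {a<..b} t * FE e t) = (LBINT t. indicator {a+h<..b+h} t * FE e t - indicator {a<..b} t * FE e t)"
  using i1 i3 by simp
 also have "\<dots> = (LBINT t. indicator {b<..b+h} t * FE e t - indicator {a<..a+h} t * FE e t)"
  using ab by (intro bochner_cong) (auto simp: indicator_def)
 also have "\<dots> = (LBINT t. indicator {b<..b+h} t * FE e t) - (LBINT t. indicator {a<..a+h} t * FE e t)"
  using ab by (intro Bochner_Integration.integral_diff i) auto
 finally show "(LBINT t. indicator {a<..b} t * (FE e (t + h) - FE e t)) =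
   (LBINT t. indicator {b<..b+h} t * FE e t) - (LBINT t. indicator {a<..a+h} t * FE e t)" .
qed

lemma integral_Ioc_const: "0 <= h ==> (LBINT t. indicator {b<..b+h} t * (c::real)) = h * c"
 "integrable lborel (%t. indicator {b<..b+h} t * (c::real))"
proof -
 have "integrable lborel (indicator {b<..b+h} :: real => real)" by (cases "0 <= h") (auto intro!: integrable_real_indicator)
 then show "integrable lborel (%t. indicator {b<..b+h} t * (c::real))" by simp
 show "(LBINT t. indicator {b<..b+h} t * (c::real)) = h * c" if "0 <= h" using that by simp
qed

text \<open>The second factor in \<open>step_inequality\<close>, which mixes the times \<open>t\<close> and \<open>t + h\<close> and tends to
 \<open>P e + A\<close> as \<open>h\<close> tends to \<open>0\<close>.\<close>

definition Qh :: "real => real => real \<times> 'a => 'a" where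
 "Qh e h z = P e (z + (h, 0)) + (1 / 2) *\<^sub>R (A z + A (z + (h, 0)))"

lemma Qh_sq:
 assumes e: "0 < e"
 shows "square_integrable (Qh e h)" "L2_sqnorm (Qh e h) <= 2 * L2_sqnorm (P e) + 2 * L2_sqnorm A"
proof -
 note AA = square_integrable_add[OF A_sq time_shift_L2(1)[OF A_sq, of h]]
 have AAm: "square_integrable (%z. (1 / 2) *\<^sub>R (A z + A (z + (h, 0))))"
  "L2_sqnorm (%z. (1 / 2) *\<^sub>R (A z + A (z + (h, 0)))) <= (1 / 2)\<^sup>2 * L2_sqnorm (%z. A z + A (z + (h, 0)))"
  using square_integrable_scaleR[OF AA(1), of "%_. 1 / 2" "1 / 2"] by auto
 note s = square_integrable_add[OF time_shift_L2(1)[OF P_sq[OF e], of h] AAm(1)]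
 show "square_integrable (Qh e h)" unfolding Qh_def[abs_def] by (rule s(1))
 have "L2_sqnorm (Qh e h) <= 2 * L2_sqnorm (P e) + 2 * ((1 / 2)\<^sup>2 * (2 * L2_sqnorm A + 2 * L2_sqnorm A))"
  using s(2) AAm(2) AA(2) unfolding Qh_def[abs_def] time_shift_L2(2)[OF A_sq] time_shift_L2(2)[OF P_sq[OF e]] by (simp add: power2_eq_square)
 then show "L2_sqnorm (Qh e h) <= 2 * L2_sqnorm (P e) + 2 * L2_sqnorm A" by (simp add: power2_eq_square)
qed

text \<open>Both factors depend continuously in L2 on the shifts. The difference from the pairing
  without shifts is a sum of two terms, each a small factor against a bounded one.\<close>

lemma shifted_pairing:
 assumes e: "0 < e" and S: "bounded S" "S \<in> sets borel" and \<eta>: "0 < \<eta>"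
 obtains \<delta> where "0 < \<delta>" "!!\<sigma> h. \<bar>\<sigma>\<bar> < \<delta> ==> \<bar>h\<bar> < \<delta> ==>
  \<bar>(LBINT z. indicator S z * (J (z + (\<sigma>, 0)) \<bullet> Qh e h z)) - (LBINT z. indicator S z * (J z \<bullet> (P e z + A z)))\<bar> <= \<eta>"
proof -
 define B1 B2 where "B1 = 2 * L2_sqnorm (P e) + 2 * L2_sqnorm A" and "B2 = L2_sqnorm J"
 have B: "0 <= B1" "0 <= B2" by (simp_all add: B1_def B2_def L2_sqnorm_nonneg)
 \<comment> \<open>Chosen so that
   \<open>sqrt (\<nu> * B1) + sqrt (B2 * (3 * \<nu>)) <= \<eta>\<close>. Here \<open>B1\<close>
   bounds the squared norm of \<open>Qh\<close>, \<open>B2\<close> is that of the flux, and the 3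
   covers the constant \<open>2 + 1 / 2\<close> from the two parts of the error in
   \<open>Qh\<close>.\<close>
 define \<nu> where "\<nu> = (\<eta> / (sqrt B1 + sqrt (3 * B2) + 1))\<^sup>2"
 have den: "0 < sqrt B1 + sqrt (3 * B2) + 1" using B by (simp add: add_nonneg_pos)
 have \<nu>: "0 < \<nu>" using \<eta> den by (simp add: \<nu>_def)
 have small: "sqrt (\<nu> * B1) + sqrt (B2 * (3 * \<nu>)) <= \<eta>"
 proof -
  have sn: "sqrt \<nu> = \<eta> / (sqrt B1 + sqrt (3 * B2) + 1)" using \<eta> den by (simp add: \<nu>_def)
  have "sqrt (\<nu> * B1) + sqrt (B2 * (3 * \<nu>)) = sqrt \<nu> * (sqrt B1 + sqrt (3 * B2))" by (simp add: real_sqrt_mult algebra_simps)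
  also have "\<dots> <= sqrt \<nu> * (sqrt B1 + sqrt (3 * B2) + 1)" using \<nu> by (intro mult_left_mono) auto
  also have "\<dots> = \<eta>" unfolding sn using den by simp
  finally show ?thesis .
 qed
 obtain d1 where d1: "0 < d1" "!!\<sigma>. \<bar>\<sigma>\<bar> < d1 ==> square_integrable (%z. indicator S z *\<^sub>R (J (z + (\<sigma>, 0)) - J z))"
  "!!\<sigma>. \<bar>\<sigma>\<bar> < d1 ==> L2_sqnorm (%z. indicator S z *\<^sub>R (J (z + (\<sigma>, 0)) - J z)) <= \<nu>"
  using time_shift_continuous[OF J_sq S \<nu>] by blast
 obtain d2 where d2: "0 < d2" "!!\<sigma>. \<bar>\<sigma>\<bar> < d2 ==> square_integrable (%z. indicator S z *\<^sub>R (P e (z + (\<sigma>, 0)) - P e z))"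
  "!!\<sigma>. \<bar>\<sigma>\<bar> < d2 ==> L2_sqnorm (%z. indicator S z *\<^sub>R (P e (z + (\<sigma>, 0)) - P e z)) <= \<nu>"
  using time_shift_continuous[OF P_sq[OF e] S \<nu>] by blast
 obtain d3 where d3: "0 < d3" "!!\<sigma>. \<bar>\<sigma>\<bar> < d3 ==> square_integrable (%z. indicator S z *\<^sub>R (A (z + (\<sigma>, 0)) - A z))"
  "!!\<sigma>. \<bar>\<sigma>\<bar> < d3 ==> L2_sqnorm (%z. indicator S z *\<^sub>R (A (z + (\<sigma>, 0)) - A z)) <= \<nu>"
  using time_shift_continuous[OF A_sq S \<nu>] by blast
 show ?thesis
 proof (rule that[of "min d1 (min d2 d3)"])
  fix \<sigma> h assume s: "\<bar>\<sigma>\<bar> < min d1 (min d2 d3)" and h: "\<bar>h\<bar> < min d1 (min d2 d3)"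
  let ?X = "%z. indicator S z *\<^sub>R (J (z + (\<sigma>, 0)) - J z)"
  let ?Y = "%z. indicator S z *\<^sub>R (P e (z + (h, 0)) - P e z) + (1 / 2) *\<^sub>R (indicator S z *\<^sub>R (A (z + (h, 0)) - A z))"
  have X: "square_integrable ?X" "L2_sqnorm ?X <= \<nu>" using d1 s by auto
  have Y1: "square_integrable (%z. indicator S z *\<^sub>R (P e (z + (h, 0)) - P e z))"
   "L2_sqnorm (%z. indicator S z *\<^sub>R (P e (z + (h, 0)) - P e z)) <= \<nu>" using d2 h by auto
  have Y2: "square_integrable (%z. indicator S z *\<^sub>R (A (z + (h, 0)) - A z))"
   "L2_sqnorm (%z. indicator S z *\<^sub>R (A (z + (h, 0)) - A z)) <= \<nu>" using d3 h by auto
  have Y3: "square_integrable (%z. (1 / 2) *\<^sub>R (indicator S z *\<^sub>R (A (z + (h, 0)) - A z)))"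
   by (rule square_integrable_scaleR(1)[OF Y2(1), of _ "1 / 2"]) auto
  have "L2_sqnorm (%z. (1 / 2) *\<^sub>R (indicator S z *\<^sub>R (A (z + (h, 0)) - A z)))
    <= (1 / 2)\<^sup>2 * L2_sqnorm (%z. indicator S z *\<^sub>R (A (z + (h, 0)) - A z))"
   by (rule square_integrable_scaleR(2)[OF Y2(1)]) auto
  also have "\<dots> <= (1 / 2)\<^sup>2 * \<nu>" by (intro mult_left_mono Y2(2)) simp
  finally have Y4: "L2_sqnorm (%z. (1 / 2) *\<^sub>R (indicator S z *\<^sub>R (A (z + (h, 0)) - A z))) <= (1 / 2)\<^sup>2 * \<nu>" .
  have Y: "square_integrable ?Y" "L2_sqnorm ?Y <= 3 * \<nu>"
   using square_integrable_add[OF Y1(1) Y3] Y1(2) Y4 \<nu> by (auto simp only: power2_eq_square)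
  have iQ: "integrable lborel (%z. ?X z \<bullet> Qh e h z)" by (rule L2_inner(1)[OF X(1) Qh_sq(1)[OF e]])
  have iY: "integrable lborel (%z. J z \<bullet> ?Y z)" by (rule L2_inner(1)[OF J_sq Y(1)])
  have iJ: "integrable lborel (%z. indicator S z * (J z \<bullet> (P e z + A z)))"
   using integrable_mult_indicator[OF _ L2_inner(1)[OF J_sq square_integrable_add(1)[OF P_sq[OF e] A_sq]], of S] S by simp
  have pt: "indicator S z * (J (z + (\<sigma>, 0)) \<bullet> Qh e h z) = indicator S z * (J z \<bullet> (P e z + A z)) + ?X z \<bullet> Qh e h z + J z \<bullet> ?Y z" for z
  proof -
   have half: "(1 / 2) *\<^sub>R (x + y) = x + (1 / 2) *\<^sub>R (y - x)" for x y :: 'a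
    by (rule euclidean_eqI) (simp add: inner_add_left inner_diff_left field_simps)
   have split: "a \<bullet> Q = j \<bullet> p + (a - j) \<bullet> Q + j \<bullet> y" if "Q = p + y" for a j p y Q :: 'a
    unfolding that by (simp add: inner_diff_left inner_add_right)
   have "Qh e h z = (P e z + A z) + ((P e (z + (h, 0)) - P e z) + (1 / 2) *\<^sub>R (A (z + (h, 0)) - A z))" unfolding Qh_def half by simp
   then have "J (z + (\<sigma>, 0)) \<bullet> Qh e h z = J z \<bullet> (P e z + A z) + (J (z + (\<sigma>, 0)) - J z) \<bullet> Qh e h z
     + J z \<bullet> ((P e (z + (h, 0)) - P e z) + (1 / 2) *\<^sub>R (A (z + (h, 0)) - A z))" by (rule split)
   then show ?thesis by (cases "z \<in> S") simp_all
  qed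
  have "(LBINT z. indicator S z * (J (z + (\<sigma>, 0)) \<bullet> Qh e h z))
    = (LBINT z. indicator S z * (J z \<bullet> (P e z + A z))) + (LBINT z. ?X z \<bullet> Qh e h z) + (LBINT z. J z \<bullet> ?Y z)"
   unfolding pt using iJ iQ iY by (simp only: Bochner_Integration.integral_add Bochner_Integration.integrable_add)
  moreover have "\<bar>LBINT z. ?X z \<bullet> Qh e h z\<bar> <= sqrt (\<nu> * B1)" by (rule order_trans[OF L2_inner(2)[OF X(1) Qh_sq(1)[OF e]]])
    (use X(2) Qh_sq(2)[OF e, of h] \<nu> in \<open>auto simp: B1_def L2_sqnorm_nonneg intro!: mult_mono\<close>)
  moreover have "\<bar>LBINT z. J z \<bullet> ?Y z\<bar> <= sqrt (B2 * (3 * \<nu>))" by (rule order_trans[OF L2_inner(2)[OF J_sq Y(1)]])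
    (use Y(2) in \<open>auto simp: B2_def L2_sqnorm_nonneg intro!: mult_mono\<close>)
  ultimately show "\<bar>(LBINT z. indicator S z * (J (z + (\<sigma>, 0)) \<bullet> Qh e h z)) - (LBINT z. indicator S z * (J z \<bullet> (P e z + A z)))\<bar> <= \<eta>"
   using small by linarith
 qed (use d1 d2 d3 in auto)
qed

end

context dissipative_flow
begin

text \<open>A product of norms is at most the sum of their squares, and L2 norms are invariant under
  time shifts. This justifies exchanging the integrals over \<sigma> and over space-time.\<close>

lemma shifted_integrable:
 fixes h :: real and S :: "(real \<times> 'a) set"
 assumes e: "0 < e" and S: "S \<in> sets borel"
 defines "\<Theta> \<equiv> %\<sigma> z. indicator {0<..h} \<sigma> * (indicator S z * (J (z + (\<sigma>, 0)) \<bullet> Qh e h z))"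
 shows "integrable (lborel \<Otimes>\<^sub>M lborel) (%(\<sigma>, z). \<Theta> \<sigma> z)"
proof (rule integrableI_bounded)
 have 1: "(%w. snd w + (fst w, 0)) \<in> borel_measurable (borel :: (real \<times> real \<times> 'a) measure)"
  by (intro borel_measurable_continuous_onI continuous_intros)
 have 2: "(snd :: real \<times> real \<times> 'a => _) \<in> borel_measurable borel" "(fst :: real \<times> real \<times> 'a => _) \<in> borel_measurable borel"
  by (intro borel_measurable_continuous_onI continuous_intros)+
 have Qm: "Qh e h \<in> borel_measurable borel" by (rule square_integrable_measurable[OF Qh_sq(1)[OF e]])
 have "(%w. \<Theta> (fst w) (snd w)) \<in> borel_measurable borel" unfolding \<Theta>_def
  by (intro borel_measurable_times borel_measurable_inner measurable_compose[OF 1 J_meas] measurable_compose[OF 2(1) Qm]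
    measurable_compose[OF 2(1) borel_measurable_indicator] measurable_compose[OF 2(2) borel_measurable_indicator]) (use S in auto)
 then show m: "(%(\<sigma>, z). \<Theta> \<sigma> z) \<in> borel_measurable (lborel \<Otimes>\<^sub>M lborel)"
  unfolding lborel_prod by (simp add: case_prod_beta')
 have m2: "(%z. (norm (J z))\<^sup>2) \<in> borel_measurable borel" "(%z. (norm (Qh e h z))\<^sup>2) \<in> borel_measurable borel"
  using J_meas Qm by measurable
 let ?B = "L2_sqnorm J + L2_sqnorm (Qh e h)"
 have "(LBNN z. ennreal (norm (\<Theta> \<sigma> z))) <= ennreal ?B * indicator {0<..h} \<sigma>" for \<sigma>
 proof (cases "\<sigma> \<in> {0<..h}")
  case True
  have "(LBNN z. ennreal (norm (\<Theta> \<sigma> z))) <= (LBNN z. ennreal ((norm (J (z + (\<sigma>, 0))))\<^sup>2) + ennreal ((norm (Qh e h z))\<^sup>2))"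
  proof (rule nn_integral_mono)
   fix z
   let ?a = "norm (J (z + (\<sigma>, 0)))" and ?b = "norm (Qh e h z)"
   have "norm (\<Theta> \<sigma> z) <= \<bar>J (z + (\<sigma>, 0)) \<bullet> Qh e h z\<bar>" by (simp add: \<Theta>_def indicator_def)
   also have "\<dots> <= ?a * ?b" by (rule Cauchy_Schwarz_ineq2)
   also have "\<dots> <= ?a\<^sup>2 + ?b\<^sup>2"
   proof -
    have "2 * (?a * ?b) <= ?a\<^sup>2 + ?b\<^sup>2" using zero_le_power2[of "?a - ?b"] by (simp add: power2_eq_square algebra_simps)
    moreover have "0 <= ?a * ?b" by simp
    ultimately show ?thesis by linarith
   qed
   finally have "ennreal (norm (\<Theta> \<sigma> z)) <= ennreal (?a\<^sup>2 + ?b\<^sup>2)" by (rule ennreal_leI)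
   then show "ennreal (norm (\<Theta> \<sigma> z)) <= ennreal (?a\<^sup>2) + ennreal (?b\<^sup>2)" by simp
  qed
  also have "\<dots> = (LBNN z. ennreal ((norm (J (z + (\<sigma>, 0))))\<^sup>2)) + (LBNN z. ennreal ((norm (Qh e h z))\<^sup>2))"
   using measurable_compose[OF Qm borel_measurable_norm]
    measurable_compose[OF square_integrable_measurable[OF time_shift_L2(1)[OF J_sq, of \<sigma>]] borel_measurable_norm]
   by (intro nn_integral_add measurable_compose[OF _ measurable_ennreal] borel_measurable_power) simp_all
  also have "\<dots> = ennreal ?B"
   using nn_L2_sqnorm[OF time_shift_L2(1)[OF J_sq, of \<sigma>]] nn_L2_sqnorm[OF Qh_sq(1)[OF e, of h]] time_shift_L2(2)[OF J_sq, of \<sigma>]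
   by (simp add: L2_sqnorm_nonneg)
  finally show ?thesis using True by simp
 qed (simp add: \<Theta>_def)
 then have "(LBNN \<sigma>. (LBNN z. ennreal (norm (\<Theta> \<sigma> z)))) <= (LBNN \<sigma>. ennreal ?B * indicator {0<..h} \<sigma>)"
  by (intro nn_integral_mono)
 also have "\<dots> = ennreal ?B * emeasure lborel {0<..h}" by (rule nn_integral_cmult_indicator) simp
 also have "\<dots> < \<infinity>" by (cases "0 <= h") (auto simp: ennreal_mult_less_top)
 also have "(LBNN \<sigma>. (LBNN z. ennreal (norm (\<Theta> \<sigma> z))))
   = (\<integral>\<^sup>+w. ennreal (norm (case w of (\<sigma>, z) => \<Theta> \<sigma> z)) \<partial>(lborel \<Otimes>\<^sub>M lborel))"
  using lborel.nn_integral_fst[of "%w. ennreal (norm (case w of (\<sigma>, z) => \<Theta> \<sigma> z))" lborel] m by simp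
 finally show "(\<integral>\<^sup>+w. ennreal (norm (case w of (\<sigma>, z) => \<Theta> \<sigma> z)) \<partial>(lborel \<Otimes>\<^sub>M lborel)) < \<infinity>" .
qed

lemma AE_J_time_integrable: "AE x in lborel. integrable lborel (%s. J (s, x))"
proof -
 have "integrable (lborel \<Otimes>\<^sub>M lborel) (%(s, x). J (s, x))"
  unfolding lborel_prod using J_integrable by (simp add: case_prod_beta')
 from lborel_pair.AE_integrable_snd[OF this] show ?thesis .
qed

lemma Jint_shift:
 assumes i: "integrable lborel (%s. J (s, x))"
 shows "Jint t (t + h) x \<bullet> u = (LBINT \<sigma>. indicator {0<..h} \<sigma> * (J ((t, x) + (\<sigma>, 0)) \<bullet> u))"
proof -
 have ii: "integrable lborel (%s. indicator {t<..t+h} s *\<^sub>R J (s, x))" by (rule integrable_mult_indicator[OF _ i]) simp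
 have "Jint t (t + h) x \<bullet> u = (LBINT s. (indicator {t<..t+h} s *\<^sub>R J (s, x)) \<bullet> u)"
  unfolding Jint_def by (rule integral_inner_left[symmetric]) (rule ii)
 also have "\<dots> = (LBINT \<sigma>. (indicator {t<..t+h} (t + 1 * \<sigma>) *\<^sub>R J (t + 1 * \<sigma>, x)) \<bullet> u)"
  using lborel_integral_real_affine[of 1 "%s. (indicator {t<..t+h} s *\<^sub>R J (s, x)) \<bullet> u" t] by simp
 also have "\<dots> = (LBINT \<sigma>. indicator {0<..h} \<sigma> * (J ((t, x) + (\<sigma>, 0)) \<bullet> u))"
  by (intro bochner_cong) (auto simp: indicator_def)
 finally show ?thesis .
qed

text \<open>The step inequality from \<open>t\<close> to \<open>t + h\<close> is integrated over
  \<open>t\<close> in \<open>{a<..b}\<close>. On the left the energies telescope; on the right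
  \<open>Jint t (t + h)\<close> is the integral of the flux at time \<open>t + \<sigma>\<close> over
  \<sigma> in \<open>{0<..h}\<close>, and Fubini moves this integral outside.\<close>

lemma averaged_inequality:
 assumes e: "0 < e" and ab: "0 < a" "a < b" "0 < h" "b + h < T"
 defines "S \<equiv> {a<..b} \<times> ball (0::'a) R"
 shows "(LBINT t. indicator {b<..b+h} t * FE e t) - (LBINT t. indicator {a<..a+h} t * FE e t)
  <= - (LBINT \<sigma>. indicator {0<..h} \<sigma> * (LBINT z. indicator S z * (J (z + (\<sigma>, 0)) \<bullet> Qh e h z)))"
proof -
 have Sm: "S \<in> sets borel" unfolding S_def by (simp add: borel_prod[symmetric])
 let ?\<Theta> = "%\<sigma> z. indicator {0<..h} \<sigma> * (indicator S z * (J (z + (\<sigma>, 0)) \<bullet> Qh e h z))"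
 let ?g = "%z. LBINT \<sigma>. ?\<Theta> \<sigma> z"
 note pair = shifted_integrable[OF e Sm, of h]
 have gi: "integrable lborel ?g" by (rule lborel_pair.integrable_snd[OF pair])
 have gi2: "integrable (lborel \<Otimes>\<^sub>M lborel) (%(t, x). ?g (t, x))"
  unfolding lborel_prod using gi by (simp only: case_prod_beta' prod.collapse)
 have g1: "integrable lborel (%t. LBINT x. ?g (t, x))" by (rule lborel_pair.integrable_fst[OF gi2])
 have g2: "(LBINT t. (LBINT x. ?g (t, x))) = (LBINT z. ?g z)"
  using lborel_pair.integral_fst[OF gi2] unfolding lborel_prod by (simp only: case_prod_beta' prod.collapse)
 have g3: "(LBINT z. ?g z) = (LBINT \<sigma>. (LBINT z. ?\<Theta> \<sigma> z))" by (rule lborel_pair.Fubini_integral[OF pair])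
 \<comment> \<open>The step inequality needs both \<open>t\<close> and \<open>t + h\<close> to be
   good; translates of null sets are null sets.\<close>
 have good2: "AE t in lborel. t + h \<in> {0<..<T} --> good (t + h)"
 proof -
  have "AE t in distr lborel borel ((+) h). t \<in> {0<..<T} --> good t" using AE_good by (simp only: lborel_distr_plus)
  then have "AE t in lborel. h + t \<in> {0<..<T} --> good (h + t)" by (rule AE_distrD[rotated]) simp
  then show ?thesis by (simp add: add.commute)
 qed
 have "(LBINT t. indicator {a<..b} t * (FE e (t + h) - FE e t)) <= (LBINT t. - (LBINT x. ?g (t, x)))"
 proof (rule integral_mono_AE)
  show "integrable lborel (%t. indicator {a<..b} t * (FE e (t + h) - FE e t))" using ab by (intro FE_shift(1)[OF e]) auto
  show "integrable lborel (%t. - (LBINT x. ?g (t, x)))" using g1 by simp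
  show "AE t in lborel. indicator {a<..b} t * (FE e (t + h) - FE e t) <= - (LBINT x. ?g (t, x))" using AE_good good2
  proof eventually_elim
   case (elim t)
   show ?case
   proof (cases "t \<in> {a<..b}")
    case False
    then have g0: "?g (t, x) = 0" for x by (simp only: S_def indicator_def mem_Times_iff fst_conv) simp
    show ?thesis using False unfolding g0 by simp
   next
    case True
    then have gt: "good t" "good (t + h)" using elim ab by auto
    have "FE e (t + h) - FE e t <= - (LBINT x. Jint t (t + h) x \<bullet> (P e (t + h, x) + (1 / 2) *\<^sub>R (A (t, x) + A (t + h, x))))"
     using ab by (intro step_inequality[OF gt _ e]) auto
    also have "(LBINT x. Jint t (t + h) x \<bullet> (P e (t + h, x) + (1 / 2) *\<^sub>R (A (t, x) + A (t + h, x)))) = (LBINT x. ?g (t, x))"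
    proof (rule integral_cong_AE)
     have Qe: "Qh e h (t, x) = P e (t + h, x) + (1 / 2) *\<^sub>R (A (t, x) + A (t + h, x))" for x by (simp add: Qh_def)
     show "(%x. Jint t (t + h) x \<bullet> (P e (t + h, x) + (1 / 2) *\<^sub>R (A (t, x) + A (t + h, x)))) \<in> borel_measurable lborel"
      using Jint_meas section_measurable(1)[OF square_integrable_measurable[OF Qh_sq(1)[OF e, of h]], of t] unfolding Qe by simp
     show "(%x. ?g (t, x)) \<in> borel_measurable lborel" using section_measurable(1)[of ?g t] gi by simp
     show "AE x in lborel. Jint t (t + h) x \<bullet> (P e (t + h, x) + (1 / 2) *\<^sub>R (A (t, x) + A (t + h, x))) = ?g (t, x)"
      using AE_J_time_integrable
     proof eventually_elim
      case (elim x)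
      have "?\<Theta> \<sigma> (t, x) = indicator {0<..h} \<sigma> * (J ((t, x) + (\<sigma>, 0)) \<bullet> Qh e h (t, x))" for \<sigma>
       using True by (cases "x \<in> ball 0 R") (simp_all add: S_def J_zero)
      then have "(LBINT \<sigma>. ?\<Theta> \<sigma> (t, x)) = (LBINT \<sigma>. indicator {0<..h} \<sigma> * (J ((t, x) + (\<sigma>, 0)) \<bullet> Qh e h (t, x)))"
       by (simp only:)
      then show ?case unfolding Qe[symmetric] Jint_shift[OF elim] by (simp only:)
     qed
    qed
    finally show ?thesis using True by simp
   qed
  qed
 qed
 also have "\<dots> = - (LBINT \<sigma>. (LBINT z. ?\<Theta> \<sigma> z))" using g2 g3 by simp
 finally show ?thesis using FE_shift(2)[OF e, of a b h] ab by simp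
qed

text \<open>The averaged inequality is divided by \<open>h\<close>, and \<open>h\<close> is sent to
  0: the averages at the ends tend to the energies at \<open>b\<close> and \<open>a\<close> by
  continuity, and the right-hand side tends to the pairing without shifts. The tolerance \<eta> is
  shared equally among these three limits.\<close>

lemma energy_dissipation:
 assumes e: "0 < e" and ab: "0 < a" "a < b" "b < T"
 defines "S \<equiv> {a<..b} \<times> ball (0::'a) R"
 shows "FE e b - FE e a <= - (LBINT z. indicator S z * (J z \<bullet> (P e z + A z)))"
proof (rule field_le_epsilon)
 let ?I = "LBINT z. indicator S z * (J z \<bullet> (P e z + A z))"
 fix \<eta> :: real assume \<eta>: "0 < \<eta>"
 have Sm: "S \<in> sets borel" unfolding S_def by (simp add: borel_prod[symmetric])
 have Sb: "bounded S" unfolding S_def by (intro bounded_Times) auto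
 obtain \<delta>1 where d1: "0 < \<delta>1" "!!\<sigma> h. \<bar>\<sigma>\<bar> < \<delta>1 ==> \<bar>h\<bar> < \<delta>1 ==>
  \<bar>(LBINT z. indicator S z * (J (z + (\<sigma>, 0)) \<bullet> Qh e h z)) - ?I\<bar> <= \<eta> / 3"
  by (rule shifted_pairing[OF e Sb Sm, of "\<eta> / 3"]) (use \<eta> in auto)
 have near: "\<exists>d>0. \<forall>t\<in>{0..T}. dist t s < d --> dist (FE e t) (FE e s) < \<eta> / 3" if "s \<in> {0..T}" for s
 proof -
  have "0 < \<eta> / 3" using \<eta> by simp
  then show ?thesis using FE_continuous[OF e] that unfolding continuous_on_iff by blast
 qed
 obtain da where da: "0 < da" "!!t. t \<in> {0..T} ==> dist t a < da ==> dist (FE e t) (FE e a) < \<eta> / 3"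
  using near[of a] ab by auto
 obtain db where db: "0 < db" "!!t. t \<in> {0..T} ==> dist t b < db ==> dist (FE e t) (FE e b) < \<eta> / 3"
  using near[of b] ab by auto
 \<comment> \<open>Half of the minimum is strictly below all moduli of continuity, and it keeps
   \<open>b + h\<close> below \<open>T\<close>.\<close>
 define h where "h = min (min \<delta>1 (T - b)) (min da db) / 2"
 have h: "0 < h" "h < \<delta>1" "b + h < T" "h < da" "h < db"
 proof -
  define \<mu> where "\<mu> = min (min \<delta>1 (T - b)) (min da db)"
  have "0 < \<mu>" "\<mu> <= \<delta>1" "\<mu> <= T - b" "\<mu> <= da" "\<mu> <= db" "h = \<mu> / 2"
   using d1 da db ab by (auto simp: \<mu>_def h_def)
  then show "0 < h" "h < \<delta>1" "b + h < T" "h < da" "h < db" by linarith+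
 qed
 have i\<sigma>: "integrable lborel (%\<sigma>. indicator {0<..h} \<sigma> * (LBINT z. indicator S z * (J (z + (\<sigma>, 0)) \<bullet> Qh e h z)))"
  using lborel_pair.integrable_fst[OF shifted_integrable[OF e Sm, of h]] by simp
 have "h * (FE e b - \<eta> / 3) = (LBINT t. indicator {b<..b+h} t * (FE e b - \<eta> / 3))" using h by (simp only: integral_Ioc_const less_imp_le)
 also have "\<dots> <= (LBINT t. indicator {b<..b+h} t * FE e t)"
 proof (rule integral_mono[OF integral_Ioc_const(2) FE_integrable[OF e]])
  fix t
  show "indicator {b<..b+h} t * (FE e b - \<eta> / 3) <= indicator {b<..b+h} t * FE e t"
  proof (cases "t \<in> {b<..b+h}")
   case True
   then have "dist (FE e t) (FE e b) < \<eta> / 3" using h ab by (intro db(2)) (auto simp: dist_real_def)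
   then have "FE e b - \<eta> / 3 <= FE e t" unfolding dist_real_def by linarith
   then show ?thesis using True by simp
  qed simp
 qed (use h ab in auto)
 finally have B: "h * (FE e b - \<eta> / 3) <= (LBINT t. indicator {b<..b+h} t * FE e t)" .
 have "(LBINT t. indicator {a<..a+h} t * FE e t) <= (LBINT t. indicator {a<..a+h} t * (FE e a + \<eta> / 3))"
 proof (rule integral_mono[OF FE_integrable[OF e] integral_Ioc_const(2)])
  fix t
  show "indicator {a<..a+h} t * FE e t <= indicator {a<..a+h} t * (FE e a + \<eta> / 3)"
  proof (cases "t \<in> {a<..a+h}")
   case True
   then have "dist (FE e t) (FE e a) < \<eta> / 3" using h ab by (intro da(2)) (auto simp: dist_real_def)
   then have "FE e t <= FE e a + \<eta> / 3" unfolding dist_real_def by linarith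
   then show ?thesis using True by simp
  qed simp
 qed (use h ab in auto)
 also have "\<dots> = h * (FE e a + \<eta> / 3)" using h by (simp only: integral_Ioc_const less_imp_le)
 finally have A: "(LBINT t. indicator {a<..a+h} t * FE e t) <= h * (FE e a + \<eta> / 3)" .
 have "h * (?I - \<eta> / 3) = (LBINT \<sigma>. indicator {0<..0+h} \<sigma> * (?I - \<eta> / 3))"
  using h by (simp only: integral_Ioc_const less_imp_le)
 also have "\<dots> <= (LBINT \<sigma>. indicator {0<..h} \<sigma> * (LBINT z. indicator S z * (J (z + (\<sigma>, 0)) \<bullet> Qh e h z)))"
 proof (rule integral_mono[OF integral_Ioc_const(2) i\<sigma>])
  fix \<sigma>
  show "indicator {0<..0+h} \<sigma> * (?I - \<eta> / 3) <= indicator {0<..h} \<sigma> * (LBINT z. indicator S z * (J (z + (\<sigma>, 0)) \<bullet> Qh e h z))"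
  proof (cases "\<sigma> \<in> {0<..h}")
   case True
   then have "\<bar>(LBINT z. indicator S z * (J (z + (\<sigma>, 0)) \<bullet> Qh e h z)) - ?I\<bar> <= \<eta> / 3"
    using h by (intro d1(2)) auto
   then have "?I - \<eta> / 3 <= (LBINT z. indicator S z * (J (z + (\<sigma>, 0)) \<bullet> Qh e h z))" by linarith
   then show ?thesis using True by simp
  qed simp
 qed
 finally have I: "h * (?I - \<eta> / 3) <= (LBINT \<sigma>. indicator {0<..h} \<sigma> * (LBINT z. indicator S z * (J (z + (\<sigma>, 0)) \<bullet> Qh e h z)))" .
 have "h * (FE e b - \<eta> / 3) - h * (FE e a + \<eta> / 3) <= - (h * (?I - \<eta> / 3))"
 proof -
  have lin: "x - y <= - z" if "p - p' <= - i" "x <= p" "p' <= y" "z <= i" for x y z p p' i :: real using that by linarith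
  show ?thesis by (rule lin[OF averaged_inequality[OF e ab(1,2) h(1,3), folded S_def] B A I])
 qed
 then have "h * (FE e b - FE e a) <= h * (- ?I + \<eta>)" by (simp add: algebra_simps)
 then show "FE e b - FE e a <= - ?I + \<eta>" using h(1) by simp
qed

end

text \<open>Formally the energy with entropy density \<open>s powr m / (m - 1)\<close>. Taking it as
  an infimum over \<open>e = 1 / (n + 1)\<close> keeps the argument within the regularised energies,
  which decrease along this sequence and are bounded below.\<close>

definition limit_energy :: "real => ('a::euclidean_space => real) => ('a \<times> 'a => real) => ('a => real) => real" where
 "limit_energy m V K f = (INF n. free_energy m V K (inverse (real (Suc n))) f)"

lemma limit_energy:
 fixes V :: "'a::euclidean_space => real"
 assumes m: "0 < m" "m < 1"
  and V: "V \<in> borel_measurable borel" "!!x. 0 <= V x" "!!x. V x <= C"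
  and K: "K \<in> borel_measurable borel" "!!z. 0 <= K z" "!!z. K z <= C" "!!x y. K (x, y) = K (y, x)"
  and f: "integrable lborel f" "!!x. 0 <= f x" "!!x. x \<notin> ball 0 R ==> f x = 0"
 shows "(%n. free_energy m V K (inverse (real (Suc n))) f) \<longlonglongrightarrow> limit_energy m V K f"
  "- ((measure lborel (ball (0::'a) R) + (LBINT x. f x)) / (1 - m)) <= limit_energy m V K f"
proof -
 have lb: "- ((measure lborel (ball (0::'a) R) + (LBINT x. f x)) / (1 - m)) <= free_energy m V K (inverse (real (Suc n))) f" for n
  by (rule free_energy_lower_bound[OF m _ V K f]) simp
 show lim: "(%n. free_energy m V K (inverse (real (Suc n))) f) \<longlonglongrightarrow> limit_energy m V K f" unfolding limit_energy_def
 proof (rule LIMSEQ_decseq_INF)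
  show "bdd_below (range (%n. free_energy m V K (inverse (real (Suc n))) f))" using lb by (intro bdd_belowI2)
  show "decseq (%n. free_energy m V K (inverse (real (Suc n))) f)" unfolding decseq_Suc_iff
   by (intro allI free_energy_mono_eps[OF m _ _ V K f(1,2)]) (auto intro!: le_imp_inverse_le)
 qed
 show "- ((measure lborel (ball (0::'a) R) + (LBINT x. f x)) / (1 - m)) <= limit_energy m V K f"
  by (rule LIMSEQ_le_const[OF lim]) (use lb in blast)
qed

section \<open>Flux bound and vanishing regularisation\<close>

context dissipative_flow
begin

text \<open>For almost every time the slice of \<open>q\<close> carries the conserved mass.\<close>

lemma integral_q_cylinder:
 assumes ab: "0 < a" "a < b" "b < T"
 shows "integrable lborel (%z. indicator ({a<..b} \<times> ball (0::'a) R) z * q z)"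
  "(LBINT z. indicator ({a<..b} \<times> ball (0::'a) R) z * q z) = (b - a) * mass"
proof -
 let ?S = "{a<..b} \<times> ball (0::'a) R"
 have Sm: "?S \<in> sets borel" by (simp add: borel_prod[symmetric])
 have Sb: "bounded ?S" by (intro bounded_Times) auto
 show i: "integrable lborel (%z. indicator ?S z * q z)"
 proof (rule square_integrable_imp_integrable[where S = ?S, OF square_integrable_bounded[where S = ?S and C = N]])
  show "(%z. indicator ?S z * q z) \<in> borel_measurable borel"
   using Sm q_meas by (intro borel_measurable_times borel_measurable_indicator)
  show "norm (indicator ?S z * q z) <= N" for z using q_nonneg[of z] q_le[of z] N_nonneg by (auto simp: indicator_def)
 qed (use Sm Sb in auto)
 have i2: "integrable (lborel \<Otimes>\<^sub>M lborel) (%(t, x). indicator ?S (t, x) * q (t, x))"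
  unfolding lborel_prod using i by (simp only: case_prod_beta' prod.collapse)
 have "(LBINT z. indicator ?S z * q z) = (LBINT t. (LBINT x. indicator ?S (t, x) * q (t, x)))"
  using lborel_pair.integral_fst[OF i2] unfolding lborel_prod by (simp only: case_prod_beta' prod.collapse)
 also have "\<dots> = (LBINT t. indicator {a<..b} t * mass)"
 proof (rule integral_cong_AE)
  show "(%t. LBINT x. indicator ?S (t, x) * q (t, x)) \<in> borel_measurable lborel"
   by (rule borel_measurable_integrable[OF lborel_pair.integrable_fst[OF i2]])
  show "AE t in lborel. (LBINT x. indicator ?S (t, x) * q (t, x)) = indicator {a<..b} t * mass" using q_r
  proof eventually_elim
   case (elim t)
   show ?case
   proof (cases "t \<in> {a<..b}")
    case True
    then have ae: "AE x in lborel. q (t, x) = r t x" using elim ab by auto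
    have "(LBINT x. indicator ?S (t, x) * q (t, x)) = (LBINT x. q (t, x))" using True q_zero by (intro bochner_cong) (auto simp: indicator_def)
    also have "\<dots> = (LBINT x. r t x)" using section_measurable(1)[OF q_meas] r_int[of t] True ab ae by (intro integral_cong_AE) auto
    finally show ?thesis using True ab by (simp add: mass_conserved)
   next
    case False
    then have z: "indicator ?S (t, x) * q (t, x) = 0" for x by (auto simp: indicator_def)
    show ?thesis using False unfolding z by simp
   qed
  qed
 qed simp
 also have "\<dots> = (b - a) * mass" using ab by simp
 finally show "(LBINT z. indicator ?S z * q z) = (b - a) * mass" .
qed

text \<open>With \<open>w\<close> the regularised density and \<open>\<alpha> = 1 / w\<close>, the
  norm of the flux factors as \<open>(sqrt \<alpha> * norm J) * sqrt w\<close>. The pointwise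
  dissipation estimate bounds the square integral of the first factor by the energy drop, and that
  of the second is the mass, both up to order \<open>e\<close>. The constant \<open>c\<close> is the
  one in the bound for the excess of \<open>w\<close> over \<open>q\<close>.\<close>

lemma regularized_flux_bound:
 assumes e: "0 < e" "e <= 1" and ab: "0 < a" "a < b" "b < T"
 defines "S \<equiv> {a<..b} \<times> ball (0::'a) R" and "c \<equiv> 1 / m * (N powr m + 1) powr (1 / m - 1)"
 shows "FE e b <= FE e a + e * (c * L2_sqnorm A / 2)"
  "(LBINT z. indicator S z * norm (J z))\<^sup>2 <=
    (2 * (FE e a - FE e b) + e * (c * L2_sqnorm A)) * ((b - a) * mass + e * (c * measure lborel S))"
proof -
 have Sm: "S \<in> sets borel" unfolding S_def by (simp add: borel_prod[symmetric])
 have Sb: "bounded S" unfolding S_def by (intro bounded_Times) auto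
 have iS: "integrable lborel (indicator S :: _ => real)" by (rule integrable_indicator_bounded[OF Sb Sm])
 define w where "w z = (q z powr m + e) powr (1 / m)" for z
 define \<alpha> where "\<alpha> z = (q z powr m + e) powr (- 1 / m)" for z
 have pos: "0 < q z powr m + e" for z using e q_nonneg[of z] by (simp add: add_nonneg_pos)
 have wpos: "0 < w z" and \<alpha>pos: "0 < \<alpha> z" and \<alpha>w: "\<alpha> z = 1 / w z" for z
  using pos[of z] by (auto simp: w_def \<alpha>_def powr_minus_divide)
 have wle: "q z <= w z" "w z - q z <= e * c" for z unfolding w_def c_def using add_powr_diff_le[OF m e q_nonneg q_le] by auto
 have c0: "0 <= c" using m by (simp add: c_def)
 have wm: "w \<in> borel_measurable borel" and \<alpha>m: "\<alpha> \<in> borel_measurable borel"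
  unfolding w_def[abs_def] \<alpha>_def[abs_def] using q_meas by measurable
 have wN: "w z <= N + e * c" for z using wle(2)[of z] q_le[of z] by linarith
 have \<alpha>le: "\<alpha> z <= e powr (- 1 / m)" for z unfolding \<alpha>_def using m e by (intro powr_mono2') (auto simp: divide_le_0_iff)
 define u where "u z = indicator S z * (sqrt (\<alpha> z) * norm (J z))" for z
 define v where "v z = indicator S z * sqrt (w z)" for z
 have u_sq: "square_integrable u"
 proof (rule square_integrable_bound(1)[OF J_sq, of _ "sqrt (e powr (- 1 / m))"])
  show "u \<in> borel_measurable borel" unfolding u_def[abs_def] using Sm \<alpha>m measurable_compose[OF J_meas borel_measurable_norm]
   by (intro borel_measurable_times borel_measurable_indicator measurable_compose[OF _ borel_measurable_sqrt])
  show "norm (u z) <= sqrt (e powr (- 1 / m)) * norm (J z)" for z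
   using \<alpha>le[of z] \<alpha>pos[of z] by (auto simp: u_def indicator_def intro!: mult_right_mono)
 qed
 have v_sq: "square_integrable v"
 proof (rule square_integrable_bounded[where S = S and C = "sqrt (N + e * c)"])
  show "v \<in> borel_measurable borel"
   unfolding v_def[abs_def] using Sm wm by (intro borel_measurable_times borel_measurable_indicator measurable_compose[OF _ borel_measurable_sqrt])
  have "0 <= N + e * c" using N_nonneg e c0 by simp
  then show "norm (v z) <= sqrt (N + e * c)" for z using wN[of z] wpos[of z] by (auto simp: v_def indicator_def)
 qed (use Sm Sb in \<open>auto simp: v_def\<close>)
 have iJ: "integrable lborel (%z. indicator S z * (J z \<bullet> (P e z + A z)))"
  using integrable_mult_indicator[OF _ L2_inner(1)[OF J_sq square_integrable_add(1)[OF P_sq[OF e(1)] A_sq]], of S] Sm by simp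
 have iA: "integrable lborel (%z. (norm (A z))\<^sup>2)" by (rule square_integrableD[OF A_sq])
 \<comment> \<open>The factor 2 undoes the one half of the pointwise estimate, and
   \<open>w - q <= e * c\<close> turns its error into a multiple of the squared norm of the
   drift.\<close>
 have "L2_sqnorm u <= (LBINT z. 2 * (indicator S z * (J z \<bullet> (P e z + A z))) + e * c * (norm (A z))\<^sup>2)" unfolding L2_sqnorm_def
 proof (rule integral_mono[OF square_integrableD[OF u_sq]])
  show "integrable lborel (%z. 2 * (indicator S z * (J z \<bullet> (P e z + A z))) + e * c * (norm (A z))\<^sup>2)" using iJ iA by simp
  fix z
  show "(norm (u z))\<^sup>2 <= 2 * (indicator S z * (J z \<bullet> (P e z + A z))) + e * c * (norm (A z))\<^sup>2"
  proof (cases "z \<in> S")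
   case True
   have "1 / 2 * (\<alpha> z * (norm (J z))\<^sup>2) - 1 / 2 * (w z - q z) * (norm (A z))\<^sup>2 <= J z \<bullet> (P e z + A z)"
    using dissipation_pointwise[OF \<alpha>pos[of z] q_nonneg[of z], of "G z" "A z"] wle(1)[of z] wpos[of z]
    unfolding J_eq P_def \<alpha>_def[symmetric] by (simp add: \<alpha>w)
   moreover have "(w z - q z) * (norm (A z))\<^sup>2 <= e * c * (norm (A z))\<^sup>2" by (intro mult_right_mono wle) auto
   moreover have "(norm (u z))\<^sup>2 = \<alpha> z * (norm (J z))\<^sup>2" using True \<alpha>pos[of z] by (simp add: u_def power_mult_distrib)
   ultimately show ?thesis using True by simp
  next
   case False
   then show ?thesis using e c0 by (simp add: u_def)
  qed
 qed
 also have "\<dots> = 2 * (LBINT z. indicator S z * (J z \<bullet> (P e z + A z))) + e * c * L2_sqnorm A" using iJ iA by (simp add: L2_sqnorm_def)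
 also have "\<dots> <= 2 * (FE e a - FE e b) + e * (c * L2_sqnorm A)" using energy_dissipation[OF e(1) ab] unfolding S_def by simp
 finally have U: "L2_sqnorm u <= 2 * (FE e a - FE e b) + e * (c * L2_sqnorm A)" .
 show "FE e b <= FE e a + e * (c * L2_sqnorm A / 2)" using U L2_sqnorm_nonneg[of u] by simp
 have "L2_sqnorm v <= (LBINT z. indicator S z * q z + e * c * indicator S z)" unfolding L2_sqnorm_def
 proof (rule integral_mono[OF square_integrableD[OF v_sq]])
  show "integrable lborel (%z. indicator S z * q z + e * c * indicator S z)" using integral_q_cylinder(1)[OF ab] iS unfolding S_def by simp
  fix z
  show "(norm (v z))\<^sup>2 <= indicator S z * q z + e * c * indicator S z"
   using wle(2)[of z] wpos[of z] by (cases "z \<in> S") (simp_all add: v_def)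
 qed
 also have "\<dots> = (b - a) * mass + e * (c * measure lborel S)" using integral_q_cylinder[OF ab] iS Sm unfolding S_def by simp
 finally have Vb: "L2_sqnorm v <= (b - a) * mass + e * (c * measure lborel S)" .
 have uv: "norm (u z) * norm (v z) = indicator S z * norm (J z)" for z
 proof -
  have "sqrt (\<alpha> z) * sqrt (w z) = 1" using wpos[of z] by (simp add: \<alpha>w real_sqrt_mult[symmetric] del: real_sqrt_mult)
  then have "sqrt (\<alpha> z) * norm (J z) * sqrt (w z) = norm (J z)" by (simp add: mult.commute mult.left_commute)
  then show ?thesis using wpos[of z] \<alpha>pos[of z] by (cases "z \<in> S") (simp_all add: u_def v_def abs_mult)
 qed
 have "(LBINT z. indicator S z * norm (J z))\<^sup>2 <= L2_sqnorm u * L2_sqnorm v" using L2_Cauchy_Schwarz(2)[OF u_sq v_sq] unfolding uv .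
 also have "\<dots> <= (2 * (FE e a - FE e b) + e * (c * L2_sqnorm A)) * ((b - a) * mass + e * (c * measure lborel S))"
  using U Vb L2_sqnorm_nonneg[of u] L2_sqnorm_nonneg[of v] by (intro mult_mono) auto
 finally show "(LBINT z. indicator S z * norm (J z))\<^sup>2 <=
    (2 * (FE e a - FE e b) + e * (c * L2_sqnorm A)) * ((b - a) * mass + e * (c * measure lborel S))" .
qed

lemma Jint_L1_le:
 assumes t: "a <= t" "t <= b"
 shows "(LBINT x. norm (Jint a t x)) <= (LBINT z. indicator ({a<..b} \<times> ball (0::'a) R) z * norm (J z))"
proof -
 have p: "integrable (lborel \<Otimes>\<^sub>M lborel) (%(s, x). indicator {a<..b} s *\<^sub>R norm (J (s, x)))"
  using integrable_norm[OF Jcut_integrable_pair[of a b]] by (simp add: case_prod_beta')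
 have "(LBINT x. norm (Jint a t x)) <= (LBINT x. (LBINT s. indicator {a<..b} s *\<^sub>R norm (J (s, x))))"
 proof (rule integral_mono_AE[OF integrable_norm[OF Jint_integrable] lborel_pair.integrable_snd[OF p]])
  show "AE x in lborel. norm (Jint a t x) <= (LBINT s. indicator {a<..b} s *\<^sub>R norm (J (s, x)))" using AE_J_time_integrable
  proof eventually_elim
   case (elim x)
   have i: "integrable lborel (%s. indicator {c<..d} s *\<^sub>R J (s, x))" for c d :: real
    by (rule integrable_mult_indicator[OF _ elim]) simp
   show ?case unfolding Jint_def
   proof (rule Bochner_Integration.integral_norm_bound_integral[OF i])
    show "integrable lborel (%s. indicator {a<..b} s *\<^sub>R norm (J (s, x)))" using integrable_norm[OF i[of a b]] by simp
    show "norm (indicator {a<..t} s *\<^sub>R J (s, x)) <= indicator {a<..b} s *\<^sub>R norm (J (s, x))" for s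
     using t by (auto simp: indicator_def)
   qed
  qed
 qed
 also have "\<dots> = (\<integral>z. (%(s, x). indicator {a<..b} s *\<^sub>R norm (J (s, x))) z \<partial>(lborel \<Otimes>\<^sub>M lborel))"
  by (rule lborel_pair.integral_snd[OF p])
 also have "\<dots> = (LBINT z. indicator ({a<..b} \<times> ball (0::'a) R) z * norm (J z))" unfolding lborel_prod
 proof (intro bochner_cong refl)
  fix z :: "real \<times> 'a"
  show "(%(s, x). indicator {a<..b} s *\<^sub>R norm (J (s, x))) z = indicator ({a<..b} \<times> ball (0::'a) R) z * norm (J z)"
   by (cases z, cases "snd z \<in> ball 0 R") (auto simp: indicator_def J_zero)
 qed
 finally show ?thesis .
qed

abbreviation "E t \<equiv> limit_energy m V K (r t)"

text \<open>In the limit of vanishing \<open>e\<close> the error terms disappear and the energies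
  converge. The bound for \<open>Jint a t\<close> is uniform in \<open>t\<close>, because it is
  taken from the flux over all of \<open>{a<..b}\<close>.\<close>

lemma energy_controls_flux:
 assumes ab: "0 < a" "a < b" "b < T"
 shows "E b <= E a"
  "a <= t ==> t <= b ==> (LBINT x. norm (Jint a t x)) <= sqrt (2 * (E a - E b) * ((b - a) * mass))"
proof -
 define S where "S = {a<..b} \<times> ball (0::'a) R"
 define c where "c = 1 / m * (N powr m + 1) powr (1 / m - 1)"
 define X where "X = (LBINT z. indicator S z * norm (J z))"
 let ?e = "%n. inverse (real (Suc n))"
 have e0: "?e \<longlonglongrightarrow> 0" by (rule LIMSEQ_inverse_real_of_nat)
 have e: "0 < ?e n" "?e n <= 1" for n by (auto simp: inverse_le_1_iff)
 have la: "(%n. FE (?e n) a) \<longlonglongrightarrow> E a" and lb: "(%n. FE (?e n) b) \<longlonglongrightarrow> E b"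
  using ab by (auto intro!: limit_energy(1)[OF m V(1-3) K, where R = R] r_int r_nonneg r_zero simp del: of_nat_Suc)
 note bd = regularized_flux_bound[OF e ab, folded S_def c_def, folded X_def]
 have ra: "(%n. FE (?e n) a + ?e n * (c * L2_sqnorm A / 2)) \<longlonglongrightarrow> E a + 0 * (c * L2_sqnorm A / 2)"
  by (intro tendsto_intros la e0)
 show "E b <= E a" using LIMSEQ_le[OF lb ra] bd(1) by auto
 assume t: "a <= t" "t <= b"
 have "(%n. (2 * (FE (?e n) a - FE (?e n) b) + ?e n * (c * L2_sqnorm A)) * ((b - a) * mass + ?e n * (c * measure lborel S)))
   \<longlonglongrightarrow> (2 * (E a - E b) + 0 * (c * L2_sqnorm A)) * ((b - a) * mass + 0 * (c * measure lborel S))"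
  by (intro tendsto_intros la lb e0)
 then have "X\<^sup>2 <= (2 * (E a - E b) + 0 * (c * L2_sqnorm A)) * ((b - a) * mass + 0 * (c * measure lborel S))"
  by (rule LIMSEQ_le_const) (intro exI allI impI bd(2))
 then have "X <= sqrt (2 * (E a - E b) * ((b - a) * mass))" by (intro real_le_rsqrt) simp
 then show "(LBINT x. norm (Jint a t x)) <= sqrt (2 * (E a - E b) * ((b - a) * mass))" using Jint_L1_le[OF t] unfolding X_def S_def by linarith
qed

end

section \<open>Representatives and weak gradients\<close>

lemma AE_lebesgue_iff: "(AE x in lebesgue. P x) \<longleftrightarrow> (AE x in lborel. P x)" by (rule AE_completion_iff)

text \<open>All subsets of a Lebesgue null set are measurable, so preimages change only by
  measurable sets.\<close>

lemma lebesgue_measurable_cong_AE: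
 fixes f g :: "'a::euclidean_space => 'b::euclidean_space"
 assumes ae: "AE x in lborel. f x = g x" and f: "f \<in> borel_measurable lebesgue"
 shows "g \<in> borel_measurable lebesgue"
proof -
 obtain N where N: "{x. f x \<noteq> g x} \<subseteq> N" "N \<in> null_sets lborel" using ae by (auto elim!: AE_E simp: null_sets_def)
 have sub: "B \<in> sets lebesgue" if "B \<subseteq> N" for B using sets_completionI_sub[OF _ that] N(2) by blast
 show ?thesis
 proof (rule measurableI)
  fix S :: "'b set" assume S: "S \<in> sets borel"
  have fS: "f -` S \<in> sets lebesgue" using measurable_sets[OF f S] by simp
  have "f x = g x" if "x \<notin> N" for x using N(1) that by auto
  then have eq: "g -` S = (f -` S - N) \<union> (g -` S \<inter> N)" by auto
  have "(f -` S - N) \<union> (g -` S \<inter> N) \<in> sets lebesgue" by (intro sets.Un sets.Diff fS sub) auto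
  then have "g -` S \<in> sets lebesgue" by (simp only: eq[symmetric])
  then show "g -` S \<inter> space lebesgue \<in> sets lebesgue" by simp
 qed simp
qed

text \<open>Measurability and integrability hold for both functions or for neither; a function that
  is not integrable has integral 0 by convention.\<close>

lemma lebesgue_integral_cong_AE:
 fixes f g :: "'a::euclidean_space => 'b::euclidean_space"
 assumes ae: "AE x in lborel. f x = g x"
 shows "integral\<^sup>L lebesgue f = integral\<^sup>L lebesgue g" "integrable lebesgue f \<longleftrightarrow> integrable lebesgue g"
proof -
 have ae': "AE x in lborel. g x = f x" using ae by eventually_elim simp
 have m: "f \<in> borel_measurable lebesgue \<longleftrightarrow> g \<in> borel_measurable lebesgue"
  using lebesgue_measurable_cong_AE[OF ae] lebesgue_measurable_cong_AE[OF ae'] by blast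
 have ae2: "AE x in lebesgue. f x = g x" using ae by (simp only: AE_lebesgue_iff)
 show "integrable lebesgue f \<longleftrightarrow> integrable lebesgue g"
  using integrable_cong_AE[OF _ _ ae2] m borel_measurable_integrable[of lebesgue] by blast
 show "integral\<^sup>L lebesgue f = integral\<^sup>L lebesgue g"
  using integral_cong_AE[OF _ _ ae2] m borel_measurable_integrable[of lebesgue] not_integrable_integral_eq[of lebesgue] by metis
qed

text \<open>The bridge between set integrals with respect to \<open>lebesgue\<close>, in which the
  problem is posed, and Borel functions on the whole space, to which product measures and
  translations apply. The value 0 outside \<open>U\<close> is prescribed everywhere, agreement
  inside only almost everywhere.\<close>

definition borel_rep :: "'a::euclidean_space set => ('a => 'b::euclidean_space) => ('a => 'b) => bool" where
 "borel_rep U f g \<longleftrightarrow> g \<in> borel_measurable borel \<and> (\<forall>x. x \<notin> U --> g x = 0) \<and> (AE x in lborel. x \<in> U --> f x = g x)"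

lemma borel_repD:
 assumes "borel_rep U f g"
 shows "g \<in> borel_measurable borel" "!!x. x \<notin> U ==> g x = 0" "AE x in lborel. x \<in> U --> f x = g x"
 using assms by (auto simp: borel_rep_def)

lemma borel_rep_integral:
 assumes "borel_rep U f g"
 shows "(LINT x:U|lebesgue. f x) = integral\<^sup>L lborel g" "set_integrable lebesgue U f \<longleftrightarrow> integrable lborel g"
proof -
 have ae: "AE x in lborel. indicator U x *\<^sub>R f x = g x" using borel_repD(3)[OF assms]
 proof eventually_elim
  case (elim x)
  then show ?case using borel_repD(2)[OF assms, of x] by (cases "x \<in> U") auto
 qed
 have g: "g \<in> borel_measurable lborel" using borel_repD(1)[OF assms] by simp
 show "(LINT x:U|lebesgue. f x) = integral\<^sup>L lborel g"
  unfolding set_lebesgue_integral_def lebesgue_integral_cong_AE(1)[OF ae] by (rule integral_completion[OF g])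
 show "set_integrable lebesgue U f \<longleftrightarrow> integrable lborel g"
  unfolding set_integrable_def lebesgue_integral_cong_AE(2)[OF ae] by (rule integrable_completion[OF g])
qed

lemma borel_rep_compose:
 assumes f: "borel_rep U f g" and h: "(%x. h x (g x)) \<in> borel_measurable borel" "!!x. x \<notin> U ==> h x 0 = 0"
  and ae: "AE x in lborel. x \<in> U --> k x = h x (f x)"
 shows "borel_rep U k (%x. h x (g x))" unfolding borel_rep_def
proof (intro conjI allI impI h(1))
 show "AE x in lborel. x \<in> U --> k x = h x (g x)" using borel_repD(3)[OF f] ae by eventually_elim auto
qed (simp add: borel_repD(2)[OF f] h(2))

lemma ex_borel_rep:
 fixes f :: "'a::euclidean_space => 'b::euclidean_space"
 assumes f: "set_borel_measurable lebesgue U f" and U: "U \<in> sets borel"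
 obtains g where "borel_rep U f g"
proof -
 let ?f = "%x. indicator U x *\<^sub>R f x"
 have fm: "?f \<in> borel_measurable lebesgue" using f by (simp add: set_borel_measurable_def)
 have "\<exists>g. g \<in> borel_measurable lborel \<and> (AE x in lborel. ?f x \<bullet> b = g x)" for b
  using completion_ex_borel_measurable_real[OF borel_measurable_inner[OF fm borel_measurable_const]] by blast
 then obtain g where g: "!!b. g b \<in> borel_measurable lborel" "!!b. AE x in lborel. ?f x \<bullet> b = g b x" by metis
 have ae: "AE x in lborel. \<forall>b\<in>Basis. ?f x \<bullet> b = g b x" using g(2) by (simp add: AE_ball_countable countable_finite)
 have "borel_rep U f (%x. indicator U x *\<^sub>R (\<Sum>b\<in>Basis. g b x *\<^sub>R b))" unfolding borel_rep_def
 proof (intro conjI allI impI)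
  show "(%x. indicator U x *\<^sub>R (\<Sum>b\<in>Basis. g b x *\<^sub>R b)) \<in> borel_measurable borel" using g(1) U by measurable
  show "AE x in lborel. x \<in> U --> f x = indicator U x *\<^sub>R (\<Sum>b\<in>Basis. g b x *\<^sub>R b)" using ae
  proof eventually_elim
   case (elim x)
   then have "x \<in> U ==> (\<Sum>b\<in>Basis. g b x *\<^sub>R b) = (\<Sum>b\<in>Basis. (f x \<bullet> b) *\<^sub>R b)" by (intro sum.cong) auto
   then show ?case by (auto simp: euclidean_representation)
  qed
 qed auto
 then show ?thesis by (rule that)
qed

text \<open>Values above the essential bound are replaced by 0; this is a change on a null set and
  makes the bound hold everywhere.\<close>

lemma Linf_borel_rep:
 assumes f: "Linf_on U f" and U: "U \<in> sets borel"
 obtains g C where "borel_rep U f g" "0 <= C" "!!x. norm (g x) <= C"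
proof -
 obtain g0 where g0: "borel_rep U f g0" using ex_borel_rep[OF _ U] f unfolding Linf_on_def by blast
 obtain C where C: "AE x in lborel. x \<in> U --> norm (f x) <= C" using f unfolding Linf_on_def AE_lebesgue_iff by blast
 have "borel_rep U f (%x. if norm (g0 x) <= C then g0 x else 0)"
 proof (rule borel_rep_compose[OF g0, of "%_ y. if norm y <= C then y else 0"])
  show "(%x. if norm (g0 x) <= C then g0 x else 0) \<in> borel_measurable borel" using borel_repD(1)[OF g0] by measurable
  show "AE x in lborel. x \<in> U --> f x = (if norm (f x) <= C then f x else 0)" using C by eventually_elim auto
 qed simp
 then show ?thesis by (rule that[of _ "max 0 C"]) auto
qed

text \<open>A null set of the product has null slices for almost every \<open>t\<close>.\<close>

lemma borel_rep_section:
 fixes f :: "'c::euclidean_space \<times> 'a::euclidean_space => 'b::euclidean_space"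
 assumes f: "borel_rep (A \<times> B) f g"
 shows "AE t in lborel. t \<in> A --> borel_rep B (%x. f (t, x)) (%x. g (t, x))"
proof -
 have "AE z in lborel \<Otimes>\<^sub>M lborel. z \<in> A \<times> B --> f z = g z"
  using borel_repD(3)[OF f] by (simp only: lborel_prod)
 then have "AE t in lborel. AE x in lborel. (t, x) \<in> A \<times> B --> f (t, x) = g (t, x)" by (rule lborel_pair.AE_pair)
 then show ?thesis
 proof eventually_elim
  case (elim t)
  show ?case unfolding borel_rep_def
  proof (intro impI conjI allI section_measurable(1)[OF borel_repD(1)[OF f]])
   assume "t \<in> A"
   then show "AE x in lborel. x \<in> B --> f (t, x) = g (t, x)" using elim by auto
  qed (use borel_repD(2)[OF f] in auto)
 qed
qed

section \<open>Weak gradients: invariance under changes on null sets, uniqueness\<close>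

lemma has_weak_pderiv_cong:
 assumes w: "has_weak_pderiv U b f g"
  and ae: "AE x in lborel. x \<in> U --> f x = f' x" "AE x in lborel. x \<in> U --> g x = g' x"
 shows "has_weak_pderiv U b f' g'"
proof -
 have L: "L1_loc U h'" if "L1_loc U h" "AE x in lborel. x \<in> U --> h x = h' x" for h h' :: "'a => real"
  unfolding L1_loc_def L1_on_def set_integrable_def
 proof (intro allI impI)
  fix C assume C: "compact C \<and> C \<subseteq> U"
  have "AE x in lborel. indicator C x *\<^sub>R h x = indicator C x *\<^sub>R h' x"
   using that(2) by eventually_elim (use C in \<open>auto simp: indicator_def\<close>)
  from lebesgue_integral_cong_AE(2)[OF this] show "integrable lebesgue (%x. indicator C x *\<^sub>R h' x)"
   using that(1) C unfolding L1_loc_def L1_on_def set_integrable_def by blast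
 qed
 have I: "(LINT x:U|lebesgue. h x * k x) = (LINT x:U|lebesgue. h' x * k x)"
  if "AE x in lborel. x \<in> U --> h x = h' x" for h h' k :: "'a => real" unfolding set_lebesgue_integral_def
 proof (rule lebesgue_integral_cong_AE(1))
  show "AE x in lborel. indicator U x *\<^sub>R (h x * k x) = indicator U x *\<^sub>R (h' x * k x)"
   using that by eventually_elim (auto simp: indicator_def)
 qed
 show ?thesis using w L[OF _ ae(1)] L[OF _ ae(2)] I[OF ae(1)] I[OF ae(2)] unfolding has_weak_pderiv_def by metis
qed

lemma has_weak_grad_cong:
 assumes w: "has_weak_grad U f G"
  and ae: "AE x in lborel. x \<in> U --> f x = f' x" "AE x in lborel. x \<in> U --> G x = G' x"
 shows "has_weak_grad U f' G'" unfolding has_weak_grad_def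
proof
 fix b :: 'a assume b: "b \<in> Basis"
 show "has_weak_pderiv U b f' (%x. G' x \<bullet> b)"
  by (rule has_weak_pderiv_cong[OF _ ae(1)]) (use w b ae(2) in \<open>auto simp: has_weak_grad_def\<close>)
qed

lemma L1_loc_test_integrable:
 assumes g: "L1_loc U g" and t: "test_fun U \<phi>"
 shows "set_integrable lebesgue U (%x. g x * \<phi> x)"
proof -
 obtain C where C: "compact C" "C \<subseteq> U" "!!x. x \<notin> C ==> \<phi> x = 0" and sm: "smooth_on UNIV \<phi>"
  using t by (auto simp: test_fun_def)
 obtain L where L: "!!x. \<bar>\<phi> x\<bar> <= L" using smooth_compact_support_bounds[OF sm C(1,3)] by metis
 have gi: "integrable lebesgue (%x. indicator C x *\<^sub>R g x)" using g C unfolding L1_loc_def L1_on_def set_integrable_def by blast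
 have "\<phi> \<in> borel_measurable borel" by (intro borel_measurable_continuous_onI smooth_on_continuous_on[OF sm])
 then have \<phi>m: "\<phi> \<in> borel_measurable lebesgue" by (intro measurable_completion) simp
 have "integrable lebesgue (%x. (indicator C x *\<^sub>R g x) * \<phi> x)"
 proof (rule bochner_bound[of _ "%x. L * norm (indicator C x *\<^sub>R g x)"])
  show "(%x. (indicator C x *\<^sub>R g x) * \<phi> x) \<in> borel_measurable lebesgue"
   using borel_measurable_integrable[OF gi] \<phi>m by (rule borel_measurable_times)
  have "norm ((indicator C x *\<^sub>R g x) * \<phi> x) <= L * norm (indicator C x *\<^sub>R g x)" for x
   using mult_right_mono[OF L[of x], of "norm (indicator C x *\<^sub>R g x)"] by (simp add: abs_mult mult.commute)
  moreover have "0 <= L" using L[of 0] by linarith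
  ultimately show "AE x in lebesgue. norm ((indicator C x *\<^sub>R g x) * \<phi> x) <= norm (L * norm (indicator C x *\<^sub>R g x))"
   by (intro AE_I2) (auto simp: abs_mult)
 qed (use gi in simp)
 moreover have "(%x. (indicator C x *\<^sub>R g x) * \<phi> x) = (%x. indicator U x *\<^sub>R (g x * \<phi> x))"
  using C by (force simp: indicator_def)
 ultimately show ?thesis by (simp add: set_integrable_def)
qed

text \<open>The difference of two weak gradients integrates to 0 against every test function, so the
  fundamental lemma applies to each component.\<close>

lemma weak_grad_unique:
 fixes U :: "'a::euclidean_space set"
 assumes U: "open U" and G: "has_weak_grad U f G" "has_weak_grad U f G'"
 shows "AE x in lborel. x \<in> U --> G x = G' x"
proof -
 have "AE x in lborel. x \<in> U --> G x \<bullet> b = G' x \<bullet> b" if b: "b \<in> Basis" for b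
 proof -
  have w: "has_weak_pderiv U b f (%x. G x \<bullet> b)" "has_weak_pderiv U b f (%x. G' x \<bullet> b)"
   using G b by (auto simp: has_weak_grad_def)
  then have L: "L1_loc U (%x. G x \<bullet> b)" "L1_loc U (%x. G' x \<bullet> b)" by (auto simp: has_weak_pderiv_def)
  have "L1_loc U (%x. G x \<bullet> b - G' x \<bullet> b)" using L set_integral_diff(1) unfolding L1_loc_def L1_on_def by blast
  then have "AE x in lebesgue. x \<in> U --> G x \<bullet> b - G' x \<bullet> b = 0"
  proof (rule AE_eq_0_if_test_integrals_eq_0[OF U])
   fix \<phi> :: "'a => real" assume t: "test_fun U \<phi>"
   have "(LINT x:U|lebesgue. (G x \<bullet> b - G' x \<bullet> b) * \<phi> x) =
     (LINT x:U|lebesgue. (G x \<bullet> b) * \<phi> x) - (LINT x:U|lebesgue. (G' x \<bullet> b) * \<phi> x)"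
    using set_integral_diff(2)[OF L1_loc_test_integrable[OF L(1) t] L1_loc_test_integrable[OF L(2) t]] by (simp add: left_diff_distrib)
   also have "\<dots> = 0" using w t unfolding has_weak_pderiv_def by fastforce
   finally show "(LINT x:U|lebesgue. (G x \<bullet> b - G' x \<bullet> b) * \<phi> x) = 0" .
  qed
  then show ?thesis unfolding AE_lebesgue_iff by eventually_elim auto
 qed
 then have "AE x in lborel. \<forall>b\<in>Basis. x \<in> U --> G x \<bullet> b = G' x \<bullet> b"
  by (subst AE_ball_countable) (auto simp: countable_finite)
 then show ?thesis by eventually_elim (auto intro: euclidean_eqI)
qed

text \<open>The choice hidden in \<open>weak_grad\<close> is harmless: the selected field agrees
  almost everywhere with any known weak gradient.\<close>

lemma weak_grad_AE:
 assumes "open U" "has_weak_grad U f G"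
 shows "AE x in lborel. x \<in> U --> weak_grad U f x = G x"
 by (rule weak_grad_unique[OF assms(1) _ assms(2)]) (unfold weak_grad_def, rule someI[where P = "has_weak_grad U f", OF assms(2)])

section \<open>Tensor products of test functions\<close>

lemma smooth_linear_comp:
 fixes f :: "'b::euclidean_space => real" and L :: "'a::euclidean_space => 'b"
 assumes f: "smooth_on UNIV f" and L: "bounded_linear L"
 shows "smooth_on UNIV (%x. f (L x))"
proof -
 let ?S = "{%x. g (L x) |g. smooth_on UNIV g}"
 have der: "((%x. g (L x)) has_derivative (%k. grad g (L x) \<bullet> L k)) (at x)" if "smooth_on UNIV g" for g x
  using diff_chain_at[OF bounded_linear_imp_has_derivative[OF L, of "at x"] smooth_has_derivative_grad[OF that, of "L x"]] by (simp add: o_def)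
 show ?thesis
 proof (rule fun_algebra_smooth[of _ ?S])
  show "(%x. f (L x)) \<in> fun_algebra ?S" using f by (auto intro: fun_algebra.intros)
 next
  fix g x assume "g \<in> ?S"
  then show "g differentiable at x" using der by (auto simp: differentiable_def)
 next
  fix g and b :: 'a assume "g \<in> ?S" "b \<in> Basis"
  then obtain h where h: "g = (%x. h (L x))" "smooth_on UNIV h" by auto
  have "pderiv_at b g = (%x. \<Sum>c\<in>Basis. (L b \<bullet> c) * pderiv_at c h (L x))"
  proof
   fix x
   have "pderiv_at b g x = grad h (L x) \<bullet> L b" unfolding h(1) by (rule pderiv_at_eq[OF der[OF h(2)]])
   also have "\<dots> = (\<Sum>c\<in>Basis. (grad h (L x) \<bullet> c) * (L b \<bullet> c))" by (rule euclidean_inner)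
   also have "\<dots> = (\<Sum>c\<in>Basis. (L b \<bullet> c) * pderiv_at c h (L x))"
    by (intro sum.cong) (auto simp: grad_inner_Basis mult.commute)
   finally show "pderiv_at b g x = (\<Sum>c\<in>Basis. (L b \<bullet> c) * pderiv_at c h (L x))" .
  qed
  moreover have "(%x. (L b \<bullet> c) * pderiv_at c h (L x)) \<in> fun_algebra ?S" if "c \<in> Basis" for c
   by (intro fun_algebra.mult fun_algebra.const fun_algebra.base CollectI exI[of _ "pderiv_at c h"] conjI refl
     smooth_on_pderiv_at[OF h(2) that])
  ultimately show "pderiv_at b g \<in> fun_algebra ?S" by (simp add: fun_algebra_sum)
 qed
qed

lemma smooth_tensor:
 fixes f :: "'a::euclidean_space => real" and g :: "'b::euclidean_space => real"
 assumes f: "smooth_on UNIV f" and g: "smooth_on UNIV g"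
 shows "smooth_on UNIV (%z. f (fst z) * g (snd z))"
  "pderiv_at (u, 0) (%z. f (fst z) * g (snd z)) (x, y) = pderiv_at u f x * g y"
proof -
 show "smooth_on UNIV (%z. f (fst z) * g (snd z))"
  by (intro smooth_mult smooth_linear_comp[OF f] smooth_linear_comp[OF g] bounded_linear_fst bounded_linear_snd)
 have "((%z. f (fst z)) has_derivative (%k. grad f x \<bullet> fst k)) (at (x, y))"
  using diff_chain_at[OF bounded_linear_imp_has_derivative[OF bounded_linear_fst] smooth_has_derivative_grad[OF f], of "(x, y)"]
  by (simp add: o_def)
 moreover have "((%z. g (snd z)) has_derivative (%k. grad g y \<bullet> snd k)) (at (x, y))"
  using diff_chain_at[OF bounded_linear_imp_has_derivative[OF bounded_linear_snd] smooth_has_derivative_grad[OF g], of "(x, y)"]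
  by (simp add: o_def)
 ultimately have "((%z. f (fst z) * g (snd z)) has_derivative (%k. f x * (grad g y \<bullet> snd k) + (grad f x \<bullet> fst k) * g y)) (at (x, y))"
  using has_derivative_mult by fastforce
 then show "pderiv_at (u, 0) (%z. f (fst z) * g (snd z)) (x, y) = pderiv_at u f x * g y"
  by (simp add: pderiv_at_eq pderiv_at_eq[OF smooth_has_derivative_grad[OF f]])
qed

lemma test_fun_tensor:
 assumes f: "test_fun A f" and g: "test_fun B g"
 shows "test_fun (A \<times> B) (%z. f (fst z) * g (snd z))"
proof -
 obtain C D where "compact C" "C \<subseteq> A" "!!x. x \<notin> C ==> f x = 0" "compact D" "D \<subseteq> B" "!!x. x \<notin> D ==> g x = 0"
  using f g unfolding test_fun_def by metis
 then have "compact (C \<times> D)" "C \<times> D \<subseteq> A \<times> B" "!!z. z \<notin> C \<times> D ==> f (fst z) * g (snd z) = 0"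
  by (auto simp: compact_Times mem_Times_iff)
 then show ?thesis using f g smooth_tensor(1) unfolding test_fun_def by blast
qed

lemma grad_cmult:
 fixes g :: "'a::euclidean_space => real"
 assumes "smooth_on UNIV g"
 shows "grad (%y. c * g y) x = c *\<^sub>R grad g x"
proof (rule grad_eqI)
 show "((%y. c * g y) has_derivative (%k. (c *\<^sub>R grad g x) \<bullet> k)) (at x)"
  using has_derivative_mult_right[OF smooth_has_derivative_grad[OF assms, of x], of c] by simp
qed

lemma L1_loc_bounded:
 fixes g :: "'a::euclidean_space => real"
 assumes g: "g \<in> borel_measurable borel" and le: "!!x. \<bar>g x\<bar> <= D"
 shows "L1_loc U g" unfolding L1_loc_def L1_on_def
proof (intro allI impI)
 fix C assume C: "compact C \<and> C \<subseteq> U"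
 then have Cm: "C \<in> sets borel" by (simp add: compact_imp_closed)
 have "borel_rep C g (%x. indicator C x *\<^sub>R g x)" using g Cm by (auto simp: borel_rep_def)
 moreover have "integrable lborel (%x. indicator C x *\<^sub>R g x)"
 proof (rule square_integrable_imp_integrable[where S = C, OF square_integrable_bounded[where S = C and C = D]])
  show "(%x. indicator C x *\<^sub>R g x) \<in> borel_measurable borel" using g Cm by measurable
  show "norm (indicator C x *\<^sub>R g x) <= D" for x using le[of x] by (auto simp: indicator_def)
 qed (use C Cm in \<open>auto simp: compact_imp_bounded\<close>)
 ultimately show "set_integrable lebesgue C g" by (simp add: borel_rep_integral(2))
qed

lemma integrable_product_bounded:
 fixes g :: "'a::euclidean_space \<times> 'b::euclidean_space => real"
 assumes g: "g \<in> borel_measurable borel" and le: "!!x y. \<bar>g (x, y)\<bar> <= D" and zero: "!!x y. x \<notin> S ==> g (x, y) = 0"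
  and S: "bounded S" "S \<in> sets borel" and w: "integrable lborel w"
 shows "integrable (lborel \<Otimes>\<^sub>M lborel) (%(x, y). w y * g (x, y))"
proof (rule bochner_bound)
 have D: "0 <= D" using le[of 0 0] by linarith
 have iS: "integrable lborel (indicator S :: 'a => real)" by (rule integrable_indicator_bounded[OF S])
 show "integrable (lborel \<Otimes>\<^sub>M lborel) (%(x, y). (D * indicator S x) * norm (w y))"
 proof (rule lborel_pair.Fubini_integrable)
  have [measurable]: "(indicator S :: 'a => real) \<in> borel_measurable borel" using S(2) by simp
  have [measurable]: "w \<in> borel_measurable borel" using w by auto
  show "(%(x, y). (D * indicator S x) * norm (w y)) \<in> borel_measurable (lborel \<Otimes>\<^sub>M lborel)" by measurable
  have "(LBINT y. norm (case (x, y) of (x, y) => (D * indicator S x) * norm (w y))) = (D * indicator S x) * (LBINT y. norm (w y))" for x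
   using D by (simp add: abs_mult)
  then show "integrable lborel (%x. LBINT y. norm (case (x, y) of (x, y) => (D * indicator S x) * norm (w y)))" using iS by simp
  show "AE x in lborel. integrable lborel (%y. case (x, y) of (x, y) => (D * indicator S x) * norm (w y))" using w by simp
 qed
 have wm: "w \<in> borel_measurable borel" using w by auto
 show "(%(x, y). w y * g (x, y)) \<in> borel_measurable (lborel \<Otimes>\<^sub>M lborel)"
  using section_measurable(3)[OF g] wm by (simp add: case_prod_beta')
 show "AE z in lborel \<Otimes>\<^sub>M lborel. norm (case z of (x, y) => w y * g (x, y)) <= norm (case z of (x, y) => (D * indicator S x) * norm (w y))"
 proof (intro AE_I2)
  fix z :: "'a \<times> 'b"
  obtain x y where z: "z = (x, y)" by (cases z)
  show "norm (case z of (x, y) => w y * g (x, y)) <= norm (case z of (x, y) => (D * indicator S x) * norm (w y))"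
   using mult_right_mono[OF le[of x y], of "\<bar>w y\<bar>"] D zero[of x y] by (cases "x \<in> S") (simp_all add: z abs_mult mult.commute)
 qed
qed

text \<open>Testing the kernel with products of \<phi> in \<open>x\<close> and \<xi> in
  \<open>y\<close> shows that \<open>h y\<close>, the integral over \<open>x\<close> of
  \<open>K\<close> times the derivative of \<phi> plus \<open>kb\<close> times \<phi>, is orthogonal
  to every \<xi> and thus vanishes for almost every \<open>y\<close>. Multiplying by
  \<open>f\<close> and integrating gives the identity, although \<open>f\<close> is only integrable
  and cannot itself serve as a test function.\<close>

lemma potential_weak_grad:
 fixes K :: "'a::euclidean_space \<times> 'a => real" and k :: "'a \<times> 'a => 'a"
 assumes K: "K \<in> borel_measurable borel" "!!z. \<bar>K z\<bar> <= C" and k: "k \<in> borel_measurable borel" "!!z. norm (k z) <= C"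
  and K0: "!!x y. x \<notin> ball 0 R \<or> y \<notin> ball 0 R ==> K (x, y) = 0"
  and k0: "!!x y. x \<notin> ball 0 R \<or> y \<notin> ball 0 R ==> k (x, y) = 0"
  and weak: "!!b. b \<in> Basis ==> has_weak_pderiv (ball 0 R \<times> ball 0 R) (b, 0) K (%z. k z \<bullet> b)"
  and f: "integrable lborel f" "!!x. x \<notin> ball 0 R ==> f x = 0"
 shows "has_weak_grad (ball 0 R) (potential K f) (%x. LBINT y. f y *\<^sub>R k (x, y))" unfolding has_weak_grad_def has_weak_pderiv_def
proof (intro ballI conjI allI impI)
 fix b :: 'a assume b: "b \<in> Basis"
 define kb where "kb z = k z \<bullet> b" for z
 have C0: "0 <= C" using K(2)[of 0] by linarith
 have kbm: "kb \<in> borel_measurable borel" unfolding kb_def[abs_def] using k(1) by measurable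
 have kb: "\<bar>kb z\<bar> <= C" for z using Basis_le_norm[OF b, of "k z"] k(2)[of z] by (simp add: kb_def)
 have fm: "f \<in> borel_measurable borel" using f by auto
 have ik: "integrable lborel (%y. f y *\<^sub>R k (x, y))" for x
 proof (rule bochner_bound[of _ "%y. C * norm (f y)"])
  show "(%y. f y *\<^sub>R k (x, y)) \<in> borel_measurable lborel" using fm section_measurable(1)[OF k(1), of x] by simp
  show "AE y in lborel. norm (f y *\<^sub>R k (x, y)) <= norm (C * norm (f y))"
   using mult_left_mono[OF k(2) abs_ge_zero] C0 by (intro AE_I2) (simp add: abs_mult mult.commute)
 qed (use f in simp)
 have kint: "(LBINT y. f y *\<^sub>R k (x, y)) \<bullet> b = potential kb f x" for x
  unfolding potential_def kb_def using ik[of x] by (subst integral_inner_left[symmetric]) (auto simp: mult.commute)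
 have pot_meas: "potential H f \<in> borel_measurable borel" and pot_int: "integrable lborel (%y. H (x, y) * f y)"
  and pot_le: "\<bar>potential H f x\<bar> <= C * (LBINT y. \<bar>f y\<bar>)"
  if H: "H \<in> borel_measurable borel" "!!z. \<bar>H z\<bar> <= C" for H :: "'a \<times> 'a => real" and x
 proof -
  show "integrable lborel (%y. H (x, y) * f y)"
   using integrable_mult_bounded(1)[OF f(1) section_measurable(1)[OF H(1), of x] H(2)] by (simp add: mult.commute)
  show "\<bar>potential H f x\<bar> <= C * (LBINT y. \<bar>f y\<bar>)"
   using integrable_mult_bounded(2)[OF f(1) section_measurable(1)[OF H(1), of x] H(2)] by (simp add: potential_def mult.commute)
  have "(%x. LBINT y. H (x, y) * f y) \<in> borel_measurable lborel"
   using section_measurable(3)[OF H(1)] fm by (intro lborel.borel_measurable_lebesgue_integral) (simp add: case_prod_beta')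
  then show "potential H f \<in> borel_measurable borel" by (simp add: potential_def[abs_def])
 qed
 show "L1_loc (ball 0 R) (potential K f)" by (rule L1_loc_bounded[OF pot_meas pot_le]) (fact K)+
 show "L1_loc (ball 0 R) (%x. (LBINT y. f y *\<^sub>R k (x, y)) \<bullet> b)"
  unfolding kint by (rule L1_loc_bounded[OF pot_meas pot_le]) (fact kbm kb)+
 fix \<phi> :: "'a => real" assume t: "test_fun (ball 0 R) \<phi>"
 obtain S where S: "compact S" "S \<subseteq> ball 0 R" "!!x. x \<notin> S ==> \<phi> x = 0" and sm: "smooth_on UNIV \<phi>"
  using t by (auto simp: test_fun_def)
 obtain L where L: "0 <= L" "!!x. \<bar>\<phi> x\<bar> <= L" "!!x. norm (grad \<phi> x) <= L" "!!x. x \<notin> S ==> grad \<phi> x = 0"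
  using smooth_compact_support_bounds[OF sm S(1,3)] by metis
 define \<phi>' where "\<phi>' x = pderiv_at b \<phi> x" for x
 have nS: "x \<notin> ball 0 R ==> x \<notin> S" for x using S(2) by blast
 have \<phi>': "\<bar>\<phi>' x\<bar> <= L" "x \<notin> ball 0 R ==> \<phi>' x = 0" "x \<notin> ball 0 R ==> \<phi> x = 0" for x
  using Basis_le_norm[OF b, of "grad \<phi> x"] L(3)[of x] L(4)[of x] nS[of x] S(3)[of x]
  by (auto simp: \<phi>'_def grad_inner_Basis[OF b, symmetric])
 have \<phi>m: "\<phi> \<in> borel_measurable borel" "\<phi>' \<in> borel_measurable borel" unfolding \<phi>'_def[abs_def]
  by (intro borel_measurable_continuous_onI smooth_on_continuous_on sm smooth_on_pderiv_at[OF _ b])+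
 have fs: "(fst :: 'a \<times> 'a => 'a) \<in> borel_measurable borel" "(snd :: 'a \<times> 'a => 'a) \<in> borel_measurable borel"
  by (intro borel_measurable_continuous_onI continuous_intros)+
 define g where "g z = K z * \<phi>' (fst z) + kb z * \<phi> (fst z)" for z
 have gm: "g \<in> borel_measurable borel"
  unfolding g_def[abs_def] using K(1) kbm measurable_compose[OF fs(1) \<phi>m(1)] measurable_compose[OF fs(1) \<phi>m(2)] by measurable
 have g_le: "\<bar>g (x, y)\<bar> <= C * L + C * L" for x y
  unfolding g_def using K(2)[of "(x, y)"] kb[of "(x, y)"] \<phi>'(1)[of x] L(2)[of x] C0 L(1)
  by (intro order_trans[OF abs_triangle_ineq] add_mono) (auto simp: abs_mult intro!: mult_mono)
 have g0: "x \<notin> ball 0 R ==> g (x, y) = 0" for x y using \<phi>'(2,3)[of x] by (simp add: g_def)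
 define h where "h y = (LBINT x. g (x, y))" for y
 have pair: "integrable (lborel \<Otimes>\<^sub>M lborel) (%(x, y). w y * g (x, y))" if "integrable lborel w" for w
  by (rule integrable_product_bounded[OF gm g_le g0 _ _ that, where S = "ball 0 R"]) auto
 have swap: "(LBINT z. w (snd z) * g z) = (LBINT y. w y * h y)" if "integrable lborel w" for w
  using lborel_pair.integral_snd[OF pair[OF that]] unfolding lborel_prod by (simp add: case_prod_beta' h_def)
 have hm: "h \<in> borel_measurable borel"
 proof -
  have "(%y. LBINT x. g (x, y)) \<in> borel_measurable lborel"
   by (intro lborel.borel_measurable_lebesgue_integral section_measurable(4)[OF gm])
  then show ?thesis by (simp add: h_def[abs_def])
 qed
 have iS: "integrable lborel (indicator (ball (0::'a) R) :: 'a => real)" by (rule integrable_indicator_bounded) auto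
 have hle: "\<bar>h y\<bar> <= (C * L + C * L) * measure lborel (ball (0::'a) R)" for y
 proof -
  have "norm (h y) <= (LBINT x. (C * L + C * L) * indicator (ball (0::'a) R) x)" unfolding h_def
  proof (rule Bochner_Integration.integral_norm_bound_integral)
   show "integrable lborel (%x. g (x, y))"
    by (rule square_integrable_imp_integrable[where S = "ball 0 R", OF square_integrable_bounded[where S = "ball 0 R" and C = "C * L + C * L"]])
     (use section_measurable(2)[OF gm] g_le g0 in auto)
   show "norm (g (x, y)) <= (C * L + C * L) * indicator (ball 0 R) x" for x using g_le[of x y] g0[of x y] by (cases "x \<in> ball 0 R") auto
  qed (use iS in simp)
  then show ?thesis by simp
 qed
 have "AE y in lebesgue. y \<in> ball 0 R --> h y = 0"
 proof (rule AE_eq_0_if_test_integrals_eq_0[OF open_ball L1_loc_bounded[OF hm hle]])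
  fix \<xi> :: "'a => real" assume c: "test_fun (ball 0 R) \<xi>"
  obtain S' where S': "compact S'" "S' \<subseteq> ball 0 R" "!!x. x \<notin> S' ==> \<xi> x = 0" and smc: "smooth_on UNIV \<xi>"
   using c by (auto simp: test_fun_def)
  obtain L' where L': "!!x. \<bar>\<xi> x\<bar> <= L'" using smooth_compact_support_bounds[OF smc S'(1,3)] by metis
  have cm: "\<xi> \<in> borel_measurable borel" by (intro borel_measurable_continuous_onI smooth_on_continuous_on smc)
  have c0: "x \<notin> ball 0 R ==> \<xi> x = 0" for x using S'(2,3) by blast
  have ci: "integrable lborel \<xi>"
   by (rule square_integrable_imp_integrable[where S = "ball 0 R", OF square_integrable_bounded[where S = "ball 0 R" and C = L']])
    (use cm c0 L' in auto)
  let ?\<Phi> = "%z. \<phi> (fst z) * \<xi> (snd z)"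
  have cm2: "(%z. \<xi> (snd z)) \<in> borel_measurable (borel :: ('a \<times> 'a) measure)" by (rule measurable_compose[OF fs(2) cm])
  have P: "pderiv_at (b, 0) ?\<Phi> z = \<phi>' (fst z) * \<xi> (snd z)" for z
   using smooth_tensor(2)[OF sm smc, of b "fst z" "snd z"] by (simp add: \<phi>'_def)
  have i1: "integrable lborel (%z. K z * (\<phi>' (fst z) * \<xi> (snd z)))"
   and i2: "integrable lborel (%z. kb z * (\<phi> (fst z) * \<xi> (snd z)))"
  proof -
   have 1: "integrable (lborel \<Otimes>\<^sub>M lborel) (%(x, y). \<xi> y * (H (x, y) * w x))"
    if "H \<in> borel_measurable borel" "!!z. \<bar>H z\<bar> <= C" "w \<in> borel_measurable borel" "!!x. \<bar>w x\<bar> <= L" "!!x. x \<notin> ball 0 R ==> w x = 0"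
    for H :: "'a \<times> 'a => real" and w
   proof -
    have le: "\<bar>H (x, y) * w x\<bar> <= C * L" for x y unfolding abs_mult by (rule mult_mono[OF that(2,4) C0 abs_ge_zero])
    show ?thesis using integrable_product_bounded[of "%z. H z * w (fst z)" "C * L" "ball 0 R" \<xi>] ci that(5) le
      borel_measurable_times[OF that(1) measurable_compose[OF fs(1) that(3)]] by simp
   qed
   show "integrable lborel (%z. K z * (\<phi>' (fst z) * \<xi> (snd z)))"
    using 1[OF K(1,2) \<phi>m(2) \<phi>'(1,2)] unfolding lborel_prod by (simp add: case_prod_beta' mult_ac)
   show "integrable lborel (%z. kb z * (\<phi> (fst z) * \<xi> (snd z)))"
    using 1[OF kbm kb \<phi>m(1) L(2) \<phi>'(3)] unfolding lborel_prod by (simp add: case_prod_beta' mult_ac)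
  qed
  have Kz: "K z = 0" "kb z = 0" if "z \<notin> ball 0 R \<times> ball 0 R" for z
   using that K0[of "fst z" "snd z"] k0[of "fst z" "snd z"] by (auto simp: kb_def mem_Times_iff)
  have "(LINT z:ball 0 R \<times> ball 0 R|lebesgue. K z * pderiv_at (b, 0) ?\<Phi> z) = - (LINT z:ball 0 R \<times> ball 0 R|lebesgue. (k z \<bullet> b) * ?\<Phi> z)"
   using weak[OF b] test_fun_tensor[OF t c] unfolding has_weak_pderiv_def by blast
  also have "(LINT z:ball 0 R \<times> ball 0 R|lebesgue. K z * pderiv_at (b, 0) ?\<Phi> z) = (LBINT z. K z * (\<phi>' (fst z) * \<xi> (snd z)))"
   unfolding P by (rule set_integral_lebesgue_eq_lborel) (use i1 Kz in auto)
  also have "(LINT z:ball 0 R \<times> ball 0 R|lebesgue. (k z \<bullet> b) * ?\<Phi> z) = (LBINT z. kb z * (\<phi> (fst z) * \<xi> (snd z)))"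
   unfolding kb_def[symmetric] by (rule set_integral_lebesgue_eq_lborel) (use i2 Kz in auto)
  finally have "(LBINT z. K z * (\<phi>' (fst z) * \<xi> (snd z)) + kb z * (\<phi> (fst z) * \<xi> (snd z))) = 0" using i1 i2 by simp
  moreover have "K z * (\<phi>' (fst z) * \<xi> (snd z)) + kb z * (\<phi> (fst z) * \<xi> (snd z)) = \<xi> (snd z) * g z" for z
   by (simp add: g_def algebra_simps)
  ultimately have "(LBINT y. \<xi> y * h y) = 0" using swap[OF ci] by simp
  moreover have "(LINT y:ball 0 R|lebesgue. h y * \<xi> y) = (LBINT y. h y * \<xi> y)"
   by (rule set_integral_lebesgue_eq_lborel) (use hm cm c0 in auto)
  ultimately show "(LINT y:ball 0 R|lebesgue. h y * \<xi> y) = 0" by (simp add: mult.commute)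
 qed
 then have h0: "AE y in lborel. f y * h y = 0" unfolding AE_lebesgue_iff by eventually_elim (use f(2) in auto)
 have "(LBINT y. f y * h y) = (\<integral>y. 0 \<partial>(lborel :: 'a measure))" using h0 fm hm by (intro integral_cong_AE) auto
 then have z: "(LBINT z. f (snd z) * g z) = 0" using swap[OF f(1)] by simp
 have i1: "integrable lborel (%x. potential K f x * \<phi>' x)" and i2: "integrable lborel (%x. potential kb f x * \<phi> x)"
  by (rule square_integrable_imp_integrable[where S = "ball 0 R", OF square_integrable_bounded[where S = "ball 0 R" and C = "(C * (LBINT y. \<bar>f y\<bar>)) * L"]],
    use pot_meas[OF K] pot_meas[OF kbm kb] \<phi>m \<phi>' L pot_le[OF K] pot_le[OF kbm kb] C0 in \<open>auto simp: abs_mult intro!: mult_mono borel_measurable_times\<close>)+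
 have "(LBINT z. f (snd z) * g z) = (LBINT x. (LBINT y. f y * g (x, y)))"
  using lborel_pair.integral_fst[OF pair[OF f(1)]] unfolding lborel_prod by (simp add: case_prod_beta')
 also have "\<dots> = (LBINT x. potential K f x * \<phi>' x + potential kb f x * \<phi> x)"
 proof (intro bochner_cong refl)
  fix x
  have "(LBINT y. f y * g (x, y)) = (LBINT y. (K (x, y) * f y) * \<phi>' x + (kb (x, y) * f y) * \<phi> x)"
   by (intro bochner_cong) (auto simp: g_def algebra_simps)
  then show "(LBINT y. f y * g (x, y)) = potential K f x * \<phi>' x + potential kb f x * \<phi> x"
   using pot_int[OF K, of x] pot_int[OF kbm kb, of x] by (simp add: potential_def)
 qed
 also have "\<dots> = (LBINT x. potential K f x * \<phi>' x) + (LBINT x. potential kb f x * \<phi> x)" using i1 i2 by simp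
 finally have fin: "(LBINT x. potential K f x * \<phi>' x) = - (LBINT x. potential kb f x * \<phi> x)" using z by simp
 have "(LINT x:ball 0 R|lebesgue. potential K f x * pderiv_at b \<phi> x) = (LBINT x. potential K f x * \<phi>' x)"
  unfolding \<phi>'_def[symmetric] by (rule set_integral_lebesgue_eq_lborel) (use i1 \<phi>'(2) in auto)
 moreover have "(LINT x:ball 0 R|lebesgue. ((LBINT y. f y *\<^sub>R k (x, y)) \<bullet> b) * \<phi> x) = (LBINT x. potential kb f x * \<phi> x)"
  unfolding kint by (rule set_integral_lebesgue_eq_lborel) (use i2 \<phi>'(3) in auto)
 ultimately show "(LINT x:ball 0 R|lebesgue. potential K f x * pderiv_at b \<phi> x) =
   - (LINT x:ball 0 R|lebesgue. ((LBINT y. f y *\<^sub>R k (x, y)) \<bullet> b) * \<phi> x)" using fin by simp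
qed

lemma AE_lborel_swap:
 fixes P :: "'a::euclidean_space \<times> 'a => bool"
 assumes "AE z in lborel. P z"
 shows "AE z in lborel. P (prod.swap z)"
proof -
 have "AE z in distr (lborel \<Otimes>\<^sub>M lborel) (lborel \<Otimes>\<^sub>M lborel) (%(x, y). (y, x)). P z"
  using assms lborel_pair.distr_pair_swap[where ?'a = 'a and ?'b = 'a] by (simp only: lborel_prod)
 then have "AE z in (lborel :: 'a measure) \<Otimes>\<^sub>M (lborel :: 'a measure). P (case z of (x, y) => (y, x))"
  by (rule AE_distrD[rotated]) measurable
 then show ?thesis unfolding lborel_prod by (simp add: prod.swap_def case_prod_beta')
qed

section \<open>Representatives of the potentials\<close>

lemma W2inf_potential_representatives:
 fixes V :: "'a::euclidean_space => real"
 assumes W: "W2inf_on U V" and U: "open U" and nonneg: "AE x in lebesgue. x \<in> U --> 0 <= V x"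
 obtains V' gV C where "borel_rep U V V'" "!!x. 0 <= V' x" "!!x. V' x <= C"
  "gV \<in> borel_measurable borel" "!!x. norm (gV x) <= C" "!!x. x \<notin> U ==> gV x = 0"
  "has_weak_grad U V gV" "has_weak_grad U V' gV"
proof -
 have Um: "U \<in> sets borel" using U by simp
 obtain G where G: "Linf_on U V" "has_weak_grad U V G" "Linf_on U G" using W unfolding W2inf_on_def by blast
 obtain V0 C1 where V0: "borel_rep U V V0" "0 <= C1" "!!x. norm (V0 x) <= C1" using Linf_borel_rep[OF G(1) Um] by metis
 obtain gV C2 where gV: "borel_rep U G gV" "0 <= C2" "!!x. norm (gV x) <= C2" using Linf_borel_rep[OF G(3) Um] by metis
 have V': "borel_rep U V (%x. max 0 (V0 x))"
 proof (rule borel_rep_compose[OF V0(1), of "%_ y. max 0 y"])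
  show "(%x. max 0 (V0 x)) \<in> borel_measurable borel" using borel_repD(1)[OF V0(1)] by measurable
  show "AE x in lborel. x \<in> U --> V x = max 0 (V x)" using nonneg unfolding AE_lebesgue_iff by eventually_elim auto
 qed simp
 have w1: "has_weak_grad U V gV" by (rule has_weak_grad_cong[OF G(2) _ borel_repD(3)[OF gV(1)]]) simp
 have w2: "has_weak_grad U (%x. max 0 (V0 x)) gV" by (rule has_weak_grad_cong[OF w1 borel_repD(3)[OF V']]) simp
 show ?thesis
 proof (rule that[OF V' _ _ borel_repD(1)[OF gV(1)] _ borel_repD(2)[OF gV(1)] w1 w2])
  show "max 0 (V0 x) <= max C1 C2" for x using V0(2) V0(3)[of x] by auto
  show "norm (gV x) <= max C1 C2" for x using gV(3)[of x] by auto
 qed auto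
qed

text \<open>Symmetry and sign of the given kernel hold almost everywhere; averaging a representative
  with its reflection and cutting at 0 makes them hold everywhere. The field \<open>k\<close> is the
  first component of the gradient, taken in the variable \<open>x\<close>.\<close>

lemma W2inf_kernel_representatives:
 fixes K :: "'a::euclidean_space => 'a => real"
 assumes W: "W2inf_on (U \<times> U) (%(x, y). K x y)" and U: "open U"
  and sym: "AE (x, y) in lebesgue. x \<in> U \<and> y \<in> U --> K x y = K y x \<and> 0 <= K x y"
 obtains K' k C where "borel_rep (U \<times> U) (%z. K (fst z) (snd z)) K'" "!!z. 0 <= K' z" "!!z. K' z <= C"
  "!!x y. K' (x, y) = K' (y, x)"
  "k \<in> borel_measurable borel" "!!z. norm (k z) <= C" "!!z. z \<notin> U \<times> U ==> k z = 0"
  "!!b. b \<in> Basis ==> has_weak_pderiv (U \<times> U) (b, 0) K' (%z. k z \<bullet> b)"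
proof -
 let ?K = "%z. K (fst z) (snd z)"
 have UU: "U \<times> U \<in> sets borel" using open_Times[OF U U] by simp
 obtain G where G: "Linf_on (U \<times> U) ?K" "has_weak_grad (U \<times> U) ?K G" "Linf_on (U \<times> U) G"
  using W unfolding W2inf_on_def case_prod_beta' by blast
 obtain K0 C1 where K0: "borel_rep (U \<times> U) ?K K0" "0 <= C1" "!!z. norm (K0 z) <= C1" using Linf_borel_rep[OF G(1) UU] by metis
 obtain g C2 where g: "borel_rep (U \<times> U) G g" "0 <= C2" "!!z. norm (g z) <= C2" using Linf_borel_rep[OF G(3) UU] by metis
 define K' where "K' z = max 0 ((K0 z + K0 (prod.swap z)) / 2)" for z
 have sw: "prod.swap \<in> borel_measurable (borel :: ('a \<times> 'a) measure)"
  unfolding prod.swap_def by (intro borel_measurable_continuous_onI continuous_intros)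
 have K0m: "K0 \<in> borel_measurable borel" by (rule borel_repD(1)[OF K0(1)])
 have rep: "borel_rep (U \<times> U) ?K K'" unfolding borel_rep_def
 proof (intro conjI allI impI)
  show "K' \<in> borel_measurable borel" unfolding K'_def[abs_def] using K0m measurable_compose[OF sw K0m] by measurable
  show "K' z = 0" if "z \<notin> U \<times> U" for z
  proof -
   have "prod.swap z \<notin> U \<times> U" using that by (cases z) auto
   then show ?thesis using that borel_repD(2)[OF K0(1)] by (simp add: K'_def)
  qed
  have s: "AE z in lborel. z \<in> U \<times> U --> K (fst z) (snd z) = K (snd z) (fst z) \<and> 0 <= K (fst z) (snd z)"
   using sym unfolding AE_lebesgue_iff by eventually_elim auto
  show "AE z in lborel. z \<in> U \<times> U --> ?K z = K' z"
   using s borel_repD(3)[OF K0(1)] AE_lborel_swap[OF borel_repD(3)[OF K0(1)]] by eventually_elim (auto simp: K'_def)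
 qed
 define k where "k z = fst (g z)" for z
 have km: "k \<in> borel_measurable borel" unfolding k_def[abs_def] by (rule measurable_compose[OF borel_repD(1)[OF g(1)]])
   (intro borel_measurable_continuous_onI continuous_intros)
 have weak: "has_weak_pderiv (U \<times> U) (b, 0) K' (%z. k z \<bullet> b)" if b: "b \<in> Basis" for b
 proof (rule has_weak_pderiv_cong[OF _ borel_repD(3)[OF rep]])
  have "(b, 0) \<in> (Basis :: ('a \<times> 'a) set)" using b by (simp add: Basis_prod_def)
  then show "has_weak_pderiv (U \<times> U) (b, 0) ?K (%z. G z \<bullet> (b, 0))" using G(2) unfolding has_weak_grad_def by blast
  show "AE z in lborel. z \<in> U \<times> U --> G z \<bullet> (b, 0) = k z \<bullet> b"
   using borel_repD(3)[OF g(1)] by eventually_elim (auto simp: k_def inner_prod_def)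
 qed
 show ?thesis
 proof (rule that[OF rep _ _ _ km _ _ weak])
  show "K' z <= max C1 C2" for z using K0(2) K0(3)[of z] K0(3)[of "prod.swap z"] by (auto simp: K'_def max_def abs_le_iff field_simps)
  show "norm (k z) <= max C1 C2" for z using norm_fst_le[of "fst (g z)" "snd (g z)"] g(3)[of z] by (simp add: k_def)
  show "K' (x, y) = K' (y, x)" for x y by (simp add: K'_def add.commute)
  show "k z = 0" if "z \<notin> U \<times> U" for z using that borel_repD(2)[OF g(1), of z] by (simp add: k_def)
 qed (simp add: K'_def)
qed

section \<open>Recovering a primitive from polynomial tests in time\<close>

lemma continuous_zero_if_square_integral_zero:
 fixes h :: "real => real"
 assumes T: "0 < T" and h: "continuous_on {0..T} h"
  and zero: "(LBINT t. indicator {0..T} t * (h t)\<^sup>2) <= 0" and t: "t \<in> {0..T}"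
 shows "h t = 0"
proof -
 have c: "continuous_on {0..T} (%t. (h t)\<^sup>2)" by (intro continuous_intros h)
 have i: "set_integrable lborel {0..T} (%t. (h t)\<^sup>2)" unfolding set_integrable_def by (rule borel_integrable_compact[OF compact_Icc c])
 have "integral {0..T} (%t. (h t)\<^sup>2) = (LBINT t. indicator {0..T} t * (h t)\<^sup>2)"
  using set_borel_integral_eq_integral(2)[OF i] by (simp add: set_lebesgue_integral_def)
 moreover have "0 <= integral {0..T} (%t. (h t)\<^sup>2)" by (rule integral_nonneg[OF set_borel_integral_eq_integral(1)[OF i]]) simp
 ultimately have "integral {0..T} (%t. (h t)\<^sup>2) = 0" using zero by linarith
 then have "((%t. (h t)\<^sup>2) has_integral 0) (cbox 0 T)"
  using integrable_integral[OF set_borel_integral_eq_integral(1)[OF i]] by (simp only: cbox_interval)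
 then have "(h t)\<^sup>2 = 0" by (rule has_integral_0_cbox_imp_0[rotated 2]) (use c t T in auto)
 then show ?thesis by simp
qed

text \<open>The tests say that \<open>h\<close>, the difference between \<mu> and its claimed value,
  is orthogonal to all polynomials on \<open>{0..T}\<close>. By the Weierstrass theorem its square
  then has integral 0, and by continuity it vanishes. Polynomials are convenient test functions in
  time: they are smooth on the whole line and have explicit primitives that vanish at
  \<open>T\<close>.\<close>

lemma primitive_from_polynomial_tests:
 fixes \<mu> j :: "real => real"
 assumes T: "0 < T" and \<mu>: "continuous_on {0..T} \<mu>" and j: "integrable lborel j"
  and test: "!!a n. (LBINT t. indicator {0..T} t * (\<mu> t * (\<Sum>i\<le>n. a i * t ^ i))) =
    (LBINT t. indicator {0..T} t * (j t * (\<Sum>i\<le>n. a i / real (Suc i) * (t ^ Suc i - T ^ Suc i))))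
    - a0 * (\<Sum>i\<le>n. a i / real (Suc i) * (0 ^ Suc i - T ^ Suc i))"
  and t: "t \<in> {0..T}"
 shows "\<mu> t = a0 - (LBINT s. indicator {0..t} s * j s)"
proof -
 define I where "I t = (LBINT s. indicator {0..t} s * j s)" for t
 define h where "h t = \<mu> t - a0 + I t" for t
 have ji: "set_integrable lborel {0..s} j" for s unfolding set_integrable_def by (rule integrable_mult_indicator[OF _ j]) simp
 have "integral {0..s} j = I s" for s using set_borel_integral_eq_integral(2)[OF ji] by (simp add: I_def set_lebesgue_integral_def)
 then have Ic: "continuous_on {0..T} I" using indefinite_integral_continuous_1[OF set_borel_integral_eq_integral(1)[OF ji[of T]]] by simp
 have hc: "continuous_on {0..T} h" unfolding h_def[abs_def] by (intro continuous_intros \<mu> Ic)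
 have ci: "integrable lborel (%t. indicator {0..T} t * f t)" if "continuous_on {0..T} f" for f :: "real => real"
  using borel_integrable_compact[OF compact_Icc that] by simp
 have orth: "(LBINT t. indicator {0..T} t * (h t * (\<Sum>i\<le>n. a i * t ^ i))) = 0" for a n
 proof -
  define w where "w t = (\<Sum>i\<le>n. a i * t ^ i)" for t :: real
  \<comment> \<open>The primitive of \<open>w\<close> that vanishes at \<open>T\<close>, as test
    functions have to.\<close>
  define p where "p t = (\<Sum>i\<le>n. a i / real (Suc i) * (t ^ Suc i - T ^ Suc i))" for t :: real
  have wc: "continuous_on S w" for S unfolding w_def[abs_def] by (intro continuous_intros)
  have dp: "(p has_real_derivative w t) (at t)" for t unfolding p_def[abs_def] w_def
   by (auto intro!: derivative_eq_intros sum.cong simp: field_simps simp del: of_nat_Suc power_Suc)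
  have FTC: "(LBINT t. indicator {s..T} t * w t) = - p s" if "s <= T" for s
  proof -
   have "(LBINT t. w t * indicator {s..T} t) = p T - p s"
    using that dp wc[of UNIV] by (intro integral_FTC_Icc_real) (auto simp: continuous_on_eq_continuous_at)
   then show ?thesis by (simp add: p_def mult.commute)
  qed
  obtain D where D: "!!t. t \<in> {0..T} ==> \<bar>w t\<bar> <= D"
   using compact_imp_bounded[OF compact_continuous_image[OF wc compact_Icc], of 0 T] unfolding bounded_iff real_norm_def by (metis imageI)
  have D0: "0 <= D" using D[of 0] T by auto
  \<comment> \<open>\<open>w t\<close> on the triangle \<open>0 <= s <= t <= T\<close>; exchanging
    the order of integration amounts to integrating \<open>I\<close> against \<open>w\<close> by
    parts.\<close>
  let ?g = "%z. indicator {0..T} (fst z) * (if 0 <= snd z \<and> snd z <= fst z then w (fst z) else 0)"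
  have pair: "integrable (lborel \<Otimes>\<^sub>M lborel) (%(t, s). j s * ?g (t, s))"
  proof (rule integrable_product_bounded[OF _ _ _ _ _ j, where S = "{0..T}" and D = D])
   have 1: "(%z. w (fst z)) \<in> borel_measurable (borel :: (real \<times> real) measure)"
    by (intro borel_measurable_continuous_onI continuous_on_compose2[OF wc[of UNIV]] continuous_intros) auto
   have "closed ({z. 0 <= snd z} \<inter> {z. snd z <= fst z} \<inter> ({z. 0 <= fst z} \<inter> {z. fst z <= T}) :: (real \<times> real) set)"
    by (intro closed_Int closed_Collect_le continuous_intros)
   then have "(%z. indicator ({z. 0 <= snd z} \<inter> {z. snd z <= fst z} \<inter> ({z. 0 <= fst z} \<inter> {z. fst z <= T})) z * w (fst z)) \<in> borel_measurable (borel :: (real \<times> real) measure)"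
    by (intro borel_measurable_times 1 borel_measurable_indicator) auto
   moreover have "?g = (%z. indicator ({z. 0 <= snd z} \<inter> {z. snd z <= fst z} \<inter> ({z. 0 <= fst z} \<inter> {z. fst z <= T})) z * w (fst z))"
    by (auto simp: fun_eq_iff indicator_def)
   ultimately show "?g \<in> borel_measurable borel" by simp
   show "\<bar>?g (x, y)\<bar> <= D" for x y using D[of x] D0 by (auto simp: indicator_def)
  qed auto
  have "(LBINT t. (LBINT s. j s * ?g (t, s))) = (LBINT s. (LBINT t. j s * ?g (t, s)))" using lborel_pair.Fubini_integral[OF pair] by simp
  moreover have "(LBINT s. j s * ?g (t, s)) = indicator {0..T} t * (I t * w t)" for t
  proof -
   have "(LBINT s. j s * ?g (t, s)) = (LBINT s. (indicator {0..T} t * w t) * (indicator {0..t} s * j s))"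
    by (intro bochner_cong) (auto simp: indicator_def)
   then show ?thesis by (simp add: I_def)
  qed
  moreover have "(LBINT t. j s * ?g (t, s)) = - (indicator {0..T} s * (j s * p s))" for s
  proof (cases "s \<in> {0..T}")
   case True
   have "(LBINT t. j s * ?g (t, s)) = (LBINT t. j s * (indicator {s..T} t * w t))" using True by (intro bochner_cong) (auto simp: indicator_def)
   also have "\<dots> = j s * - p s" using FTC[of s] True by simp
   finally show ?thesis using True by simp
  next
   case False
   then have z: "j s * ?g (t, s) = 0" for t by (auto simp: indicator_def)
   show ?thesis using False unfolding z by simp
  qed
  ultimately have "(LBINT t. indicator {0..T} t * (I t * w t)) = - (LBINT s. indicator {0..T} s * (j s * p s))" by simp
  moreover have "(LBINT t. indicator {0..T} t * (\<mu> t * w t)) = (LBINT s. indicator {0..T} s * (j s * p s)) - a0 * p 0"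
   unfolding w_def p_def by (rule test)
  moreover have "(LBINT t. indicator {0..T} t * w t) = - p 0" using T by (intro FTC) simp
  moreover have "(LBINT t. indicator {0..T} t * (h t * w t)) = (LBINT t. indicator {0..T} t * (\<mu> t * w t))
    - a0 * (LBINT t. indicator {0..T} t * w t) + (LBINT t. indicator {0..T} t * (I t * w t))"
  proof -
   have "(LBINT t. indicator {0..T} t * (h t * w t)) = (LBINT t. indicator {0..T} t * (\<mu> t * w t) - a0 * (indicator {0..T} t * w t) + indicator {0..T} t * (I t * w t))"
    by (intro bochner_cong) (auto simp: h_def algebra_simps)
   then show ?thesis using ci[of "%t. \<mu> t * w t"] ci[of w] ci[of "%t. I t * w t"] \<mu> wc Ic by (simp add: continuous_on_mult)
  qed
  ultimately show ?thesis unfolding w_def by simp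
 qed
 define H where "H = (LBINT t. indicator {0..T} t * \<bar>h t\<bar>)"
 have "(LBINT t. indicator {0..T} t * (h t)\<^sup>2) <= 0"
 proof (rule field_le_epsilon)
  fix e :: real assume e: "0 < e"
  have H0: "0 <= H" unfolding H_def by (intro Bochner_Integration.integral_nonneg) simp
  \<comment> \<open>Accuracy of the polynomial approximation \<open>g\<close>: as \<open>h\<close>
    is orthogonal to \<open>g\<close>, the integral of the square of \<open>h\<close> equals that of
    \<open>h * (h - g)\<close>.\<close>
  define \<epsilon> where "\<epsilon> = e / (H + 1)"
  have \<epsilon>: "0 < \<epsilon>" "\<epsilon> * H <= e" using e H0 by (auto simp: \<epsilon>_def field_simps)
  obtain g where g: "real_polynomial_function g" "!!x. x \<in> {0..T} ==> \<bar>h x - g x\<bar> < \<epsilon>"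
   using Stone_Weierstrass_real_polynomial_function[OF compact_Icc hc \<epsilon>(1)] by metis
  then obtain a n where a: "g = (%x. \<Sum>i\<le>n. a i * x ^ i)" unfolding real_polynomial_function_iff_sum by blast
  have gc: "continuous_on {0..T} g" unfolding a by (intro continuous_intros)
  have "(LBINT t. indicator {0..T} t * (h t)\<^sup>2) = (LBINT t. indicator {0..T} t * (h t * (h t - g t)) + indicator {0..T} t * (h t * g t))"
   by (intro bochner_cong) (auto simp: power2_eq_square algebra_simps)
  also have "\<dots> = (LBINT t. indicator {0..T} t * (h t * (h t - g t)))"
   using ci[of "%t. h t * (h t - g t)"] ci[of "%t. h t * g t"] hc gc orth[of a n]
   by (simp add: continuous_on_mult continuous_on_diff a)
  also have "\<dots> <= (LBINT t. \<epsilon> * (indicator {0..T} t * \<bar>h t\<bar>))"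
  proof (rule integral_mono)
   show "integrable lborel (%t. indicator {0..T} t * (h t * (h t - g t)))" by (intro ci continuous_intros hc gc)
   show "integrable lborel (%t. \<epsilon> * (indicator {0..T} t * \<bar>h t\<bar>))" by (intro integrable_mult_right ci continuous_intros hc)
   fix t
   show "indicator {0..T} t * (h t * (h t - g t)) <= \<epsilon> * (indicator {0..T} t * \<bar>h t\<bar>)"
   proof (cases "t \<in> {0..T}")
    case True
    have "h t * (h t - g t) <= \<bar>h t\<bar> * \<bar>h t - g t\<bar>" by (metis abs_ge_self abs_mult)
    also have "\<dots> <= \<bar>h t\<bar> * \<epsilon>" using g(2)[OF True] by (intro mult_left_mono) auto
    finally show ?thesis using True by (simp add: mult.commute)
   qed simp
  qed
  also have "\<dots> = \<epsilon> * H" by (simp add: H_def)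
  finally show "(LBINT t. indicator {0..T} t * (h t)\<^sup>2) <= 0 + e" using \<epsilon>(2) by simp
 qed
 from continuous_zero_if_square_integral_zero[OF T hc this t] show ?thesis by (simp add: h_def I_def)
qed

section \<open>Strong solutions as flows\<close>

lemma smooth_polynomial:
 fixes a :: "nat => real"
 shows "smooth_on UNIV (%t::real. \<Sum>i\<le>n. a i * (t ^ Suc i - c i))"
proof (rule fun_algebra_smooth[where S = "{%t. t}"])
 let ?A = "fun_algebra {%t::real. t}"
 have pow: "(%t. t ^ k) \<in> ?A" for k by (induction k) (auto intro: fun_algebra.intros)
 have "(%t. a i * (t ^ Suc i + - c i)) \<in> ?A" for i using pow[of "Suc i"] by (intro fun_algebra.mult fun_algebra.add fun_algebra.const)
 then show "(%t. \<Sum>i\<le>n. a i * (t ^ Suc i - c i)) \<in> ?A" by (intro fun_algebra_sum) simp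
next
 fix g :: "real => real" and x assume "g \<in> {%t. t}"
 then show "g differentiable at x" by (simp add: differentiable_ident)
next
 fix g :: "real => real" and b :: real assume "g \<in> {%t. t}"
 then have "pderiv_at b g = (%x. b)" by (auto intro!: pderiv_at_eq has_derivative_ident)
 then show "pderiv_at b g \<in> fun_algebra {%t. t}" by (simp add: fun_algebra.const)
qed

lemma borel_rep_scaled_test:
 fixes f g h :: "'a::euclidean_space => real"
 assumes f: "borel_rep U f g" and h: "h \<in> borel_measurable borel"
 shows "(LINT x:U|lebesgue. f x * h x) = (LBINT x. g x * h x)"
proof (rule borel_rep_integral(1)[OF borel_rep_compose[OF f, of "%x y. y * h x"]])
 show "(%x. g x * h x) \<in> borel_measurable borel" by (rule borel_measurable_times[OF borel_repD(1)[OF f] h])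
qed auto

lemma borel_rep_inner_test:
 fixes f g h :: "'a::euclidean_space => 'b::euclidean_space"
 assumes f: "borel_rep U f g" and h: "h \<in> borel_measurable borel"
 shows "(LINT x:U|lebesgue. f x \<bullet> h x) = (LBINT x. g x \<bullet> h x)"
proof (rule borel_rep_integral(1)[OF borel_rep_compose[OF f, of "%x y. y \<bullet> h x"]])
 show "(%x. g x \<bullet> h x) \<in> borel_measurable borel" by (rule borel_measurable_inner[OF borel_repD(1)[OF f] h])
qed auto

lemma time_integral_rep:
 fixes f g :: "real => real"
 assumes g: "(%t. indicator {0..T} t * g t) \<in> borel_measurable borel"
  and ae: "AE t in lborel. t \<in> {0<..<T} --> f t = g t"
 shows "(LINT t:{0..T}|lebesgue. f t) = (LBINT t. indicator {0..T} t * g t)"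
proof (rule borel_rep_integral(1))
 show "borel_rep {0..T} f (%t. indicator {0..T} t * g t)" unfolding borel_rep_def
 proof (intro conjI allI impI g)
  show "AE t in lborel. t \<in> {0..T} --> f t = indicator {0..T} t * g t"
   using ae AE_lborel_singleton[of 0] AE_lborel_singleton[of T] by eventually_elim auto
 qed simp
qed

context flow_data
begin

text \<open>L1 continuity of the density, transferred to moments. It allows the identity tested in
  time to be concluded at every time and not just at almost every one.\<close>

lemma moment_continuous:
 fixes \<psi> :: "'a => real"
 assumes \<psi>: "continuous_on UNIV \<psi>"
 shows "continuous_on {0..T} (%t. LBINT x. r t x * \<psi> x)" unfolding continuous_on_def
proof
 fix s assume s: "s \<in> {0..T}"
 obtain D where D: "!!x. norm (indicator (ball (0::'a) R) x *\<^sub>R \<psi> x) <= D" using bounded_on_ball_field(2)[OF \<psi>] by blast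
 let ?g = "%x. indicator (ball (0::'a) R) x *\<^sub>R \<psi> x"
 have gm: "?g \<in> borel_measurable borel" by (rule square_integrable_measurable[OF bounded_on_ball_field(1)[OF \<psi>]])
 have rg: "r t x * \<psi> x = r t x * ?g x" for t x using r_zero[of x t] by (cases "x \<in> ball 0 R") auto
 have Dr: "\<bar>?g x\<bar> <= D" for x using D[of x] by simp
 have lip: "\<bar>(LBINT x. r t x * \<psi> x) - (LBINT x. r s x * \<psi> x)\<bar> <= D * (LBINT x. \<bar>r t x - r s x\<bar>)" if t: "t \<in> {0..T}" for t
 proof -
  have ri: "integrable lborel (r t)" "integrable lborel (r s)" using t s r_int by auto
  have "(LBINT x. r t x * \<psi> x) - (LBINT x. r s x * \<psi> x) = (LBINT x. (r t x - r s x) * ?g x)" unfolding rg left_diff_distrib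
   by (rule Bochner_Integration.integral_diff[symmetric]) (rule integrable_mult_bounded(1)[OF _ gm Dr] ri)+
  then show ?thesis using integrable_mult_bounded(2)[OF Bochner_Integration.integrable_diff[OF ri] gm Dr] by simp
 qed
 have "((%t. (LBINT x. r t x * \<psi> x) - (LBINT x. r s x * \<psi> x)) \<longlongrightarrow> 0) (at s within {0..T})"
 proof (rule Lim_null_comparison)
  show "\<forall>\<^sub>F t in at s within {0..T}. norm ((LBINT x. r t x * \<psi> x) - (LBINT x. r s x * \<psi> x)) <= D * (LBINT x. \<bar>r t x - r s x\<bar>)"
   using lip by (auto simp: eventually_at_filter)
  show "((%t. D * (LBINT x. \<bar>r t x - r s x\<bar>)) \<longlongrightarrow> 0) (at s within {0..T})"
   using tendsto_mult_right_zero[OF r_cont[OF s]] by simp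
 qed
 then show "((%t. LBINT x. r t x * \<psi> x) \<longlongrightarrow> (LBINT x. r s x * \<psi> x)) (at s within {0..T})"
  by (simp add: LIM_zero_iff)
qed

lemma pairing_integrable:
 fixes F :: "real \<times> 'a => 'a"
 assumes F: "square_integrable F" "!!z. z \<notin> {0<..<T} \<times> ball 0 R ==> F z = 0" and \<psi>: "smooth_on UNIV \<psi>"
 shows "integrable lborel (%t. LBINT x. F (t, x) \<bullet> grad \<psi> x)"
proof -
 let ?g = "%z :: real \<times> 'a. indicator {0<..<T} (fst z) *\<^sub>R (indicator (ball 0 R) (snd z) *\<^sub>R grad \<psi> (snd z))"
 obtain D where D: "!!x. norm (indicator (ball (0::'a) R) x *\<^sub>R grad \<psi> x) <= D"
  using bounded_on_ball_field(2)[OF smooth_grad_continuous_on[OF \<psi>]] by blast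
 have D0: "0 <= D" using order_trans[OF norm_ge_zero D] .
 have g: "square_integrable ?g"
 proof (rule square_integrable_bounded[where S = "{0<..<T} \<times> ball 0 R" and C = D])
  have "(%x. indicator (ball (0::'a) R) x *\<^sub>R grad \<psi> x) \<in> borel_measurable borel"
   by (rule square_integrable_measurable[OF bounded_on_ball_field(1)[OF smooth_grad_continuous_on[OF \<psi>]]])
  then have "(%z. indicator (ball (0::'a) R) (snd z) *\<^sub>R grad \<psi> (snd z)) \<in> borel_measurable (borel :: (real \<times> 'a) measure)"
   by (rule measurable_compose[OF fst_snd_borel(2)])
  moreover have "(%z. indicator {0<..<T} (fst z) :: real) \<in> borel_measurable (borel :: (real \<times> 'a) measure)"
   by (rule measurable_compose[OF fst_snd_borel(1)]) simp
  ultimately show "?g \<in> borel_measurable borel" by (rule borel_measurable_scaleR[rotated])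
  show "norm (?g z) <= D" for z using D[of "snd z"] D0 by (cases "fst z \<in> {0<..<T}") auto
 qed (auto simp: cyl_bounded indicator_def)
 have fe: "F (t, x) \<bullet> ?g (t, x) = F (t, x) \<bullet> grad \<psi> x" for t x
  using F(2)[of "(t, x)"] by (cases "(t, x) \<in> {0<..<T} \<times> ball 0 R") auto
 show ?thesis using Fubini_inner(1)[OF F(1) g] by (simp only: fe)
qed

text \<open>Test functions of the form \<open>p t * \<psi> x\<close> reduce the weak equation to a
  statement on the moment \<open>\<mu> t\<close>, which polynomial tests determine. The fields
  \<Gamma> and \<Delta> stand for the selected weak gradients; they enter only through their
  representatives \<open>G\<close> and, after multiplication by the density,
  \<open>q A\<close>.\<close>

lemma flow_identity:
 assumes T: "0 < T" and \<psi>: "smooth_on UNIV \<psi>" and t: "t \<in> {0..T}"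
  and rep: "!!t. t \<in> {0..T} ==> borel_rep (ball 0 R) (\<rho> t) (r t)"
  and G_rep: "AE t in lborel. t \<in> {0<..<T} --> borel_rep (ball 0 R) (\<Gamma> t) (%x. G (t, x))"
  and D_rep: "AE t in lborel. t \<in> {0<..<T} --> borel_rep (ball 0 R) (%x. \<rho> t x *\<^sub>R \<Delta> t x) (%x. q (t, x) *\<^sub>R A (t, x))"
  and eq: "!!\<phi>. smooth_up_to ({0..T} \<times> cball 0 R) \<phi> ==> (!!x. x \<in> cball 0 R ==> \<phi> (T, x) = 0) ==>
    (LINT x:ball 0 R|lebesgue. \<rho>0 x * \<phi> (0, x)) +
      (LINT t:{0..T}|lebesgue. LINT x:ball 0 R|lebesgue. \<rho> t x * pderiv_at (1, 0) \<phi> (t, x)) =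
      (LINT t:{0..T}|lebesgue. LINT x:ball 0 R|lebesgue. \<Gamma> t x \<bullet> grad (%y. \<phi> (t, y)) x) +
      (LINT t:{0..T}|lebesgue. LINT x:ball 0 R|lebesgue. \<rho> t x * (\<Delta> t x \<bullet> grad (%y. \<phi> (t, y)) x))"
 shows "(LBINT x. r t x * \<psi> x) = (LINT x:ball 0 R|lebesgue. \<rho>0 x * \<psi> x) -
  (LBINT s. indicator {0..t} s * (LBINT x. J (s, x) \<bullet> grad \<psi> x))"
proof -
 define \<mu> where "\<mu> t = (LBINT x. r t x * \<psi> x)" for t
 define j1 where "j1 t = (LBINT x. G (t, x) \<bullet> grad \<psi> x)" for t
 define j2 where "j2 t = (LBINT x. (q (t, x) *\<^sub>R A (t, x)) \<bullet> grad \<psi> x)" for t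
 define j where "j t = (LBINT x. J (t, x) \<bullet> grad \<psi> x)" for t
 define a0 where "a0 = (LINT x:ball 0 R|lebesgue. \<rho>0 x * \<psi> x)"
 have qA: "square_integrable (%z. q z *\<^sub>R A z)" using q_nonneg q_le by (intro square_integrable_scaleR(1)[OF A_sq q_meas, of N]) auto
 have i1: "integrable lborel j1" unfolding j1_def[abs_def] by (rule pairing_integrable[OF G_sq G_zero \<psi>])
 have i2: "integrable lborel j2" unfolding j2_def[abs_def] by (rule pairing_integrable[OF qA _ \<psi>]) (simp add: q_zero)
 have ij: "integrable lborel j" unfolding j_def[abs_def] by (rule pairing_integrable[OF J_sq J_zero \<psi>])
 have \<psi>m: "\<psi> \<in> borel_measurable borel" by (intro borel_measurable_continuous_onI smooth_on_continuous_on \<psi>)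
 have gm: "grad \<psi> \<in> borel_measurable borel" by (rule smooth_grad_measurable[OF \<psi>])
 have \<mu>c: "continuous_on {0..T} \<mu>" unfolding \<mu>_def[abs_def] by (rule moment_continuous[OF smooth_on_continuous_on[OF \<psi>]])
 \<comment> \<open>The weak equation has two separate integrals; they are combined into the flux at
   the times where both slices are square integrable.\<close>
 have jsum: "AE t in lborel. j t = j1 t + j2 t" using section_square_integrable[OF G_sq] section_square_integrable[OF qA]
 proof eventually_elim
  case (elim t)
  define g where "g x = indicator (ball 0 R) x *\<^sub>R grad \<psi> x" for x
  have g: "square_integrable g" "!!x. x \<in> ball 0 R ==> g x = grad \<psi> x"
   unfolding g_def[abs_def] by (rule bounded_on_ball_field(1)[OF smooth_grad_continuous_on[OF \<psi>]], simp)
  have z: "x \<notin> ball 0 R ==> G (t, x) = 0" "x \<notin> ball 0 R ==> q (t, x) = 0" for x using G_zero q_zero by auto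
  have 1: "G (t, x) \<bullet> grad \<psi> x = G (t, x) \<bullet> g x" "(q (t, x) *\<^sub>R A (t, x)) \<bullet> grad \<psi> x = (q (t, x) *\<^sub>R A (t, x)) \<bullet> g x" for x
   using z[of x] g(2)[of x] by (cases "x \<in> ball 0 R", auto)+
  have "j t = (LBINT x. G (t, x) \<bullet> grad \<psi> x + (q (t, x) *\<^sub>R A (t, x)) \<bullet> grad \<psi> x)"
   unfolding j_def J_eq by (simp only: inner_add_left)
  then show ?case unfolding j1_def j2_def 1 using L2_inner(1)[OF elim(1) g(1)] L2_inner(1)[OF elim(2) g(1)] by simp
 qed
 have "\<mu> t = a0 - (LBINT s. indicator {0..t} s * j s)"
 proof (rule primitive_from_polynomial_tests[OF T \<mu>c ij _ t])
  fix a :: "nat => real" and n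
  define w where "w t = (\<Sum>i\<le>n. a i * t ^ i)" for t :: real
  define p where "p t = (\<Sum>i\<le>n. a i / real (Suc i) * (t ^ Suc i - T ^ Suc i))" for t :: real
  have dp: "(p has_real_derivative w t) (at t)" for t unfolding p_def[abs_def] w_def
   by (auto intro!: derivative_eq_intros sum.cong simp: field_simps simp del: of_nat_Suc power_Suc)
  have ps: "smooth_on UNIV p" unfolding p_def[abs_def] by (rule smooth_polynomial)
  have pd: "pderiv_at 1 p t = w t" for t using pderiv_at_eq[of p "%h. w t * h" t 1] dp[of t] by (simp add: has_field_derivative_def)
  have pc: "continuous_on S p" and wc: "continuous_on S w" for S
   unfolding w_def[abs_def] by (rule smooth_on_continuous_on[OF ps], intro continuous_intros)
  let ?\<phi> = "%z. p (fst z) * \<psi> (snd z)"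
  have "smooth_up_to ({0..T} \<times> cball 0 R) ?\<phi>"
   unfolding smooth_up_to_def using smooth_tensor(1)[OF ps \<psi>] by (intro exI[of _ UNIV]) simp
  moreover have "p T = 0" by (simp add: p_def)
  ultimately have E: "(LINT x:ball 0 R|lebesgue. \<rho>0 x * ?\<phi> (0, x)) +
      (LINT t:{0..T}|lebesgue. LINT x:ball 0 R|lebesgue. \<rho> t x * pderiv_at (1, 0) ?\<phi> (t, x)) =
      (LINT t:{0..T}|lebesgue. LINT x:ball 0 R|lebesgue. \<Gamma> t x \<bullet> grad (%y. ?\<phi> (t, y)) x) +
      (LINT t:{0..T}|lebesgue. LINT x:ball 0 R|lebesgue. \<rho> t x * (\<Delta> t x \<bullet> grad (%y. ?\<phi> (t, y)) x))"
   by (intro eq) auto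
  have E1: "(LINT x:ball 0 R|lebesgue. \<rho>0 x * ?\<phi> (0, x)) = p 0 * a0"
  proof -
   have "(LINT x:ball 0 R|lebesgue. \<rho>0 x * ?\<phi> (0, x)) = (LINT x:ball 0 R|lebesgue. p 0 * (\<rho>0 x * \<psi> x))" by (simp add: mult_ac)
   then show ?thesis by (simp add: a0_def)
  qed
  have "(LINT x:ball 0 R|lebesgue. \<rho> t x * pderiv_at (1, 0) ?\<phi> (t, x)) = \<mu> t * w t" if "t \<in> {0<..<T}" for t
  proof -
   have "(LINT x:ball 0 R|lebesgue. \<rho> t x * pderiv_at (1, 0) ?\<phi> (t, x)) = (LINT x:ball 0 R|lebesgue. \<rho> t x * (w t * \<psi> x))"
    by (simp only: smooth_tensor(2)[OF ps \<psi>] pd)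
   also have "\<dots> = (LBINT x. r t x * (w t * \<psi> x))" using rep[of t] that \<psi>m by (intro borel_rep_scaled_test) auto
   also have "\<dots> = (LBINT x. w t * (r t x * \<psi> x))" by (simp add: mult_ac)
   finally show ?thesis by (simp add: \<mu>_def mult.commute)
  qed
  moreover have "(%t. indicator {0..T} t * (\<mu> t * w t)) \<in> borel_measurable borel"
   using borel_measurable_integrable[OF borel_integrable_compact[OF compact_Icc continuous_on_mult[OF \<mu>c wc]]] by simp
  ultimately have E2: "(LINT t:{0..T}|lebesgue. LINT x:ball 0 R|lebesgue. \<rho> t x * pderiv_at (1, 0) ?\<phi> (t, x))
    = (LBINT t. indicator {0..T} t * (\<mu> t * w t))" by (intro time_integral_rep) auto
  have gr: "grad (%y. ?\<phi> (t, y)) x = p t *\<^sub>R grad \<psi> x" for t x using grad_cmult[OF \<psi>] by simp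
  obtain Dp where Dp: "!!t. \<bar>indicator {0..T} t * p t\<bar> <= Dp"
  proof -
   obtain D where "!!t. t \<in> {0..T} ==> \<bar>p t\<bar> <= D"
    using compact_imp_bounded[OF compact_continuous_image[OF pc compact_Icc], of 0 T] unfolding bounded_iff real_norm_def by (metis imageI)
   then have "\<bar>indicator {0..T} t * p t\<bar> <= max 0 D" for t by (auto simp: indicator_def le_max_iff_disj)
   then show ?thesis by (rule that)
  qed
  have pm: "(%t. indicator {0..T} t * p t) \<in> borel_measurable borel"
   using borel_measurable_integrable[OF borel_integrable_compact[OF compact_Icc pc]] by simp
  have ip: "integrable lborel (%t. indicator {0..T} t * (f t * p t))" if "integrable lborel f" for f
   using integrable_mult_bounded(1)[OF that pm Dp] by (simp add: mult_ac)
  have slice: "(LBINT x. F x \<bullet> (c *\<^sub>R grad \<psi> x)) = (LBINT x. F x \<bullet> grad \<psi> x) * c" for F :: "'a => 'a" and c :: real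
   by (simp add: mult.commute)
  have "AE t in lborel. t \<in> {0<..<T} --> (LINT x:ball 0 R|lebesgue. \<Gamma> t x \<bullet> grad (%y. ?\<phi> (t, y)) x) = j1 t * p t"
   using G_rep
  proof eventually_elim
   case (elim t)
   show ?case
   proof
    assume "t \<in> {0<..<T}"
    then have "borel_rep (ball 0 R) (\<Gamma> t) (%x. G (t, x))" using elim by blast
    from borel_rep_inner_test[OF this, of "%x. p t *\<^sub>R grad \<psi> x"] gm
    show "(LINT x:ball 0 R|lebesgue. \<Gamma> t x \<bullet> grad (%y. ?\<phi> (t, y)) x) = j1 t * p t"
     unfolding gr slice j1_def by (simp only: borel_measurable_scaleR borel_measurable_const)
   qed
  qed
  then have E3: "(LINT t:{0..T}|lebesgue. LINT x:ball 0 R|lebesgue. \<Gamma> t x \<bullet> grad (%y. ?\<phi> (t, y)) x)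
    = (LBINT t. indicator {0..T} t * (j1 t * p t))" using borel_measurable_integrable[OF ip[OF i1]] by (intro time_integral_rep) auto
  have "AE t in lborel. t \<in> {0<..<T} --> (LINT x:ball 0 R|lebesgue. \<rho> t x * (\<Delta> t x \<bullet> grad (%y. ?\<phi> (t, y)) x)) = j2 t * p t"
   using D_rep
  proof eventually_elim
   case (elim t)
   show ?case
   proof
    assume "t \<in> {0<..<T}"
    then have "borel_rep (ball 0 R) (%x. \<rho> t x *\<^sub>R \<Delta> t x) (%x. q (t, x) *\<^sub>R A (t, x))" using elim by blast
    from borel_rep_inner_test[OF this, of "%x. p t *\<^sub>R grad \<psi> x"] gm
    have "(LINT x:ball 0 R|lebesgue. (\<rho> t x *\<^sub>R \<Delta> t x) \<bullet> (p t *\<^sub>R grad \<psi> x)) = j2 t * p t"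
     unfolding slice j2_def by (simp only: borel_measurable_scaleR borel_measurable_const)
    then show "(LINT x:ball 0 R|lebesgue. \<rho> t x * (\<Delta> t x \<bullet> grad (%y. ?\<phi> (t, y)) x)) = j2 t * p t"
     unfolding gr by (simp only: inner_scaleR_left)
   qed
  qed
  then have E4: "(LINT t:{0..T}|lebesgue. LINT x:ball 0 R|lebesgue. \<rho> t x * (\<Delta> t x \<bullet> grad (%y. ?\<phi> (t, y)) x))
    = (LBINT t. indicator {0..T} t * (j2 t * p t))" using borel_measurable_integrable[OF ip[OF i2]] by (intro time_integral_rep) auto
  have "(LBINT t. indicator {0..T} t * (j1 t * p t)) + (LBINT t. indicator {0..T} t * (j2 t * p t))
    = (LBINT t. indicator {0..T} t * (j1 t * p t) + indicator {0..T} t * (j2 t * p t))" using ip[OF i1] ip[OF i2] by simp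
  also have "\<dots> = (LBINT t. indicator {0..T} t * (j t * p t))"
  proof (rule integral_cong_AE)
   show "AE t in lborel. indicator {0..T} t * (j1 t * p t) + indicator {0..T} t * (j2 t * p t) = indicator {0..T} t * (j t * p t)"
    using jsum by eventually_elim (simp add: algebra_simps)
  qed (use borel_measurable_integrable[OF ip[OF i1]] borel_measurable_integrable[OF ip[OF i2]]
    borel_measurable_integrable[OF ip[OF ij]] in simp_all)
  finally show "(LBINT t. indicator {0..T} t * (\<mu> t * (\<Sum>i\<le>n. a i * t ^ i))) =
    (LBINT t. indicator {0..T} t * (j t * (\<Sum>i\<le>n. a i / real (Suc i) * (t ^ Suc i - T ^ Suc i))))
    - a0 * (\<Sum>i\<le>n. a i / real (Suc i) * (0 ^ Suc i - T ^ Suc i))"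
   using E unfolding E1 E2 E3 E4 w_def[symmetric] p_def[symmetric] by (simp add: mult.commute)
 qed
 then show ?thesis by (simp only: \<mu>_def a0_def j_def)
qed

end

lemma L1_on_nonneg_borel_rep:
 fixes f :: "'a::euclidean_space => real"
 assumes f: "L1_on U f" and U: "U \<in> sets borel" and nn: "AE x in lebesgue. x \<in> U --> 0 <= f x"
 obtains g where "borel_rep U f g" "!!x. 0 <= g x" "integrable lborel g"
proof -
 have fi: "set_integrable lebesgue U f" using f by (simp add: L1_on_def)
 then have "set_borel_measurable lebesgue U f" unfolding set_integrable_def set_borel_measurable_def by (rule borel_measurable_integrable)
 then obtain g where g: "borel_rep U f g" using ex_borel_rep[OF _ U] by metis
 have rep: "borel_rep U f (%x. max 0 (g x))"
 proof (rule borel_rep_compose[OF g, of "%_ y. max 0 y"])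
  show "(%x. max 0 (g x)) \<in> borel_measurable borel" using borel_repD(1)[OF g] by measurable
  show "AE x in lborel. x \<in> U --> f x = max 0 (f x)" using nn unfolding AE_lebesgue_iff by eventually_elim auto
 qed simp
 show ?thesis by (rule that[OF rep]) (use borel_rep_integral(2)[OF rep] fi in auto)
qed

lemma borel_rep_unique:
 assumes "borel_rep U f g" "borel_rep U f g'"
 shows "AE x in lborel. g x = g' x" using borel_repD(3)[OF assms(1)] borel_repD(3)[OF assms(2)]
proof eventually_elim
 case (elim x)
 then show ?case using borel_repD(2)[OF assms(1), of x] borel_repD(2)[OF assms(2), of x] by (cases "x \<in> U") auto
qed

lemma L2_on_borel_rep:
 fixes f :: "'a::euclidean_space => 'b::euclidean_space"
 assumes f: "L2_on U f" and U: "U \<in> sets borel"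
 obtains g where "borel_rep U f g" "square_integrable g"
proof -
 obtain g where g: "borel_rep U f g" using f ex_borel_rep[OF _ U] unfolding L2_on_def by metis
 have "borel_rep U (%x. (norm (f x))\<^sup>2) (%x. (norm (g x))\<^sup>2)" unfolding borel_rep_def
 proof (intro conjI allI impI)
  show "(%x. (norm (g x))\<^sup>2) \<in> borel_measurable borel" using borel_repD(1)[OF g] by measurable
  show "AE x in lborel. x \<in> U --> (norm (f x))\<^sup>2 = (norm (g x))\<^sup>2" using borel_repD(3)[OF g] by eventually_elim auto
 qed (simp add: borel_repD(2)[OF g])
 from borel_rep_integral(2)[OF this] have "integrable lborel (%x. (norm (g x))\<^sup>2)" using f by (simp add: L2_on_def)
 then have "square_integrable g" using borel_repD(1)[OF g] by (simp add: square_integrable_def)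
 then show ?thesis by (rule that[OF g])
qed

text \<open>At a point \<open>x\<close> both sides see only the slices of the kernels at
  \<open>x\<close>, and these agree for almost every \<open>x\<close>.\<close>

lemma interaction_eq_potential:
 fixes K :: "'a::euclidean_space => 'a => real"
 assumes K: "borel_rep (ball 0 R \<times> ball 0 R) (%z. K (fst z) (snd z)) K'" and u: "borel_rep (ball 0 R) u f"
 shows "AE x in lborel. x \<in> ball 0 R --> potential K' f x = interaction R K u x" using borel_rep_section[OF K]
proof eventually_elim
 case (elim x)
 show ?case
 proof
  assume "x \<in> ball 0 R"
  then have Kx: "borel_rep (ball 0 R) (K x) (%y. K' (x, y))" using elim by simp
  have "borel_rep (ball 0 R) (%y. K x y * u y) (%y. K' (x, y) * f y)"
  proof (rule borel_rep_compose[OF u, of "%y v. K' (x, y) * v"])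
   show "(%y. K' (x, y) * f y) \<in> borel_measurable borel" by (rule borel_measurable_times[OF borel_repD(1)[OF Kx] borel_repD(1)[OF u]])
   show "AE y in lborel. y \<in> ball 0 R --> K x y * u y = K' (x, y) * u y" using borel_repD(3)[OF Kx] by eventually_elim auto
  qed simp
  from borel_rep_integral(1)[OF this] show "potential K' f x = interaction R K u x" by (simp add: potential_def interaction_def)
 qed
qed

text \<open>The order of quantifiers matters: \<open>r\<close>, the potentials and the bound
  \<open>C\<close> are chosen once, while \<open>q\<close>, \<open>G\<close> and \<open>N\<close>
  depend on \<open>T\<close>. The energy at a given time is therefore the same whichever time
  interval is used to estimate it.\<close>

lemma strong_solution_flow:
 fixes V \<rho>0 :: "'a::euclidean_space => real" and K :: "'a => 'a => real" and \<rho> :: "real => 'a => real"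
 assumes m: "0 < m" "m < 1" and R: "0 < R"
  and V: "W2inf_on (ball 0 R) V" "AE x in lebesgue. x \<in> ball 0 R --> 0 <= V x"
  and K: "W2inf_on (ball 0 R \<times> ball 0 R) (%(x, y). K x y)"
   "AE (x, y) in lebesgue. x \<in> ball 0 R \<and> y \<in> ball 0 R --> K x y = K y x \<and> 0 <= K x y"
  and sol: "strong_solution m R V K \<rho>0 \<rho>"
 obtains r V' gV K' k C where
  "!!t. 0 <= t ==> borel_rep (ball 0 R) (\<rho> t) (r t)"
  "!!T. 0 < T ==> \<exists>N q G. dissipative_flow m R T N C r q G V' gV K' k"
proof -
 let ?B = "ball (0::'a) R"
 obtain V' gV C1 where V': "borel_rep ?B V V'" "!!x. 0 <= V' x" "!!x. V' x <= C1"
  and gV: "gV \<in> borel_measurable borel" "!!x. norm (gV x) <= C1" "!!x. x \<notin> ?B ==> gV x = 0"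
  and Vw: "has_weak_grad ?B V gV" "has_weak_grad ?B V' gV" by (rule W2inf_potential_representatives[OF V(1) open_ball V(2)]) (rule that)
 obtain K' k C2 where K': "borel_rep (?B \<times> ?B) (%z. K (fst z) (snd z)) K'" "!!z. 0 <= K' z" "!!z. K' z <= C2"
   "!!x y. K' (x, y) = K' (y, x)"
  and k: "k \<in> borel_measurable borel" "!!z. norm (k z) <= C2" "!!z. z \<notin> ?B \<times> ?B ==> k z = 0"
  and kw: "!!b. b \<in> Basis ==> has_weak_pderiv (?B \<times> ?B) (b, 0) K' (%z. k z \<bullet> b)"
  by (rule W2inf_kernel_representatives[OF K(1) open_ball K(2)]) (rule that)
 define C where "C = max C1 C2"
 have V'm: "V' \<in> borel_measurable borel" "!!x. x \<notin> ?B ==> V' x = 0" using borel_repD[OF V'(1)] by auto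
 have K'm: "K' \<in> borel_measurable borel" "!!z. z \<notin> ?B \<times> ?B ==> K' z = 0" using borel_repD[OF K'(1)] by auto
 have Cb: "V' x <= C" "norm (gV x) <= C" "K' z <= C" "norm (k z) <= C" for x z
  using V'(3)[of x] gV(2)[of x] K'(3)[of z] k(2)[of z] by (auto simp: C_def)
 have pot: "has_weak_grad ?B (potential K' f) (%x. LBINT y. f y *\<^sub>R k (x, y))"
  if "integrable lborel f" "!!x. x \<notin> ?B ==> f x = 0" for f
 proof (rule potential_weak_grad[OF K'm(1) _ k(1) Cb(4) _ _ kw that])
  show "\<bar>K' z\<bar> <= C" for z using K'(2)[of z] Cb(3)[of z] by simp
  show "K' (x, y) = 0" if "x \<notin> ?B \<or> y \<notin> ?B" for x y using that by (intro K'm(2)) auto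
  show "k (x, y) = 0" if "x \<notin> ?B \<or> y \<notin> ?B" for x y using that by (intro k(3)) auto
 qed
 have nn: "AE x in lebesgue. x \<in> ?B --> 0 <= \<rho> t x" if "0 <= t" for t
  using sol[unfolded strong_solution_def, THEN conjunct1] that by simp
 note sol_T = sol[unfolded strong_solution_def, THEN conjunct2, THEN spec, THEN mp]
 have reg: "C_L1_on {0..T} ?B \<rho>" "Linf_on ({0<..<T} \<times> ?B) (%(t, x). \<rho> t x)" "L2_H2_on T ?B (%t x. \<rho> t x powr m)"
  if "0 < T" for T by (rule sol_T[OF that, THEN conjunct1] sol_T[OF that, THEN conjunct2, THEN conjunct1]
    sol_T[OF that, THEN conjunct2, THEN conjunct2, THEN conjunct1])+
 have "\<exists>g. borel_rep ?B (\<rho> t) g \<and> (\<forall>x. 0 <= g x) \<and> integrable lborel g" if t: "0 <= t" for t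
 proof -
  have "L1_on ?B (\<rho> t)" using reg(1)[of "t + 1"] t by (auto simp: C_L1_on_def)
  show ?thesis by (rule L1_on_nonneg_borel_rep[OF \<open>L1_on ?B (\<rho> t)\<close> _ nn[OF t]]) (simp, blast)
 qed
 then obtain r0 where r0: "!!t. 0 <= t ==> borel_rep ?B (\<rho> t) (r0 t)" "!!t x. 0 <= t ==> 0 <= r0 t x"
   "!!t. 0 <= t ==> integrable lborel (r0 t)" by metis
 \<comment> \<open>Extended by 0 to negative times, so that sign and support are as required for
   every \<open>t\<close>.\<close>
 define r where "r t x = (if 0 <= t then r0 t x else 0)" for t x
 have r_rep: "borel_rep ?B (\<rho> t) (r t)" if "0 <= t" for t using r0(1)[OF that] that by (simp add: r_def[abs_def])
 have r_L1: "integrable lborel (r t)" for t using r0(3)[of t] by (cases "0 <= t") (simp_all add: r_def[abs_def])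
 have r_nn: "0 <= r t x" for t x using r0(2) by (simp add: r_def)
 have r_zero: "r t x = 0" if "x \<notin> ?B" for t x using borel_repD(2)[OF r0(1) that] by (simp add: r_def)
 have flow: "\<exists>N q G. dissipative_flow m R T N C r q G V' gV K' k" if T: "0 < T" for T
 proof -
  let ?Q = "{0<..<T} \<times> ?B"
  have Qm: "?Q \<in> sets borel" by (simp add: open_Times borel_open)
  obtain q0 N where q0: "borel_rep ?Q (%(t, x). \<rho> t x) q0" "0 <= N" "!!z. norm (q0 z) <= N"
   by (rule Linf_borel_rep[OF reg(2)[OF T] Qm]) (rule that)
  \<comment> \<open>Cutting at 0 makes the representative nonnegative everywhere; on almost every
    slice it still represents the solution.\<close>
  define q where "q z = max 0 (q0 z)" for z
  have qm: "q \<in> borel_measurable borel" unfolding q_def[abs_def] using borel_repD(1)[OF q0(1)] by measurable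
  have q_zero: "z \<notin> ?Q ==> q z = 0" for z using borel_repD(2)[OF q0(1)] by (simp add: q_def)
  have q_rep: "AE t in lborel. t \<in> {0<..<T} --> borel_rep ?B (\<rho> t) (%x. q (t, x))" using borel_rep_section[OF q0(1)]
  proof eventually_elim
   case (elim t)
   show ?case
   proof
    assume t: "t \<in> {0<..<T}"
    then have "borel_rep ?B (\<rho> t) (%x. q0 (t, x))" using elim by simp
    then show "borel_rep ?B (\<rho> t) (%x. q (t, x))" unfolding q_def
    proof (rule borel_rep_compose[of _ _ _ "%_ y. max 0 y"])
     show "(%x. max 0 (q0 (t, x))) \<in> borel_measurable borel" using section_measurable(1)[OF qm, of t] by (simp add: q_def)
     show "AE x in lborel. x \<in> ?B --> \<rho> t x = max 0 (\<rho> t x)"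
      using nn[of t] t unfolding AE_lebesgue_iff by (auto elim!: eventually_mono)
    qed simp
   qed
  qed
  have q_r: "AE t in lborel. t \<in> {0<..<T} --> (AE x in lborel. q (t, x) = r t x)"
   using q_rep by eventually_elim (auto intro!: borel_rep_unique r_rep)
  obtain \<Gamma> H where \<Gamma>: "L2_on ?Q (%(t, x). \<Gamma> t x)"
   "AE t in lebesgue. t \<in> {0<..<T} --> has_weak_grad ?B (%x. \<rho> t x powr m) (\<Gamma> t) \<and> H t"
   using reg(3)[OF T] unfolding L2_H2_on_def by fast
  obtain G where G: "borel_rep ?Q (%(t, x). \<Gamma> t x) G" "square_integrable G" by (rule L2_on_borel_rep[OF \<Gamma>(1) Qm]) (rule that)
  have \<Gamma>w: "AE t in lborel. t \<in> {0<..<T} --> has_weak_grad ?B (%x. \<rho> t x powr m) (\<Gamma> t)"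
   using \<Gamma>(2) unfolding AE_lebesgue_iff by eventually_elim blast
  have Gs: "AE t in lborel. t \<in> {0<..<T} --> borel_rep ?B (\<Gamma> t) (%x. G (t, x))"
   using borel_rep_section[OF G(1)] by simp
  interpret flow_data m R T N C r q G V' gV K' k
  proof
   show "((%t. LBINT x. \<bar>r t x - r s x\<bar>) \<longlongrightarrow> 0) (at s within {0..T})" if s: "s \<in> {0..T}" for s
   proof (rule Lim_transform_eventually)
    show "((%t. L1_norm ?B (%x. \<rho> t x - \<rho> s x)) \<longlongrightarrow> 0) (at s within {0..T})"
     using reg(1)[OF T] s unfolding C_L1_on_def by blast
    have "L1_norm ?B (%x. \<rho> t x - \<rho> s x) = (LBINT x. \<bar>r t x - r s x\<bar>)" if t: "t \<in> {0..T}" for t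
    proof -
     have rt: "borel_rep ?B (\<rho> t) (r t)" "borel_rep ?B (\<rho> s) (r s)" using s t r_rep by auto
     have "borel_rep ?B (%x. norm (\<rho> t x - \<rho> s x)) (%x. \<bar>r t x - r s x\<bar>)" unfolding borel_rep_def
     proof (intro conjI allI impI)
      show "(%x. \<bar>r t x - r s x\<bar>) \<in> borel_measurable borel"
       using borel_repD(1)[OF rt(1)] borel_repD(1)[OF rt(2)] by measurable
      show "AE x in lborel. x \<in> ?B --> norm (\<rho> t x - \<rho> s x) = \<bar>r t x - r s x\<bar>"
       using borel_repD(3)[OF rt(1)] borel_repD(3)[OF rt(2)] by eventually_elim auto
     qed (simp add: r_zero)
     from borel_rep_integral(1)[OF this] show ?thesis by (simp add: L1_norm_def)
    qed
    then show "\<forall>\<^sub>F t in at s within {0..T}. L1_norm ?B (%x. \<rho> t x - \<rho> s x) = (LBINT x. \<bar>r t x - r s x\<bar>)"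
     by (auto simp: eventually_at_filter)
   qed
   show "0 <= q z" "q z <= N" for z using q0(2) q0(3)[of z] by (auto simp: q_def)
   show "AE t in lborel. t \<in> {0<..<T} --> has_weak_grad ?B (%x. q (t, x) powr m) (%x. G (t, x))"
    using \<Gamma>w Gs q_rep
   proof eventually_elim
    case (elim t)
    show ?case
    proof
     assume t: "t \<in> {0<..<T}"
     show "has_weak_grad ?B (%x. q (t, x) powr m) (%x. G (t, x))"
     proof (rule has_weak_grad_cong)
      show "has_weak_grad ?B (%x. \<rho> t x powr m) (\<Gamma> t)" using elim t by blast
      have "AE x in lborel. x \<in> ?B --> \<rho> t x = q (t, x)" using elim t borel_repD(3) by blast
      then show "AE x in lborel. x \<in> ?B --> \<rho> t x powr m = q (t, x) powr m" by eventually_elim auto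
      show "AE x in lborel. x \<in> ?B --> \<Gamma> t x = G (t, x)" using elim t borel_repD(3) by blast
     qed
    qed
   qed
   show "G z = 0" if "z \<notin> ?Q" for z using borel_repD(2)[OF G(1) that] .
   show "K' (x, y) = 0" "k (x, y) = 0" if "x \<notin> ?B" for x y using K'm(2)[of "(x, y)"] k(3)[of "(x, y)"] that by auto
  qed (assumption | rule m R r_L1 r_nn r_zero qm q_zero q_r G(2) V'm V'(2) gV(1,3) Cb Vw(2) K'm(1) K'(2,4) k(1) pot)+
  have wV: "AE x in lborel. x \<in> ?B --> weak_grad ?B V x = gV x" by (rule weak_grad_AE[OF open_ball Vw(1)])
  have G_rep: "AE t in lborel. t \<in> {0<..<T} --> borel_rep ?B (weak_grad ?B (%y. \<rho> t y powr m)) (%x. G (t, x))"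
   using \<Gamma>w Gs
  proof eventually_elim
   case (elim t)
   show ?case
   proof
    assume t: "t \<in> {0<..<T}"
    then have g: "borel_rep ?B (\<Gamma> t) (%x. G (t, x))" and w: "has_weak_grad ?B (%x. \<rho> t x powr m) (\<Gamma> t)" using elim by auto
    show "borel_rep ?B (weak_grad ?B (%y. \<rho> t y powr m)) (%x. G (t, x))"
     using borel_rep_compose[OF g, of "%_ y. y"] borel_repD(1)[OF g] weak_grad_AE[OF open_ball w] by simp
   qed
  qed
  have D_rep: "AE t in lborel. t \<in> {0<..<T} -->
   borel_rep ?B (%x. \<rho> t x *\<^sub>R (weak_grad ?B V x + weak_grad ?B (interaction R K (\<rho> t)) x)) (%x. q (t, x) *\<^sub>R A (t, x))"
   using q_rep q_r
  proof eventually_elim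
   case (elim t)
   show ?case
   proof
    assume t: "t \<in> {0<..<T}"
    then have qt: "borel_rep ?B (\<rho> t) (%x. q (t, x))" and ae: "AE x in lborel. q (t, x) = r t x" using elim by auto
    have "has_weak_grad ?B (interaction R K (\<rho> t)) (%x. LBINT y. r t y *\<^sub>R k (x, y))"
     using t by (intro has_weak_grad_cong[OF pot[OF r_L1 r_zero] interaction_eq_potential[OF K'(1) r_rep]]) auto
    then have wI: "AE x in lborel. x \<in> ?B --> weak_grad ?B (interaction R K (\<rho> t)) x = (LBINT y. r t y *\<^sub>R k (x, y))"
     by (rule weak_grad_AE[OF open_ball])
    have dr: "drift_K q k (t, x) = (LBINT y. r t y *\<^sub>R k (x, y))" for x unfolding drift_K_def fst_conv snd_conv
    proof (rule integral_cong_AE)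
     show "AE y in lborel. q (t, y) *\<^sub>R k (x, y) = r t y *\<^sub>R k (x, y)" using ae by eventually_elim simp
     show "(%y. q (t, y) *\<^sub>R k (x, y)) \<in> borel_measurable lborel" by (rule borel_measurable_integrable[OF W_integrand])
     show "(%y. r t y *\<^sub>R k (x, y)) \<in> borel_measurable lborel"
      using section_measurable(1)[OF k(1), of x] borel_measurable_integrable[OF r_L1[of t]] by simp
    qed
    show "borel_rep ?B (%x. \<rho> t x *\<^sub>R (weak_grad ?B V x + weak_grad ?B (interaction R K (\<rho> t)) x)) (%x. q (t, x) *\<^sub>R A (t, x))"
     unfolding borel_rep_def
    proof (intro conjI allI impI)
     show "(%x. q (t, x) *\<^sub>R A (t, x)) \<in> borel_measurable borel"
      by (intro borel_measurable_scaleR section_measurable(1)[OF qm] section_measurable(1)[OF square_integrable_measurable[OF A_sq]])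
     show "q (t, x) *\<^sub>R A (t, x) = 0" if "x \<notin> ?B" for x using that q_zero by simp
     show "AE x in lborel. x \<in> ?B -->
       \<rho> t x *\<^sub>R (weak_grad ?B V x + weak_grad ?B (interaction R K (\<rho> t)) x) = q (t, x) *\<^sub>R A (t, x)"
      using wV wI borel_repD(3)[OF qt] by eventually_elim (use t in \<open>auto simp: A_def dr\<close>)
    qed
   qed
  qed
  have eq: "(LINT x:?B|lebesgue. \<rho>0 x * \<phi> (0, x)) +
      (LINT t:{0..T}|lebesgue. LINT x:?B|lebesgue. \<rho> t x * pderiv_at (1, 0) \<phi> (t, x)) =
      (LINT t:{0..T}|lebesgue. LINT x:?B|lebesgue. weak_grad ?B (%y. \<rho> t y powr m) x \<bullet> grad (%y. \<phi> (t, y)) x) +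
      (LINT t:{0..T}|lebesgue. LINT x:?B|lebesgue. \<rho> t x *
       ((weak_grad ?B V x + weak_grad ?B (interaction R K (\<rho> t)) x) \<bullet> grad (%y. \<phi> (t, y)) x))"
   if "smooth_up_to ({0..T} \<times> cball 0 R) \<phi>" "!!x. x \<in> cball 0 R ==> \<phi> (T, x) = 0" for \<phi>
   by (rule sol_T[OF T, THEN conjunct2, THEN conjunct2, THEN conjunct2, THEN conjunct2, THEN spec, of \<phi>, THEN mp]) (use that in simp)
  have "dissipative_flow m R T N C r q G V' gV K' k"
  proof unfold_locales
   fix \<psi> :: "'a => real" and t :: real
   assume \<psi>: "smooth_on UNIV \<psi>" and t: "0 <= t" "t <= T"
   have id: "(LBINT x. r t x * \<psi> x) = (LINT x:?B|lebesgue. \<rho>0 x * \<psi> x) -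
     (LBINT s. indicator {0..t} s * (LBINT x. J (s, x) \<bullet> grad \<psi> x))" if "t \<in> {0..T}" for t
    by (rule flow_identity[OF T \<psi> that _ G_rep D_rep]) (use r_rep in simp, rule eq)
   \<comment> \<open>Evaluating the identity at time 0 identifies the moments of \<open>r 0\<close>
     with those of the initial datum.\<close>
   have "(LBINT s. indicator {0..0} s * (LBINT x. J (s, x) \<bullet> grad \<psi> x)) = (\<integral>s. 0 \<partial>(lborel :: real measure))"
   proof (rule integral_cong_AE)
    show "AE s in lborel. indicator {0..0} s * (LBINT x. J (s, x) \<bullet> grad \<psi> x) = 0"
     using AE_lborel_singleton[of 0] by eventually_elim simp
    show "(%s. indicator {0..0} s * (LBINT x. J (s, x) \<bullet> grad \<psi> x)) \<in> borel_measurable lborel"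
     using borel_measurable_integrable[OF pairing_integrable[OF J_sq J_zero \<psi>]] by measurable
   qed simp
   then have "(LBINT x. r 0 x * \<psi> x) = (LINT x:?B|lebesgue. \<rho>0 x * \<psi> x)" using id[of 0] T by simp
   then show "(LBINT x. r t x * \<psi> x) = (LBINT x. r 0 x * \<psi> x) -
     (LBINT s. indicator {0..t} s * (LBINT x. J (s, x) \<bullet> grad \<psi> x))" using id[of t] t by simp
  qed
  then show ?thesis by blast
 qed
 show ?thesis by (rule that[OF r_rep flow])
qed

section \<open>Convergence\<close>

text \<open>The working form of the norm: an integrable Borel field on the whole space with the
  right divergence on \<open>U\<close> bounds it, and the part of the field outside \<open>U\<close>
  can only increase the bound.\<close>

lemma Wm11_field:
 fixes F :: "'a::euclidean_space => 'a"
 assumes U: "U \<in> sets borel" and F: "integrable lborel F"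
  and div: "!!\<phi>. test_fun U \<phi> ==> \<mu> \<phi> = - (LBINT x. F x \<bullet> grad \<phi> x)"
 shows "\<mu> \<in> Wm11 U" "Wm11_norm U \<mu> <= ennreal (LBINT x. norm (F x))"
proof -
 have Fm: "F \<in> borel_measurable borel" using F by auto
 have rep: "borel_rep U F (%x. indicator U x *\<^sub>R F x)" using Fm U by (auto simp: borel_rep_def)
 have iU: "integrable lborel (%x. indicator U x *\<^sub>R F x)" using integrable_mult_indicator[OF _ F] U by simp
 then have L1: "L1_on U F" unfolding L1_on_def by (simp add: borel_rep_integral(2)[OF rep])
 have d: "is_div_on U \<mu> F" unfolding is_div_on_def
 proof (intro allI impI)
  fix \<phi> :: "'a => real" assume t: "test_fun U \<phi>"
  obtain S where S: "compact S" "S \<subseteq> U" "!!x. x \<notin> S ==> \<phi> x = 0" and sm: "smooth_on UNIV \<phi>"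
   using t by (auto simp: test_fun_def)
  have "!!x. x \<notin> S ==> grad \<phi> x = 0" using smooth_compact_support_bounds[OF sm S(1,3)] by metis
  then have "x \<notin> U ==> grad \<phi> x = 0" for x using S(2) by blast
  then have "(LINT x:U|lebesgue. F x \<bullet> grad \<phi> x) = (LBINT x. F x \<bullet> grad \<phi> x)"
   by (intro set_integral_lebesgue_eq_lborel borel_measurable_inner Fm smooth_grad_measurable[OF sm]) simp
  then show "\<mu> \<phi> = - (LINT x:U|lebesgue. F x \<bullet> grad \<phi> x)" using div[OF t] by simp
 qed
 show "\<mu> \<in> Wm11 U" by (rule Wm11I[OF L1 d])
 have "borel_rep U (%x. norm (F x)) (%x. norm (indicator U x *\<^sub>R F x))" unfolding borel_rep_def
 proof (intro conjI allI impI)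
  show "(%x. norm (indicator U x *\<^sub>R F x)) \<in> borel_measurable borel"
   by (rule measurable_compose[OF borel_repD(1)[OF rep] borel_measurable_norm])
 qed auto
 then have "L1_norm U F = (LBINT x. norm (indicator U x *\<^sub>R F x))" unfolding L1_norm_def by (rule borel_rep_integral(1))
 also have "\<dots> <= (LBINT x. norm (F x))" using iU F by (intro integral_mono integrable_norm) (auto simp: indicator_def)
 finally show "Wm11_norm U \<mu> <= ennreal (LBINT x. norm (F x))" using Wm11_norm_le[OF L1 d] by (rule order_trans[OF _ ennreal_leI, rotated])
qed

text \<open>Each fact is read off from a flow on a finite interval that is long enough for the times
  involved. For intervals of length 1 the factor \<open>(b - a) * mass\<close> in the flux bound
  becomes \<open>M\<close>.\<close>

lemma flow_consequences:
 fixes V :: "'a::euclidean_space => real"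
 assumes flow: "\<forall>T>0. \<exists>N q G. dissipative_flow m R T N C r q G V gV K k"
 defines "E \<equiv> %t. limit_energy m V K (r t)" and "M \<equiv> LBINT x. r 0 x"
 shows "0 <= t ==> (LBINT x. \<bar>r t x\<bar>) = M"
  "0 < a ==> a < b ==> E b <= E a"
  "0 < a ==> - ((measure lborel (ball (0::'a) R) + M) / (1 - m)) <= E a"
  "0 < a ==> a <= t ==> t <= a + 1 ==> \<exists>F. integrable lborel F \<and>
    (LBINT x. norm (F x)) <= sqrt (2 * (E a - E (a + 1)) * M) \<and>
    (\<forall>\<psi>. smooth_on UNIV \<psi> --> (LBINT x. (r t x - r a x) * \<psi> x) = - (LBINT x. F x \<bullet> grad \<psi> x))"
  "0 <= t ==> integrable lborel (r t)" "x \<notin> ball 0 R ==> r t x = 0"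
  "0 <= s ==> s <= T ==> 0 < T ==> ((%t. LBINT x. \<bar>r t x - r s x\<bar>) \<longlongrightarrow> 0) (at s within {0..T})"
proof -
 show mass: "(LBINT x. \<bar>r t x\<bar>) = M" if t: "0 <= t" for t
 proof -
  obtain N q G where "dissipative_flow m R (t + 1) N C r q G V gV K k" using flow[rule_format, of "t + 1"] t by auto
  then interpret dissipative_flow m R "t + 1" N C r q G V gV K k .
  show ?thesis using mass_conserved[of t] t by (simp add: r_nonneg mass_def M_def)
 qed
 show "E b <= E a" if ab: "0 < a" "a < b" for a b
 proof -
  obtain N q G where "dissipative_flow m R (b + 1) N C r q G V gV K k" using flow[rule_format, of "b + 1"] ab by auto
  then interpret dissipative_flow m R "b + 1" N C r q G V gV K k .
  show ?thesis using energy_controls_flux(1)[OF ab] unfolding E_def by simp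
 qed
 show "- ((measure lborel (ball (0::'a) R) + M) / (1 - m)) <= E a" if a: "0 < a" for a
 proof -
  obtain N q G where "dissipative_flow m R (a + 1) N C r q G V gV K k" using flow[rule_format, of "a + 1"] a by auto
  then interpret dissipative_flow m R "a + 1" N C r q G V gV K k .
  have "- ((measure lborel (ball (0::'a) R) + (LBINT x. r a x)) / (1 - m)) <= limit_energy m V K (r a)"
   by (rule limit_energy(2)[OF m V(1-3) K _ r_nonneg r_zero]) (use a r_int in auto)
  then show ?thesis using mass[of a] a by (simp add: E_def r_nonneg)
 qed
 show "\<exists>F. integrable lborel F \<and> (LBINT x. norm (F x)) <= sqrt (2 * (E a - E (a + 1)) * M) \<and>
    (\<forall>\<psi>. smooth_on UNIV \<psi> --> (LBINT x. (r t x - r a x) * \<psi> x) = - (LBINT x. F x \<bullet> grad \<psi> x))"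
  if at: "0 < a" "a <= t" "t <= a + 1"
 proof -
  obtain N q G where "dissipative_flow m R (a + 2) N C r q G V gV K k" using flow[rule_format, of "a + 2"] at by auto
  then interpret dissipative_flow m R "a + 2" N C r q G V gV K k .
  have "(LBINT x. norm (Jint a t x)) <= sqrt (2 * (E a - E (a + 1)) * M)"
   using energy_controls_flux(2)[of a "a + 1" t] at unfolding E_def by (simp add: mass_def M_def)
  then show ?thesis using Jint_integrable[of a t] smooth_identity[of _ a t] at by auto
 qed
 show "integrable lborel (r t)" if t: "0 <= t"
 proof -
  obtain N q G where "dissipative_flow m R (t + 1) N C r q G V gV K k" using flow[rule_format, of "t + 1"] t by auto
  then interpret dissipative_flow m R "t + 1" N C r q G V gV K k .
  show ?thesis using r_int[of t] t by simp
 qed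
 show "r t x = 0" if "x \<notin> ball 0 R"
 proof -
  obtain N q G where "dissipative_flow m R 1 N C r q G V gV K k" using flow[rule_format, of 1] by auto
  then interpret dissipative_flow m R 1 N C r q G V gV K k .
  show ?thesis by (rule r_zero[OF that])
 qed
 show "((%t. LBINT x. \<bar>r t x - r s x\<bar>) \<longlongrightarrow> 0) (at s within {0..T})" if s: "0 <= s" "s <= T" "0 < T"
 proof -
  obtain N q G where "dissipative_flow m R T N C r q G V gV K k" using flow[rule_format, of T] s by auto
  then interpret dissipative_flow m R T N C r q G V gV K k .
  show ?thesis using r_cont[of s] s by simp
 qed
qed

lemma antimono_tendsto_at_top:
 fixes E :: "real => real"
 assumes mono: "!!a b. 0 < a ==> a < b ==> E b <= E a" and lower: "!!a. 0 < a ==> L <= E a"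
 obtains l where "(E \<longlongrightarrow> l) at_top"
proof
 show "(E \<longlongrightarrow> (INF t\<in>{0<..}. E t)) at_top"
 proof (rule decreasing_tendsto)
  have bdd: "bdd_below (E ` {0<..})" using lower by (auto intro!: bdd_belowI2)
  show "\<forall>\<^sub>F t in at_top. (INF t\<in>{0<..}. E t) <= E t"
   using eventually_gt_at_top[of 0] by eventually_elim (rule cINF_lower[OF bdd], simp)
  fix x assume "(INF t\<in>{0<..}. E t) < x"
  then obtain s where s: "0 < s" "E s < x" using bdd by (subst (asm) cINF_less_iff) auto
  show "\<forall>\<^sub>F t in at_top. E t < x" using eventually_gt_at_top[of s] by eventually_elim (use mono[OF s(1)] s(2) in force)
 qed
qed

theorem theorem2p4:
  fixes m R :: real
    and V \<rho>0 :: "'a::euclidean_space \<Rightarrow> real"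
    and K :: "'a \<Rightarrow> 'a \<Rightarrow> real"
    and \<rho> :: "real \<Rightarrow> 'a \<Rightarrow> real"
    and \<tau> :: "nat \<Rightarrow> real"
  assumes "0 < m" "m < 1" "0 < R"
    and "Linf_on (ball 0 R) \<rho>0"
    and "AE x in lebesgue. x \<in> ball 0 R \<longrightarrow> 0 \<le> \<rho>0 x"
    and "W2inf_on (ball 0 R) V"
    and "AE x in lebesgue. x \<in> ball 0 R \<longrightarrow> 0 \<le> V x"
    and "no_flux_V R V"
    and "W2inf_on (ball 0 R \<times> ball 0 R) (\<lambda>(x, y). K x y)"
    and "AE (x, y) in lebesgue. x \<in> ball 0 R \<and> y \<in> ball 0 R \<longrightarrow> K x y = K y x \<and> 0 \<le> K x y"
    and "no_flux_K R K"
    and "strong_solution m R V K \<rho>0 \<rho>"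
    and "\<forall>n. 0 \<le> \<tau> n"
    and "filterlim \<tau> at_top sequentially"
  shows "\<exists>\<mu>\<in>Wm11 (ball 0 R). \<exists>r. strict_mono r \<and>
           tendsto_C_Wm11 {0..1} (ball 0 R)
             (\<lambda>k t. dist_of_fun (ball 0 R) (\<rho> (t + \<tau> (r k)))) (\<lambda>t. \<mu>)"
proof -
 let ?B = "ball (0::'a) R"
 have R: "0 < R" and \<tau>0: "!!n. 0 <= \<tau> n" and \<tau>lim: "filterlim \<tau> at_top sequentially" using assms by auto
 obtain r V' gV K' k C where rep: "!!t. 0 <= t ==> borel_rep ?B (\<rho> t) (r t)"
  and flow: "!!T. 0 < T ==> \<exists>N q G. dissipative_flow m R T N C r q G V' gV K' k"
  by (rule strong_solution_flow[OF assms(1-3,6,7,9,10,12)]) (rule that)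
 define E where "E t = limit_energy m V' K' (r t)" for t
 define M where "M = (LBINT x. r 0 x)"
 have "\<forall>T>0. \<exists>N q G. dissipative_flow m R T N C r q G V' gV K' k" using flow by blast
 note fc = flow_consequences[OF this, folded E_def M_def]
 have Bm: "?B \<in> sets borel" by simp
 have dist_eq: "dist_of_fun ?B (\<rho> t) \<phi> = (LBINT x. r t x * \<phi> x)" if "0 <= t" "test_fun ?B \<phi>" for t \<phi>
  unfolding dist_of_fun_def by (rule borel_rep_scaled_test[OF rep[OF that(1)]])
   (use that(2) in \<open>auto simp: test_fun_def intro!: borel_measurable_continuous_onI smooth_on_continuous_on\<close>)
 have ri: "integrable lborel (%x. r t x * \<phi> x)" if t: "0 <= t" and f: "test_fun ?B \<phi>" for t \<phi>
 proof -
  obtain L where L: "!!x. \<bar>\<phi> x\<bar> <= L" using test_fun_bounds[OF f] by metis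
  have "\<phi> \<in> borel_measurable borel" using f by (auto simp: test_fun_def intro!: borel_measurable_continuous_onI smooth_on_continuous_on)
  from integrable_mult_bounded(1)[OF fc(5)[OF t] this L] show ?thesis .
 qed
 have diff_eq: "dist_of_fun ?B (\<rho> t) \<phi> - dist_of_fun ?B (\<rho> s) \<phi> = (LBINT x. (r t x - r s x) * \<phi> x)"
  if "0 <= t" "0 <= s" "test_fun ?B \<phi>" for t s \<phi> using that ri by (simp add: dist_eq left_diff_distrib)
 \<comment> \<open>Continuity in L1 carries over to the weaker norm through the L1 bound for
   \<open>div_inverse\<close>.\<close>
 have cont: "(%t. dist_of_fun ?B (\<rho> (t + \<sigma>))) \<in> C_Wm11 {0..1} ?B" if \<sigma>: "0 <= \<sigma>" for \<sigma>
  unfolding C_Wm11_def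
 proof (intro CollectI conjI ballI)
  fix t :: real assume t: "t \<in> {0..1}"
  then have t': "0 <= t + \<sigma>" using \<sigma> by simp
  show "dist_of_fun ?B (\<rho> (t + \<sigma>)) \<in> Wm11 ?B"
  proof (rule Wm11_field(1)[OF Bm integrable_div_inverse[OF R fc(5)[OF t']]])
   fix \<phi> :: "'a => real" assume f: "test_fun ?B \<phi>"
   show "dist_of_fun ?B (\<rho> (t + \<sigma>)) \<phi> = - (LBINT x. div_inverse R (r (t + \<sigma>)) x \<bullet> grad \<phi> x)"
    unfolding dist_eq[OF t' f] by (rule div_inverse_test[OF R fc(5)[OF t'] fc(6) f])
  qed
 next
  fix s :: real assume s: "s \<in> {0..1}"
  let ?c = "direction_bound TYPE('a) * (2 * R)"
  let ?d = "%t. ennreal (?c * (LBINT x. \<bar>r (t + \<sigma>) x - r (s + \<sigma>) x\<bar>))"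
  have shift: "filterlim (%t. t + \<sigma>) (at (s + \<sigma>) within {0..\<sigma> + 1}) (at s within {0..1})"
   using \<sigma> unfolding filterlim_at by (auto simp: eventually_at_filter intro!: tendsto_intros)
  have "((%t. LBINT x. \<bar>r (t + \<sigma>) x - r (s + \<sigma>) x\<bar>) \<longlongrightarrow> 0) (at s within {0..1})"
   using filterlim_compose[OF fc(7)[of "s + \<sigma>" "\<sigma> + 1"] shift] s \<sigma> by simp
  then have lim: "(?d \<longlongrightarrow> 0) (at s within {0..1})" using tendsto_ennrealI[OF tendsto_mult_right_zero[of _ _ ?c]] by fastforce
  show "((%t. Wm11_norm ?B (%\<phi>. dist_of_fun ?B (\<rho> (t + \<sigma>)) \<phi> - dist_of_fun ?B (\<rho> (s + \<sigma>)) \<phi>)) \<longlongrightarrow> 0) (at s within {0..1})"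
  proof (rule tendsto_sandwich[OF _ _ tendsto_const lim])
   have "Wm11_norm ?B (%\<phi>. dist_of_fun ?B (\<rho> (t + \<sigma>)) \<phi> - dist_of_fun ?B (\<rho> (s + \<sigma>)) \<phi>) <= ?d t" if t: "t \<in> {0..1}" for t
   proof -
    have ts: "0 <= t + \<sigma>" "0 <= s + \<sigma>" using t s \<sigma> by auto
    have di: "integrable lborel (%x. r (t + \<sigma>) x - r (s + \<sigma>) x)" using fc(5)[OF ts(1)] fc(5)[OF ts(2)] by simp
    have "Wm11_norm ?B (%\<phi>. dist_of_fun ?B (\<rho> (t + \<sigma>)) \<phi> - dist_of_fun ?B (\<rho> (s + \<sigma>)) \<phi>)
     <= ennreal (LBINT x. norm (div_inverse R (%x. r (t + \<sigma>) x - r (s + \<sigma>) x) x))"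
    proof (rule Wm11_field(2)[OF Bm integrable_div_inverse[OF R di]])
     fix \<phi> :: "'a => real" assume f: "test_fun ?B \<phi>"
     show "dist_of_fun ?B (\<rho> (t + \<sigma>)) \<phi> - dist_of_fun ?B (\<rho> (s + \<sigma>)) \<phi> =
       - (LBINT x. div_inverse R (%x. r (t + \<sigma>) x - r (s + \<sigma>) x) x \<bullet> grad \<phi> x)"
      unfolding diff_eq[OF ts f] by (rule div_inverse_test[OF R di _ f]) (simp add: fc(6))
    qed
    also have "\<dots> <= ?d t" by (intro ennreal_leI div_inverse_L1[OF R di])
    finally show ?thesis .
   qed
   then show "\<forall>\<^sub>F t in at s within {0..1}. Wm11_norm ?B (%\<phi>. dist_of_fun ?B (\<rho> (t + \<sigma>)) \<phi> - dist_of_fun ?B (\<rho> (s + \<sigma>)) \<phi>) <= ?d t"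
    by (auto simp: eventually_at_filter)
  qed simp
 qed
 obtain l where l: "(E \<longlongrightarrow> l) at_top" by (rule antimono_tendsto_at_top[OF fc(2,3)])
 have \<tau>1: "filterlim (%n. \<tau> n + 1) at_top sequentially"
  using filterlim_tendsto_add_at_top[OF tendsto_const \<tau>lim, of 1] by (simp add: add.commute)
 \<comment> \<open>Bounds all increments within the time window of length 1 that starts at
   \<open>\<tau> n\<close>; the energies at its two ends have the same limit
   \<open>l\<close>.\<close>
 define \<delta> where "\<delta> n = sqrt (2 * (E (\<tau> n) - E (\<tau> n + 1)) * M)" for n
 have "\<delta> \<longlonglongrightarrow> sqrt (2 * (l - l) * M)"
  unfolding \<delta>_def by (intro tendsto_intros filterlim_compose[OF l \<tau>lim] filterlim_compose[OF l \<tau>1])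
 then have \<delta>: "\<delta> \<longlonglongrightarrow> 0" by simp
 \<comment> \<open>The flux estimate is available at positive times; the finitely many initial
   indices are dropped, and \<open>n0\<close> reappears in the final subsequence
   \<open>j\<close>.\<close>
 obtain n0 where n0: "!!n. n0 <= n ==> 0 < \<tau> n"
  using \<tau>lim unfolding filterlim_at_top_dense eventually_sequentially by blast
 define f where "f n = r (\<tau> (n + n0))" for n
 have fi: "integrable lborel (f n)" for n unfolding f_def by (rule fc(5)[OF \<tau>0])
 obtain s \<Phi> where s: "strict_mono s" and \<Phi>: "integrable lborel \<Phi>"
  and conv: "(%n. LBINT x. norm (indicator ?B x *\<^sub>R div_inverse R (f (s n)) x - \<Phi> x)) \<longlonglongrightarrow> 0"
 proof (rule div_inverse_compact[OF R fi])
  show "(LBINT x. \<bar>f n x\<bar>) <= M" for n unfolding f_def fc(1)[OF \<tau>0] by simp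
 qed (rule that)
 define j where "j n = s n + n0" for n
 have j: "strict_mono j" using s by (auto simp: strict_mono_def j_def)
 \<comment> \<open>As the divergence of the limit field it belongs to the space by
   construction.\<close>
 define \<mu> where "\<mu> \<phi> = - (LBINT x. \<Phi> x \<bullet> grad \<phi> x)" for \<phi>
 have \<mu>: "\<mu> \<in> Wm11 ?B" by (rule Wm11_field(1)[OF Bm \<Phi>]) (simp add: \<mu>_def)
 have const: "(%t. \<mu>) \<in> C_Wm11 {0..1} ?B"
 proof -
  \<comment> \<open>The zero field is the witness that the distance of \<mu> from itself is
    0.\<close>
  have "Wm11_norm ?B (%\<phi>. \<mu> \<phi> - \<mu> \<phi>) <= ennreal (\<integral>x. norm (0::'a) \<partial>(lborel :: 'a measure))"
   by (rule Wm11_field(2)[OF Bm]) auto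
  then have "Wm11_norm ?B (%\<phi>. \<mu> \<phi> - \<mu> \<phi>) = 0" by simp
  then show ?thesis using \<mu> by (simp add: C_Wm11_def)
 qed
 define \<epsilon> where "\<epsilon> n = (LBINT x. norm (indicator ?B x *\<^sub>R div_inverse R (f (s n)) x - \<Phi> x))" for n
 \<comment> \<open>The witness is the field \<open>F + (?D - \<Phi>)\<close>: \<open>F\<close>
   carries the increment from time \<open>\<tau> (j n)\<close> to \<open>t + \<tau> (j n)\<close>,
   and \<open>?D - \<Phi>\<close> the distance to the limit at the starting time. The bound on its
   L1 norm does not involve \<open>t\<close>, which makes the convergence uniform.\<close>
 have bound: "Wm11_norm ?B (%\<phi>. dist_of_fun ?B (\<rho> (t + \<tau> (j n))) \<phi> - \<mu> \<phi>) <= ennreal (\<delta> (j n) + \<epsilon> n)"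
  if t: "t \<in> {0..1}" for t n
 proof -
  define a where "a = \<tau> (j n)"
  have a: "0 < a" "0 <= a" using n0[of "j n"] by (auto simp: a_def j_def)
  have fs: "f (s n) = r a" by (simp add: f_def a_def j_def)
  obtain F where F: "integrable lborel F" "(LBINT x. norm (F x)) <= sqrt (2 * (E a - E (a + 1)) * M)"
   "!!\<psi>. smooth_on UNIV \<psi> ==> (LBINT x. (r (t + a) x - r a x) * \<psi> x) = - (LBINT x. F x \<bullet> grad \<psi> x)"
   using fc(4)[OF a(1), of "t + a"] t by auto
  let ?D = "%x. indicator ?B x *\<^sub>R div_inverse R (r a) x"
  have Di: "integrable lborel ?D" using integrable_mult_indicator[OF _ integrable_div_inverse[OF R fc(5)[OF a(2)]], of ?B] by simp
  have Gi: "integrable lborel (%x. F x + (?D x - \<Phi> x))" using F(1) Di \<Phi> by simp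
  have ta: "0 <= t + a" using t a by simp
  have "Wm11_norm ?B (%\<phi>. dist_of_fun ?B (\<rho> (t + a)) \<phi> - \<mu> \<phi>) <= ennreal (LBINT x. norm (F x + (?D x - \<Phi> x)))"
  proof (rule Wm11_field(2)[OF Bm Gi])
   fix \<phi> :: "'a => real" assume tf: "test_fun ?B \<phi>"
   then have sm: "smooth_on UNIV \<phi>" by (simp add: test_fun_def)
   obtain S where S: "compact S" "S \<subseteq> ?B" "!!x. x \<notin> S ==> \<phi> x = 0" using tf by (auto simp: test_fun_def)
   obtain L where L: "!!x. norm (grad \<phi> x) <= L" "!!x. x \<notin> S ==> grad \<phi> x = 0"
    using smooth_compact_support_bounds[OF sm S(1,3)] by metis
   have g0: "x \<notin> ?B ==> grad \<phi> x = 0" for x using L(2) S(2) by blast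
   have ig: "integrable lborel (%x. H x \<bullet> grad \<phi> x)" if H: "integrable lborel H" for H :: "'a => 'a"
   proof (rule bochner_bound[of _ "%x. L * norm (H x)"])
    show "(%x. H x \<bullet> grad \<phi> x) \<in> borel_measurable lborel"
     using borel_measurable_inner[of H borel "grad \<phi>"] H smooth_grad_measurable[OF sm] by auto
    have "norm (H x \<bullet> grad \<phi> x) <= L * norm (H x)" for x
     using Cauchy_Schwarz_ineq2[of "H x" "grad \<phi> x"] mult_left_mono[OF L(1)[of x] norm_ge_zero[of "H x"]] by (simp add: mult.commute)
    then have "norm (H x \<bullet> grad \<phi> x) <= norm (L * norm (H x))" for x
     using abs_ge_self[of "L * norm (H x)"] order_trans unfolding real_norm_def by blast
    then show "AE x in lborel. norm (H x \<bullet> grad \<phi> x) <= norm (L * norm (H x))" by simp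
   qed (use H in simp)
   have "(LBINT x. ?D x \<bullet> grad \<phi> x) = (LBINT x. div_inverse R (r a) x \<bullet> grad \<phi> x)"
    using g0 by (intro bochner_cong) (auto simp: indicator_def)
   then have 1: "dist_of_fun ?B (\<rho> a) \<phi> = - (LBINT x. ?D x \<bullet> grad \<phi> x)"
    using div_inverse_test[OF R fc(5)[OF a(2)] fc(6) tf] dist_eq[OF a(2) tf] by simp
   have 2: "dist_of_fun ?B (\<rho> (t + a)) \<phi> - dist_of_fun ?B (\<rho> a) \<phi> = - (LBINT x. F x \<bullet> grad \<phi> x)"
    using diff_eq[OF ta a(2) tf] F(3)[OF sm] by simp
   have "(LBINT x. (F x + (?D x - \<Phi> x)) \<bullet> grad \<phi> x)
    = (LBINT x. F x \<bullet> grad \<phi> x) + ((LBINT x. ?D x \<bullet> grad \<phi> x) - (LBINT x. \<Phi> x \<bullet> grad \<phi> x))"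
    unfolding inner_add_left inner_diff_left
    using ig[OF F(1)] ig[OF Di] ig[OF \<Phi>] by (simp only: Bochner_Integration.integral_add Bochner_Integration.integral_diff Bochner_Integration.integrable_diff)
   then show "dist_of_fun ?B (\<rho> (t + a)) \<phi> - \<mu> \<phi> = - (LBINT x. (F x + (?D x - \<Phi> x)) \<bullet> grad \<phi> x)"
    using 1 2 by (simp add: \<mu>_def)
  qed
  also have "(LBINT x. norm (F x + (?D x - \<Phi> x))) <= (LBINT x. norm (F x) + norm (?D x - \<Phi> x))"
   using F(1) Di \<Phi> by (intro integral_mono) (auto intro: norm_triangle_ineq)
  also have "\<dots> = (LBINT x. norm (F x)) + (LBINT x. norm (?D x - \<Phi> x))" using F(1) Di \<Phi> by simp
  also have "\<dots> <= \<delta> (j n) + \<epsilon> n" using F(2) by (simp add: \<delta>_def \<epsilon>_def fs a_def[symmetric])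
  finally show ?thesis by (simp add: a_def ennreal_leI)
 qed
 have sup: "(%n. SUP t\<in>{0..1}. Wm11_norm ?B (%\<phi>. dist_of_fun ?B (\<rho> (t + \<tau> (j n))) \<phi> - \<mu> \<phi>)) \<longlonglongrightarrow> 0"
 proof (rule tendsto_sandwich[OF _ _ tendsto_const])
  have "(%n. \<delta> (j n) + \<epsilon> n) \<longlonglongrightarrow> 0 + 0"
   using LIMSEQ_subseq_LIMSEQ[OF \<delta> j] conv unfolding o_def \<epsilon>_def[symmetric] by (rule tendsto_add)
  then show "(%n. ennreal (\<delta> (j n) + \<epsilon> n)) \<longlonglongrightarrow> 0" using tendsto_ennrealI by fastforce
  show "\<forall>\<^sub>F n in sequentially. (SUP t\<in>{0..1}. Wm11_norm ?B (%\<phi>. dist_of_fun ?B (\<rho> (t + \<tau> (j n))) \<phi> - \<mu> \<phi>)) <= ennreal (\<delta> (j n) + \<epsilon> n)"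
   using bound by (intro always_eventually allI SUP_least) auto
 qed simp
 have "tendsto_C_Wm11 {0..1} ?B (%n t. dist_of_fun ?B (\<rho> (t + \<tau> (j n)))) (%t. \<mu>)"
  unfolding tendsto_C_Wm11_def using cont[OF \<tau>0] const sup by auto
 then show ?thesis using \<mu> j by blast
qed

end
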